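(* For every integer $n>1$, rigid homogeneous CR models $M\subset\mathbb C^n$ of CR dimension $1$ (hence CR codimension $n-1$) and reduced growth vector $(2,1,\dots,1)$ are unique up to local biholomorphism.
   Context: A real submanifold $M\subset\mathbb C^n$ of CR dimension $1$ has the induced CR structure $D=TM\cap J\,TM$ of real rank $2$ with complex structure $J$ on $D$; here $\dim M=n+1$. The weak derived flag is $D^1=D$, $D^{k+1}=[D,D^k]$, of constant ranks $d_k$, and $D$ is assumed bracket-generating ($D^s=TM$ for some $s$). The reduced growth vector is $(r_1,r_2,\dots)$, $r_k=d_k-d_{k-1}$, $d_0=0$; here it is $(2,1,\dots,1)$ with $n$ entries. $M$ is rigid if it is given in suitable local holomorphic coordinates by equations $\operatorname{Re}(z_k)=f_k(z_1,\bar z_1)$, $k=2,\dots,n$. A CR model is a real submanifold of $\mathbb C^n$ given by weighted homogeneous polynomial equations, i.e. admitting a scaling symmetry $\sum\lambda_kz_k\partial_{z_k}$ with weights $\lambda_k\in\mathbb N$ (polynomial model of Beloshapka); it is homogeneous if its local symmetries act transitively. Up to local CR equivalence, homogeneous models are standard models: the simply connected nilpotent Lie group $\exp(\mathfrak m)$ of a graded nilpotent Lie algebra $\mathfrak m=\bigoplus_{k\ge1}\mathfrak g_{-k}$ generated by $\mathfrak g_{-1}$, $\dim\mathfrak g_{-1}=2$, with left-invariant distribution $D=\mathfrak g_{-1}$ and left-invariant complex structure $J$ given by a complex structure on $\mathfrak g_{-1}$. *)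

theory Defs
  imports "HOL-Analysis.Analysis"
begin

section \<open>Smooth and holomorphic maps\<close>

text \<open>The predicates below are meant for open domains.\<close>

primrec times_differentiable_on ::
    "nat \<Rightarrow> ('a::real_normed_vector \<Rightarrow> 'b::real_normed_vector) \<Rightarrow> 'a set \<Rightarrow> bool" where
  "times_differentiable_on 0 f U \<longleftrightarrow> continuous_on U f"
| "times_differentiable_on (Suc k) f U \<longleftrightarrow>
     (\<forall>x\<in>U. f differentiable (at x)) \<and>
     (\<forall>v. times_differentiable_on k (\<lambda>x. frechet_derivative f (at x) v) U)"

definition smooth_on ::
    "('a::real_normed_vector \<Rightarrow> 'b::real_normed_vector) \<Rightarrow> 'a set \<Rightarrow> bool" where
  "smooth_on f U \<longleftrightarrow> (\<forall>k. times_differentiable_on k f U)"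

definition diffeomorphism_between ::
    "('a::real_normed_vector \<Rightarrow> 'b::real_normed_vector) \<Rightarrow> 'a set \<Rightarrow> 'b set \<Rightarrow> bool" where
  "diffeomorphism_between \<phi> U V \<longleftrightarrow>
     open U \<and> open V \<and> bij_betw \<phi> U V \<and> smooth_on \<phi> U \<and> smooth_on (inv_into U \<phi>) V"

text \<open>\<open>(*s)\<close> is multiplication of a vector of \<open>complex ^ 'n\<close> by a complex scalar, so the
  derivative is required to be complex linear.\<close>

definition holomorphic_map_on :: "(complex ^ 'n \<Rightarrow> complex ^ 'm) \<Rightarrow> (complex ^ 'n) set \<Rightarrow> bool" where
  "holomorphic_map_on f U \<longleftrightarrow>
     (\<forall>z\<in>U. \<exists>f'. (f has_derivative f') (at z) \<and> Vector_Spaces.linear (*s) (*s) f')"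

definition biholomorphism_between ::
    "(complex ^ 'n \<Rightarrow> complex ^ 'n) \<Rightarrow> (complex ^ 'n) set \<Rightarrow> (complex ^ 'n) set \<Rightarrow> bool" where
  "biholomorphism_between \<phi> U V \<longleftrightarrow>
     open U \<and> open V \<and> bij_betw \<phi> U V \<and>
     holomorphic_map_on \<phi> U \<and> holomorphic_map_on (inv_into U \<phi>) V"

section \<open>Real submanifolds and their tangent spaces\<close>

definition real_submanifold :: "nat \<Rightarrow> 'a::euclidean_space set \<Rightarrow> bool" where
  "real_submanifold d M \<longleftrightarrow>
     (\<forall>p\<in>M. \<exists>U V \<phi> S. p \<in> U \<and> diffeomorphism_between \<phi> U V \<and>
        subspace (S :: 'a set) \<and> dim S = d \<and> \<phi> ` (M \<inter> U) = S \<inter> V)"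

definition tangent_space :: "'a::euclidean_space set \<Rightarrow> 'a \<Rightarrow> 'a set" where
  "tangent_space M p =
     {v. \<exists>(\<gamma> :: real \<Rightarrow> 'a) \<epsilon>. \<epsilon> > 0 \<and> smooth_on \<gamma> {-\<epsilon><..<\<epsilon>} \<and> \<gamma> ` {-\<epsilon><..<\<epsilon>} \<subseteq> M \<and>
        \<gamma> 0 = p \<and> (\<gamma> has_vector_derivative v) (at 0)}"

section \<open>The induced CR structure and its weak derived flag\<close>

definition CR_distribution :: "(complex ^ 'n) set \<Rightarrow> complex ^ 'n \<Rightarrow> (complex ^ 'n) set" where
  "CR_distribution M p = tangent_space M p \<inter> (\<lambda>v. \<i> *s v) ` tangent_space M p"

text \<open>Here \<open>dim\<close> is the real dimension.\<close>

definition has_CR_dimension :: "(complex ^ 'n) set \<Rightarrow> nat \<Rightarrow> bool" where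
  "has_CR_dimension M m \<longleftrightarrow> (\<forall>p\<in>M. dim (CR_distribution M p) = 2 * m)"

text \<open>A local section of a field \<open>E\<close> of subspaces over \<open>M \<inter> U\<close> is represented by a smooth
  extension to the open set \<open>U\<close> of the ambient space.\<close>

definition section_on :: "'a::euclidean_space set \<Rightarrow> ('a \<Rightarrow> 'a set) \<Rightarrow> 'a set \<Rightarrow> ('a \<Rightarrow> 'a) \<Rightarrow> bool" where
  "section_on M E U X \<longleftrightarrow> smooth_on X U \<and> (\<forall>q \<in> M \<inter> U. X q \<in> E q)"

text \<open>At points of \<open>M\<close> the bracket of two vector fields tangent to \<open>M\<close> depends only on their
  restrictions to \<open>M\<close>, so the choice of extensions is immaterial below.\<close>

definition lie_bracket :: "('a::euclidean_space \<Rightarrow> 'a) \<Rightarrow> ('a \<Rightarrow> 'a) \<Rightarrow> 'a \<Rightarrow> 'a" where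
  "lie_bracket X Y p = frechet_derivative Y (at p) (X p) - frechet_derivative X (at p) (Y p)"

definition bracket_distribution ::
    "'a::euclidean_space set \<Rightarrow> ('a \<Rightarrow> 'a set) \<Rightarrow> ('a \<Rightarrow> 'a set) \<Rightarrow> 'a \<Rightarrow> 'a set" where
  "bracket_distribution M D E p =
     span {lie_bracket X Y p | X Y. \<exists>U. open U \<and> p \<in> U \<and> section_on M D U X \<and> section_on M E U Y}"

fun weak_derived_flag :: "(complex ^ 'n) set \<Rightarrow> nat \<Rightarrow> complex ^ 'n \<Rightarrow> (complex ^ 'n) set" where
  "weak_derived_flag M 0 = (\<lambda>p. {0})"
| "weak_derived_flag M (Suc 0) = CR_distribution M"
| "weak_derived_flag M (Suc (Suc k)) =
     bracket_distribution M (CR_distribution M) (weak_derived_flag M (Suc k))"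

definition bracket_generating :: "(complex ^ 'n) set \<Rightarrow> bool" where
  "bracket_generating M \<longleftrightarrow> (\<exists>s. \<forall>p\<in>M. weak_derived_flag M s p = tangent_space M p)"

text \<open>\<open>rs = [r\<^sub>1, r\<^sub>2, \<dots>]\<close> lists the rank jumps up to the step at which the flag reaches the
  tangent bundle. All ranks are thereby constant on \<open>M\<close>.\<close>

definition has_reduced_growth_vector :: "(complex ^ 'n) set \<Rightarrow> nat list \<Rightarrow> bool" where
  "has_reduced_growth_vector M rs \<longleftrightarrow>
     (\<forall>p\<in>M. (\<forall>k < length rs.
          dim (weak_derived_flag M (Suc k) p) = dim (weak_derived_flag M k p) + rs ! k) \<and>
        weak_derived_flag M (length rs) p = tangent_space M p)"

section \<open>Rigid submanifolds, CR models and homogeneity\<close>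

text \<open>The distinguished coordinate \<open>z\<^sub>1\<close> is the one with index \<open>i\<close>; as the index type
  carries no order, a permutation of coordinates is absorbed into \<open>\<phi>\<close>.\<close>

definition rigid :: "(complex ^ 'n) set \<Rightarrow> bool" where
  "rigid M \<longleftrightarrow>
     (\<forall>p\<in>M. \<exists>U V \<phi> i (f :: 'n \<Rightarrow> complex \<Rightarrow> real).
        p \<in> U \<and> biholomorphism_between \<phi> U V \<and>
        (\<forall>k. k \<noteq> i \<longrightarrow> smooth_on (f k) ((\<lambda>w. w $ i) ` V)) \<and>
        \<phi> ` (M \<inter> U) = {w \<in> V. \<forall>k. k \<noteq> i \<longrightarrow> Re (w $ k) = f k (w $ i)})"

text \<open>The flow of the vector field \<open>\<Sum>\<^sub>k \<mu>\<^sub>k z\<^sub>k \<partial>/\<partial>z\<^sub>k\<close> at time \<open>ln t\<close>.\<close>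

definition weighted_scaling :: "('n \<Rightarrow> nat) \<Rightarrow> real \<Rightarrow> complex ^ 'n \<Rightarrow> complex ^ 'n" where
  "weighted_scaling \<mu> t z = (\<chi> k. of_real (t ^ \<mu> k) * z $ k)"

definition weighted_homogeneous :: "('n \<Rightarrow> nat) \<Rightarrow> (complex ^ 'n \<Rightarrow> real) \<Rightarrow> bool" where
  "weighted_homogeneous \<mu> P \<longleftrightarrow> (\<exists>d::nat. \<forall>t>0. \<forall>z. P (weighted_scaling \<mu> t z) = t ^ d * P z)"

text \<open>A \<open>real_polynomial_function\<close> on \<open>complex ^ 'n\<close> is a real-valued polynomial in the real and
  imaginary parts of the coordinates, i.e. in \<open>z\<close> and its conjugate.\<close>

definition CR_model :: "(complex ^ 'n) set \<Rightarrow> bool" where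
  "CR_model M \<longleftrightarrow>
     (\<exists>(\<mu> :: 'n \<Rightarrow> nat) Ps. (\<forall>k. \<mu> k > 0) \<and> finite Ps \<and>
        (\<forall>P\<in>Ps. real_polynomial_function P \<and> weighted_homogeneous \<mu> P) \<and>
        M = {z. \<forall>P\<in>Ps. P z = 0})"

definition locally_biholomorphic_at ::
    "(complex ^ 'n) set \<Rightarrow> complex ^ 'n \<Rightarrow> (complex ^ 'n) set \<Rightarrow> complex ^ 'n \<Rightarrow> bool" where
  "locally_biholomorphic_at M p M' q \<longleftrightarrow>
     (\<exists>U V \<phi>. p \<in> U \<and> biholomorphism_between \<phi> U V \<and> \<phi> p = q \<and> \<phi> ` (M \<inter> U) = M' \<inter> V)"

definition locally_homogeneous :: "(complex ^ 'n) set \<Rightarrow> bool" where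
  "locally_homogeneous M \<longleftrightarrow> (\<forall>p\<in>M. \<forall>q\<in>M. locally_biholomorphic_at M p M q)"

definition rigid_homogeneous_CR_model :: "(complex ^ 'n) set \<Rightarrow> bool" where
  "rigid_homogeneous_CR_model M \<longleftrightarrow> CR_model M \<and> rigid M \<and> locally_homogeneous M"

end

theory Submission
  imports Defs "HOL-Complex_Analysis.Conformal_Mappings"
begin

text \<open>Near a generic point a rigid manifold is a graph \<open>Re w\<^sub>k = f\<^sub>k(w\<^sub>1)\<close>, and the weak derived flag is read
  off from \<open>h = (\<Delta> f\<^sub>k)\<^sub>k\<close>: the jump \<open>1\<close> from \<open>D\<^sup>2\<close> to \<open>D\<^sup>3\<close> makes \<open>h\<close>, \<open>h\<^sub>x\<close>, \<open>h\<^sub>y\<close> linearly dependent, so up to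
  a factor \<open>h\<close> is a curve depending on one real function, and since \<open>D\<close> is bracket generating this curve
  lies in no hyperplane. Hence, after a linear change of the \<open>w\<^sub>k\<close> and subtraction of real parts of
  holomorphic functions, \<open>f\<^sub>k(\<zeta>) = (Re \<zeta>)\<^sup>k + O(|\<zeta>|\<^sup>k\<^sup>+\<^sup>1)\<close>, i.e. the weighted tangent cone is the model
  \<open>Re w\<^sub>k = (Re w\<^sub>1)\<^sup>k\<close>. By homogeneity such a chart exists at the origin, where the manifold is a cone for some
  weighted dilations. Conjugated by the chart, these dilations are asymptotic to the dilations of the model,
  because a holomorphic function with vanishing real part on the model is constant. Rescaling the chart and
  its inverse therefore converges, and the limits are mutually inverse maps between the given manifold and
  the model.\<close>

section \<open>Smooth functions\<close>

text \<open>Having the model as weighted tangent cone does not by itself determine \<open>M\<close>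
  nearby; the dilations of \<open>M\<close> must turn the approximation into an equivalence. The
  obstacle is that their weights \<open>\<mu>\<close> are unknown and a priori unrelated to the
  weights 1, ..., n of the model, so a rescaled chart could tend to 0 or blow up. The two gradings
  are compared through \<open>T t\<close>, the dilation of \<open>M\<close> seen in the chart. Its
  derivative at 0 preserves the complex tangent line of the graph and multiplies it by
  \<open>t ^ m\<close>, where \<open>m\<close> is one of the weights in \<open>\<mu>\<close>. Hence
  \<open>T t\<close> is asymptotically the model dilation by \<open>t ^ m\<close>, whereas in the
  coordinates of \<open>M\<close> it is diagonal with eigenvalues \<open>t ^ \<mu> l\<close>.
  Comparing both descriptions yields the lower bounds on the weighted orders of the chart and its
  inverse under which both rescalings converge; the limits are leading weighted parts. The exponents
  2, ..., n come from the powers 0, ..., n - 2 of a parameter of the curve \<open>h\<close>, raised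
  by 2 when the Laplacian is inverted.\<close>

lemma times_differentiable_on_cong:
  assumes "open U" "\<And>x. x \<in> U \<Longrightarrow> f x = g x"
  shows "times_differentiable_on k f U \<longleftrightarrow> times_differentiable_on k g U"
  using assms(2)
proof (induction k arbitrary: f g)
  case 0
  then show ?case using continuous_on_cong by fastforce
next
  case (Suc k)
  have imp: "times_differentiable_on (Suc k) g U"
    if td: "times_differentiable_on (Suc k) f U" and eq: "\<And>x. x \<in> U \<Longrightarrow> f x = g x" for f g :: "'a \<Rightarrow> 'b"
  proof -
    have D: "(g has_derivative frechet_derivative f (at x)) (at x)" if "x \<in> U" for x
    proof -
      have "(f has_derivative frechet_derivative f (at x)) (at x)"
        using td that by (simp add: frechet_derivative_works)
      then show ?thesis
        using has_derivative_transform_within_open[OF _ assms(1) that] eq by blast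
    qed
    then have E: "frechet_derivative f (at x) = frechet_derivative g (at x)" if "x \<in> U" for x
      using frechet_derivative_at[OF D[OF that]] by simp
    show ?thesis
      using td D Suc.IH[of "\<lambda>x. frechet_derivative f (at x) v" "\<lambda>x. frechet_derivative g (at x) v" for v] E
      by (auto simp: differentiable_def)
  qed
  show ?case using imp[of f g] imp[of g f] Suc.prems by metis
qed

lemma times_differentiable_on_subset:
  "times_differentiable_on k f U \<Longrightarrow> V \<subseteq> U \<Longrightarrow> times_differentiable_on k f V"
  by (induction k arbitrary: f) (auto intro: continuous_on_subset)

lemma times_differentiable_on_SucD:
  "times_differentiable_on (Suc k) f U \<Longrightarrow> times_differentiable_on k f U"
proof (induction k arbitrary: f)
  case 0
  then show ?case
    by (auto intro!: continuous_at_imp_continuous_on differentiable_imp_continuous_within)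
next
  case (Suc k)
  then show ?case by (metis times_differentiable_on.simps(2))
qed

lemma times_differentiable_on_SucI:
  assumes "open U" "\<And>x. x \<in> U \<Longrightarrow> (f has_derivative f' x) (at x)"
    and "\<And>v. times_differentiable_on k (\<lambda>x. f' x v) U"
  shows "times_differentiable_on (Suc k) f U"
proof -
  have "f' x = frechet_derivative f (at x)" if "x \<in> U" for x
    using frechet_derivative_at[OF assms(2)[OF that]] .
  then have "times_differentiable_on k (\<lambda>x. frechet_derivative f (at x) v) U" for v
    using times_differentiable_on_cong[OF assms(1), of "\<lambda>x. f' x v" "\<lambda>x. frechet_derivative f (at x) v" k]
      assms(3)[of v] by simp
  then show ?thesis using assms(2) by (auto simp: differentiable_def)
qed

lemma times_differentiable_on_has_derivative:
  "times_differentiable_on (Suc k) f U \<Longrightarrow> x \<in> U \<Longrightarrow>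
     (f has_derivative frechet_derivative f (at x)) (at x)"
  by (simp add: frechet_derivative_works)

lemma times_differentiable_on_const: "open U \<Longrightarrow> times_differentiable_on k (\<lambda>x. c) U"
proof (induction k arbitrary: c)
  case (Suc k)
  show ?case
    by (rule times_differentiable_on_SucI[where f' = "\<lambda>x v. 0"]) (use Suc in auto)
qed auto

lemma times_differentiable_on_bounded_linear:
  assumes "open U" "bounded_linear L"
  shows "times_differentiable_on k L U"
proof (cases k)
  case 0
  then show ?thesis
    using linear_continuous_on[OF assms(2)] by simp
next
  case (Suc j)
  show ?thesis unfolding Suc
    by (rule times_differentiable_on_SucI[where f' = "\<lambda>x. L"])
      (use assms in \<open>auto intro: bounded_linear_imp_has_derivative times_differentiable_on_const\<close>)
qed

lemma times_differentiable_on_linear_comp: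
  assumes "open U" "bounded_linear L" "times_differentiable_on k f U"
  shows "times_differentiable_on k (\<lambda>x. L (f x)) U"
  using assms(3)
proof (induction k arbitrary: f)
  case 0
  then show ?case
    using bounded_linear.continuous_on[OF assms(2)] by simp
next
  case (Suc k)
  show ?case
  proof (rule times_differentiable_on_SucI[OF assms(1)])
    fix x assume "x \<in> U"
    then show "((\<lambda>x. L (f x)) has_derivative (\<lambda>v. L (frechet_derivative f (at x) v))) (at x)"
      using bounded_linear.has_derivative[OF assms(2)] times_differentiable_on_has_derivative[OF Suc.prems] by blast
  next
    fix v show "times_differentiable_on k (\<lambda>x. L (frechet_derivative f (at x) v)) U"
      using Suc by simp
  qed
qed

lemma times_differentiable_on_add:
  assumes "open U" "times_differentiable_on k f U" "times_differentiable_on k g U"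
  shows "times_differentiable_on k (\<lambda>x. f x + g x) U"
  using assms(2,3)
proof (induction k arbitrary: f g)
  case 0
  then show ?case by (simp add: continuous_on_add)
next
  case (Suc k)
  show ?case
    by (rule times_differentiable_on_SucI[OF assms(1),
        where f' = "\<lambda>x v. frechet_derivative f (at x) v + frechet_derivative g (at x) v"])
     (use Suc in \<open>auto intro!: has_derivative_add times_differentiable_on_has_derivative simp del: times_differentiable_on.simps\<close>, use Suc in auto)
qed

lemma times_differentiable_on_bilinear:
  assumes "open U" "bounded_bilinear b" "times_differentiable_on k f U" "times_differentiable_on k g U"
  shows "times_differentiable_on k (\<lambda>x. b (f x) (g x)) U"
  using assms(3,4)
proof (induction k arbitrary: f g)
  case 0
  then show ?case by (simp add: bounded_bilinear.continuous_on[OF assms(2)])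
next
  case (Suc k)
  show ?case
  proof (rule times_differentiable_on_SucI[OF assms(1)])
    fix x assume x: "x \<in> U"
    show "((\<lambda>x. b (f x) (g x)) has_derivative
        (\<lambda>v. b (f x) (frechet_derivative g (at x) v) + b (frechet_derivative f (at x) v) (g x))) (at x)"
      by (rule bounded_bilinear.FDERIV[OF assms(2)])
        (use Suc.prems x times_differentiable_on_has_derivative in blast)+
  next
    fix v
    have "times_differentiable_on k f U" "times_differentiable_on k g U"
      using Suc.prems times_differentiable_on_SucD by blast+
    then show "times_differentiable_on k
        (\<lambda>x. b (f x) (frechet_derivative g (at x) v) + b (frechet_derivative f (at x) v) (g x)) U"
      using Suc by (intro times_differentiable_on_add[OF assms(1)]) auto
  qed
qed

lemma times_differentiable_on_sum:
  assumes "open U" "\<And>i. i \<in> I \<Longrightarrow> times_differentiable_on k (f i) U"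
  shows "times_differentiable_on k (\<lambda>x. \<Sum>i\<in>I. f i x) U"
  using assms(2)
  by (induction I rule: infinite_finite_induct)
    (auto intro!: times_differentiable_on_const times_differentiable_on_add assms(1))

text \<open>The derivative of a composite applies a varying linear map to a varying vector. Expanded
  over \<open>Basis\<close> it becomes a sum of products whose factors fall under the induction
  hypothesis or under the assumption on \<open>f\<close>.\<close>

lemma times_differentiable_on_compose:
  fixes f :: "'a::real_normed_vector \<Rightarrow> 'b::euclidean_space"
    and g :: "'b \<Rightarrow> 'c::real_normed_vector"
  assumes "open U" "open V" "f ` U \<subseteq> V"
    and "times_differentiable_on k g V" "times_differentiable_on k f U"
  shows "times_differentiable_on k (\<lambda>x. g (f x)) U"
  using assms(4,5)
proof (induction k arbitrary: g)
  case 0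
  then show ?case using continuous_on_compose2 assms(3) by auto
next
  case (Suc k)
  let ?Df = "\<lambda>x. frechet_derivative f (at x)" and ?Dg = "\<lambda>y. frechet_derivative g (at y)"
  show ?case
  proof (rule times_differentiable_on_SucI[OF assms(1)])
    fix x assume x: "x \<in> U"
    then have Dg: "(g has_derivative ?Dg (f x)) (at (f x))"
      using times_differentiable_on_has_derivative[OF Suc.prems(1)] assms(3) by auto
    have "((\<lambda>x. g (f x)) has_derivative (\<lambda>v. ?Dg (f x) (?Df x v))) (at x)"
      using diff_chain_at[OF times_differentiable_on_has_derivative[OF Suc.prems(2) x] Dg]
      by (simp add: o_def)
    moreover
    have "?Dg (f x) w = (\<Sum>b\<in>Basis. (w \<bullet> b) *\<^sub>R ?Dg (f x) b)" for w
    proof -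
      have lin: "linear (?Dg (f x))" using Dg has_derivative_linear by blast
      have "?Dg (f x) w = ?Dg (f x) (\<Sum>b\<in>Basis. (w \<bullet> b) *\<^sub>R b)"
        by (simp add: euclidean_representation)
      then show ?thesis by (simp add: linear_sum[OF lin] linear_cmul[OF lin])
    qed
    then have "(\<lambda>v. ?Dg (f x) (?Df x v)) = (\<lambda>v. \<Sum>b\<in>Basis. (?Df x v \<bullet> b) *\<^sub>R ?Dg (f x) b)"
      by (intro ext)
    ultimately show "((\<lambda>x. g (f x)) has_derivative
        (\<lambda>v. \<Sum>b\<in>Basis. (?Df x v \<bullet> b) *\<^sub>R ?Dg (f x) b)) (at x)"
      by (simp only:)
  next
    fix v
    have f: "times_differentiable_on k f U" using Suc.prems times_differentiable_on_SucD by blast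
    have "times_differentiable_on k (\<lambda>x. ?Dg (f x) b) U" for b
      by (rule Suc.IH[of "\<lambda>y. ?Dg y b", OF _ f]) (use Suc.prems in auto)
    moreover have "times_differentiable_on k (\<lambda>x. ?Df x v \<bullet> b) U" for b
      by (rule times_differentiable_on_linear_comp[OF assms(1) bounded_linear_inner_left])
        (use Suc.prems in auto)
    ultimately show "times_differentiable_on k (\<lambda>x. \<Sum>b\<in>Basis. (?Df x v \<bullet> b) *\<^sub>R ?Dg (f x) b) U"
      by (intro times_differentiable_on_sum[OF assms(1)]
          times_differentiable_on_bilinear[OF assms(1) bounded_bilinear_scaleR]) auto
  qed
qed

lemma times_differentiable_on_inverse:
  fixes f :: "'a::real_normed_vector \<Rightarrow> real"
  assumes "open U" "\<And>x. x \<in> U \<Longrightarrow> f x \<noteq> 0" "times_differentiable_on k f U"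
  shows "times_differentiable_on k (\<lambda>x. inverse (f x)) U"
  using assms(3)
proof (induction k)
  case 0
  then show ?case using assms(2) by (auto intro!: continuous_intros)
next
  case (Suc k)
  show ?case
  proof (rule times_differentiable_on_SucI[OF assms(1)])
    fix x assume x: "x \<in> U"
    show "((\<lambda>x. inverse (f x)) has_derivative
        (\<lambda>v. - (inverse (f x) * frechet_derivative f (at x) v * inverse (f x)))) (at x)"
      by (rule Deriv.has_derivative_inverse[OF assms(2)[OF x]
            times_differentiable_on_has_derivative[OF Suc.prems x]])
  next
    fix v
    have inv: "times_differentiable_on k (\<lambda>x. inverse (f x)) U"
      using Suc times_differentiable_on_SucD by blast
    have "times_differentiable_on k (\<lambda>x. inverse (f x) * frechet_derivative f (at x) v * inverse (f x)) U"
      by (intro times_differentiable_on_bilinear[OF assms(1) bounded_bilinear_mult] inv)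
        (use Suc.prems in auto)
    then show "times_differentiable_on k
        (\<lambda>x. - (inverse (f x) * frechet_derivative f (at x) v * inverse (f x))) U"
      by (rule times_differentiable_on_linear_comp[OF assms(1), rotated])
        (rule bounded_linear_minus[OF bounded_linear_ident])
  qed
qed

section \<open>Smooth maps: algebra, composition, differentiation\<close>

lemma smooth_on_cong:
  "open U \<Longrightarrow> (\<And>x. x \<in> U \<Longrightarrow> f x = g x) \<Longrightarrow> smooth_on f U \<longleftrightarrow> smooth_on g U"
  unfolding smooth_on_def using times_differentiable_on_cong by blast

lemma smooth_on_subset: "smooth_on f U \<Longrightarrow> V \<subseteq> U \<Longrightarrow> smooth_on f V"
  unfolding smooth_on_def using times_differentiable_on_subset by blast

lemma smooth_on_const: "open U \<Longrightarrow> smooth_on (\<lambda>x. c) U"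
  unfolding smooth_on_def using times_differentiable_on_const by blast

lemma smooth_on_bounded_linear: "open U \<Longrightarrow> bounded_linear L \<Longrightarrow> smooth_on L U"
  unfolding smooth_on_def using times_differentiable_on_bounded_linear by blast

lemma smooth_on_linear_comp:
  "open U \<Longrightarrow> bounded_linear L \<Longrightarrow> smooth_on f U \<Longrightarrow> smooth_on (\<lambda>x. L (f x)) U"
  unfolding smooth_on_def using times_differentiable_on_linear_comp[of U L _ f] by simp

lemma smooth_on_add:
  "open U \<Longrightarrow> smooth_on f U \<Longrightarrow> smooth_on g U \<Longrightarrow> smooth_on (\<lambda>x. f x + g x) U"
  unfolding smooth_on_def using times_differentiable_on_add[of U _ f g] by simp

lemma smooth_on_uminus: "open U \<Longrightarrow> smooth_on f U \<Longrightarrow> smooth_on (\<lambda>x. - f x) U"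
  using smooth_on_linear_comp[OF _ bounded_linear_minus[OF bounded_linear_ident], of U f] by simp

lemma smooth_on_diff:
  "open U \<Longrightarrow> smooth_on f U \<Longrightarrow> smooth_on g U \<Longrightarrow> smooth_on (\<lambda>x. f x - g x) U"
  using smooth_on_add[of U f "\<lambda>x. - g x"] smooth_on_uminus[of U g] by simp

lemma smooth_on_bilinear:
  "open U \<Longrightarrow> bounded_bilinear b \<Longrightarrow> smooth_on f U \<Longrightarrow> smooth_on g U \<Longrightarrow> smooth_on (\<lambda>x. b (f x) (g x)) U"
  unfolding smooth_on_def using times_differentiable_on_bilinear[of U b _ f g] by simp

lemma smooth_on_mult:
  fixes f g :: "'a::real_normed_vector \<Rightarrow> 'b::real_normed_algebra"
  shows "open U \<Longrightarrow> smooth_on f U \<Longrightarrow> smooth_on g U \<Longrightarrow> smooth_on (\<lambda>x. f x * g x) U"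
  using smooth_on_bilinear[OF _ bounded_bilinear_mult, of U f g] by simp

lemma smooth_on_scaleR:
  "open U \<Longrightarrow> smooth_on f U \<Longrightarrow> smooth_on g U \<Longrightarrow> smooth_on (\<lambda>x. f x *\<^sub>R g x) U"
  using smooth_on_bilinear[OF _ bounded_bilinear_scaleR, of U f g] by simp

lemma smooth_on_sum:
  "open U \<Longrightarrow> (\<And>i. i \<in> I \<Longrightarrow> smooth_on (f i) U) \<Longrightarrow> smooth_on (\<lambda>x. \<Sum>i\<in>I. f i x) U"
  unfolding smooth_on_def using times_differentiable_on_sum[of U I _ f] by simp

lemma smooth_on_power:
  fixes f :: "'a::real_normed_vector \<Rightarrow> 'b::{real_normed_algebra_1}"
  shows "open U \<Longrightarrow> smooth_on f U \<Longrightarrow> smooth_on (\<lambda>x. f x ^ n) U"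
  by (induction n) (auto intro: smooth_on_const smooth_on_mult)

lemma smooth_on_compose:
  fixes f :: "'a::real_normed_vector \<Rightarrow> 'b::euclidean_space"
  shows "open U \<Longrightarrow> open V \<Longrightarrow> f ` U \<subseteq> V \<Longrightarrow> smooth_on g V \<Longrightarrow> smooth_on f U \<Longrightarrow> smooth_on (\<lambda>x. g (f x)) U"
  unfolding smooth_on_def using times_differentiable_on_compose[of U V f _ g] by simp

lemma smooth_on_inverse:
  fixes f :: "'a::real_normed_vector \<Rightarrow> real"
  shows "open U \<Longrightarrow> (\<And>x. x \<in> U \<Longrightarrow> f x \<noteq> 0) \<Longrightarrow> smooth_on f U \<Longrightarrow> smooth_on (\<lambda>x. inverse (f x)) U"
  unfolding smooth_on_def using times_differentiable_on_inverse[of U f] by simp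

lemma smooth_on_divide:
  fixes f g :: "'a::real_normed_vector \<Rightarrow> real"
  assumes "open U" "\<And>x. x \<in> U \<Longrightarrow> g x \<noteq> 0" "smooth_on f U" "smooth_on g U"
  shows "smooth_on (\<lambda>x. f x / g x) U"
  unfolding divide_inverse by (intro smooth_on_mult smooth_on_inverse assms)

lemma smooth_on_has_derivative:
  "smooth_on f U \<Longrightarrow> x \<in> U \<Longrightarrow> (f has_derivative frechet_derivative f (at x)) (at x)"
  unfolding smooth_on_def using times_differentiable_on_has_derivative by blast

lemma smooth_on_derivative: "smooth_on f U \<Longrightarrow> smooth_on (\<lambda>x. frechet_derivative f (at x) v) U"
  unfolding smooth_on_def using times_differentiable_on.simps(2)[of _ f U] by blast

lemma smooth_on_continuous_on: "smooth_on f U \<Longrightarrow> continuous_on U f"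
  unfolding smooth_on_def using times_differentiable_on.simps(1)[of f U] by blast

lemma smooth_on_vec_lambda:
  fixes f :: "'n::finite \<Rightarrow> 'a::real_normed_vector \<Rightarrow> 'b::euclidean_space"
  assumes "open U" "\<And>k. smooth_on (f k) U"
  shows "smooth_on (\<lambda>x. \<chi> k. f k x) U"
proof -
  have "bounded_linear (axis k :: 'b \<Rightarrow> 'b ^ 'n)" for k
    unfolding linear_conv_bounded_linear[symmetric]
    by (rule linearI) (auto simp: axis_def vec_eq_iff)
  then have "smooth_on (\<lambda>x. \<Sum>k\<in>UNIV. axis k (f k x)) U"
    by (intro smooth_on_sum smooth_on_linear_comp[where L = "axis k" for k] assms)
  moreover have "(\<Sum>k\<in>UNIV. axis k (f k x)) = (\<chi> k. f k x)" for x
    by (simp add: vec_eq_iff axis_def sum.delta' if_distrib[of "\<lambda>h. h $ _"] cong: if_cong)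
  ultimately show ?thesis by simp
qed

section \<open>Symmetry of second derivatives\<close>

lemma linear_basis_expansion:
  fixes L :: "'a::euclidean_space \<Rightarrow> 'b::real_vector"
  assumes "linear L"
  shows "L w = (\<Sum>b\<in>Basis. (w \<bullet> b) *\<^sub>R L b)"
proof -
  have "L w = L (\<Sum>b\<in>Basis. (w \<bullet> b) *\<^sub>R b)"
    by (simp add: euclidean_representation)
  then show ?thesis by (simp add: linear_sum[OF assms] linear_cmul[OF assms])
qed

text \<open>Both mixed derivatives are limits of the same symmetric second difference quotient.\<close>

lemma second_difference_quotient:
  fixes f :: "'a::real_normed_vector \<Rightarrow> real"
  assumes U: "open U" "p \<in> U" and f: "smooth_on f U" and e: "e > 0"
  shows "\<exists>d>0. \<forall>s. 0 < s \<and> s < d \<longrightarrow>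
    \<bar>(f (p + s *\<^sub>R u + s *\<^sub>R v) - f (p + s *\<^sub>R u) - f (p + s *\<^sub>R v) + f p) / s^2
      - frechet_derivative (\<lambda>x. frechet_derivative f (at x) u) (at p) v\<bar> < e"
proof -
  define g where "g = (\<lambda>x. frechet_derivative f (at x) u)"
  define k where "k = (\<lambda>x. frechet_derivative g (at x) v)"
  have g: "smooth_on g U" unfolding g_def by (rule smooth_on_derivative[OF f])
  then have k: "smooth_on k U" unfolding k_def by (rule smooth_on_derivative)
  obtain r where r: "r > 0" "ball p r \<subseteq> U" using U open_contains_ball by blast
  have "isCont k p" using smooth_on_continuous_on[OF k] U continuous_on_eq_continuous_at by blast
  then obtain d0 where d0: "d0 > 0" "\<And>x. dist x p < d0 \<Longrightarrow> dist (k x) (k p) < e"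
    using e unfolding continuous_at_eps_delta by blast
  \<comment> \<open>Keeps the whole parallelogram spanned by \<open>s *\<^sub>R u\<close> and
    \<open>s *\<^sub>R v\<close> inside the ball; the summand 1 prevents division by 0.\<close>
  define d where "d = min r d0 / (norm u + norm v + 1)"
  have dpos: "d > 0" using r d0 unfolding d_def by (smt (verit) divide_pos_pos norm_ge_zero)
  have close: "dist (p + a *\<^sub>R u + b *\<^sub>R v) p < min r d0"
    if "0 \<le> a" "a \<le> s" "0 \<le> b" "b \<le> s" "0 < s" "s < d" for a b s
  proof -
    have "norm (a *\<^sub>R u + b *\<^sub>R v) \<le> a * norm u + b * norm v"
      using norm_triangle_ineq[of "a *\<^sub>R u" "b *\<^sub>R v"] that by simp
    also have "\<dots> \<le> s * norm u + s * norm v"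
      by (intro add_mono mult_right_mono) (use that in auto)
    also have "\<dots> < d * (norm u + norm v + 1)"
    proof -
      have "s * (norm u + norm v) \<le> d * (norm u + norm v)" using that by (intro mult_right_mono) auto
      then show ?thesis using dpos by (simp add: algebra_simps)
    qed
    also have "\<dots> = min r d0" unfolding d_def
      by (smt (verit) nonzero_eq_divide_eq norm_ge_zero)
    finally show ?thesis by (simp add: dist_norm add.assoc)
  qed
  show ?thesis
  proof (intro exI[of _ d] conjI allI impI)
    show "d > 0" by (rule dpos)
    fix s assume s: "0 < s \<and> s < d"
    have inU: "p + a *\<^sub>R u + b *\<^sub>R v \<in> U" if "0 \<le> a" "a \<le> s" "0 \<le> b" "b \<le> s" for a b
      using close[of a s b] that s r by (auto simp: dist_commute subset_iff)
    \<comment> \<open>The mean value theorem is applied to \<open>F\<close> in the direction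
      \<open>u\<close>, then to \<open>g\<close> in the direction \<open>v\<close>; this order
      decides which mixed derivative appears.\<close>
    define F where "F = (\<lambda>a. f (p + a *\<^sub>R u + s *\<^sub>R v) - f (p + a *\<^sub>R u))"
    have DF: "(F has_real_derivative (g (p + a *\<^sub>R u + s *\<^sub>R v) - g (p + a *\<^sub>R u))) (at a)"
      if a: "0 \<le> a" "a \<le> s" for a
    proof -
      have *: "((\<lambda>a. f (p + a *\<^sub>R u + b *\<^sub>R v)) has_real_derivative g (p + a *\<^sub>R u + b *\<^sub>R v)) (at a)"
        if b: "0 \<le> b" "b \<le> s" for b
      proof -
        let ?D = "frechet_derivative f (at (p + a *\<^sub>R u + b *\<^sub>R v))"
        have D: "(f has_derivative ?D) (at (p + a *\<^sub>R u + b *\<^sub>R v))"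
          using smooth_on_has_derivative[OF f inU] a b by auto
        have "((\<lambda>a. p + a *\<^sub>R u + b *\<^sub>R v) has_derivative (\<lambda>h. h *\<^sub>R u)) (at a)"
          by (auto intro!: derivative_eq_intros)
        from diff_chain_at[OF this D] have "((\<lambda>a. f (p + a *\<^sub>R u + b *\<^sub>R v)) has_derivative (\<lambda>h. ?D (h *\<^sub>R u))) (at a)"
          by (simp add: o_def)
        then show ?thesis
          unfolding has_field_derivative_def g_def
          using linear_cmul[OF has_derivative_linear[OF D], of _ u] by (simp add: mult.commute[of _ "?D u"])
      qed
      show ?thesis unfolding F_def using *[of s] *[of 0] a s by (auto intro!: derivative_eq_intros)
    qed
    obtain a where a: "0 < a" "a < s" "F s - F 0 = s * (g (p + a *\<^sub>R u + s *\<^sub>R v) - g (p + a *\<^sub>R u))"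
      using MVT2[of 0 s F, OF _ DF] s by auto
    have DG: "((\<lambda>b. g (p + a *\<^sub>R u + b *\<^sub>R v)) has_real_derivative k (p + a *\<^sub>R u + b *\<^sub>R v)) (at b)"
      if b: "0 \<le> b" "b \<le> s" for b
    proof -
      let ?D = "frechet_derivative g (at (p + a *\<^sub>R u + b *\<^sub>R v))"
      have D: "(g has_derivative ?D) (at (p + a *\<^sub>R u + b *\<^sub>R v))"
        using smooth_on_has_derivative[OF g inU] a b by auto
      have "((\<lambda>b. p + a *\<^sub>R u + b *\<^sub>R v) has_derivative (\<lambda>h. h *\<^sub>R v)) (at b)"
        by (auto intro!: derivative_eq_intros)
      from diff_chain_at[OF this D] have "((\<lambda>b. g (p + a *\<^sub>R u + b *\<^sub>R v)) has_derivative (\<lambda>h. ?D (h *\<^sub>R v))) (at b)"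
        by (simp add: o_def)
      then show ?thesis
        unfolding has_field_derivative_def k_def
        using linear_cmul[OF has_derivative_linear[OF D], of _ v] by (simp add: mult.commute[of _ "?D v"])
    qed
    obtain b where b: "0 < b" "b < s"
      "g (p + a *\<^sub>R u + s *\<^sub>R v) - g (p + a *\<^sub>R u) = s * k (p + a *\<^sub>R u + b *\<^sub>R v)"
      using MVT2[of 0 s "\<lambda>b. g (p + a *\<^sub>R u + b *\<^sub>R v)", OF _ DG] s by auto
    have "(f (p + s *\<^sub>R u + s *\<^sub>R v) - f (p + s *\<^sub>R u) - f (p + s *\<^sub>R v) + f p) / s^2 = (F s - F 0) / s^2"
      unfolding F_def by (simp add: algebra_simps)
    also have "\<dots> = k (p + a *\<^sub>R u + b *\<^sub>R v)"
      using a b s by (simp add: power2_eq_square)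
    finally show "\<bar>(f (p + s *\<^sub>R u + s *\<^sub>R v) - f (p + s *\<^sub>R u) - f (p + s *\<^sub>R v) + f p) / s^2
      - frechet_derivative (\<lambda>x. frechet_derivative f (at x) u) (at p) v\<bar> < e"
      using d0(2)[of "p + a *\<^sub>R u + b *\<^sub>R v"] close[of a s b] a b s
      by (simp add: dist_real_def k_def g_def)
  qed
qed

lemma second_derivative_symmetric_real:
  fixes f :: "'a::real_normed_vector \<Rightarrow> real"
  assumes "open U" "p \<in> U" "smooth_on f U"
  shows "frechet_derivative (\<lambda>x. frechet_derivative f (at x) u) (at p) v
       = frechet_derivative (\<lambda>x. frechet_derivative f (at x) v) (at p) u" (is "?A = ?B")
proof (rule ccontr)
  assume "?A \<noteq> ?B"
  then have e: "\<bar>?A - ?B\<bar> / 2 > 0" by simp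
  obtain d1 where d1: "d1 > 0" "\<And>s. 0 < s \<and> s < d1 \<Longrightarrow>
    \<bar>(f (p + s *\<^sub>R u + s *\<^sub>R v) - f (p + s *\<^sub>R u) - f (p + s *\<^sub>R v) + f p) / s^2 - ?A\<bar> < \<bar>?A - ?B\<bar> / 2"
    using second_difference_quotient[OF assms e] by blast
  obtain d2 where d2: "d2 > 0" "\<And>s. 0 < s \<and> s < d2 \<Longrightarrow>
    \<bar>(f (p + s *\<^sub>R v + s *\<^sub>R u) - f (p + s *\<^sub>R v) - f (p + s *\<^sub>R u) + f p) / s^2 - ?B\<bar> < \<bar>?A - ?B\<bar> / 2"
    using second_difference_quotient[OF assms e] by blast
  define s where "s = min d1 d2 / 2"
  have s: "0 < s \<and> s < d1" "0 < s \<and> s < d2" using d1(1) d2(1) unfolding s_def by auto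
  have *: "False" if "\<bar>q - a\<bar> < \<bar>a - b\<bar> / 2" "\<bar>q - b\<bar> < \<bar>a - b\<bar> / 2" for a b q :: real
    using that by (smt (verit) field_sum_of_halves)
  have "f (p + s *\<^sub>R v + s *\<^sub>R u) - f (p + s *\<^sub>R v) - f (p + s *\<^sub>R u) + f p
      = f (p + s *\<^sub>R u + s *\<^sub>R v) - f (p + s *\<^sub>R u) - f (p + s *\<^sub>R v) + f p"
    by (simp add: algebra_simps)
  then show False using d2(2)[OF s(2)] by (intro *[OF d1(2)[OF s(1)]]) (simp only:)
qed

lemma frechet_derivative_linear_comp:
  assumes "bounded_linear L" "(f has_derivative f') (at x)"
  shows "frechet_derivative (\<lambda>x. L (f x)) (at x) v = L (f' v)"
  using fun_cong[OF frechet_derivative_at[OF bounded_linear.has_derivative[OF assms]], of v] by simp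

lemma second_derivative_symmetric:
  fixes f :: "'a::real_normed_vector \<Rightarrow> 'b::euclidean_space"
  assumes U: "open U" "p \<in> U" and f: "smooth_on f U"
  shows "frechet_derivative (\<lambda>x. frechet_derivative f (at x) u) (at p) v
       = frechet_derivative (\<lambda>x. frechet_derivative f (at x) v) (at p) u"
proof (rule euclidean_eqI)
  fix b :: 'b assume "b \<in> Basis"
  have *: "frechet_derivative (\<lambda>x. frechet_derivative f (at x) u) (at p) v \<bullet> b
     = frechet_derivative (\<lambda>x. frechet_derivative (\<lambda>y. f y \<bullet> b) (at x) u) (at p) v" for u v
  proof -
    have "frechet_derivative (\<lambda>x. frechet_derivative f (at x) u) (at p) v \<bullet> b
        = frechet_derivative (\<lambda>x. frechet_derivative f (at x) u \<bullet> b) (at p) v"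
      by (rule frechet_derivative_linear_comp[OF bounded_linear_inner_left, symmetric])
        (rule smooth_on_has_derivative[OF smooth_on_derivative[OF f] U(2)])
    also have "frechet_derivative (\<lambda>x. frechet_derivative f (at x) u \<bullet> b) (at p)
        = frechet_derivative (\<lambda>x. frechet_derivative (\<lambda>y. f y \<bullet> b) (at x) u) (at p)"
    proof (rule frechet_derivative_transform_within_open[OF _ U])
      show "(\<lambda>x. frechet_derivative f (at x) u \<bullet> b) differentiable at p"
        using smooth_on_has_derivative[OF smooth_on_linear_comp[OF U(1) bounded_linear_inner_left
              smooth_on_derivative[OF f]] U(2)] differentiable_def by blast
    next
      fix x assume "x \<in> U"
      then show "frechet_derivative f (at x) u \<bullet> b = frechet_derivative (\<lambda>y. f y \<bullet> b) (at x) u"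
        using frechet_derivative_linear_comp[OF bounded_linear_inner_left smooth_on_has_derivative[OF f]] by simp
    qed
    finally show ?thesis .
  qed
  have "smooth_on (\<lambda>y. f y \<bullet> b) U"
    by (rule smooth_on_linear_comp[OF U(1) bounded_linear_inner_left f])
  then show "frechet_derivative (\<lambda>x. frechet_derivative f (at x) u) (at p) v \<bullet> b
       = frechet_derivative (\<lambda>x. frechet_derivative f (at x) v) (at p) u \<bullet> b"
    unfolding * using second_derivative_symmetric_real[OF U] by blast
qed

section \<open>Holomorphic functions of several variables and weighted expansions\<close>

lemma has_derivative_cart:
  fixes f :: "'a::real_normed_vector \<Rightarrow> 'b::euclidean_space ^ 'n"
  assumes "\<And>k. ((\<lambda>x. f x $ k) has_derivative (\<lambda>v. f' v $ k)) (at x)"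
  shows "(f has_derivative f') (at x)"
proof (subst has_derivative_componentwise_within, intro ballI)
  fix i :: "'b ^ 'n" assume "i \<in> Basis"
  then obtain k u where i: "i = axis k u" by (auto simp: Basis_vec_def)
  show "((\<lambda>x. f x \<bullet> i) has_derivative (\<lambda>x. f' x \<bullet> i)) (at x)"
    unfolding i inner_axis by (rule has_derivative_inner_left[OF assms])
qed

lemma has_derivative_vec_nth:
  "(f has_derivative f') F \<Longrightarrow> ((\<lambda>x. f x $ k) has_derivative (\<lambda>v. f' v $ k)) F"
  by (rule bounded_linear.has_derivative[OF bounded_linear_vec_nth])

text \<open>In \<open>rigid\<close> the functions \<open>f k\<close> live on such a projection, so
  this is what allows them to be differentiated there.\<close>

lemma open_nth_image:
  assumes "open (V :: ('a::real_normed_vector ^ 'n) set)"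
  shows "open ((\<lambda>w. w $ i) ` V)"
proof (subst open_contains_ball, intro ballI)
  fix y assume "y \<in> (\<lambda>w. w $ i) ` V"
  then obtain w where w: "w \<in> V" "y = w $ i" by auto
  then obtain r where r: "r > 0" "ball w r \<subseteq> V" using assms open_contains_ball by blast
  have "x \<in> (\<lambda>w. w $ i) ` V" if x: "x \<in> ball y r" for x
  proof
    have "norm (axis i (x - y) :: 'a ^ 'n) = norm (x - y)"
      by (simp add: norm_vec_def L2_set_def axis_def if_distrib[of "\<lambda>t. norm t ^ 2"] sum.delta' cong: if_cong)
    then have "w + axis i (x - y) \<in> ball w r"
      using x by (simp add: dist_norm norm_minus_commute)
    then show "w + axis i (x - y) \<in> V" using r by blast
    show "x = (w + axis i (x - y)) $ i" using w by simp
  qed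
  then show "\<exists>e>0. ball y e \<subseteq> (\<lambda>w. w $ i) ` V" using r by blast
qed

text \<open>Homogeneity under complex scalars, together with the additivity of a real derivative,
  amounts to complex linearity.\<close>

definition holomorphic_fun_on :: "(complex ^ 'n \<Rightarrow> complex) \<Rightarrow> (complex ^ 'n) set \<Rightarrow> bool" where
  "holomorphic_fun_on f U \<longleftrightarrow>
     (\<forall>z\<in>U. \<exists>f'. (f has_derivative f') (at z) \<and> (\<forall>c v. f' (c *s v) = c * f' v))"

lemma holomorphic_fun_onD:
  assumes "holomorphic_fun_on f U" "z \<in> U"
  shows "(f has_derivative frechet_derivative f (at z)) (at z)"
    and "frechet_derivative f (at z) (c *s v) = c * frechet_derivative f (at z) v"
proof -
  obtain f' where f': "(f has_derivative f') (at z)" "\<And>c v. f' (c *s v) = c * f' v"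
    using assms unfolding holomorphic_fun_on_def by blast
  have "f' = frechet_derivative f (at z)" using frechet_derivative_at[OF f'(1)] .
  then show "(f has_derivative frechet_derivative f (at z)) (at z)"
    "frechet_derivative f (at z) (c *s v) = c * frechet_derivative f (at z) v"
    using f' by auto
qed

lemma holomorphic_map_onD:
  assumes "holomorphic_map_on f U" "z \<in> U"
  shows "(f has_derivative frechet_derivative f (at z)) (at z)"
    and "frechet_derivative f (at z) (c *s v) = c *s frechet_derivative f (at z) v"
proof -
  obtain f' where f': "(f has_derivative f') (at z)" "Vector_Spaces.linear (*s) (*s) f'"
    using assms unfolding holomorphic_map_on_def by blast
  have "f' = frechet_derivative f (at z)" using frechet_derivative_at[OF f'(1)] .
  then show "(f has_derivative frechet_derivative f (at z)) (at z)"
    "frechet_derivative f (at z) (c *s v) = c *s frechet_derivative f (at z) v"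
    using f' by (auto simp: Vector_Spaces.linear_def module_hom_def module_hom_axioms_def)
qed

lemma holomorphic_map_on_iff:
  fixes f :: "complex ^ 'n \<Rightarrow> complex ^ 'm"
  shows "holomorphic_map_on f U \<longleftrightarrow> (\<forall>k. holomorphic_fun_on (\<lambda>z. f z $ k) U)"
proof
  assume h: "holomorphic_map_on f U"
  show "\<forall>k. holomorphic_fun_on (\<lambda>z. f z $ k) U"
    unfolding holomorphic_fun_on_def
  proof (intro allI ballI)
    fix k z assume z: "z \<in> U"
    show "\<exists>f'. ((\<lambda>z. f z $ k) has_derivative f') (at z) \<and> (\<forall>c v. f' (c *s v) = c * f' v)"
      by (rule exI[of _ "\<lambda>v. frechet_derivative f (at z) v $ k"])
        (use holomorphic_map_onD[OF h z] has_derivative_vec_nth in auto)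
  qed
next
  assume h: "\<forall>k. holomorphic_fun_on (\<lambda>z. f z $ k) U"
  show "holomorphic_map_on f U"
    unfolding holomorphic_map_on_def
  proof
    fix z assume z: "z \<in> U"
    define f' :: "complex ^ 'n \<Rightarrow> complex ^ 'm" where "f' v = (\<chi> k. frechet_derivative (\<lambda>z. f z $ k) (at z) v)" for v
    have D: "(f has_derivative f') (at z)"
      by (rule has_derivative_cart) (use holomorphic_fun_onD(1) h z in \<open>auto simp: f'_def\<close>)
    have "f' (c *s v) = c *s f' v" for c v
      using holomorphic_fun_onD(2)[OF spec[OF h] z] by (simp add: f'_def vec_eq_iff)
    moreover have "f' (u + v) = f' u + f' v" for u v
      using linear_add[OF has_derivative_linear[OF D]] .
    ultimately have "Vector_Spaces.linear (*s) (*s) f'"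
      by unfold_locales (auto simp: vec.scale_right_distrib vec.scale_left_distrib)
    then show "\<exists>f'. (f has_derivative f') (at z) \<and> Vector_Spaces.linear (*s) (*s) f'" using D by blast
  qed
qed

lemma holomorphic_fun_on_subset: "holomorphic_fun_on f U \<Longrightarrow> V \<subseteq> U \<Longrightarrow> holomorphic_fun_on f V"
  unfolding holomorphic_fun_on_def by blast

lemma holomorphic_map_on_subset: "holomorphic_map_on f U \<Longrightarrow> V \<subseteq> U \<Longrightarrow> holomorphic_map_on f V"
  unfolding holomorphic_map_on_def by blast

lemma holomorphic_fun_on_continuous_on: "holomorphic_fun_on f U \<Longrightarrow> continuous_on U f"
  by (meson continuous_at_imp_continuous_on has_derivative_continuous holomorphic_fun_onD(1))

lemma holomorphic_map_on_continuous_on: "holomorphic_map_on f U \<Longrightarrow> continuous_on U f"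
  by (meson continuous_at_imp_continuous_on has_derivative_continuous holomorphic_map_onD(1))

lemma holomorphic_fun_on_cong:
  assumes "open U" "\<And>z. z \<in> U \<Longrightarrow> f z = g z" "holomorphic_fun_on f U"
  shows "holomorphic_fun_on g U"
  unfolding holomorphic_fun_on_def
proof
  fix z assume z: "z \<in> U"
  then have "(g has_derivative frechet_derivative f (at z)) (at z)"
    using has_derivative_transform_within_open[OF holomorphic_fun_onD(1)[OF assms(3) z] assms(1) z] assms(2)
    by blast
  then show "\<exists>f'. (g has_derivative f') (at z) \<and> (\<forall>c v. f' (c *s v) = c * f' v)"
    using holomorphic_fun_onD(2)[OF assms(3) z] by blast
qed

lemma holomorphic_map_on_cong:
  assumes "open U" "\<And>z. z \<in> U \<Longrightarrow> f z = g z" "holomorphic_map_on f U"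
  shows "holomorphic_map_on g U"
proof -
  have "holomorphic_fun_on (\<lambda>z. g z $ k) U" for k
    by (rule holomorphic_fun_on_cong[OF assms(1), of "\<lambda>z. f z $ k"])
      (use assms in \<open>auto simp: holomorphic_map_on_iff\<close>)
  then show ?thesis by (simp add: holomorphic_map_on_iff)
qed

lemma holomorphic_fun_on_nth: "holomorphic_fun_on (\<lambda>z. z $ k) U"
  unfolding holomorphic_fun_on_def
  by (intro ballI exI[of _ "\<lambda>z. z $ k"]) (auto intro!: bounded_linear_imp_has_derivative)

lemma holomorphic_fun_on_const: "holomorphic_fun_on (\<lambda>z. c) U"
  unfolding holomorphic_fun_on_def by (intro ballI exI[of _ "\<lambda>z. 0"]) auto

lemma holomorphic_fun_on_add:
  assumes "holomorphic_fun_on f U" "holomorphic_fun_on g U"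
  shows "holomorphic_fun_on (\<lambda>z. f z + g z) U"
  unfolding holomorphic_fun_on_def
proof
  fix z assume z: "z \<in> U"
  show "\<exists>f'. ((\<lambda>z. f z + g z) has_derivative f') (at z) \<and> (\<forall>c v. f' (c *s v) = c * f' v)"
    by (rule exI[of _ "\<lambda>v. frechet_derivative f (at z) v + frechet_derivative g (at z) v"])
      (use holomorphic_fun_onD[OF assms(1) z] holomorphic_fun_onD[OF assms(2) z] in
        \<open>auto intro: has_derivative_add simp: algebra_simps\<close>)
qed

lemma holomorphic_fun_on_cmult:
  assumes "holomorphic_fun_on f U"
  shows "holomorphic_fun_on (\<lambda>z. a * f z) U"
  unfolding holomorphic_fun_on_def
proof
  fix z assume z: "z \<in> U"
  show "\<exists>f'. ((\<lambda>z. a * f z) has_derivative f') (at z) \<and> (\<forall>c v. f' (c *s v) = c * f' v)"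
    by (rule exI[of _ "\<lambda>v. a * frechet_derivative f (at z) v"])
      (use holomorphic_fun_onD[OF assms z] in
        \<open>auto intro: has_derivative_mult_right simp: algebra_simps\<close>)
qed

lemma holomorphic_fun_on_diff:
  assumes "holomorphic_fun_on f U" "holomorphic_fun_on g U"
  shows "holomorphic_fun_on (\<lambda>z. f z - g z) U"
  using holomorphic_fun_on_add[OF assms(1) holomorphic_fun_on_cmult[OF assms(2), of "-1"]] by simp

lemma holomorphic_fun_on_sum:
  "(\<And>i. i \<in> I \<Longrightarrow> holomorphic_fun_on (f i) U) \<Longrightarrow> holomorphic_fun_on (\<lambda>z. \<Sum>i\<in>I. f i z) U"
  by (induction I rule: infinite_finite_induct)
    (auto intro: holomorphic_fun_on_const holomorphic_fun_on_add)

lemma holomorphic_fun_on_compose: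
  assumes "holomorphic_fun_on f V" "holomorphic_map_on g U" "g ` U \<subseteq> V"
  shows "holomorphic_fun_on (\<lambda>z. f (g z)) U"
  unfolding holomorphic_fun_on_def
proof
  fix z assume z: "z \<in> U"
  then have gz: "g z \<in> V" using assms by blast
  show "\<exists>f'. ((\<lambda>z. f (g z)) has_derivative f') (at z) \<and> (\<forall>c v. f' (c *s v) = c * f' v)"
    using diff_chain_at[OF holomorphic_map_onD(1)[OF assms(2) z] holomorphic_fun_onD(1)[OF assms(1) gz]]
    by (intro exI[of _ "\<lambda>v. frechet_derivative f (at (g z)) (frechet_derivative g (at z) v)"])
      (simp add: o_def holomorphic_map_onD(2)[OF assms(2) z] holomorphic_fun_onD(2)[OF assms(1) gz])
qed

lemma holomorphic_map_on_compose:
  assumes "holomorphic_map_on f V" "holomorphic_map_on g U" "g ` U \<subseteq> V"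
  shows "holomorphic_map_on (\<lambda>z. f (g z)) U"
  using assms holomorphic_fun_on_compose[of "\<lambda>z. f z $ k" V g U for k]
  by (simp add: holomorphic_map_on_iff)

lemma holomorphic_fun_on_one_variable:
  assumes "p holomorphic_on S" "open S" "(\<lambda>z. z $ i) ` U \<subseteq> S"
  shows "holomorphic_fun_on (\<lambda>z. p (z $ i)) U"
  unfolding holomorphic_fun_on_def
proof
  fix z assume z: "z \<in> U"
  then have "(p has_field_derivative deriv p (z $ i)) (at (z $ i))"
    using assms holomorphic_derivI by blast
  then have "(p has_derivative (\<lambda>h. deriv p (z $ i) * h)) (at (z $ i))"
    by (simp add: has_field_derivative_def)
  moreover have "((\<lambda>z. z $ i) has_derivative (\<lambda>z. z $ i)) (at z)"
    by (rule bounded_linear_imp_has_derivative[OF bounded_linear_vec_nth])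
  ultimately show "\<exists>f'. ((\<lambda>z. p (z $ i)) has_derivative f') (at z) \<and> (\<forall>c v. f' (c *s v) = c * f' v)"
    using diff_chain_at[of "\<lambda>z. z $ i" "\<lambda>z. z $ i" z p]
    by (intro exI[of _ "\<lambda>v. deriv p (z $ i) * v $ i"]) (simp add: o_def)
qed

text \<open>The passage to one complex variable. It is applied to complex lines and to the weighted
  curves \<open>\<lambda>\<tau>. cscale \<omega> \<tau> w\<close>.\<close>

lemma holomorphic_fun_on_curve:
  assumes f: "holomorphic_fun_on f U" and S: "open S" "\<gamma> ` S \<subseteq> U"
    and \<gamma>: "\<And>k. (\<lambda>\<zeta>. \<gamma> \<zeta> $ k) holomorphic_on S"
  shows "(\<lambda>\<zeta>. f (\<gamma> \<zeta>)) holomorphic_on S"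
    and "\<zeta> \<in> S \<Longrightarrow> ((\<lambda>\<zeta>. f (\<gamma> \<zeta>)) has_field_derivative
           frechet_derivative f (at (\<gamma> \<zeta>)) (\<chi> k. deriv (\<lambda>\<zeta>. \<gamma> \<zeta> $ k) \<zeta>)) (at \<zeta>)"
proof -
  have *: "((\<lambda>\<zeta>. f (\<gamma> \<zeta>)) has_field_derivative
           frechet_derivative f (at (\<gamma> \<zeta>)) (\<chi> k. deriv (\<lambda>\<zeta>. \<gamma> \<zeta> $ k) \<zeta>)) (at \<zeta>)"
    if \<zeta>: "\<zeta> \<in> S" for \<zeta>
  proof -
    define v :: "complex ^ 'a" where "v = (\<chi> k. deriv (\<lambda>\<zeta>. \<gamma> \<zeta> $ k) \<zeta>)"
    have "(\<gamma> has_derivative (\<lambda>h. h *s v)) (at \<zeta>)"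
    proof (rule has_derivative_cart)
      fix k
      have "((\<lambda>\<zeta>. \<gamma> \<zeta> $ k) has_field_derivative v $ k) (at \<zeta>)"
        unfolding v_def using holomorphic_derivI[OF \<gamma> S(1) \<zeta>] by simp
      then show "((\<lambda>x. \<gamma> x $ k) has_derivative (\<lambda>h. (h *s v) $ k)) (at \<zeta>)"
        by (simp add: has_field_derivative_def mult.commute[of _ "v $ k"])
    qed
    moreover have "\<gamma> \<zeta> \<in> U" using S \<zeta> by blast
    ultimately have "((\<lambda>\<zeta>. f (\<gamma> \<zeta>)) has_derivative (\<lambda>h. h * frechet_derivative f (at (\<gamma> \<zeta>)) v)) (at \<zeta>)"
      using diff_chain_at[of \<gamma> "\<lambda>h. h *s v" \<zeta> f "frechet_derivative f (at (\<gamma> \<zeta>))"]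
        holomorphic_fun_onD[OF f, of "\<gamma> \<zeta>"]
      by (simp add: o_def)
    moreover have "(\<lambda>h. h * frechet_derivative f (at (\<gamma> \<zeta>)) v) = (*) (frechet_derivative f (at (\<gamma> \<zeta>)) v)"
      by (auto simp: mult.commute)
    ultimately show ?thesis
      unfolding has_field_derivative_def v_def by simp
  qed
  show "(\<lambda>\<zeta>. f (\<gamma> \<zeta>)) holomorphic_on S"
    unfolding holomorphic_on_open[OF S(1)] using * by (intro ballI exI) 
  show "\<zeta> \<in> S \<Longrightarrow> ((\<lambda>\<zeta>. f (\<gamma> \<zeta>)) has_field_derivative
           frechet_derivative f (at (\<gamma> \<zeta>)) (\<chi> k. deriv (\<lambda>\<zeta>. \<gamma> \<zeta> $ k) \<zeta>)) (at \<zeta>)" by (rule *)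
qed

section \<open>Restriction to lines, Taylor estimates and uniform limits\<close>

lemma holomorphic_fun_on_line:
  assumes f: "holomorphic_fun_on f U" and S: "open S" "\<And>\<zeta>. \<zeta> \<in> S \<Longrightarrow> z + \<zeta> *s v \<in> U"
  shows "(\<lambda>\<zeta>. f (z + \<zeta> *s v)) holomorphic_on S"
    and "\<zeta> \<in> S \<Longrightarrow> ((\<lambda>\<zeta>. f (z + \<zeta> *s v)) has_field_derivative
           frechet_derivative f (at (z + \<zeta> *s v)) v) (at \<zeta>)"
proof -
  have [simp]: "deriv (\<lambda>\<zeta>. z $ k + \<zeta> * v $ k) \<zeta> = v $ k" for k \<zeta>
    by (rule DERIV_imp_deriv) (auto intro!: derivative_eq_intros)
  have h: "(\<lambda>\<zeta>. (z + \<zeta> *s v) $ k) holomorphic_on S" for k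
    by (simp, intro holomorphic_intros)
  have sub: "(\<lambda>\<zeta>. z + \<zeta> *s v) ` S \<subseteq> U" using S by blast
  show "(\<lambda>\<zeta>. f (z + \<zeta> *s v)) holomorphic_on S"
    using holomorphic_fun_on_curve(1)[OF f S(1) sub h] .
  show "\<zeta> \<in> S \<Longrightarrow> ((\<lambda>\<zeta>. f (z + \<zeta> *s v)) has_field_derivative
           frechet_derivative f (at (z + \<zeta> *s v)) v) (at \<zeta>)"
    using holomorphic_fun_on_curve(2)[OF f S(1) sub h, of \<zeta>] by simp
qed

text \<open>Cauchy's estimates on the circle of radius \<open>R/2\<close> dominate the tail of the
  power series by a geometric series of ratio at most 1/2; its sum accounts for the factor
  2.\<close>

lemma taylor_remainder_bound:
  assumes f: "f holomorphic_on ball 0 R" and R: "0 < R"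
    and B: "\<And>\<zeta>. \<zeta> \<in> ball 0 R \<Longrightarrow> norm (f \<zeta>) \<le> C" and \<tau>: "norm \<tau> \<le> R / 4"
  shows "norm (f \<tau> - (\<Sum>k<q. (deriv ^^ k) f 0 / fact k * \<tau> ^ k)) \<le> 2 * C * (2 * norm \<tau> / R) ^ q"
proof -
  define a where "a k = (deriv ^^ k) f 0 / fact k" for k
  have C0: "0 \<le> C" using order_trans[OF norm_ge_zero B[of 0]] R by simp
  have a: "norm (a k) \<le> C * (2 / R) ^ k" for k
  proof -
    have "norm ((deriv ^^ k) f 0) \<le> fact k * C / (R/2) ^ k"
    proof (rule Cauchy_inequality)
      show "f holomorphic_on ball 0 (R/2)" using f by (rule holomorphic_on_subset) (use R in auto)
      show "continuous_on (cball 0 (R/2)) f"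
        by (rule holomorphic_on_imp_continuous_on, rule holomorphic_on_subset[OF f]) (use R in auto)
      show "cmod (f x) \<le> C" if "cmod (0 - x) = R/2" for x using B[of x] that R by auto
    qed (use R in auto)
    then show ?thesis by (simp add: a_def norm_divide field_simps)
  qed
  define x where "x = 2 * norm \<tau> / R"
  have x: "0 \<le> x" "x \<le> 1/2" using \<tau> R by (auto simp: x_def field_simps)
  have sums: "(\<lambda>k. a k * \<tau> ^ k) sums f \<tau>"
    using holomorphic_power_series[OF f, of \<tau>] \<tau> R by (simp add: a_def)
  have bnd: "norm (a k * \<tau> ^ k) \<le> C * x ^ k" for k
  proof -
    have "norm (a k * \<tau> ^ k) = norm (a k) * norm \<tau> ^ k" by (simp add: norm_mult norm_power)
    also have "\<dots> \<le> C * (2 / R) ^ k * norm \<tau> ^ k" by (intro mult_right_mono a) auto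
    also have "\<dots> = C * x ^ k" by (simp add: x_def power_divide power_mult_distrib)
    finally show ?thesis .
  qed
  have bnd': "norm (a (k + q) * \<tau> ^ (k + q)) \<le> C * x ^ q * x ^ k" for k
    using bnd[of "k + q"] by (simp add: power_add mult_ac)
  have sums': "(\<lambda>k. a (k + q) * \<tau> ^ (k + q)) sums (f \<tau> - (\<Sum>k<q. a k * \<tau> ^ k))"
    using sums_iff_shift'[of "\<lambda>k. a k * \<tau> ^ k" q] sums by simp
  have geo: "(\<lambda>k. C * x ^ q * x ^ k) sums (C * x ^ q * (1 / (1 - x)))"
    by (intro sums_mult geometric_sums) (use x in auto)
  have "norm (f \<tau> - (\<Sum>k<q. a k * \<tau> ^ k)) \<le> C * x ^ q * (1 / (1 - x))"
  proof -
    have sm: "summable (\<lambda>k. norm (a (k + q) * \<tau> ^ (k + q)))"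
      by (rule summable_comparison_test'[OF sums_summable[OF geo], of 0])
        (use bnd' in simp)
    have "norm (f \<tau> - (\<Sum>k<q. a k * \<tau> ^ k)) = norm (\<Sum>k. a (k + q) * \<tau> ^ (k + q))"
      using sums' by (simp add: sums_iff)
    also have "\<dots> \<le> (\<Sum>k. norm (a (k + q) * \<tau> ^ (k + q)))" by (rule summable_norm[OF sm])
    also have "\<dots> \<le> (\<Sum>k. C * x ^ q * x ^ k)"
      by (rule suminf_le[OF _ sm sums_summable[OF geo]])
        (use bnd' in simp)
    also have "\<dots> = C * x ^ q * (1 / (1 - x))" using geo by (simp add: sums_iff)
    finally show ?thesis .
  qed
  also have "\<dots> \<le> C * x ^ q * 2"
    by (intro mult_left_mono) (use x C0 in \<open>auto simp: field_simps\<close>)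
  finally show ?thesis by (simp add: a_def x_def mult_ac)
qed

lemma holomorphic_uniform_limit_open:
  assumes "open A" "uniform_limit A f g F" "\<forall>\<^sub>F n in F. f n holomorphic_on A" "F \<noteq> bot"
  shows "g holomorphic_on A"
proof -
  have "\<exists>r>0. g holomorphic_on ball z r" if z: "z \<in> A" for z
  proof -
    obtain r where r: "r > 0" "cball z r \<subseteq> A" using assms(1) z open_contains_cball by blast
    have "\<forall>\<^sub>F n in F. continuous_on (cball z r) (f n) \<and> f n holomorphic_on ball z r"
      using assms(3)
      by (rule eventually_mono)
        (use r in \<open>auto intro: holomorphic_on_imp_continuous_on holomorphic_on_subset[OF _ subset_trans[OF ball_subset_cball]] holomorphic_on_subset\<close>)
    then have "g holomorphic_on ball z r"
      using holomorphic_uniform_limit[OF _ uniform_limit_on_subset[OF assms(2) r(2)] assms(4)] by blast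
    then show ?thesis using r by blast
  qed
  then show ?thesis
    by (metis analytic_on_def analytic_imp_holomorphic)
qed

lemma norm_cscale_vec: "norm (c *s v) = cmod c * norm (v :: complex ^ 'n)"
  by (simp add: norm_vec_def L2_set_right_distrib norm_mult)

text \<open>Taylor's formula of order 2 for the restriction to the line through \<open>z\<close> in
  direction \<open>h\<close>, evaluated at the parameter 1. The disc has radius
  \<open>r / norm h\<close>, whence the constant \<open>8 * C / r^2\<close>.\<close>

lemma line_remainder_bound:
  assumes f: "(\<lambda>\<zeta>. f (z + \<zeta> *s h)) holomorphic_on ball 0 (r / norm h)" and r: "0 < r" "h \<noteq> 0" "norm h \<le> r / 4"
    and B: "\<And>w. w \<in> ball z r \<Longrightarrow> norm (f w) \<le> C"
  shows "norm (f (z + h) - f z - deriv (\<lambda>\<zeta>. f (z + \<zeta> *s h)) 0) \<le> 8 * C / r^2 * norm h ^ 2"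
proof -
  let ?g = "\<lambda>\<zeta>. f (z + \<zeta> *s h)"
  have "norm (?g 1 - (\<Sum>k<2. (deriv ^^ k) ?g 0 / fact k * 1 ^ k)) \<le> 2 * C * (2 * norm (1::complex) / (r / norm h)) ^ 2"
  proof (rule taylor_remainder_bound[OF f])
    show "0 < r / norm h" using r by simp
    show "norm (?g \<zeta>) \<le> C" if "\<zeta> \<in> ball 0 (r / norm h)" for \<zeta>
      by (rule B) (use that r in \<open>simp add: dist_norm norm_cscale_vec field_simps\<close>)
    show "cmod 1 \<le> r / norm h / 4" using r by (simp add: field_simps)
  qed
  then show ?thesis using r by (simp add: numeral_2_eq_2 field_simps)
qed

text \<open>Along each line the one-variable theorems give holomorphy and convergence of
  derivatives, so the directional derivatives of the limit are complex linear in the direction. The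
  bound of \<open>line_remainder_bound\<close> is uniform in the direction and upgrades them to a
  total derivative.\<close>

lemma holomorphic_fun_on_uniform_limit:
  fixes g :: "'a \<Rightarrow> complex ^ 'n \<Rightarrow> complex"
  assumes U: "open U" and g: "\<forall>\<^sub>F n in F. holomorphic_fun_on (g n) U"
    and lim: "uniform_limit U g G F" and F: "F \<noteq> bot"
  shows "holomorphic_fun_on G U"
  unfolding holomorphic_fun_on_def
proof
  fix z assume "z \<in> U"
  then obtain r where r: "r > 0" "cball z r \<subseteq> U" using U open_contains_cball by blast
  have contG: "continuous_on U G"
    by (rule uniform_limit_theorem[OF eventually_mono[OF g] lim F]) (rule holomorphic_fun_on_continuous_on)
  obtain C where C: "\<And>w. w \<in> cball z r \<Longrightarrow> norm (G w) \<le> C"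
    using compact_imp_bounded[OF compact_continuous_image[OF continuous_on_subset[OF contG r(2)] compact_cball]]
    unfolding bounded_iff by (metis image_eqI)
  define L where "L h = deriv (\<lambda>\<zeta>. G (z + \<zeta> *s h)) 0" for h
  \<comment> \<open>\<open>s = 0\<close> gives the large disc needed for the remainder estimate,
    \<open>s = 1\<close> covers the direction \<open>h = 0\<close>.\<close>
  have disc: "z + \<zeta> *s h \<in> U" if "\<zeta> \<in> ball 0 (r / (norm h + s))" "s \<ge> 0" "norm h + s > 0" for \<zeta> h s
  proof -
    have "norm \<zeta> * norm h \<le> norm \<zeta> * (norm h + s)" using that by (intro mult_left_mono) auto
    also have "\<dots> < r" using that by (simp add: field_simps)
    finally have "z + \<zeta> *s h \<in> cball z r" by (simp add: dist_norm norm_cscale_vec)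
    then show ?thesis using r by blast
  qed
  have line: "uniform_limit (ball 0 (r / (norm h + s))) (\<lambda>n \<zeta>. g n (z + \<zeta> *s h)) (\<lambda>\<zeta>. G (z + \<zeta> *s h)) F"
    "\<forall>\<^sub>F n in F. (\<lambda>\<zeta>. g n (z + \<zeta> *s h)) holomorphic_on (ball 0 (r / (norm h + s)))"
    if hs: "s \<ge> 0" "norm h + s > 0" for h s
  proof -
    show "uniform_limit (ball 0 (r / (norm h + s))) (\<lambda>n \<zeta>. g n (z + \<zeta> *s h)) (\<lambda>\<zeta>. G (z + \<zeta> *s h)) F"
      by (rule uniform_limit_compose'[OF lim]) (use disc hs in auto)
    show "\<forall>\<^sub>F n in F. (\<lambda>\<zeta>. g n (z + \<zeta> *s h)) holomorphic_on (ball 0 (r / (norm h + s)))"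
      using g by (rule eventually_mono) (rule holomorphic_fun_on_line(1), auto intro: disc hs)
  qed
  have holG: "(\<lambda>\<zeta>. G (z + \<zeta> *s h)) holomorphic_on (ball 0 (r / norm h))" if h: "h \<noteq> 0" for h
  proof (rule holomorphic_uniform_limit_open)
    show "open (ball 0 (r / norm h) :: complex set)" by simp
    show "uniform_limit (ball 0 (r / norm h)) (\<lambda>n \<zeta>. g n (z + \<zeta> *s h)) (\<lambda>\<zeta>. G (z + \<zeta> *s h)) F"
      "\<forall>\<^sub>F n in F. (\<lambda>\<zeta>. g n (z + \<zeta> *s h)) holomorphic_on (ball 0 (r / norm h))"
      using line[of 0 h] h by auto
    show "F \<noteq> bot" by (rule F)
  qed
  have Llim: "((\<lambda>n. frechet_derivative (g n) (at z) h) \<longlongrightarrow> L h) F" for h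
  proof -
    have pos: "norm h + 1 > 0" by (smt (verit) norm_ge_zero)
    have "((\<lambda>n. deriv (\<lambda>\<zeta>. g n (z + \<zeta> *s h)) 0) \<longlongrightarrow> L h) F"
      unfolding L_def
      by (rule deriv_complex_uniform_limit[OF line[OF _ pos] F]) (use r pos in auto)
    moreover have "\<forall>\<^sub>F n in F. deriv (\<lambda>\<zeta>. g n (z + \<zeta> *s h)) 0 = frechet_derivative (g n) (at z) h"
      using g
    proof (rule eventually_mono)
      fix n assume gn: "holomorphic_fun_on (g n) U"
      show "deriv (\<lambda>\<zeta>. g n (z + \<zeta> *s h)) 0 = frechet_derivative (g n) (at z) h"
        using DERIV_imp_deriv[OF holomorphic_fun_on_line(2)[OF gn open_ball[of 0 "r / (norm h + 1)"] disc[OF _ _ pos], of 0]]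
          r pos by simp
    qed
    ultimately show ?thesis by (rule Lim_transform_eventually)
  qed
  have Ladd: "L (u + v) = L u + L v" for u v
  proof (rule tendsto_unique[OF F Llim])
    have "\<forall>\<^sub>F n in F. frechet_derivative (g n) (at z) u + frechet_derivative (g n) (at z) v
         = frechet_derivative (g n) (at z) (u + v)"
      using g by (rule eventually_mono)
        (use linear_add[OF has_derivative_linear[OF holomorphic_fun_onD(1)[OF _ \<open>z \<in> U\<close>]]] in auto)
    then show "((\<lambda>n. frechet_derivative (g n) (at z) (u + v)) \<longlongrightarrow> L u + L v) F"
      by (rule Lim_transform_eventually[OF tendsto_add[OF Llim Llim]])
  qed
  have Lscale: "L (c *s v) = c * L v" for c v
  proof (rule tendsto_unique[OF F Llim])
    have "\<forall>\<^sub>F n in F. c * frechet_derivative (g n) (at z) v = frechet_derivative (g n) (at z) (c *s v)"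
      using g by (rule eventually_mono) (use holomorphic_fun_onD(2)[OF _ \<open>z \<in> U\<close>] in auto)
    then show "((\<lambda>n. frechet_derivative (g n) (at z) (c *s v)) \<longlongrightarrow> c * L v) F"
      by (rule Lim_transform_eventually[OF tendsto_mult_left[OF Llim]])
  qed
  have "linear L"
  proof (rule linearI)
    fix c :: real and v :: "complex ^ 'n"
    have "c *\<^sub>R v = of_real c *s v"
      by (simp add: vec_eq_iff scaleR_conv_of_real[where 'a = complex])
    then show "L (c *\<^sub>R v) = c *\<^sub>R L v" using Lscale by (simp add: scaleR_conv_of_real)
  qed (rule Ladd)
  have "(G has_derivative L) (at z)"
    unfolding has_derivative_at_alt
  proof (intro conjI allI impI)
    show "bounded_linear L" using \<open>linear L\<close> linear_conv_bounded_linear by blast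
    fix e :: real assume e: "e > 0"
    have C0: "C \<ge> 0" using order_trans[OF norm_ge_zero C[of z]] r by simp
    define K where "K = 8 * C / r^2 + 1"
    have K: "K > 0" using C0 r unfolding K_def by (smt (verit) divide_nonneg_pos zero_less_power mult_nonneg_nonneg)
    show "\<exists>d>0. \<forall>y. norm (y - z) < d \<longrightarrow> norm (G y - G z - L (y - z)) \<le> e * norm (y - z)"
    proof (intro exI[of _ "min (r/4) (e / K)"] conjI allI impI)
      show "min (r/4) (e / K) > 0" using r e K by simp
      fix y assume y: "norm (y - z) < min (r/4) (e / K)"
      show "norm (G y - G z - L (y - z)) \<le> e * norm (y - z)"
      proof (cases "y = z")
        case True
        then show ?thesis using linear_0[OF \<open>linear L\<close>] by simp
      next
        case False
        have "norm (G (z + (y - z)) - G z - L (y - z)) \<le> 8 * C / r^2 * norm (y - z) ^ 2"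
          unfolding L_def by (rule line_remainder_bound[OF holG]) (use False y r C in auto)
        also have "\<dots> \<le> K * norm (y - z) ^ 2" unfolding K_def by (intro mult_right_mono) auto
        also have "\<dots> = (K * norm (y - z)) * norm (y - z)" by (simp add: power2_eq_square)
        also have "\<dots> \<le> e * norm (y - z)"
          by (intro mult_right_mono) (use y K in \<open>auto simp: field_simps\<close>)
        finally show ?thesis by simp
      qed
    qed
  qed
  then show "\<exists>f'. (G has_derivative f') (at z) \<and> (\<forall>c v. f' (c *s v) = c * f' v)"
    using Lscale by blast
qed


lemma holomorphic_map_on_translation: "holomorphic_map_on (\<lambda>z. z + a) U"
  by (auto simp: holomorphic_map_on_iff intro!: holomorphic_fun_on_add holomorphic_fun_on_nth holomorphic_fun_on_const)

lemma holomorphic_fun_on_local: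
  assumes "\<And>z. z \<in> U \<Longrightarrow> \<exists>V. z \<in> V \<and> holomorphic_fun_on f V"
  shows "holomorphic_fun_on f U"
  using assms unfolding holomorphic_fun_on_def by blast

text \<open>A directional derivative is the locally uniform limit of difference quotients, which are
  holomorphic; uniformity comes from \<open>line_remainder_bound\<close>.\<close>

lemma holomorphic_fun_on_derivative:
  fixes f :: "complex ^ 'n \<Rightarrow> complex"
  assumes U: "open U" and f: "holomorphic_fun_on f U"
  shows "holomorphic_fun_on (\<lambda>z. frechet_derivative f (at z) v) U"
proof (cases "v = 0")
  case True
  have "frechet_derivative f (at z) v = 0" if "z \<in> U" for z
    using holomorphic_fun_onD(2)[OF f that, of 0 0] True by simp
  then show ?thesis
    by (intro holomorphic_fun_on_cong[OF U _ holomorphic_fun_on_const[of 0]]) simp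
next
  case v: False
  show ?thesis
  proof (rule holomorphic_fun_on_local)
    fix z0 assume "z0 \<in> U"
    then obtain R where R: "R > 0" "cball z0 R \<subseteq> U" using U open_contains_cball by blast
    \<comment> \<open>Half the radius, so that balls of radius \<open>r\<close> around points of
      \<open>ball z0 r\<close> stay in the region where \<open>f\<close> is bounded.\<close>
    define r where "r = R / 2"
    have r: "r > 0" "cball z0 (2 * r) \<subseteq> U" using R by (auto simp: r_def)
    obtain C where C: "\<And>w. w \<in> cball z0 (2 * r) \<Longrightarrow> norm (f w) \<le> C"
      using compact_imp_bounded[OF compact_continuous_image[OF continuous_on_subset[OF
          holomorphic_fun_on_continuous_on[OF f] r(2)] compact_cball]]
      unfolding bounded_iff by (metis image_eqI)
    have C0: "C \<ge> 0" using order_trans[OF norm_ge_zero C[of z0]] r by simp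
    define s where "s n = complex_of_real (inverse (real (Suc n)))" for n
    have norms: "norm (s n) = inverse (real (Suc n))" for n unfolding s_def by (simp only: norm_of_real) simp
    have s0: "s n \<noteq> 0" for n using norms[of n] by (auto simp del: of_nat_Suc)
    have slim: "(\<lambda>n. norm (s n)) \<longlonglongrightarrow> 0"
      unfolding norms using LIMSEQ_inverse_real_of_nat .
    have small: "\<forall>\<^sub>F n in sequentially. norm (s n *s v) \<le> r / 4"
    proof -
      have "(\<lambda>n. norm (s n *s v)) \<longlonglongrightarrow> 0"
        unfolding norm_cscale_vec using tendsto_mult_left_zero[OF slim] .
      then have "\<forall>\<^sub>F n in sequentially. norm (s n *s v) < r / 4"
        using r by (intro order_tendstoD(2)) auto
      then show ?thesis by (rule eventually_mono) simp
    qed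
    define g where "g n z = inverse (s n) * (f (z + s n *s v) - f z)" for n z
    have "holomorphic_fun_on (\<lambda>z. frechet_derivative f (at z) v) (ball z0 r)"
    proof (rule holomorphic_fun_on_uniform_limit)
      show "\<forall>\<^sub>F n in sequentially. holomorphic_fun_on (g n) (ball z0 r)"
        using small
      proof (rule eventually_mono)
        fix n assume n: "norm (s n *s v) \<le> r / 4"
        have sub: "(\<lambda>z. z + s n *s v) ` ball z0 r \<subseteq> U"
        proof
          fix w assume "w \<in> (\<lambda>z. z + s n *s v) ` ball z0 r"
          then obtain z where z: "z \<in> ball z0 r" "w = z + s n *s v" by blast
          have "norm (w - z0) \<le> norm (z - z0) + norm (s n *s v)"
            unfolding z using norm_triangle_ineq[of "z - z0" "s n *s v"] by (simp add: algebra_simps)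
          then show "w \<in> U" using z n r by (auto simp: dist_norm norm_minus_commute subset_iff)
        qed
        have "ball z0 r \<subseteq> U" using r by (auto simp: subset_iff)
        then show "holomorphic_fun_on (g n) (ball z0 r)"
          unfolding g_def
          by (intro holomorphic_fun_on_cmult holomorphic_fun_on_diff
              holomorphic_fun_on_compose[OF f holomorphic_map_on_translation sub]
              holomorphic_fun_on_subset[OF f])
      qed
      show "uniform_limit (ball z0 r) g (\<lambda>z. frechet_derivative f (at z) v) sequentially"
      proof (rule uniform_limitI)
        fix e :: real assume e: "e > 0"
        define K where "K = 8 * C / r^2 * norm v ^ 2"
        have K0: "K \<ge> 0" using C0 by (simp add: K_def)
        have "(\<lambda>n. K * norm (s n)) \<longlonglongrightarrow> 0" using tendsto_mult_right_zero[OF slim] .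
        then have "\<forall>\<^sub>F n in sequentially. K * norm (s n) < e" using e by (intro order_tendstoD(2)) auto
        with small show "\<forall>\<^sub>F n in sequentially. \<forall>x\<in>ball z0 r. dist (g n x) (frechet_derivative f (at x) v) < e"
        proof eventually_elim
          case (elim n)
          show ?case
          proof
            fix z assume z: "z \<in> ball z0 r"
            let ?h = "s n *s v"
            have h0: "?h \<noteq> 0" using v s0 by (metis norm_cscale_vec norm_eq_zero mult_eq_0_iff)
            have inU: "w \<in> cball z0 (2 * r)" if "w \<in> ball z r" for w
              using dist_triangle[of z0 w z] that z by (simp add: dist_commute)
            have line: "z + \<zeta> *s ?h \<in> U" if "\<zeta> \<in> ball 0 (r / norm ?h)" for \<zeta>
            proof -
              have "z + \<zeta> *s ?h \<in> ball z r"
                using that h0 by (simp add: dist_norm norm_cscale_vec norm_mult pos_less_divide_eq mult.assoc)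
              then show ?thesis using inU r by blast
            qed
            have zU: "z \<in> U" using inU[of z] r by auto
            have "deriv (\<lambda>\<zeta>. f (z + \<zeta> *s ?h)) 0 = frechet_derivative f (at z) ?h"
            proof -
              have "((\<lambda>\<zeta>. f (z + \<zeta> *s ?h)) has_field_derivative frechet_derivative f (at (z + 0 *s ?h)) ?h) (at 0)"
                by (rule holomorphic_fun_on_line(2)[OF f open_ball[of 0 "r / norm ?h"] line]) (use h0 r in auto)
              then show ?thesis using DERIV_imp_deriv[of "\<lambda>\<zeta>. f (z + \<zeta> *s ?h)"] by simp
            qed
            moreover have "norm (f (z + ?h) - f z - deriv (\<lambda>\<zeta>. f (z + \<zeta> *s ?h)) 0) \<le> 8 * C / r^2 * norm ?h ^ 2"
            proof (rule line_remainder_bound)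
              show "(\<lambda>\<zeta>. f (z + \<zeta> *s ?h)) holomorphic_on ball 0 (r / norm ?h)"
                by (rule holomorphic_fun_on_line(1)[OF f open_ball line])
            qed (use r h0 elim inU C in auto)
            ultimately have "norm (f (z + ?h) - f z - s n * frechet_derivative f (at z) v) \<le> K * norm (s n) ^ 2"
              using holomorphic_fun_onD(2)[OF f zU]
              by (simp add: norm_cscale_vec power_mult_distrib K_def mult_ac)
            moreover have "g n z - frechet_derivative f (at z) v
                = inverse (s n) * (f (z + ?h) - f z - s n * frechet_derivative f (at z) v)"
              unfolding g_def using s0[of n] by (simp add: field_simps)
            ultimately have "norm (g n z - frechet_derivative f (at z) v) \<le> inverse (norm (s n)) * (K * norm (s n) ^ 2)"
              by (simp add: norm_mult norm_inverse mult_left_mono)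
            also have "\<dots> = K * norm (s n)" using s0[of n] by (simp add: power2_eq_square)
            finally show "dist (g n z) (frechet_derivative f (at z) v) < e"
              using elim by (simp add: dist_norm)
          qed
        qed
      qed
    qed auto
    then show "\<exists>V. z0 \<in> V \<and> holomorphic_fun_on (\<lambda>z. frechet_derivative f (at z) v) V"
      using r by (intro exI[of _ "ball z0 r"]) auto
  qed
qed

lemma holomorphic_fun_on_imp_smooth_on:
  assumes "open U" "holomorphic_fun_on f U"
  shows "smooth_on f U"
proof -
  have "times_differentiable_on k f U" for k
    using assms(2)
  proof (induction k arbitrary: f)
    case 0
    then show ?case using holomorphic_fun_on_continuous_on by simp
  next
    case (Suc k)
    show ?case
      by (rule times_differentiable_on_SucI[OF assms(1) holomorphic_fun_onD(1)[OF Suc.prems]])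
        (use Suc holomorphic_fun_on_derivative[OF assms(1)] in blast)+
  qed
  then show ?thesis by (simp add: smooth_on_def)
qed

lemma holomorphic_map_on_imp_smooth_on:
  fixes f :: "complex ^ 'n \<Rightarrow> complex ^ 'm"
  assumes "open U" "holomorphic_map_on f U"
  shows "smooth_on f U"
proof -
  have "smooth_on (\<lambda>z. \<chi> k. f z $ k) U"
    by (rule smooth_on_vec_lambda[OF assms(1)])
      (use assms holomorphic_fun_on_imp_smooth_on in \<open>auto simp: holomorphic_map_on_iff\<close>)
  then show ?thesis by simp
qed

lemma holomorphic_on_imp_smooth_on:
  fixes p :: "complex \<Rightarrow> complex"
  assumes "open S" "p holomorphic_on S"
  shows "smooth_on p S"
proof -
  have "times_differentiable_on k p S" for k
    using assms(2)
  proof (induction k arbitrary: p)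
    case 0
    then show ?case using holomorphic_on_imp_continuous_on by simp
  next
    case (Suc k)
    show ?case
    proof (rule times_differentiable_on_SucI[OF assms(1), where f' = "\<lambda>z h. deriv p z * h"])
      show "(p has_derivative (\<lambda>h. deriv p z * h)) (at z)" if "z \<in> S" for z
        using holomorphic_derivI[OF Suc.prems assms(1) that] by (simp add: has_field_derivative_def)
      show "times_differentiable_on k (\<lambda>z. deriv p z * h) S" for h
        by (rule Suc.IH) (intro holomorphic_intros Suc.prems assms(1))
    qed
  qed
  then show ?thesis by (simp add: smooth_on_def)
qed

section \<open>Weighted dilations and weighted homogeneous components\<close>

definition cscale :: "('n \<Rightarrow> nat) \<Rightarrow> complex \<Rightarrow> complex ^ 'n \<Rightarrow> complex ^ 'n" where
  "cscale \<omega> \<tau> z = (\<chi> k. \<tau> ^ \<omega> k * z $ k)"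

lemma cscale_nth [simp]: "cscale \<omega> \<tau> z $ k = \<tau> ^ \<omega> k * z $ k"
  by (simp add: cscale_def)

lemma cscale_1 [simp]: "cscale \<omega> 1 z = z" by (simp add: vec_eq_iff)

lemma cscale_0_right [simp]: "cscale \<omega> \<tau> 0 = 0" by (simp add: vec_eq_iff)

lemma cscale_cscale [simp]: "cscale \<omega> s (cscale \<omega> t z) = cscale \<omega> (s * t) z"
  by (simp add: vec_eq_iff power_mult_distrib)

lemma weighted_scaling_eq: "weighted_scaling \<omega> t z = cscale \<omega> (of_real t) z"
  by (simp add: vec_eq_iff weighted_scaling_def)

lemma norm_cscale_le: "norm \<tau> \<le> 1 \<Longrightarrow> norm (cscale \<omega> \<tau> z) \<le> norm z"
  by (rule norm_le_componentwise_cart)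
    (auto simp: norm_mult norm_power intro!: mult_left_le_one_le power_le_one)

lemma norm_cscale_le':
  assumes "norm \<tau> \<le> 1" "\<And>k. \<omega> k > 0"
  shows "norm (cscale \<omega> \<tau> z) \<le> norm \<tau> * norm z"
proof -
  have "norm (cscale \<omega> \<tau> z) \<le> norm (\<tau> *s z)"
  proof (rule norm_le_componentwise_cart)
    fix k
    obtain j where "\<omega> k = Suc j" using assms(2)[of k] gr0_conv_Suc by blast
    then show "norm (cscale \<omega> \<tau> z $ k) \<le> norm ((\<tau> *s z) $ k)"
      using power_le_one[of "norm \<tau>" j] assms(1)
      by (auto simp: norm_mult norm_power intro!: mult_right_mono mult_left_le)
  qed
  then show ?thesis by (simp add: norm_cscale_vec)
qed

lemma holomorphic_map_on_cscale: "holomorphic_map_on (cscale \<omega> \<tau>) U"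
  by (auto simp: holomorphic_map_on_iff intro!: holomorphic_fun_on_cmult holomorphic_fun_on_nth)

lemma continuous_on_cscale: "continuous_on U (cscale \<omega> \<tau>)"
  by (rule holomorphic_map_on_continuous_on[OF holomorphic_map_on_cscale])

text \<open>The component of \<open>g\<close> of weighted degree \<open>j\<close>. The complex
  parameter in \<open>cscale\<close> makes it a Taylor coefficient in one variable, so that
  monomials in several variables never appear.\<close>

definition weight_coeff :: "('n \<Rightarrow> nat) \<Rightarrow> nat \<Rightarrow> (complex ^ 'n \<Rightarrow> complex) \<Rightarrow> complex ^ 'n \<Rightarrow> complex" where
  "weight_coeff \<omega> j g w = (deriv ^^ j) (\<lambda>\<tau>. g (cscale \<omega> \<tau> w)) 0 / fact j"

lemma cscale_in_ball: "w \<in> ball 0 r \<Longrightarrow> norm \<tau> \<le> 1 \<Longrightarrow> cscale \<omega> \<tau> w \<in> ball 0 r"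
  using norm_cscale_le[of \<tau> \<omega> w] by (auto simp: dist_norm)

lemma holomorphic_on_weight_curve:
  assumes "holomorphic_fun_on g (ball 0 r)" "w \<in> ball 0 r"
  shows "(\<lambda>\<tau>. g (cscale \<omega> \<tau> w)) holomorphic_on ball 0 1"
proof -
  have "(\<lambda>\<tau>. cscale \<omega> \<tau> w) ` ball 0 1 \<subseteq> ball 0 r"
    using cscale_in_ball[OF assms(2)] by (auto simp: image_subset_iff simp del: mem_ball)
  moreover have "(\<lambda>\<zeta>. cscale \<omega> \<zeta> w $ k) holomorphic_on ball 0 1" for k
    unfolding cscale_nth by (intro holomorphic_intros)
  ultimately show ?thesis
    using holomorphic_fun_on_curve(1)[OF assms(1) open_ball, of "\<lambda>\<tau>. cscale \<omega> \<tau> w" 0 1] by simp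
qed

lemma weight_expansion:
  assumes g: "holomorphic_fun_on g (ball 0 r)" and C: "\<And>z. z \<in> ball 0 r \<Longrightarrow> norm (g z) \<le> C"
    and w: "w \<in> ball 0 r" and \<tau>: "norm \<tau> \<le> 1 / 4"
  shows "norm (g (cscale \<omega> \<tau> w) - (\<Sum>k<q. weight_coeff \<omega> k g w * \<tau> ^ k)) \<le> 2 * C * (2 * norm \<tau>) ^ q"
proof -
  have "norm (g (cscale \<omega> \<zeta> w)) \<le> C" if "\<zeta> \<in> ball 0 1" for \<zeta>
    using C[OF cscale_in_ball[OF w]] that by simp
  then show ?thesis
    using taylor_remainder_bound[OF holomorphic_on_weight_curve[OF g w, of \<omega>], of C \<tau> q] \<tau>
    by (simp add: weight_coeff_def)
qed

lemma weight_expansion_lowest: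
  assumes g: "holomorphic_fun_on g (ball 0 r)" and C: "\<And>z. z \<in> ball 0 r \<Longrightarrow> norm (g z) \<le> C"
    and w: "w \<in> ball 0 r" and \<tau>: "norm \<tau> \<le> 1 / 4"
    and low: "\<And>k. k < q \<Longrightarrow> weight_coeff \<omega> k g w = 0"
  shows "norm (g (cscale \<omega> \<tau> w) - \<tau> ^ q * weight_coeff \<omega> q g w) \<le> 2 * C * (2 * norm \<tau>) ^ Suc q"
    and "norm (g (cscale \<omega> \<tau> w)) \<le> 2 * C * (2 * norm \<tau>) ^ q"
  using weight_expansion[OF g C w \<tau>, of \<omega> "Suc q"] weight_expansion[OF g C w \<tau>, of \<omega> q] low
  by (simp_all add: mult.commute)

lemma weight_coeff_cscale:
  assumes g: "holomorphic_fun_on g (ball 0 r)" and w: "w \<in> ball 0 r" and \<sigma>: "norm \<sigma> \<le> 1"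
  shows "weight_coeff \<omega> q g (cscale \<omega> \<sigma> w) = \<sigma> ^ q * weight_coeff \<omega> q g w"
proof -
  have "(deriv ^^ q) (\<lambda>\<tau>. g (cscale \<omega> (\<sigma> * \<tau>) w)) 0 = \<sigma> ^ q * (deriv ^^ q) (\<lambda>\<tau>. g (cscale \<omega> \<tau> w)) (\<sigma> * 0)"
  proof (rule higher_deriv_compose_linear[OF holomorphic_on_weight_curve[OF g w]])
    show "\<sigma> * \<zeta> \<in> ball 0 1" if "\<zeta> \<in> ball 0 1" for \<zeta>
      using that \<sigma> mult_le_less_imp_less[of "norm \<sigma>" 1 "norm \<zeta>" 1] mult_left_le_one_le[of "norm \<zeta>" "norm \<sigma>"]
      by (simp add: norm_mult)
  qed auto
  then show ?thesis by (simp add: weight_coeff_def mult.commute)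
qed

text \<open>When the lower coefficients vanish, the coefficient of degree \<open>q\<close> is the
  uniform limit of \<open>g (cscale \<omega> s w) / s ^ q\<close> as \<open>s\<close> tends to
  0.\<close>

lemma holomorphic_fun_on_weight_coeff:
  assumes g: "holomorphic_fun_on g (ball 0 r)" and C: "\<And>z. z \<in> ball 0 r \<Longrightarrow> norm (g z) \<le> C"
    and low: "\<And>k w. k < q \<Longrightarrow> w \<in> ball 0 r \<Longrightarrow> weight_coeff \<omega> k g w = 0"
  shows "holomorphic_fun_on (weight_coeff \<omega> q g) (ball 0 r)"
proof (rule holomorphic_fun_on_uniform_limit)
  define s where "s n = complex_of_real (inverse (real (Suc n)))" for n
  have norms: "norm (s n) = inverse (real (Suc n))" for n unfolding s_def by (simp only: norm_of_real) simp
    have s0: "s n \<noteq> 0" for n using norms[of n] by (auto simp del: of_nat_Suc)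
  have slim: "(\<lambda>n. norm (s n)) \<longlonglongrightarrow> 0"
    unfolding norms using LIMSEQ_inverse_real_of_nat .
  have small: "\<forall>\<^sub>F n in sequentially. norm (s n) < 1 / 4"
    using order_tendstoD(2)[OF slim, of "1/4"] by simp
  have sn1: "norm (s n) \<le> 1" for n unfolding norms by (simp add: field_simps)
  have sub: "cscale \<omega> (s n) ` ball 0 r \<subseteq> ball 0 r" for n
    using cscale_in_ball[OF _ sn1] by blast
  show "\<forall>\<^sub>F n in sequentially. holomorphic_fun_on (\<lambda>w. inverse (s n ^ q) * g (cscale \<omega> (s n) w)) (ball 0 r)"
    by (intro always_eventually allI holomorphic_fun_on_cmult
        holomorphic_fun_on_compose[OF g holomorphic_map_on_cscale sub])
  show "uniform_limit (ball 0 r) (\<lambda>n w. inverse (s n ^ q) * g (cscale \<omega> (s n) w)) (weight_coeff \<omega> q g) sequentially"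
  proof (rule uniform_limitI)
    fix e :: real assume e: "e > 0"
    have "(\<lambda>n. (4 * C * 2 ^ q) * norm (s n)) \<longlonglongrightarrow> 0" using tendsto_mult_right_zero[OF slim] .
    then have "\<forall>\<^sub>F n in sequentially. (4 * C * 2 ^ q) * norm (s n) < e" using e by (intro order_tendstoD(2)) auto
    with small show "\<forall>\<^sub>F n in sequentially. \<forall>w\<in>ball 0 r.
        dist (inverse (s n ^ q) * g (cscale \<omega> (s n) w)) (weight_coeff \<omega> q g w) < e"
    proof eventually_elim
      case (elim n)
      show ?case
      proof
        fix w :: "complex ^ 'a" assume w: "w \<in> ball 0 r"
        have "inverse (s n ^ q) * g (cscale \<omega> (s n) w) - weight_coeff \<omega> q g w
            = inverse (s n ^ q) * (g (cscale \<omega> (s n) w) - s n ^ q * weight_coeff \<omega> q g w)"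
          using s0[of n] by (simp add: field_simps)
        then have "norm (inverse (s n ^ q) * g (cscale \<omega> (s n) w) - weight_coeff \<omega> q g w)
            \<le> inverse (norm (s n) ^ q) * (2 * C * (2 * norm (s n)) ^ Suc q)"
          using weight_expansion_lowest(1)[OF g C w _ low[OF _ w], of "s n" q] elim
          by (simp only: norm_mult norm_inverse norm_power) (intro mult_left_mono, auto)
        also have "\<dots> = (4 * C * 2 ^ q) * norm (s n)"
          using s0[of n] by (simp add: power_mult_distrib)
        finally show "dist (inverse (s n ^ q) * g (cscale \<omega> (s n) w)) (weight_coeff \<omega> q g w) < e"
          using elim by (simp add: dist_norm)
      qed
    qed
  qed
qed auto

text \<open>Weighted coefficients are derivatives of one-variable functions, so Weierstrass'
  convergence theorem applies. It lets lower bounds on weighted orders survive a limit.\<close>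

lemma weight_coeff_limit:
  fixes g :: "'a \<Rightarrow> complex ^ 'n \<Rightarrow> complex"
  assumes g: "\<forall>\<^sub>F n in F. holomorphic_fun_on (g n) (ball 0 r)"
    and lim: "uniform_limit (ball 0 r) g G F" and F: "F \<noteq> bot" and w: "w \<in> ball 0 r"
  shows "((\<lambda>n. weight_coeff \<omega> q (g n) w) \<longlongrightarrow> weight_coeff \<omega> q G w) F"
proof -
  have ul: "uniform_limit (ball 0 1) (\<lambda>n \<tau>. g n (cscale \<omega> \<tau> w)) (\<lambda>\<tau>. G (cscale \<omega> \<tau> w)) F"
    by (rule uniform_limit_compose'[OF lim]) (use cscale_in_ball[OF w] in auto)
  have hol: "\<forall>\<^sub>F n in F. (\<lambda>\<tau>. g n (cscale \<omega> \<tau> w)) holomorphic_on ball 0 1"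
    using g by (rule eventually_mono) (rule holomorphic_on_weight_curve[OF _ w])
  show ?thesis
    unfolding weight_coeff_def
    by (rule tendsto_divide[OF higher_deriv_complex_uniform_limit[OF ul hol F]]) auto
qed

text \<open>If all weighted coefficients vanish, the expansion bound at the parameter 1/4 is
  \<open>2 * C * (1/2) ^ q\<close> for every \<open>q\<close>, so the function is zero near
  0.\<close>

lemma weight_order_cases:
  fixes g :: "complex ^ 'n \<Rightarrow> complex"
  assumes g: "holomorphic_fun_on g (ball 0 r)" and C: "\<And>z. z \<in> ball 0 r \<Longrightarrow> norm (g z) \<le> C" and r: "r > 0"
  obtains \<delta> where "\<delta> > 0" "\<And>w. w \<in> ball 0 \<delta> \<Longrightarrow> g w = 0"
  | q w where "\<And>k w. k < q \<Longrightarrow> w \<in> ball 0 r \<Longrightarrow> weight_coeff \<omega> k g w = 0" "w \<in> ball 0 r" "weight_coeff \<omega> q g w \<noteq> 0"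
proof (cases "\<exists>q w. w \<in> ball 0 r \<and> weight_coeff \<omega> q g w \<noteq> 0")
  case True
  then show ?thesis
    using that(2) exists_least_iff[of "\<lambda>q. \<exists>w. w \<in> ball 0 r \<and> weight_coeff \<omega> q g w \<noteq> 0"] by blast
next
  case False
  have zero: "g (cscale \<omega> (1/4) w) = 0" if w: "w \<in> ball 0 r" for w
  proof -
    have bd: "norm (g (cscale \<omega> (1/4) w)) \<le> 2 * C * (1/2) ^ q" for q
      using weight_expansion_lowest(2)[OF g C w, of "1/4" q] False w by simp
    have "(\<lambda>q. 2 * C * (1/2) ^ q) \<longlonglongrightarrow> 2 * C * 0" by (intro tendsto_intros LIMSEQ_power_zero) auto
    then have "norm (g (cscale \<omega> (1/4) w)) \<le> 0"
      using LIMSEQ_le_const[of _ "2 * C * 0" "norm (g (cscale \<omega> (1/4) w))"] bd by auto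
    then show ?thesis by simp
  qed
  \<comment> \<open>The vanishing is known at points of the form
    \<open>cscale \<omega> (1/4) w\<close>; every point near 0 has this form with \<open>w\<close>
    in the ball.\<close>
  have "open (cscale \<omega> 4 -` ball 0 r)" using continuous_on_cscale open_vimage by blast
  moreover have "0 \<in> cscale \<omega> 4 -` ball 0 r" using r by simp
  ultimately obtain \<delta> where \<delta>: "\<delta> > 0" "ball 0 \<delta> \<subseteq> cscale \<omega> 4 -` ball 0 r"
    using open_contains_ball by blast
  have "g w = 0" if "w \<in> ball 0 \<delta>" for w
    using zero[of "cscale \<omega> 4 w"] \<delta> that by auto
  then show ?thesis using that(1) \<delta>(1) by blast
qed

section \<open>The model\<close>

lemma biholomorphism_betweenI:
  assumes "open U" "open V" "holomorphic_map_on \<phi> U" "holomorphic_map_on \<psi> V"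
    and "\<And>z. z \<in> U \<Longrightarrow> \<phi> z \<in> V" "\<And>w. w \<in> V \<Longrightarrow> \<psi> w \<in> U"
    and "\<And>z. z \<in> U \<Longrightarrow> \<psi> (\<phi> z) = z" "\<And>w. w \<in> V \<Longrightarrow> \<phi> (\<psi> w) = w"
  shows "biholomorphism_between \<phi> U V"
proof -
  have bij: "bij_betw \<phi> U V"
    by (rule bij_betwI[where g = \<psi>]) (use assms in auto)
  have "inv_into U \<phi> w = \<psi> w" if "w \<in> V" for w
    by (rule inv_into_f_eq) (use bij assms that in \<open>auto simp: bij_betw_def\<close>)
  then have "holomorphic_map_on (inv_into U \<phi>) V"
    using holomorphic_map_on_cong[OF assms(2), of \<psi>] assms(4) by simp
  then show ?thesis using assms bij by (simp add: biholomorphism_between_def)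
qed

lemma biholomorphism_betweenE:
  assumes "biholomorphism_between \<phi> U V"
  obtains \<psi> where "open U" "open V" "holomorphic_map_on \<phi> U" "holomorphic_map_on \<psi> V"
    "\<And>z. z \<in> U \<Longrightarrow> \<phi> z \<in> V" "\<And>w. w \<in> V \<Longrightarrow> \<psi> w \<in> U"
    "\<And>z. z \<in> U \<Longrightarrow> \<psi> (\<phi> z) = z" "\<And>w. w \<in> V \<Longrightarrow> \<phi> (\<psi> w) = w"
proof (rule that[of "inv_into U \<phi>"])
  have bij: "bij_betw \<phi> U V" using assms by (simp add: biholomorphism_between_def)
  show "\<And>z. z \<in> U \<Longrightarrow> \<phi> z \<in> V" using bij by (auto simp: bij_betw_def)
  show "\<And>w. w \<in> V \<Longrightarrow> inv_into U \<phi> w \<in> U" using bij by (metis bij_betw_def inv_into_into)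
  show "\<And>z. z \<in> U \<Longrightarrow> inv_into U \<phi> (\<phi> z) = z" using bij by (simp add: bij_betw_def)
  show "\<And>w. w \<in> V \<Longrightarrow> \<phi> (inv_into U \<phi> w) = w" using bij by (metis bij_betw_def f_inv_into_f)
qed (use assms in \<open>auto simp: biholomorphism_between_def\<close>)

lemma biholomorphism_between_inverse:
  assumes "biholomorphism_between \<phi> U V"
  obtains \<psi> where "biholomorphism_between \<psi> V U" "\<And>z. z \<in> U \<Longrightarrow> \<psi> (\<phi> z) = z" "\<And>w. w \<in> V \<Longrightarrow> \<phi> (\<psi> w) = w"
  using assms
proof (rule biholomorphism_betweenE)
  fix \<psi> assume *: "open U" "open V" "holomorphic_map_on \<phi> U" "holomorphic_map_on \<psi> V"
    "\<And>z. z \<in> U \<Longrightarrow> \<phi> z \<in> V" "\<And>w. w \<in> V \<Longrightarrow> \<psi> w \<in> U"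
    "\<And>z. z \<in> U \<Longrightarrow> \<psi> (\<phi> z) = z" "\<And>w. w \<in> V \<Longrightarrow> \<phi> (\<psi> w) = w"
  show thesis
    using that[of \<psi>] biholomorphism_betweenI[of V U \<psi> \<phi>] * by blast
qed

lemma locally_biholomorphic_at_sym:
  assumes "locally_biholomorphic_at M p N q"
  shows "locally_biholomorphic_at N q M p"
proof -
  obtain U V \<phi> where 1: "p \<in> U" "biholomorphism_between \<phi> U V" "\<phi> p = q" "\<phi> ` (M \<inter> U) = N \<inter> V"
    using assms unfolding locally_biholomorphic_at_def by blast
  obtain \<psi> where 2: "biholomorphism_between \<psi> V U" "\<And>z. z \<in> U \<Longrightarrow> \<psi> (\<phi> z) = z" "\<And>w. w \<in> V \<Longrightarrow> \<phi> (\<psi> w) = w"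
    using biholomorphism_between_inverse[OF 1(2)] by metis
  have "q \<in> V" using 1 by (auto simp: biholomorphism_between_def bij_betw_def)
  moreover have "\<psi> q = p" using 1 2 by auto
  moreover have "\<psi> ` (N \<inter> V) = M \<inter> U"
    unfolding 1(4)[symmetric] image_image using 2(2) by (auto simp: image_iff)
  ultimately show ?thesis unfolding locally_biholomorphic_at_def using 2(1) by blast
qed

lemma locally_biholomorphic_at_trans:
  assumes "locally_biholomorphic_at M p N q" "locally_biholomorphic_at N q L r"
  shows "locally_biholomorphic_at M p L r"
proof -
  obtain U V \<phi> where 1: "p \<in> U" "biholomorphism_between \<phi> U V" "\<phi> p = q" "\<phi> ` (M \<inter> U) = N \<inter> V"
    using assms unfolding locally_biholomorphic_at_def by blast
  obtain U' V' \<phi>' where 2: "q \<in> U'" "biholomorphism_between \<phi>' U' V'" "\<phi>' q = r" "\<phi>' ` (N \<inter> U') = L \<inter> V'"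
    using assms unfolding locally_biholomorphic_at_def by blast
  obtain \<psi> where \<psi>: "open U" "open V" "holomorphic_map_on \<phi> U" "holomorphic_map_on \<psi> V"
    "\<And>z. z \<in> U \<Longrightarrow> \<phi> z \<in> V" "\<And>w. w \<in> V \<Longrightarrow> \<psi> w \<in> U"
    "\<And>z. z \<in> U \<Longrightarrow> \<psi> (\<phi> z) = z" "\<And>w. w \<in> V \<Longrightarrow> \<phi> (\<psi> w) = w"
    using biholomorphism_betweenE[OF 1(2)] by metis
  obtain \<psi>' where \<psi>': "open U'" "open V'" "holomorphic_map_on \<phi>' U'" "holomorphic_map_on \<psi>' V'"
    "\<And>z. z \<in> U' \<Longrightarrow> \<phi>' z \<in> V'" "\<And>w. w \<in> V' \<Longrightarrow> \<psi>' w \<in> U'"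
    "\<And>z. z \<in> U' \<Longrightarrow> \<psi>' (\<phi>' z) = z" "\<And>w. w \<in> V' \<Longrightarrow> \<phi>' (\<psi>' w) = w"
    using biholomorphism_betweenE[OF 2(2)] by metis
  define A where "A = U \<inter> \<phi> -` U'"
  define B where "B = V' \<inter> \<psi>' -` V"
  have "open A" unfolding A_def
    using continuous_open_preimage[OF holomorphic_map_on_continuous_on[OF \<psi>(3)] \<psi>(1) \<psi>'(1)] .
  moreover have "open B" unfolding B_def
    using continuous_open_preimage[OF holomorphic_map_on_continuous_on[OF \<psi>'(4)] \<psi>'(2) \<psi>(2)] .
  moreover have "holomorphic_map_on (\<lambda>z. \<phi>' (\<phi> z)) A"
    by (rule holomorphic_map_on_compose[OF \<psi>'(3) holomorphic_map_on_subset[OF \<psi>(3)]]) (auto simp: A_def)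
  moreover have "holomorphic_map_on (\<lambda>z. \<psi> (\<psi>' z)) B"
    by (rule holomorphic_map_on_compose[OF \<psi>(4) holomorphic_map_on_subset[OF \<psi>'(4)]]) (auto simp: B_def)
  ultimately have "biholomorphism_between (\<lambda>z. \<phi>' (\<phi> z)) A B"
    by (rule biholomorphism_betweenI) (use \<psi> \<psi>' in \<open>auto simp: A_def B_def\<close>)
  moreover have "(\<lambda>z. \<phi>' (\<phi> z)) ` (M \<inter> A) = L \<inter> B"
  proof (intro equalityI subsetI)
    fix y assume "y \<in> (\<lambda>z. \<phi>' (\<phi> z)) ` (M \<inter> A)"
    then obtain z where z: "z \<in> M" "z \<in> U" "\<phi> z \<in> U'" "y = \<phi>' (\<phi> z)" by (auto simp: A_def)
    then have "\<phi> z \<in> N" using 1(4) by blast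
    then have "y \<in> L" using 2(4) z by blast
    then show "y \<in> L \<inter> B" using z \<psi> \<psi>' by (auto simp: B_def)
  next
    fix y assume y: "y \<in> L \<inter> B"
    then have "y \<in> \<phi>' ` (N \<inter> U')" using 2(4) by (auto simp: B_def)
    then obtain w where w: "w \<in> N" "w \<in> U'" "y = \<phi>' w" by blast
    then have "w \<in> V" using y \<psi>' by (auto simp: B_def)
    then have "w \<in> \<phi> ` (M \<inter> U)" using 1(4) w by blast
    then show "y \<in> (\<lambda>z. \<phi>' (\<phi> z)) ` (M \<inter> A)" using w by (auto simp: A_def)
  qed
  ultimately show ?thesis
    unfolding locally_biholomorphic_at_def using 1 2
    by (intro exI[of _ A] exI[of _ B] exI[of _ "\<lambda>z. \<phi>' (\<phi> z)"]) (auto simp: A_def)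
qed

text \<open>The moment curve when \<open>e\<close> enumerates the numbers 1 to n; the model is the
  tube over it.\<close>

definition model_curve :: "('n \<Rightarrow> nat) \<Rightarrow> real \<Rightarrow> complex ^ 'n" where
  "model_curve e x = (\<chi> k. of_real (x ^ e k))"

text \<open>For \<open>e i = 1\<close> the equation with \<open>k = i\<close> is trivial, so all
  indices can be treated alike.\<close>

definition model :: "('n \<Rightarrow> nat) \<Rightarrow> 'n \<Rightarrow> (complex ^ 'n) set" where
  "model e i = {w. \<forall>k. Re (w $ k) = Re (w $ i) ^ e k}"

definition cnj_vec :: "complex ^ 'n \<Rightarrow> complex ^ 'n" where
  "cnj_vec w = (\<chi> k. cnj (w $ k))"

lemma norm_cnj_vec [simp]: "norm (cnj_vec w) = norm w"
  by (simp add: norm_vec_def cnj_vec_def)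

lemma cnj_vec_cnj_vec [simp]: "cnj_vec (cnj_vec w) = w"
  by (simp add: cnj_vec_def)

lemma cnj_vec_minus [simp]: "cnj_vec (- w) = - cnj_vec w"
  by (simp add: cnj_vec_def vec_eq_iff)

text \<open>Over the point \<open>x\<close> of the curve the model contains the maximal totally real subspace
  \<open>model_curve e x + \<i> \<real>\<^sup>n\<close>, and the Schwarz reflection principle applies to it.\<close>

lemma model_reflection:
  fixes g :: "complex ^ 'n \<Rightarrow> complex"
  assumes g: "holomorphic_fun_on g (ball 0 R)" and ei: "e i = 1"
    and re: "\<And>w. w \<in> model e i \<Longrightarrow> w \<in> ball 0 R \<Longrightarrow> Re (g w) = 0"
    and x: "norm (model_curve e x) < R / 8" and w: "norm w < R / 8"
  shows "g w = - cnj (g (2 *\<^sub>R model_curve e x - cnj_vec w))"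
proof -
  \<comment> \<open>\<open>a\<close> lies on the totally real slice over \<open>x\<close>, and
    \<open>w = a + b\<close> with \<open>b\<close> real. On the complex line through
    \<open>a\<close> in direction \<open>\<i> *s b\<close> the real parameters stay in the slice,
    while \<open>- \<i>\<close> gives \<open>w\<close> and \<open>\<i>\<close> its mirror image.
    Both norms are at most \<open>R / 4\<close>, so the disc of radius 2 stays in the ball.\<close>
  define a :: "complex ^ 'n" where "a = (\<chi> k. of_real (x ^ e k) + \<i> * of_real (Im (w $ k)))"
  define b :: "complex ^ 'n" where "b = (\<chi> k. of_real (Re (w $ k) - x ^ e k))"
  have na: "norm a \<le> R / 4"
  proof -
    have "a = model_curve e x + (\<chi> k. \<i> * of_real (Im (w $ k)))"
      by (simp add: a_def model_curve_def vec_eq_iff)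
    moreover have "norm ((\<chi> k. \<i> * of_real (Im (w $ k))) :: complex ^ 'n) \<le> norm w"
      by (rule norm_le_componentwise_cart) (simp add: norm_mult abs_Im_le_cmod)
    ultimately have "norm a \<le> norm (model_curve e x) + norm w"
      using norm_triangle_ineq[of "model_curve e x"] by (metis add_left_mono order_trans)
    then show ?thesis using x w by simp
  qed
  have nb: "norm b \<le> R / 4"
  proof -
    define w' :: "complex ^ 'n" where "w' = (\<chi> k. of_real (Re (w $ k)))"
    have "b = w' - model_curve e x"
      by (simp add: b_def model_curve_def vec_eq_iff w'_def)
    then have "norm b \<le> norm w' + norm (model_curve e x)" by (simp add: norm_triangle_ineq4)
    moreover have "norm w' \<le> norm w"
      unfolding w'_def by (rule norm_le_componentwise_cart) (simp add: abs_Re_le_cmod)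
    ultimately show ?thesis using x w by simp
  qed
  have Rpos: "R > 0" using w norm_ge_zero[of w] by linarith
  define v where "v = \<i> *s b"
  have inball: "a + \<zeta> *s v \<in> ball 0 R" if "\<zeta> \<in> ball 0 2" for \<zeta>
  proof -
    have "norm (a + \<zeta> *s v) \<le> norm a + norm \<zeta> * norm b"
      using norm_triangle_ineq[of a "\<zeta> *s v"] by (simp add: norm_cscale_vec v_def norm_mult)
    also have "\<dots> \<le> R / 4 + 2 * (R / 4)"
      by (intro add_mono na mult_mono nb) (use that in auto)
    also have "\<dots> < R" using Rpos by simp
    finally show ?thesis by simp
  qed
  define P where "P \<zeta> = g (a + \<zeta> *s v)" for \<zeta>
  have P: "P holomorphic_on ball 0 2"
    unfolding P_def by (rule holomorphic_fun_on_line(1)[OF g open_ball inball])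
  have cnjball: "cnj ` ball 0 2 = ball 0 2"
  proof (intro equalityI subsetI)
    fix \<zeta> :: complex assume "\<zeta> \<in> ball 0 2"
    then show "\<zeta> \<in> cnj ` ball 0 2" by (intro image_eqI[of _ _ "cnj \<zeta>"]) auto
  qed auto
  have Q: "cnj \<circ> P \<circ> cnj holomorphic_on ball 0 2"
    by (rule holomorphic_on_compose_cnj_cnj) (use P in \<open>auto simp: cnjball\<close>)
  have real0: "P \<zeta> + (cnj \<circ> P \<circ> cnj) \<zeta> = 0" if \<zeta>: "\<zeta> \<in> complex_of_real ` {-1<..<1}" for \<zeta>
  proof -
    obtain t where t: "\<zeta> = of_real t" "\<bar>t\<bar> < 1" using \<zeta> by auto
    have comp: "(a + \<zeta> *s v) $ k = of_real (x ^ e k) + \<i> * of_real (Im (w $ k) + t * (Re (w $ k) - x ^ e k))" for k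
      by (simp add: t a_def v_def b_def algebra_simps)
    have "Re ((a + \<zeta> *s v) $ k) = x ^ e k" for k
      unfolding comp by (simp del: of_real_power of_real_add of_real_mult of_real_diff)
    then have "a + \<zeta> *s v \<in> model e i" unfolding model_def using ei by simp
    moreover have "a + \<zeta> *s v \<in> ball 0 R" by (rule inball) (use t in simp)
    ultimately have "Re (P \<zeta>) = 0" using re by (simp add: P_def)
    then show ?thesis by (simp add: t complex_eq_iff)
  qed
  \<comment> \<open>The sum of \<open>P\<close> and its reflection vanishes on a real segment, hence
    on the whole disc.\<close>
  have "P (-\<i>) + (cnj \<circ> P \<circ> cnj) (-\<i>) = 0"
  proof (rule analytic_continuation[where S = "ball 0 2" and U = "complex_of_real ` {-1<..<1}" and \<xi> = 0 and f = "\<lambda>\<zeta>. P \<zeta> + (cnj \<circ> P \<circ> cnj) \<zeta>"])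
    show "(\<lambda>\<zeta>. P \<zeta> + (cnj \<circ> P \<circ> cnj) \<zeta>) holomorphic_on ball 0 2"
      by (intro holomorphic_intros P Q)
    show "0 islimpt complex_of_real ` {-1<..<1}"
      unfolding islimpt_approachable
    proof (intro allI impI)
      fix d :: real assume "d > 0"
      then show "\<exists>x'\<in>complex_of_real ` {-1<..<1}. x' \<noteq> 0 \<and> dist x' 0 < d"
        by (intro bexI[of _ "complex_of_real (min d 1 / 2)"] imageI) (auto simp del: of_real_divide)
    qed
  qed (use real0 in \<open>auto simp: dist_norm\<close>)
  moreover have "a + (-\<i>) *s v = w"
    by (simp add: vec_eq_iff a_def v_def b_def complex_eq_iff)
  moreover have "a + \<i> *s v = 2 *\<^sub>R model_curve e x - cnj_vec w"
    by (simp add: vec_eq_iff a_def v_def b_def complex_eq_iff model_curve_def cnj_vec_def)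
  ultimately have "g w + cnj (g (2 *\<^sub>R model_curve e x - cnj_vec w)) = 0" by (simp add: P_def)
  then show ?thesis by (rule eq_neg_iff_add_eq_0[THEN iffD2])
qed

lemma has_vector_derivative_model_curve:
  "(model_curve e has_vector_derivative (\<chi> k. of_real (real (e k) * x ^ (e k - 1)))) (at x)"
  unfolding has_vector_derivative_def
proof (rule has_derivative_cart)
  fix k
  have "((\<lambda>x. x ^ e k) has_real_derivative real (e k) * x ^ (e k - 1)) (at x)"
    by (auto intro!: derivative_eq_intros)
  then have "((\<lambda>x. x ^ e k) has_derivative (\<lambda>h. real (e k) * x ^ (e k - 1) * h)) (at x)"
    by (simp add: has_field_derivative_def)
  from bounded_linear.has_derivative[OF bounded_linear_of_real this]
  show "((\<lambda>x. model_curve e x $ k) has_derivative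
      (\<lambda>h. (h *\<^sub>R (\<chi> k. of_real (real (e k) * x ^ (e k - 1)))) $ k)) (at x)"
    by (simp add: model_curve_def scaleR_conv_of_real[where 'a = complex] mult_ac)
qed

text \<open>By reflection \<open>g (2 *\<^sub>R model_curve e x + v)\<close> does not depend on \<open>x\<close>, so the derivative of \<open>g\<close>
  annihilates all velocities of the curve; these span the whole space.\<close>

lemma real_part_zero_on_model_imp_constant:
  fixes g :: "complex ^ 'n \<Rightarrow> complex"
  assumes g: "holomorphic_fun_on g (ball 0 R)" and R: "R > 0"
    and e: "inj e" "\<And>k. e k > 0" "e i = 1"
    and re: "\<And>w. w \<in> model e i \<Longrightarrow> w \<in> ball 0 R \<Longrightarrow> Re (g w) = 0"
  obtains \<delta> where "\<delta> > 0" "\<delta> \<le> R" "\<And>w. w \<in> ball 0 \<delta> \<Longrightarrow> g w = g 0"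
proof -
  have cont: "isCont (model_curve e) 0"
    using has_vector_derivative_model_curve has_vector_derivative_continuous by blast
  have mc0: "model_curve e 0 = 0" using e(2) by (simp add: model_curve_def vec_eq_iff)
  obtain \<delta>1 where \<delta>1: "\<delta>1 > 0" "\<And>x. \<bar>x\<bar> < \<delta>1 \<Longrightarrow> norm (model_curve e x) < R / 64"
  proof -
    have "R / 64 > 0" using R by simp
    then obtain d where "d > 0" "\<forall>x'. dist x' 0 < d \<longrightarrow> dist (model_curve e x') (model_curve e 0) < R / 64"
      using cont unfolding continuous_at_eps_delta by blast
    then show ?thesis using that mc0 by (auto simp: dist_norm)
  qed
  define D where "D u = frechet_derivative g (at u)" for u
  have gD: "(g has_derivative D u) (at u)" if "u \<in> ball 0 R" for u
    unfolding D_def by (rule holomorphic_fun_onD(1)[OF g that])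
  have vel: "D u (\<chi> k. of_real (real (e k) * x0 ^ (e k - 1))) = 0"
    if u: "norm u < R / 16" and x0: "\<bar>x0\<bar> < \<delta>1" for u x0
  proof -
    \<comment> \<open>Chosen so that the translated curve
      \<open>2 *\<^sub>R model_curve e x + v\<close> passes through \<open>u\<close> at
      \<open>x0\<close>.\<close>
    define v where "v = u - 2 *\<^sub>R model_curve e x0"
    have v: "norm v < R / 8"
      using norm_triangle_ineq4[of u "2 *\<^sub>R model_curve e x0"] u \<delta>1(2)[OF x0] R by (simp add: v_def)
    have const: "g (2 *\<^sub>R model_curve e x + v) = - cnj (g (- cnj_vec v))" if "\<bar>x\<bar> < \<delta>1" for x
    proof -
      have "g (- cnj_vec v) = - cnj (g (2 *\<^sub>R model_curve e x - cnj_vec (- cnj_vec v)))"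
        by (rule model_reflection[where R = R and i = i and e = e, OF g e(3)]) (use \<delta>1(2)[OF that] R v re in auto)
      then show ?thesis by simp
    qed
    let ?\<gamma>' = "(\<chi> k. of_real (real (e k) * x0 ^ (e k - 1))) :: complex ^ 'n"
    have uu: "2 *\<^sub>R model_curve e x0 + v = u" by (simp add: v_def)
    have "((\<lambda>x. 2 *\<^sub>R model_curve e x + v) has_derivative (\<lambda>h. h *\<^sub>R (2 *\<^sub>R ?\<gamma>'))) (at x0)"
      using has_vector_derivative_model_curve[of e x0]
      unfolding has_vector_derivative_def by (auto intro!: derivative_eq_intros simp: fun_eq_iff)
    moreover have "(g has_derivative D u) (at (2 *\<^sub>R model_curve e x0 + v))"
      unfolding uu by (rule gD) (use u R in simp)
    ultimately have "((\<lambda>x. g (2 *\<^sub>R model_curve e x + v)) has_derivative (\<lambda>h. D u (h *\<^sub>R (2 *\<^sub>R ?\<gamma>')))) (at x0)"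
      using diff_chain_at by (fastforce simp: o_def)
    moreover have "((\<lambda>x. g (2 *\<^sub>R model_curve e x + v)) has_derivative (\<lambda>h. 0)) (at x0)"
    proof (rule has_derivative_transform_within_open[where s = "{-\<delta>1<..<\<delta>1}"])
      show "((\<lambda>x. - cnj (g (- cnj_vec v))) has_derivative (\<lambda>h. 0)) (at x0)" by simp
    qed (use x0 const in auto)
    ultimately have "(\<lambda>h. D u (h *\<^sub>R (2 *\<^sub>R ?\<gamma>'))) = (\<lambda>h. 0)"
      by (rule has_derivative_unique)
    then have "D u (1 *\<^sub>R (2 *\<^sub>R ?\<gamma>')) = 0" by metis
    moreover have "linear (D u)" using gD[of u] u R has_derivative_linear by force
    ultimately show ?thesis using linear_cmul[of "D u" 2 ?\<gamma>'] by simp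
  qed
  have D0: "D u = (\<lambda>h. 0)" if u: "norm u < R / 16" for u
  proof -
    have uR: "u \<in> ball 0 R" using u R by simp
    have lin: "linear (D u)" using gD[OF uR] has_derivative_linear by blast
    have expand: "D u h = (\<Sum>k\<in>UNIV. h $ k * D u (axis k 1))" for h
    proof -
      have "h = (\<Sum>k\<in>UNIV. h $ k *s axis k 1)" by (simp add: basis_expansion)
      then have "D u h = (\<Sum>k\<in>UNIV. D u (h $ k *s axis k 1))" using linear_sum[OF lin] by metis
      then show ?thesis using holomorphic_fun_onD(2)[OF g uR] by (simp add: D_def)
    qed
    \<comment> \<open>By \<open>vel\<close> this polynomial vanishes on an interval. Since
      \<open>e\<close> is injective, each partial derivative of \<open>g\<close> occurs in a degree
      of its own and must vanish.\<close>
    define p where "p = (\<Sum>k\<in>UNIV. monom (of_nat (e k) * D u (axis k 1)) (e k - 1))"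
    have "poly p (of_real x) = 0" if "\<bar>x\<bar> < \<delta>1" for x
      using vel[OF u that] unfolding expand[of "\<chi> k. _ k"]
      by (simp add: p_def poly_sum poly_monom mult_ac)
    then have "complex_of_real ` {-\<delta>1<..<\<delta>1} \<subseteq> {x. poly p x = 0}" by auto
    moreover have "infinite (complex_of_real ` {-\<delta>1<..<\<delta>1})"
      using \<delta>1(1) by (subst finite_image_iff) (auto intro: inj_onI)
    ultimately have p0: "p = 0" using poly_roots_finite finite_subset by blast
    have "D u (axis k 1) = 0" for k
    proof -
      have "coeff p (e k - 1) = (\<Sum>j\<in>UNIV. if j = k then of_nat (e j) * D u (axis j 1) else 0)"
        unfolding p_def coeff_sum
      proof (rule sum.cong[OF refl])
        fix j
        have "e j - 1 = e k - 1 \<longleftrightarrow> j = k"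
          using e(2)[of j] e(2)[of k] inj_eq[OF e(1), of j k] by linarith
        then show "coeff (monom (of_nat (e j) * D u (axis j 1)) (e j - 1)) (e k - 1)
          = (if j = k then of_nat (e j) * D u (axis j 1) else 0)" by simp
      qed
      then show ?thesis using p0 e(2)[of k] by simp
    qed
    then show ?thesis by (intro ext) (subst expand, simp)
  qed
  have "g constant_on ball 0 (R / 16)"
  proof (rule has_derivative_zero_connected_constant_on[where K = "{}"])
    show "continuous_on (ball 0 (R / 16)) g"
      by (rule continuous_on_subset[OF holomorphic_fun_on_continuous_on[OF g]]) (use R in auto)
    show "\<forall>u\<in>ball 0 (R / 16) - {}. (g has_derivative (\<lambda>h. 0)) (at u within ball 0 (R / 16))"
    proof
      fix u :: "complex ^ 'n" assume "u \<in> ball 0 (R / 16) - {}"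
      then have u: "norm u < R / 16" by simp
      then have "(g has_derivative (\<lambda>h. 0)) (at u)" using gD[of u] D0[OF u] R by simp
      then show "(g has_derivative (\<lambda>h. 0)) (at u within ball 0 (R / 16))"
        by (rule has_derivative_at_withinI)
    qed
  qed simp_all
  then obtain c where "\<And>u. u \<in> ball 0 (R / 16) \<Longrightarrow> g u = c" unfolding constant_on_def by blast
  then show ?thesis using that[of "R / 16"] R by simp
qed

text \<open>The base point may move with the parameter, because the expansion error is uniform on
  the ball and the coefficient is continuous. This is essential later: points of the rescaled graph
  reach the model only in the limit.\<close>

lemma weight_limit:
  assumes g: "holomorphic_fun_on g (ball 0 r)" and C: "\<And>z. z \<in> ball 0 r \<Longrightarrow> norm (g z) \<le> C"
    and low: "\<And>k w. k < q \<Longrightarrow> w \<in> ball 0 r \<Longrightarrow> weight_coeff \<omega> k g w = 0"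
    and p: "p \<in> ball 0 r" "(h \<longlongrightarrow> p) F" and \<sigma>: "(\<sigma> \<longlongrightarrow> 0) F" "\<forall>\<^sub>F s in F. \<sigma> s \<noteq> 0"
  shows "((\<lambda>s. g (cscale \<omega> (\<sigma> s) (h s)) / \<sigma> s ^ q) \<longlongrightarrow> weight_coeff \<omega> q g p) F"
proof (rule Lim_transform)
  have "isCont (weight_coeff \<omega> q g) p"
    using holomorphic_fun_on_continuous_on[OF holomorphic_fun_on_weight_coeff[OF g C low]] p(1)
    by (simp add: continuous_on_eq_continuous_at)
  then show "((\<lambda>s. weight_coeff \<omega> q g (h s)) \<longlongrightarrow> weight_coeff \<omega> q g p) F"
    using p(2) isCont_tendsto_compose by blast
  have hball: "\<forall>\<^sub>F s in F. h s \<in> ball 0 r" using p topological_tendstoD open_ball by blast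
  have n\<sigma>: "((\<lambda>s. norm (\<sigma> s)) \<longlongrightarrow> 0) F" using tendsto_norm_zero[OF \<sigma>(1)] .
  then have small: "\<forall>\<^sub>F s in F. norm (\<sigma> s) < 1/4" by (rule order_tendstoD(2)) simp
  show "((\<lambda>s. g (cscale \<omega> (\<sigma> s) (h s)) / \<sigma> s ^ q - weight_coeff \<omega> q g (h s)) \<longlongrightarrow> 0) F"
  proof (rule Lim_null_comparison)
    show "((\<lambda>s. (4 * C * 2 ^ q) * norm (\<sigma> s)) \<longlongrightarrow> 0) F" by (rule tendsto_mult_right_zero[OF n\<sigma>])
    show "\<forall>\<^sub>F s in F. norm (g (cscale \<omega> (\<sigma> s) (h s)) / \<sigma> s ^ q - weight_coeff \<omega> q g (h s))
        \<le> (4 * C * 2 ^ q) * norm (\<sigma> s)"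
      using hball small \<sigma>(2)
    proof eventually_elim
      case (elim s)
      have "g (cscale \<omega> (\<sigma> s) (h s)) / \<sigma> s ^ q - weight_coeff \<omega> q g (h s)
          = (g (cscale \<omega> (\<sigma> s) (h s)) - \<sigma> s ^ q * weight_coeff \<omega> q g (h s)) / \<sigma> s ^ q"
        using elim by (simp add: field_simps)
      then have "norm (g (cscale \<omega> (\<sigma> s) (h s)) / \<sigma> s ^ q - weight_coeff \<omega> q g (h s))
          \<le> (2 * C * (2 * norm (\<sigma> s)) ^ Suc q) / norm (\<sigma> s) ^ q"
        using weight_expansion_lowest(1)[OF g C elim(1) _ low[OF _ elim(1)], of "\<sigma> s" q] elim
        by (simp only: norm_divide norm_power) (intro divide_right_mono, auto)
      also have "\<dots> = (4 * C * 2 ^ q) * norm (\<sigma> s)"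
        using elim by (simp add: power_mult_distrib)
      finally show ?case .
    qed
  qed
qed

section \<open>Rescaling a chart at the origin\<close>

lemma eventually_in_open_ball:
  fixes h :: "'b \<Rightarrow> 'a::metric_space"
  shows "(h \<longlongrightarrow> p) F \<Longrightarrow> p \<in> ball c r \<Longrightarrow> \<forall>\<^sub>F s in F. h s \<in> ball c r"
  using topological_tendstoD open_ball by blast

lemma at_right_0_tendsto:
  "((\<lambda>s. complex_of_real s) \<longlongrightarrow> 0) (at_right 0)"
  "\<forall>\<^sub>F s in at_right 0. complex_of_real s \<noteq> 0"
  "\<forall>\<^sub>F s::real in at_right 0. 0 < s"
proof -
  show "((\<lambda>s. complex_of_real s) \<longlongrightarrow> 0) (at_right 0)"
    using tendsto_of_real[OF tendsto_ident_at, of 0 "{0<..}", where 'a = complex] by simp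
  show "\<forall>\<^sub>F s::real in at_right 0. 0 < s" by (simp add: eventually_at_right_less)
  then show "\<forall>\<^sub>F s in at_right 0. complex_of_real s \<noteq> 0" by (rule eventually_mono) simp
qed

lemma vec_eq_axis_multiple:
  fixes v :: "complex ^ 'n"
  assumes "\<And>k. k \<noteq> i \<Longrightarrow> v $ k = 0"
  shows "v = v $ i *s axis i 1"
  using assms by (auto simp: vec_eq_iff axis_def)

text \<open>The weights \<open>\<mu>\<close> of the dilations and the exponents \<open>e\<close> of
  the graph are unrelated here. The radii ensure that the conjugated dilations \<open>T t\<close>
  are defined and bounded on one ball for all \<open>t\<close> between 0 and 1.\<close>

locale weighted_graph_chart =
  fixes M :: "(complex ^ 'n) set" and \<mu> e :: "'n \<Rightarrow> nat" and i :: 'n and F :: "'n \<Rightarrow> complex \<Rightarrow> real"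
    and \<phi> \<psi> :: "complex ^ 'n \<Rightarrow> complex ^ 'n" and U V :: "(complex ^ 'n) set" and R K C \<rho> r :: real
  assumes closedM: "closed M" and scaleM: "\<And>t z. t > 0 \<Longrightarrow> z \<in> M \<Longrightarrow> cscale \<mu> (of_real t) z \<in> M"
    and mu: "\<And>k. \<mu> k > 0" and e: "inj e" "\<And>k. e k > 0" "e i = 1"
    and openU: "open U" and openV: "open V"
    and hol\<phi>: "holomorphic_map_on \<phi> U" and hol\<psi>: "holomorphic_map_on \<psi> V"
    and \<phi>V: "\<And>z. z \<in> U \<Longrightarrow> \<phi> z \<in> V" and \<psi>U: "\<And>w. w \<in> V \<Longrightarrow> \<psi> w \<in> U"
    and \<psi>\<phi>: "\<And>z. z \<in> U \<Longrightarrow> \<psi> (\<phi> z) = z" and \<phi>\<psi>: "\<And>w. w \<in> V \<Longrightarrow> \<phi> (\<psi> w) = w"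
    and U0: "0 \<in> U" and \<phi>0: "\<phi> 0 = 0"
    and graph: "\<phi> ` (M \<inter> U) = {w \<in> V. \<forall>k. Re (w $ k) = F k (w $ i)}"
    and Fi: "F i = Re"
    and K0: "K \<ge> 0" and R0: "R > 0"
    and F: "\<And>k \<zeta>. norm \<zeta> < R \<Longrightarrow> \<bar>F k \<zeta> - Re \<zeta> ^ e k\<bar> \<le> K * norm \<zeta> ^ Suc (e k)"
    and \<rho>: "\<rho> > 0" "ball 0 \<rho> \<subseteq> U" and C: "\<And>z. z \<in> ball 0 \<rho> \<Longrightarrow> norm (\<phi> z) \<le> C"
    and r: "r > 0" "r \<le> R" "ball 0 r \<subseteq> V" and \<psi>r: "\<And>w. w \<in> ball 0 r \<Longrightarrow> \<psi> w \<in> ball 0 \<rho>"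
begin

definition on_graph :: "complex ^ 'n \<Rightarrow> bool" where
  "on_graph w \<longleftrightarrow> (\<forall>k. Re (w $ k) = F k (w $ i))"

text \<open>The dilation of \<open>M\<close> read in the chart; by \<open>T_on_graph\<close> it
  preserves the graph.\<close>

definition T :: "real \<Rightarrow> complex ^ 'n \<Rightarrow> complex ^ 'n" where
  "T t w = \<phi> (cscale \<mu> (of_real t) (\<psi> w))"

lemma V0: "0 \<in> V" using \<phi>V[OF U0] \<phi>0 by simp

lemma \<psi>0: "\<psi> 0 = 0" using \<psi>\<phi>[OF U0] \<phi>0 by simp

lemma T0: "T t 0 = 0" by (simp add: T_def \<psi>0 \<phi>0)

lemma e_eq_1: "e k = 1 \<longleftrightarrow> k = i" using e(1) e(3) by (metis inj_eq)

lemma cscale_\<psi>: "w \<in> ball 0 r \<Longrightarrow> 0 \<le> t \<Longrightarrow> t \<le> 1 \<Longrightarrow> cscale \<mu> (of_real t) (\<psi> w) \<in> ball 0 \<rho>"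
  by (rule cscale_in_ball[OF \<psi>r]) auto

lemma \<psi>_T: "w \<in> ball 0 r \<Longrightarrow> 0 \<le> t \<Longrightarrow> t \<le> 1 \<Longrightarrow> \<psi> (T t w) = cscale \<mu> (of_real t) (\<psi> w)"
  unfolding T_def using cscale_\<psi> \<rho>(2) \<psi>\<phi> by blast

lemma hol_T: "0 \<le> t \<Longrightarrow> t \<le> 1 \<Longrightarrow> holomorphic_map_on (T t) (ball 0 r)"
  unfolding T_def
  by (rule holomorphic_map_on_compose[OF hol\<phi> holomorphic_map_on_compose[OF
          holomorphic_map_on_cscale[of _ _ UNIV] holomorphic_map_on_subset[OF hol\<psi> r(3)] subset_UNIV]])
    (use cscale_\<psi> \<rho>(2) in blast)

lemma hol_T_nth: "0 \<le> t \<Longrightarrow> t \<le> 1 \<Longrightarrow> holomorphic_fun_on (\<lambda>w. T t w $ k) (ball 0 r)"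
  using hol_T holomorphic_map_on_iff by blast

lemma T_bound: "w \<in> ball 0 r \<Longrightarrow> 0 \<le> t \<Longrightarrow> t \<le> 1 \<Longrightarrow> norm (T t w $ k) \<le> C"
  unfolding T_def by (rule order_trans[OF Finite_Cartesian_Product.norm_nth_le C[OF cscale_\<psi>]])

lemma T_on_graph:
  assumes w: "w \<in> ball 0 r" "on_graph w" and t: "0 < t" "t \<le> 1"
  shows "on_graph (T t w)"
proof -
  have "w \<in> \<phi> ` (M \<inter> U)" unfolding graph using w r(3) by (auto simp: on_graph_def)
  then obtain z where z: "z \<in> M" "z \<in> U" "w = \<phi> z" by blast
  have "cscale \<mu> (of_real t) z \<in> M" using scaleM t z by blast
  moreover have "cscale \<mu> (of_real t) z \<in> U"
    using cscale_\<psi>[OF w(1), of t] t \<rho>(2) \<psi>\<phi>[OF z(2)] z(3) by auto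
  ultimately have "\<phi> (cscale \<mu> (of_real t) z) \<in> \<phi> ` (M \<inter> U)" by blast
  then show ?thesis unfolding graph using z \<psi>\<phi>[OF z(2)] by (simp add: on_graph_def T_def)
qed

text \<open>The error \<open>K * norm \<zeta> ^ Suc (e k)\<close> has one factor more than the
  weight \<open>e k\<close> absorbs, and this factor tends to 0.\<close>

lemma F_limit:
  fixes \<sigma> :: "'b \<Rightarrow> real" and \<zeta> :: "'b \<Rightarrow> complex"
  assumes \<zeta>: "((\<lambda>s. \<zeta> s / of_real (\<sigma> s)) \<longlongrightarrow> a) G" and \<sigma>: "(\<sigma> \<longlongrightarrow> 0) G" "\<forall>\<^sub>F s in G. \<sigma> s > 0"
  shows "((\<lambda>s. F k (\<zeta> s) / \<sigma> s ^ e k) \<longlongrightarrow> Re a ^ e k) G"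
proof (rule Lim_transform)
  show "((\<lambda>s. Re (\<zeta> s / of_real (\<sigma> s)) ^ e k) \<longlongrightarrow> Re a ^ e k) G"
    by (intro tendsto_intros \<zeta>)
  have "((\<lambda>s. \<zeta> s / of_real (\<sigma> s) * of_real (\<sigma> s)) \<longlongrightarrow> a * of_real 0) G"
    by (intro tendsto_intros \<zeta> \<sigma>)
  moreover have "\<forall>\<^sub>F s in G. \<zeta> s / of_real (\<sigma> s) * of_real (\<sigma> s) = \<zeta> s"
    using \<sigma>(2) by (rule eventually_mono) simp
  ultimately have \<zeta>0: "(\<zeta> \<longlongrightarrow> 0) G" using Lim_transform_eventually by fastforce
  then have small: "\<forall>\<^sub>F s in G. norm (\<zeta> s) < R"
    using R0 order_tendstoD(2)[OF tendsto_norm_zero] by blast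
  show "((\<lambda>s. F k (\<zeta> s) / \<sigma> s ^ e k - Re (\<zeta> s / of_real (\<sigma> s)) ^ e k) \<longlongrightarrow> 0) G"
  proof (rule Lim_null_comparison)
    have "((\<lambda>s. K * norm (\<zeta> s / of_real (\<sigma> s)) ^ e k * norm (\<zeta> s)) \<longlongrightarrow> K * norm a ^ e k * norm (0::complex)) G"
      by (intro tendsto_intros \<zeta> \<zeta>0)
    then show "((\<lambda>s. K * norm (\<zeta> s / of_real (\<sigma> s)) ^ e k * norm (\<zeta> s)) \<longlongrightarrow> 0) G" by simp
    show "\<forall>\<^sub>F s in G. norm (F k (\<zeta> s) / \<sigma> s ^ e k - Re (\<zeta> s / of_real (\<sigma> s)) ^ e k)
       \<le> K * norm (\<zeta> s / of_real (\<sigma> s)) ^ e k * norm (\<zeta> s)"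
      using small \<sigma>(2)
    proof eventually_elim
      case (elim s)
      have "Re (\<zeta> s / of_real (\<sigma> s)) ^ e k = Re (\<zeta> s) ^ e k / \<sigma> s ^ e k"
        by (simp add: power_divide)
      then have "F k (\<zeta> s) / \<sigma> s ^ e k - Re (\<zeta> s / of_real (\<sigma> s)) ^ e k = (F k (\<zeta> s) - Re (\<zeta> s) ^ e k) / \<sigma> s ^ e k"
        by (simp add: diff_divide_distrib)
      then have "norm (F k (\<zeta> s) / \<sigma> s ^ e k - Re (\<zeta> s / of_real (\<sigma> s)) ^ e k) = \<bar>F k (\<zeta> s) - Re (\<zeta> s) ^ e k\<bar> / \<sigma> s ^ e k"
        using elim by simp
      also have "\<dots> \<le> (K * norm (\<zeta> s) ^ Suc (e k)) / \<sigma> s ^ e k"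
        by (intro divide_right_mono F) (use elim in auto)
      also have "\<dots> = K * norm (\<zeta> s / of_real (\<sigma> s)) ^ e k * norm (\<zeta> s)"
        using elim by (simp add: norm_divide power_divide)
      finally show ?case .
    qed
  qed
qed

text \<open>A point of the graph dilated by \<open>1 / s\<close> that shares with \<open>p\<close>
  the coordinate \<open>i\<close> and all imaginary parts; it tends to \<open>p\<close> if
  \<open>p\<close> lies on the model.\<close>

definition graph_approx :: "real \<Rightarrow> complex ^ 'n \<Rightarrow> complex ^ 'n" where
  "graph_approx s p = (\<chi> k. Complex (F k (of_real s * p $ i) / s ^ e k) (Im (p $ k)))"

lemma graph_approx_nth_i: "s > 0 \<Longrightarrow> graph_approx s p $ i = p $ i"
  by (simp add: graph_approx_def Fi e(3) complex_eq_iff)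

lemma on_graph_approx:
  assumes "s > 0" shows "on_graph (cscale e (of_real s) (graph_approx s p))"
proof -
  have "cscale e (of_real s) (graph_approx s p) $ i = of_real s * p $ i"
    using graph_approx_nth_i[OF assms] e(3) by simp
  then show ?thesis
    unfolding on_graph_def using assms
    by (simp add: graph_approx_def flip: of_real_power)
qed

lemma graph_approx_tendsto:
  fixes \<sigma> :: "'b \<Rightarrow> real"
  assumes "p \<in> model e i" and \<sigma>: "(\<sigma> \<longlongrightarrow> 0) G" "\<forall>\<^sub>F s in G. \<sigma> s > 0"
  shows "((\<lambda>s. graph_approx (\<sigma> s) p) \<longlongrightarrow> p) G"
proof (rule vec_tendstoI)
  fix k
  have "((\<lambda>s. of_real (\<sigma> s) * p $ i / of_real (\<sigma> s)) \<longlongrightarrow> p $ i) G"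
  proof (rule Lim_transform_eventually[OF tendsto_const])
    show "\<forall>\<^sub>F s in G. p $ i = of_real (\<sigma> s) * p $ i / of_real (\<sigma> s)"
      using \<sigma>(2) by (rule eventually_mono) simp
  qed
  then have "((\<lambda>s. F k (of_real (\<sigma> s) * p $ i) / \<sigma> s ^ e k) \<longlongrightarrow> Re (p $ i) ^ e k) G"
    by (rule F_limit[OF _ \<sigma>])
  then have "((\<lambda>s. Complex (F k (of_real (\<sigma> s) * p $ i) / \<sigma> s ^ e k) (Im (p $ k))) \<longlongrightarrow> Complex (Re (p $ i) ^ e k) (Im (p $ k))) G"
    by (intro tendsto_Complex tendsto_const)
  moreover have "Complex (Re (p $ i) ^ e k) (Im (p $ k)) = p $ k"
  proof -
    have "Re (p $ k) = Re (p $ i) ^ e k" using assms(1) unfolding model_def by blast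
    then show ?thesis by (simp add: complex_eq_iff)
  qed
  ultimately show "((\<lambda>s. graph_approx (\<sigma> s) p $ k) \<longlongrightarrow> p $ k) G" by (simp add: graph_approx_def)
qed

lemma F_at_0: "F k 0 = 0" using F[of 0 k] R0 e(2)[of k] by simp

lemma F_has_derivative_0:
  assumes "k \<noteq> i" shows "(F k has_derivative (\<lambda>h. 0)) (at 0)"
  unfolding has_derivative_at_alt
proof (intro conjI allI impI)
  \<comment> \<open>By injectivity of \<open>e\<close> only \<open>i\<close> has exponent 1, so the
    exponent of \<open>k\<close> is at least 2.\<close>
  obtain j where j: "e k = Suc (Suc j)"
    using e_eq_1[of k] e(2)[of k] assms by (cases "e k"; cases "e k - 1") auto
  fix \<epsilon> :: real assume \<epsilon>: "\<epsilon> > 0"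
  show "\<exists>d>0. \<forall>y. norm (y - 0) < d \<longrightarrow> norm (F k y - F k 0 - 0) \<le> \<epsilon> * norm (y - 0)"
  proof (intro exI[of _ "min (min R 1) (\<epsilon> / (1 + K))"] conjI allI impI)
    show "min (min R 1) (\<epsilon> / (1 + K)) > 0" using R0 \<epsilon> K0 by simp
    fix y :: complex assume y: "norm (y - 0) < min (min R 1) (\<epsilon> / (1 + K))"
    have "\<bar>F k y\<bar> \<le> \<bar>Re y ^ e k\<bar> + K * norm y ^ Suc (e k)"
      using F[of y k] y abs_triangle_ineq4[of "F k y - Re y ^ e k" "- (Re y ^ e k)"] by simp
    also have "\<bar>Re y ^ e k\<bar> \<le> norm y ^ e k"
      unfolding power_abs by (intro power_mono abs_Re_le_cmod) auto
    also have "norm y ^ e k + K * norm y ^ Suc (e k) \<le> norm y ^ 2 + K * norm y ^ 2"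
      by (intro add_mono mult_left_mono power_decreasing K0) (use y j in auto)
    also have "\<dots> = ((1 + K) * norm y) * norm y" by (simp add: power2_eq_square algebra_simps)
    also have "\<dots> \<le> \<epsilon> * norm y"
      by (intro mult_right_mono) (use y K0 in \<open>auto simp: field_simps\<close>)
    finally show "norm (F k y - F k 0 - 0) \<le> \<epsilon> * norm (y - 0)" by (simp add: F_at_0)
  qed
qed auto

section \<open>The conjugated dilations to first order\<close>

abbreviation D where "D f \<equiv> frechet_derivative f (at (0 :: complex ^ 'n))"

lemma zero_in_ball_r: "(0 :: complex ^ 'n) \<in> ball 0 r" using r by simp

text \<open>\<open>axis i 1\<close> spans the complex tangent line of the graph at 0, and a
  holomorphic map that preserves the graph preserves this line.\<close>

lemma D_T_axis:
  assumes t: "0 < t" "t \<le> 1" and k: "k \<noteq> i"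
  shows "D (T t) (axis i 1) $ k = 0"
proof -
  have DT: "(T t has_derivative D (T t)) (at 0)" "\<And>c v. D (T t) (c *s v) = c *s D (T t) v"
    using holomorphic_map_onD[OF hol_T zero_in_ball_r] t by auto
  have "Re (a * D (T t) (axis i 1) $ k) = 0" for a
  proof -
    \<comment> \<open>A curve on the graph with velocity \<open>a *s axis i 1\<close>. It controls
      real parts only; letting \<open>a\<close> run over complex numbers controls the imaginary part
      as well.\<close>
    define cu :: "real \<Rightarrow> complex ^ 'n" where "cu s = (\<chi> j. if j = i then of_real s * a else of_real (F j (of_real s * a)))" for s
    have cu0: "cu 0 = 0" by (simp add: cu_def vec_eq_iff F_at_0)
    have cuD: "(cu has_derivative (\<lambda>h. h *\<^sub>R (a *s axis i 1))) (at 0)"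
    proof (rule has_derivative_cart)
      fix j
      have lin: "((\<lambda>s. of_real s * a) has_derivative (\<lambda>h. of_real h * a)) (at 0)"
        by (auto intro!: derivative_eq_intros)
      show "((\<lambda>s. cu s $ j) has_derivative (\<lambda>h. (h *\<^sub>R (a *s axis i 1)) $ j)) (at 0)"
      proof (cases "j = i")
        case True
        then show ?thesis using lin by (simp add: cu_def axis_def scaleR_conv_of_real[where 'a = complex])
      next
        case False
        have "(F j has_derivative (\<lambda>h. 0)) (at (complex_of_real 0 * a))" using F_has_derivative_0[OF False] by simp
        then have "((\<lambda>s. F j (of_real s * a)) has_derivative (\<lambda>h. 0)) (at 0)"
          using diff_chain_at[OF lin] by (simp add: o_def)
        then have "((\<lambda>s. complex_of_real (F j (of_real s * a))) has_derivative (\<lambda>h. of_real 0)) (at 0)"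
          by (rule bounded_linear.has_derivative[OF bounded_linear_of_real])
        then show ?thesis using False by (simp add: cu_def axis_def)
      qed
    qed
    have TcuD: "((\<lambda>s. T t (cu s)) has_derivative (\<lambda>h. D (T t) (h *\<^sub>R (a *s axis i 1)))) (at 0)"
      using diff_chain_at[OF cuD, of "T t"] DT(1) cu0 by (simp add: o_def)
    have 1: "((\<lambda>s. Re (T t (cu s) $ k)) has_derivative (\<lambda>h. Re (D (T t) (h *\<^sub>R (a *s axis i 1)) $ k))) (at 0)"
      by (rule bounded_linear.has_derivative[OF bounded_linear_Re has_derivative_vec_nth[OF TcuD]])
    have "(F k has_derivative (\<lambda>h. 0)) (at (T t (cu 0) $ i))"
      using F_has_derivative_0[OF k] by (simp add: cu0 T0)
    then have 2: "((\<lambda>s. F k (T t (cu s) $ i)) has_derivative (\<lambda>h. 0)) (at 0)"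
      using diff_chain_at[OF has_derivative_vec_nth[OF TcuD, of i], of "F k"] by (simp add: o_def)
    have "(cu \<longlongrightarrow> 0) (at 0)"
      using has_derivative_continuous[OF cuD] cu0 by (simp add: isCont_def)
    then have "\<forall>\<^sub>F s in at 0. cu s \<in> ball 0 r" using eventually_in_open_ball zero_in_ball_r by blast
    then have ev: "\<forall>\<^sub>F s in at 0. F k (T t (cu s) $ i) = Re (T t (cu s) $ k)"
    proof (rule eventually_mono)
      fix s assume s: "cu s \<in> ball 0 r"
      have "on_graph (cu s)" by (auto simp: on_graph_def cu_def Fi)
      then have "on_graph (T t (cu s))" using T_on_graph s t by blast
      then show "F k (T t (cu s) $ i) = Re (T t (cu s) $ k)" by (simp add: on_graph_def)
    qed
    have "((\<lambda>s. Re (T t (cu s) $ k)) has_derivative (\<lambda>h. 0)) (at 0)"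
      by (rule has_derivative_transform_eventually[OF 2 ev]) (auto simp: cu0 T0 F_at_0)
    then have "(\<lambda>h. Re (D (T t) (h *\<^sub>R (a *s axis i 1)) $ k)) = (\<lambda>h. 0)"
      using has_derivative_unique[OF 1] by blast
    then have "Re (D (T t) (1 *\<^sub>R (a *s axis i 1)) $ k) = 0" by (rule fun_cong)
    then show ?thesis using DT(2) by simp
  qed
  from this[of 1] this[of "-\<i>"] show ?thesis by (simp add: complex_eq_iff)
qed

text \<open>The line is an eigenline of \<open>D (T t)\<close>, which is conjugate to the diagonal
  map with entries \<open>t ^ \<mu> k\<close>. The eigenvalue is read off at a non-zero coordinate
  \<open>l\<close> of the vector \<open>D \<psi> (axis i 1)\<close>; this vector does not depend on
  \<open>t\<close>, hence neither does \<open>l\<close>.\<close>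

lemma ex_distinguished_weight: "\<exists>l. \<forall>t. 0 < t \<and> t \<le> 1 \<longrightarrow> D (T t) (axis i 1) = of_real t ^ \<mu> l *s axis i 1"
proof -
  have D\<phi>: "(\<phi> has_derivative D \<phi>) (at 0)" "\<And>c v. D \<phi> (c *s v) = c *s D \<phi> v"
    using holomorphic_map_onD[OF hol\<phi> U0] by auto
  have D\<psi>: "(\<psi> has_derivative D \<psi>) (at 0)" "\<And>c v. D \<psi> (c *s v) = c *s D \<psi> v"
    using holomorphic_map_onD[OF hol\<psi> V0] by auto
  have inv1: "D \<phi> (D \<psi> h) = h" for h
  proof -
    have "((\<lambda>w. \<phi> (\<psi> w)) has_derivative (\<lambda>h. D \<phi> (D \<psi> h))) (at 0)"
      using diff_chain_at[OF D\<psi>(1), of \<phi>] D\<phi>(1) \<psi>0 by (simp add: o_def)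
    moreover have "((\<lambda>w. \<phi> (\<psi> w)) has_derivative (\<lambda>h. h)) (at 0)"
      by (rule has_derivative_transform_within_open[OF has_derivative_ident openV V0]) (simp add: \<phi>\<psi>)
    ultimately show ?thesis using has_derivative_unique by metis
  qed
  have inv2: "D \<psi> (D \<phi> h) = h" for h
  proof -
    have "((\<lambda>w. \<psi> (\<phi> w)) has_derivative (\<lambda>h. D \<psi> (D \<phi> h))) (at 0)"
      using diff_chain_at[OF D\<phi>(1), of \<psi>] D\<psi>(1) \<phi>0 by (simp add: o_def)
    moreover have "((\<lambda>w. \<psi> (\<phi> w)) has_derivative (\<lambda>h. h)) (at 0)"
      by (rule has_derivative_transform_within_open[OF has_derivative_ident openU U0]) (simp add: \<psi>\<phi>)
    ultimately show ?thesis using has_derivative_unique by metis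
  qed
  define v where "v = D \<psi> (axis i 1)"
  have "D \<phi> v = axis i 1" by (simp add: v_def inv1)
  moreover have "D \<phi> 0 = 0" using D\<phi>(2)[of 0 0] by simp
  ultimately have "v \<noteq> 0" by (auto simp: axis_eq_0_iff)
  then obtain l where l: "v $ l \<noteq> 0" by (auto simp: vec_eq_iff)
  have "D (T t) (axis i 1) = of_real t ^ \<mu> l *s axis i 1" if t: "0 < t \<and> t \<le> 1" for t
  proof -
    define c where "c = D (T t) (axis i 1) $ i"
    have c: "D (T t) (axis i 1) = c *s axis i 1"
      unfolding c_def by (rule vec_eq_axis_multiple) (use D_T_axis t in auto)
    have linc: "((cscale \<mu> (of_real t)) has_derivative cscale \<mu> (of_real t)) (at (\<psi> 0))"
    proof (rule has_derivative_cart)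
      fix k
      have "((\<lambda>x. x $ k) has_derivative (\<lambda>v. v $ k)) (at (\<psi> 0))"
        by (rule bounded_linear_imp_has_derivative[OF bounded_linear_vec_nth])
      then show "((\<lambda>x. cscale \<mu> (of_real t) x $ k) has_derivative (\<lambda>v. cscale \<mu> (of_real t) v $ k)) (at (\<psi> 0))"
        unfolding cscale_nth by (rule has_derivative_mult_right)
    qed
    have "((\<lambda>w. cscale \<mu> (of_real t) (\<psi> w)) has_derivative (\<lambda>h. cscale \<mu> (of_real t) (D \<psi> h))) (at 0)"
      using diff_chain_at[OF D\<psi>(1) linc] by (simp add: o_def)
    moreover have "(\<phi> has_derivative D \<phi>) (at (cscale \<mu> (of_real t) (\<psi> 0)))"
      using D\<phi>(1) by (simp add: \<psi>0)
    ultimately have "(T t has_derivative (\<lambda>h. D \<phi> (cscale \<mu> (of_real t) (D \<psi> h)))) (at 0)"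
      unfolding T_def using diff_chain_at by (fastforce simp: o_def)
    then have "D (T t) (axis i 1) = D \<phi> (cscale \<mu> (of_real t) v)"
      using frechet_derivative_at v_def by metis
    then have "D \<psi> (c *s axis i 1) = cscale \<mu> (of_real t) v" using c inv2 by metis
    then have "c *s v = cscale \<mu> (of_real t) v" using D\<psi>(2) v_def by metis
    then have "c * v $ l = of_real t ^ \<mu> l * v $ l" by (metis cscale_nth vector_smult_component)
    then have "c = of_real t ^ \<mu> l" using l by simp
    then show ?thesis using c by simp
  qed
  then show ?thesis by blast
qed

text \<open>The ratio of the two gradings: the dilation of \<open>M\<close> by \<open>t\<close> will
  correspond to the dilation of the model by \<open>t ^ m\<close>.\<close>

definition m :: nat where
  "m = \<mu> (SOME l. \<forall>t. 0 < t \<and> t \<le> 1 \<longrightarrow> D (T t) (axis i 1) = of_real t ^ \<mu> l *s axis i 1)"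

lemma m_pos: "m > 0" by (simp add: m_def mu)

lemma D_T_axis_i: "0 < t \<Longrightarrow> t \<le> 1 \<Longrightarrow> D (T t) (axis i 1) = of_real t ^ m *s axis i 1"
  using someI_ex[OF ex_distinguished_weight] unfolding m_def by blast

section \<open>Weighted asymptotics of the conjugated dilations\<close>

lemma weight_coeff_0: "weight_coeff \<omega> 0 g w = g (cscale \<omega> 0 w)"
  by (simp add: weight_coeff_def)

lemma cscale_0_left: "(\<And>k. \<omega> k > 0) \<Longrightarrow> cscale \<omega> 0 w = 0"
  by (simp add: vec_eq_iff)

text \<open>Only the coordinate \<open>i\<close> has weight 1, so the part of degree 1 of this
  component is its derivative along \<open>axis i 1\<close>, where the eigenvalue is known.\<close>

lemma T_i_tendsto:
  fixes \<sigma> :: "'b \<Rightarrow> complex"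
  assumes t: "0 < t" "t \<le> 1" and w: "w \<in> ball 0 r" "(h \<longlongrightarrow> w) G"
    and \<sigma>: "(\<sigma> \<longlongrightarrow> 0) G" "\<forall>\<^sub>F s in G. \<sigma> s \<noteq> 0"
  shows "((\<lambda>s. T t (cscale e (\<sigma> s) (h s)) $ i / \<sigma> s) \<longlongrightarrow> of_real t ^ m * w $ i) G"
proof -
  let ?g = "\<lambda>w. T t w $ i"
  have hol: "holomorphic_fun_on ?g (ball 0 r)" using hol_T_nth t by simp
  have low: "weight_coeff e k ?g w = 0" if "k < 1" for k w
    using that by (simp add: weight_coeff_0 cscale_0_left e(2) T0)
  have lim: "((\<lambda>s. ?g (cscale e (\<sigma> s) (h s)) / \<sigma> s ^ 1) \<longlongrightarrow> weight_coeff e 1 ?g w) G"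
    by (rule weight_limit[OF hol T_bound low w \<sigma>]) (use t in auto)
  have "weight_coeff e 1 ?g w = of_real t ^ m * w $ i"
  proof -
    have sub: "(\<lambda>\<tau>. cscale e \<tau> w) ` ball 0 1 \<subseteq> ball 0 r"
      using cscale_in_ball[OF w(1)] by (auto simp: image_subset_iff simp del: mem_ball)
    have holc: "(\<lambda>\<zeta>. cscale e \<zeta> w $ k) holomorphic_on ball 0 1" for k
      unfolding cscale_nth by (intro holomorphic_intros)
    have c0: "cscale e 0 w = 0" by (simp add: cscale_0_left e(2))
    have "deriv (\<lambda>\<zeta>. cscale e \<zeta> w $ k) 0 = (if k = i then w $ i else 0)" for k
    proof (rule DERIV_imp_deriv)
      have "((\<lambda>\<zeta>. \<zeta> ^ e k * w $ k) has_field_derivative of_nat (e k) * 0 ^ (e k - 1) * w $ k) (at 0)"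
        by (auto intro!: derivative_eq_intros)
      moreover have "of_nat (e k) * 0 ^ (e k - 1) * w $ k = (if k = i then w $ i else 0)"
        using e_eq_1[of k] e(2)[of k] by (cases "e k - 1") auto
      ultimately show "((\<lambda>\<zeta>. cscale e \<zeta> w $ k) has_field_derivative (if k = i then w $ i else 0)) (at 0)"
        by simp
    qed
    then have vec: "(\<chi> k. deriv (\<lambda>\<zeta>. cscale e \<zeta> w $ k) 0) = w $ i *s axis i 1"
      by (simp add: vec_eq_iff axis_def)
    have "((\<lambda>\<tau>. ?g (cscale e \<tau> w)) has_field_derivative D ?g (w $ i *s axis i 1)) (at 0)"
      using holomorphic_fun_on_curve(2)[OF hol open_ball sub holc, of 0] unfolding c0 vec by simp
    then have "deriv (\<lambda>\<tau>. ?g (cscale e \<tau> w)) 0 = D ?g (w $ i *s axis i 1)" by (rule DERIV_imp_deriv)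
    moreover have "D ?g h = D (T t) h $ i" for h
    proof -
      have "(T t has_derivative D (T t)) (at 0)"
        using holomorphic_map_onD(1)[OF hol_T zero_in_ball_r] t by auto
      then have "(?g has_derivative (\<lambda>h. D (T t) h $ i)) (at 0)" by (rule has_derivative_vec_nth)
      from frechet_derivative_at[OF this] show ?thesis by metis
    qed
    moreover have "D (T t) (w $ i *s axis i 1) = w $ i *s (of_real t ^ m *s axis i 1)"
      using holomorphic_map_onD(2)[OF hol_T zero_in_ball_r] t D_T_axis_i by simp
    ultimately show ?thesis by (simp add: weight_coeff_def axis_def)
  qed
  then show ?thesis using lim by simp
qed

text \<open>A lowest weighted coefficient of the difference has real part 0 on the model, because
  \<open>T t\<close> preserves the graph and the graph rescales to the model. Hence it is constant
  near 0 with the value 0 taken at the origin, and homogeneity spreads the vanishing. Below degree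
  \<open>e k\<close> the number \<open>\<kappa>\<close> is free; in degree \<open>e k\<close> it
  must be the factor of the model dilation by \<open>t ^ m\<close>.\<close>

lemma T_weight_coeff_vanish:
  assumes t: "0 < t" "t \<le> 1" and q: "q < e k \<or> q = e k \<and> \<kappa> = (t ^ m) ^ e k" and w: "w \<in> ball 0 r"
  shows "weight_coeff e q (\<lambda>w. T t w $ k - of_real \<kappa> * w $ k) w = 0"
  using q w
proof (induction q arbitrary: w rule: less_induct)
  case (less q)
  let ?g = "\<lambda>w. T t w $ k - of_real \<kappa> * w $ k"
  have hol: "holomorphic_fun_on ?g (ball 0 r)"
    by (intro holomorphic_fun_on_diff holomorphic_fun_on_cmult holomorphic_fun_on_nth hol_T_nth) (use t in auto)
  have bd: "norm (?g z) \<le> C + \<bar>\<kappa>\<bar> * r" if "z \<in> ball 0 r" for z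
  proof -
    have "norm (?g z) \<le> norm (T t z $ k) + \<bar>\<kappa>\<bar> * norm (z $ k)"
      using norm_triangle_ineq4[of "T t z $ k" "of_real \<kappa> * z $ k"] by (simp add: norm_mult)
    also have "\<dots> \<le> C + \<bar>\<kappa>\<bar> * r"
      by (intro add_mono T_bound mult_left_mono) (use that t order_trans[OF Finite_Cartesian_Product.norm_nth_le[of z k], of r] in auto)
    finally show ?thesis .
  qed
  have low: "weight_coeff e j ?g z = 0" if "j < q" "z \<in> ball 0 r" for j z
    using less.IH[of j z] less.prems that by auto
  have qe: "q \<le> e k" using less.prems by auto
  have Re0: "Re (weight_coeff e q ?g p) = 0" if p: "p \<in> model e i" "p \<in> ball 0 r" for p
  proof -
    let ?a = "\<lambda>s. graph_approx s p"
    have idlim: "((\<lambda>s::real. s) \<longlongrightarrow> 0) (at_right 0)" by (rule tendsto_ident_at)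
    note ev = at_right_0_tendsto
    have alim: "(?a \<longlongrightarrow> p) (at_right 0)"
      by (rule graph_approx_tendsto[OF p(1) idlim ev(3)])
    have aball: "\<forall>\<^sub>F s in at_right 0. ?a s \<in> ball 0 r" by (rule eventually_in_open_ball[OF alim p(2)])
    have s1: "\<forall>\<^sub>F s::real in at_right 0. s < 1" using idlim by (rule order_tendstoD(2)) simp
    have L: "((\<lambda>s. ?g (cscale e (of_real s) (?a s)) / of_real s ^ q) \<longlongrightarrow> weight_coeff e q ?g p) (at_right 0)"
      by (rule weight_limit[OF hol bd low p(2) alim ev(1,2)])
    then have L1: "((\<lambda>s. Re (?g (cscale e (of_real s) (?a s)) / of_real s ^ q)) \<longlongrightarrow> Re (weight_coeff e q ?g p)) (at_right 0)"
      by (rule tendsto_Re)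
    have Ti: "((\<lambda>s. F k (T t (cscale e (of_real s) (?a s)) $ i) / s ^ e k) \<longlongrightarrow> Re (of_real t ^ m * p $ i) ^ e k) (at_right 0)"
      by (rule F_limit[OF T_i_tendsto[OF t p(2) alim ev(1,2)] idlim ev(3)])
    have Fp: "((\<lambda>s. F k (of_real s * p $ i) / s ^ e k) \<longlongrightarrow> Re (p $ i) ^ e k) (at_right 0)"
    proof (rule F_limit[OF _ idlim ev(3)])
      show "((\<lambda>s. of_real s * p $ i / of_real s) \<longlongrightarrow> p $ i) (at_right 0)"
        by (rule Lim_transform_eventually[OF tendsto_const]) (rule eventually_mono[OF ev(2)], simp)
    qed
    \<comment> \<open>\<open>s ^ e k * E s\<close> is the real part of the difference at a point of
      the graph. For \<open>q = e k\<close> the choice of \<open>\<kappa>\<close> makes the limit of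
      \<open>E\<close> zero; for smaller \<open>q\<close> a factor \<open>s ^ (e k - q)\<close>
      remains.\<close>
    define E where "E s = F k (T t (cscale e (of_real s) (?a s)) $ i) / s ^ e k - \<kappa> * (F k (of_real s * p $ i) / s ^ e k)" for s
    have E: "(E \<longlongrightarrow> (t ^ m * Re (p $ i)) ^ e k - \<kappa> * Re (p $ i) ^ e k) (at_right 0)"
    proof -
      have "Re (of_real t ^ m * p $ i) = t ^ m * Re (p $ i)" by (simp flip: of_real_power)
      then show ?thesis unfolding E_def using tendsto_diff[OF Ti tendsto_mult_left[OF Fp, of \<kappa>]] by simp
    qed
    have eq: "\<forall>\<^sub>F s in at_right 0. Re (?g (cscale e (of_real s) (?a s)) / of_real s ^ q) = E s * s ^ (e k - q)"
      using aball s1 ev(3)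
    proof eventually_elim
      case (elim s)
      have sq: "s ^ e k = s ^ q * s ^ (e k - q)" using qe by (simp flip: power_add)
      have ball: "cscale e (of_real s) (?a s) \<in> ball 0 r" by (rule cscale_in_ball) (use elim in auto)
      have "on_graph (cscale e (of_real s) (?a s))" using on_graph_approx elim by simp
      then have "on_graph (T t (cscale e (of_real s) (?a s)))" using T_on_graph[OF ball] t by simp
      then have "Re (T t (cscale e (of_real s) (?a s)) $ k) = F k (T t (cscale e (of_real s) (?a s)) $ i)"
        by (simp add: on_graph_def)
      moreover have "Re (cscale e (of_real s) (?a s) $ k) = F k (of_real s * p $ i)"
        using elim by (simp add: graph_approx_def flip: of_real_power)
      ultimately have "Re (?g (cscale e (of_real s) (?a s))) = s ^ e k * E s"
        using elim by (simp add: E_def algebra_simps del: cscale_nth)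
      moreover have "Re (z / of_real s ^ q) = Re z / s ^ q" for z by (simp flip: of_real_power)
      ultimately show ?case using elim unfolding sq by simp
    qed
    have "((\<lambda>s. E s * s ^ (e k - q)) \<longlongrightarrow> 0) (at_right 0)"
    proof (cases "q = e k")
      case True
      then show ?thesis using E less.prems by (simp add: power_mult_distrib)
    next
      case False
      have "((\<lambda>s. E s * s ^ (e k - q)) \<longlongrightarrow> ((t ^ m * Re (p $ i)) ^ e k - \<kappa> * Re (p $ i) ^ e k) * 0 ^ (e k - q)) (at_right 0)"
        by (intro tendsto_intros E idlim)
      moreover have "(0::real) ^ (e k - q) = 0" using False qe by simp
      ultimately show ?thesis by simp
    qed
    then have "((\<lambda>s. Re (?g (cscale e (of_real s) (?a s)) / of_real s ^ q)) \<longlongrightarrow> 0) (at_right 0)"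
      by (rule Lim_transform_eventually) (use eq in \<open>simp add: eq_commute\<close>)
    then show ?thesis using tendsto_unique[OF _ L1] by (simp add: trivial_limit_at_right_real)
  qed
  have holc: "holomorphic_fun_on (weight_coeff e q ?g) (ball 0 r)"
    by (rule holomorphic_fun_on_weight_coeff[OF hol bd low])
  obtain \<delta> where \<delta>: "\<delta> > 0" "\<delta> \<le> r" "\<And>w. w \<in> ball 0 \<delta> \<Longrightarrow> weight_coeff e q ?g w = weight_coeff e q ?g 0"
    by (rule real_part_zero_on_model_imp_constant[OF holc r(1) e Re0]) (assumption | rule that)+
  have "weight_coeff e q ?g 0 = 0"
    by (simp add: weight_coeff_def T0)
  then have zero: "weight_coeff e q ?g z = 0" if "z \<in> ball 0 \<delta>" for z using \<delta>(3)[OF that] by simp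
  \<comment> \<open>Dilating by \<open>\<sigma>\<close> moves all of \<open>ball 0 r\<close> into
    the small ball where the coefficient is known to vanish.\<close>
  define \<sigma> where "\<sigma> = min 1 (\<delta> / (2 * r))"
  have \<sigma>: "0 < \<sigma>" "\<sigma> \<le> 1" "\<sigma> * r < \<delta>" using \<delta> r by (auto simp: \<sigma>_def min_def field_simps)
  have "norm (cscale e (of_real \<sigma>) w) \<le> \<sigma> * norm w"
    using norm_cscale_le'[of "of_real \<sigma>" e w] \<sigma> e(2) by simp
  also have "\<dots> \<le> \<sigma> * r" using \<sigma> less.prems by (intro mult_left_mono) auto
  finally have "cscale e (of_real \<sigma>) w \<in> ball 0 \<delta>" using \<sigma> by simp
  then have "weight_coeff e q ?g (cscale e (of_real \<sigma>) w) = 0" by (rule zero)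
  then show ?case
    using weight_coeff_cscale[OF hol less.prems(2), of "of_real \<sigma>" e q] \<sigma> by simp
qed

text \<open>The precise sense in which \<open>T t\<close> is asymptotic to the model dilation by
  \<open>t ^ m\<close>: componentwise, at the scale of the weight of each component.\<close>

lemma T_tendsto:
  assumes t: "0 < t" "t \<le> 1" and w: "w \<in> ball 0 r"
  shows "((\<lambda>s. T t (cscale e (of_real s) w) $ k / of_real s ^ e k) \<longlongrightarrow> of_real ((t ^ m) ^ e k) * w $ k) (at_right 0)"
proof -
  let ?\<kappa> = "(t ^ m) ^ e k"
  let ?g = "\<lambda>w. T t w $ k - of_real ?\<kappa> * w $ k"
  have hol: "holomorphic_fun_on ?g (ball 0 r)"
    by (intro holomorphic_fun_on_diff holomorphic_fun_on_cmult holomorphic_fun_on_nth hol_T_nth) (use t in auto)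
  have bd: "norm (?g z) \<le> C + \<bar>?\<kappa>\<bar> * r" if "z \<in> ball 0 r" for z
  proof -
    have "norm (?g z) \<le> norm (T t z $ k) + \<bar>?\<kappa>\<bar> * norm (z $ k)"
      using norm_triangle_ineq4[of "T t z $ k" "of_real ?\<kappa> * z $ k"] by (simp only: norm_mult norm_of_real)
    also have "\<dots> \<le> C + \<bar>?\<kappa>\<bar> * r"
      by (intro add_mono T_bound mult_left_mono) (use that t order_trans[OF Finite_Cartesian_Product.norm_nth_le[of z k], of r] in auto)
    finally show ?thesis .
  qed
  have van: "weight_coeff e q ?g z = 0" if "q \<le> e k" "z \<in> ball 0 r" for q z
    by (rule T_weight_coeff_vanish[OF t _ that(2)]) (use that(1) in auto)
  have "((\<lambda>s. ?g (cscale e (of_real s) w) / of_real s ^ e k) \<longlongrightarrow> weight_coeff e (e k) ?g w) (at_right 0)"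
    by (rule weight_limit[OF hol bd van w tendsto_const at_right_0_tendsto(1,2)]) auto
  then have "((\<lambda>s. ?g (cscale e (of_real s) w) / of_real s ^ e k + of_real ?\<kappa> * w $ k) \<longlongrightarrow> 0 + of_real ?\<kappa> * w $ k) (at_right 0)"
    using van[OF _ w, of "e k"] by (intro tendsto_add tendsto_const) simp
  moreover have "\<forall>\<^sub>F s in at_right 0. ?g (cscale e (of_real s) w) / of_real s ^ e k + of_real ?\<kappa> * w $ k
      = T t (cscale e (of_real s) w) $ k / of_real s ^ e k"
    using at_right_0_tendsto(2) by (rule eventually_mono) (simp add: field_simps)
  ultimately show ?thesis using Lim_transform_eventually by fastforce
qed

text \<open>A holomorphic eigenfunction of the contraction \<open>T (1/2)\<close> has the weighted order dictated by its
  eigenvalue, because \<open>T (1/2)\<close> is asymptotically the dilation with factor \<open>(1/2) ^ m\<close>.\<close>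

lemma eigenfunction_order:
  assumes hol: "holomorphic_fun_on \<theta> (ball 0 r)" and bd: "\<And>z. z \<in> ball 0 r \<Longrightarrow> norm (\<theta> z) \<le> B"
    and eig: "\<And>w. w \<in> ball 0 r \<Longrightarrow> T (1/2) w \<in> ball 0 r \<Longrightarrow> \<theta> (T (1/2) w) = (1/2) ^ p * \<theta> w"
    and low: "\<And>k w. k < q \<Longrightarrow> w \<in> ball 0 r \<Longrightarrow> weight_coeff e k \<theta> w = 0"
    and w: "w \<in> ball 0 r" "weight_coeff e q \<theta> w \<noteq> 0"
  shows "m * q = p"
proof -
  define c where "c = ((1/2) ^ m :: complex)"
  \<comment> \<open>\<open>T (1/2)\<close> conjugated with the dilation by \<open>s\<close>. As
    \<open>s\<close> tends to 0 it becomes the dilation by \<open>c\<close>, so the eigenvalue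
    equation passes to the leading part of \<open>\<theta>\<close>, on which that dilation acts by
    \<open>c ^ q\<close>.\<close>
  define W where "W s = cscale e (1 / of_real s) (T (1/2) (cscale e (of_real s) w))" for s :: real
  have cw: "cscale e c w \<in> ball 0 r" by (rule cscale_in_ball[OF w(1)]) (simp add: c_def norm_power power_le_one)
  have Wlim: "(W \<longlongrightarrow> cscale e c w) (at_right 0)"
  proof (rule vec_tendstoI)
    fix k
    have "((\<lambda>s. T (1/2) (cscale e (of_real s) w) $ k / of_real s ^ e k) \<longlongrightarrow> of_real (((1/2) ^ m) ^ e k) * w $ k) (at_right 0)"
      by (rule T_tendsto[OF _ _ w(1)]) auto
    then show "((\<lambda>s. W s $ k) \<longlongrightarrow> cscale e c w $ k) (at_right 0)"
      by (simp add: W_def c_def power_divide)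
  qed
  have Wball: "\<forall>\<^sub>F s in at_right 0. W s \<in> ball 0 r" by (rule eventually_in_open_ball[OF Wlim cw])
  have idlim: "((\<lambda>s::real. s) \<longlongrightarrow> 0) (at_right 0)" by (rule tendsto_ident_at)
  have s1: "\<forall>\<^sub>F s::real in at_right 0. s < 1" using idlim by (rule order_tendstoD(2)) simp
  have L1: "((\<lambda>s. \<theta> (cscale e (of_real s) (W s)) / of_real s ^ q) \<longlongrightarrow> weight_coeff e q \<theta> (cscale e c w)) (at_right 0)"
    by (rule weight_limit[OF hol bd low cw Wlim at_right_0_tendsto(1,2)])
  have "((\<lambda>s. \<theta> (cscale e (of_real s) w) / of_real s ^ q) \<longlongrightarrow> weight_coeff e q \<theta> w) (at_right 0)"
    by (rule weight_limit[OF hol bd low w(1) tendsto_const at_right_0_tendsto(1,2)])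
  then have L2: "((\<lambda>s. (1/2) ^ p * (\<theta> (cscale e (of_real s) w) / of_real s ^ q)) \<longlongrightarrow> (1/2) ^ p * weight_coeff e q \<theta> w) (at_right 0)"
    by (rule tendsto_mult_left)
  have "\<forall>\<^sub>F s in at_right 0. (1/2) ^ p * (\<theta> (cscale e (of_real s) w) / of_real s ^ q) = \<theta> (cscale e (of_real s) (W s)) / of_real s ^ q"
    using Wball s1 at_right_0_tendsto(3)
  proof eventually_elim
    case (elim s)
    have TW: "cscale e (of_real s) (W s) = T (1/2) (cscale e (of_real s) w)" using elim by (simp add: W_def)
    have "cscale e (of_real s) (W s) \<in> ball 0 r" by (rule cscale_in_ball) (use elim in auto)
    moreover have "cscale e (of_real s) w \<in> ball 0 r" by (rule cscale_in_ball[OF w(1)]) (use elim in auto)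
    ultimately show ?case using eig[of "cscale e (of_real s) w"] by (simp add: TW)
  qed
  then have "((\<lambda>s. \<theta> (cscale e (of_real s) (W s)) / of_real s ^ q) \<longlongrightarrow> (1/2) ^ p * weight_coeff e q \<theta> w) (at_right 0)"
    by (rule Lim_transform_eventually[OF L2])
  then have "weight_coeff e q \<theta> (cscale e c w) = (1/2) ^ p * weight_coeff e q \<theta> w"
    using tendsto_unique[OF _ L1] by (simp add: trivial_limit_at_right_real)
  moreover have "weight_coeff e q \<theta> (cscale e c w) = c ^ q * weight_coeff e q \<theta> w"
    by (rule weight_coeff_cscale[OF hol w(1)]) (simp add: c_def norm_power power_le_one)
  ultimately have "((1/2) ^ (m * q) :: complex) = (1/2) ^ p"
    using w(2) by (simp add: c_def power_mult)
  then have "norm (((1/2) ^ (m * q)) :: complex) = norm (((1/2) ^ p) :: complex)" by simp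
  then have "((1/2) ^ (m * q) :: real) = (1/2) ^ p" by (simp add: norm_power norm_divide)
  then show ?thesis by (simp add: power_one_over)
qed

end

section \<open>Weighted orders of the chart and limits of its rescalings\<close>

lemma weight_coeff_cmult:
  assumes g: "holomorphic_fun_on g (ball 0 r)" and w: "w \<in> ball 0 r"
  shows "weight_coeff \<omega> j (\<lambda>w. a * g w) w = a * weight_coeff \<omega> j g w"
  unfolding weight_coeff_def
  by (subst higher_deriv_cmult[OF holomorphic_on_weight_curve[OF g w]]) auto

text \<open>At the parameter 1/4 both the value and the expansion error are at most
  \<open>C\<close>; dividing by \<open>(1/4) ^ q\<close> gives the factor
  \<open>4 ^ q\<close>.\<close>

lemma weight_coeff_bounded:
  assumes g: "holomorphic_fun_on g (ball 0 r)" and C: "\<And>z. z \<in> ball 0 r \<Longrightarrow> norm (g z) \<le> C"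
    and w: "w \<in> ball 0 r" and low: "\<And>k. k < q \<Longrightarrow> weight_coeff \<omega> k g w = 0"
  shows "norm (weight_coeff \<omega> q g w) \<le> 4 ^ q * (2 * C)"
proof -
  let ?x = "cscale \<omega> (1/4) w"
  have C0: "0 \<le> C" using order_trans[OF norm_ge_zero C[OF w]] .
  have "norm (g ?x - (1/4) ^ q * weight_coeff \<omega> q g w) \<le> 2 * C * (2 * norm (1/4 :: complex)) ^ Suc q"
    by (rule weight_expansion_lowest(1)[OF g C w _ low]) auto
  also have "\<dots> \<le> C" using C0 power_le_one[of "1/2::real" q] by (simp add: mult_left_le)
  finally have 1: "norm (g ?x - (1/4) ^ q * weight_coeff \<omega> q g w) \<le> C" .
  have 2: "norm (g ?x) \<le> C" by (rule C[OF cscale_in_ball[OF w]]) simp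
  have "norm ((1/4) ^ q * weight_coeff \<omega> q g w) \<le> 2 * C"
    using norm_triangle_ineq4[of "g ?x" "g ?x - (1/4) ^ q * weight_coeff \<omega> q g w"] 1 2 by simp
  then show ?thesis by (simp add: norm_mult norm_power norm_divide power_one_over field_simps)
qed

text \<open>Excludes infinite weighted order for the components of a chart and of its inverse: a
  local inverse reaches a whole neighbourhood of 0, so none of its components vanishes identically
  near 0.\<close>

lemma local_inverse_component_nonzero:
  fixes \<phi> \<psi> :: "complex ^ 'n \<Rightarrow> complex ^ 'n"
  assumes "isCont \<phi> 0" "\<phi> 0 = 0" "open U" "0 \<in> U" "\<And>z. z \<in> U \<Longrightarrow> \<psi> (\<phi> z) = z" "\<delta> > 0"
  obtains w where "w \<in> ball 0 \<delta>" "\<psi> w $ l \<noteq> 0"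
proof -
  obtain \<eta>1 where \<eta>1: "\<eta>1 > 0" "ball 0 \<eta>1 \<subseteq> U" using assms(3,4) open_contains_ball by blast
  obtain \<eta>2 where \<eta>2: "\<eta>2 > 0" "\<And>z. dist z 0 < \<eta>2 \<Longrightarrow> dist (\<phi> z) (\<phi> 0) < \<delta>"
    using assms(1,6) unfolding continuous_at_eps_delta by blast
  define z :: "complex ^ 'n" where "z = of_real (min \<eta>1 \<eta>2 / 2) *s axis l 1"
  have nz: "norm z = min \<eta>1 \<eta>2 / 2"
    using \<eta>1(1) \<eta>2(1) unfolding z_def norm_cscale_vec norm_of_real
    by (simp add: norm_vec_def L2_set_def axis_def if_distrib[of "\<lambda>t. norm t ^ 2"] sum.delta' cong: if_cong)
  have "z \<in> U" using \<eta>1 \<eta>2(1) nz by (auto simp: subset_iff)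
  then have "\<psi> (\<phi> z) $ l \<noteq> 0" using assms(5) \<eta>1(1) \<eta>2(1) by (simp add: z_def axis_def)
  moreover have "\<phi> z \<in> ball 0 \<delta>" using \<eta>2(2)[of z] nz \<eta>1(1) \<eta>2(1) assms(2) by simp
  ultimately show ?thesis using that by blast
qed

context weighted_graph_chart
begin

lemma cont\<phi>: "isCont \<phi> 0"
  using holomorphic_map_on_continuous_on[OF hol\<phi>] openU U0 by (simp add: continuous_on_eq_continuous_at)

lemma cont\<psi>: "isCont \<psi> 0"
  using holomorphic_map_on_continuous_on[OF hol\<psi>] openV V0 by (simp add: continuous_on_eq_continuous_at)

lemma hol\<psi>_nth: "holomorphic_fun_on (\<lambda>w. \<psi> w $ l) (ball 0 r)"
  using holomorphic_map_on_subset[OF hol\<psi> r(3)] holomorphic_map_on_iff by blast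

lemma hol\<phi>_nth: "holomorphic_fun_on (\<lambda>w. \<phi> w $ l) (ball 0 \<rho>)"
  using holomorphic_map_on_subset[OF hol\<phi> \<rho>(2)] holomorphic_map_on_iff by blast

lemma \<psi>_bound: "w \<in> ball 0 r \<Longrightarrow> norm (\<psi> w $ l) \<le> \<rho>"
  using order_trans[OF Finite_Cartesian_Product.norm_nth_le, of "\<psi> w" \<rho> l] \<psi>r[of w] by simp

lemma \<phi>_bound: "z \<in> ball 0 \<rho> \<Longrightarrow> norm (\<phi> z $ l) \<le> C"
  using order_trans[OF Finite_Cartesian_Product.norm_nth_le C, of z l] .

text \<open>\<open>\<psi>\<close> conjugates \<open>T (1/2)\<close> to a diagonal map, so each of
  its components is an eigenfunction, with eigenvalue \<open>(1/2) ^ \<mu> l\<close>. In particular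
  \<open>m\<close> divides every weight of \<open>M\<close>.\<close>

lemma \<psi>_order:
  "\<exists>q. m * q = \<mu> l \<and> (\<forall>k<q. \<forall>w\<in>ball 0 r. weight_coeff e k (\<lambda>w. \<psi> w $ l) w = 0)"
proof (rule weight_order_cases[OF hol\<psi>_nth[of l] \<psi>_bound[of _ l] r(1), where \<omega> = e])
  fix \<delta> :: real assume \<delta>: "\<delta> > 0" "\<And>w. w \<in> ball 0 \<delta> \<Longrightarrow> \<psi> w $ l = 0"
  then show ?thesis
    using local_inverse_component_nonzero[OF cont\<phi> \<phi>0 openU U0 \<psi>\<phi> \<delta>(1), of l] by blast
next
  fix q w assume low: "\<And>k w. k < q \<Longrightarrow> w \<in> ball 0 r \<Longrightarrow> weight_coeff e k (\<lambda>w. \<psi> w $ l) w = 0"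
    and w: "w \<in> ball 0 r" "weight_coeff e q (\<lambda>w. \<psi> w $ l) w \<noteq> 0"
  have "m * q = \<mu> l"
  proof (rule eigenfunction_order[OF hol\<psi>_nth \<psi>_bound _ low w])
    show "\<psi> (T (1/2) w) $ l = (1/2) ^ \<mu> l * \<psi> w $ l" if "w \<in> ball 0 r" for w
      using \<psi>_T[OF that, of "1/2"] by simp
  qed auto
  then show ?thesis using low by blast
qed auto

text \<open>Let \<open>b\<close> be the leading part with respect to \<open>\<mu>\<close> of
  component \<open>k\<close> of \<open>\<phi>\<close>, of degree \<open>p\<close>. Then
  \<open>b\<close> composed with \<open>\<psi>\<close> is an eigenfunction of \<open>T (1/2)\<close>
  with eigenvalue \<open>(1/2) ^ p\<close>, so its order \<open>q\<close> with respect to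
  \<open>e\<close> satisfies \<open>m * q = p\<close>. As a limit of rescalings of
  \<open>T t\<close> it also has order at least \<open>e k\<close>, whence
  \<open>m * e k \<le> p\<close>.\<close>

lemma \<phi>_order:
  assumes j: "j < m * e k" and z: "z \<in> ball 0 \<rho>"
  shows "weight_coeff \<mu> j (\<lambda>z. \<phi> z $ k) z = 0"
proof (rule weight_order_cases[OF hol\<phi>_nth[of k] \<phi>_bound[of _ k] \<rho>(1), where \<omega> = \<mu>])
  fix \<delta> :: real assume \<delta>: "\<delta> > 0" "\<And>w. w \<in> ball 0 \<delta> \<Longrightarrow> \<phi> w $ k = 0"
  then show ?thesis
    using local_inverse_component_nonzero[OF cont\<psi> \<psi>0 openV V0 \<phi>\<psi> \<delta>(1), of k] by blast
next
  fix p z1 assume low: "\<And>j z. j < p \<Longrightarrow> z \<in> ball 0 \<rho> \<Longrightarrow> weight_coeff \<mu> j (\<lambda>z. \<phi> z $ k) z = 0"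
    and z1: "z1 \<in> ball 0 \<rho>" "weight_coeff \<mu> p (\<lambda>z. \<phi> z $ k) z1 \<noteq> 0"
  define b where "b = weight_coeff \<mu> p (\<lambda>z. \<phi> z $ k)"
  have holb: "holomorphic_fun_on b (ball 0 \<rho>)"
    unfolding b_def by (rule holomorphic_fun_on_weight_coeff[OF hol\<phi>_nth \<phi>_bound low])
  have bcs: "b (cscale \<mu> \<sigma> z) = \<sigma> ^ p * b z" if "z \<in> ball 0 \<rho>" "norm \<sigma> \<le> 1" for \<sigma> z
    unfolding b_def by (rule weight_coeff_cscale[OF hol\<phi>_nth that])
  define \<theta> where "\<theta> w = b (\<psi> w)" for w
  have hol\<theta>: "holomorphic_fun_on \<theta> (ball 0 r)"
    unfolding \<theta>_def
    by (rule holomorphic_fun_on_compose[OF holb holomorphic_map_on_subset[OF hol\<psi> r(3)]]) (use \<psi>r in blast)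
  have bd\<theta>: "norm (\<theta> w) \<le> 4 ^ p * (2 * C)" if "w \<in> ball 0 r" for w
    unfolding \<theta>_def b_def by (rule weight_coeff_bounded[OF hol\<phi>_nth \<phi>_bound \<psi>r[OF that] low[OF _ \<psi>r[OF that]]])
  have eig: "\<theta> (T (1/2) w) = (1/2) ^ p * \<theta> w" if "w \<in> ball 0 r" for w
    unfolding \<theta>_def using \<psi>_T[OF that, of "1/2"] bcs[OF \<psi>r[OF that], of "1/2"] by simp
  have coeff0: "weight_coeff e j \<theta> w = 0" if j: "j < e k" and w: "w \<in> ball 0 r" for j w
  proof -
    \<comment> \<open>These functions tend uniformly to \<open>\<theta>\<close> as \<open>t\<close>
      tends to 0. Each has order at least \<open>e k\<close> by \<open>T_weight_coeff_vanish\<close>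
      with \<open>\<kappa> = 0\<close>, and this bound survives the limit.\<close>
    define g where "g t w = inverse (of_real t ^ p) * T t w $ k" for t :: real and w
    have idlim: "((\<lambda>s::real. s) \<longlongrightarrow> 0) (at_right 0)" by (rule tendsto_ident_at)
    have t4: "\<forall>\<^sub>F t::real in at_right 0. t < 1/4" using idlim by (rule order_tendstoD(2)) simp
    have t01: "\<forall>\<^sub>F t::real in at_right 0. 0 < t \<and> t < 1/4"
      using at_right_0_tendsto(3) t4 by eventually_elim simp
    have holg: "\<forall>\<^sub>F t in at_right 0. holomorphic_fun_on (g t) (ball 0 r)"
      using t01 unfolding g_def
      by (rule eventually_mono) (intro holomorphic_fun_on_cmult hol_T_nth, auto)
    have ul: "uniform_limit (ball 0 r) g \<theta> (at_right 0)"
    proof (rule uniform_limitI)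
      fix \<epsilon> :: real assume \<epsilon>: "\<epsilon> > 0"
      have "((\<lambda>t. (4 * C * 2 ^ p) * t) \<longlongrightarrow> 0) (at_right 0)"
        using tendsto_mult_right_zero[OF idlim] .
      then have "\<forall>\<^sub>F t in at_right 0. (4 * C * 2 ^ p) * t < \<epsilon>" using \<epsilon> by (intro order_tendstoD(2)) auto
      with t01 show "\<forall>\<^sub>F t in at_right 0. \<forall>w\<in>ball 0 r. dist (g t w) (\<theta> w) < \<epsilon>"
      proof eventually_elim
        case (elim t)
        show ?case
        proof
          fix w :: "complex ^ 'n" assume w: "w \<in> ball 0 r"
          let ?z = "\<psi> w"
          have "g t w - \<theta> w = inverse (of_real t ^ p) * (\<phi> (cscale \<mu> (of_real t) ?z) $ k - of_real t ^ p * b ?z)"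
            using elim by (simp add: g_def \<theta>_def T_def field_simps)
          then have "norm (g t w - \<theta> w) = inverse (t ^ p) * norm (\<phi> (cscale \<mu> (of_real t) ?z) $ k - of_real t ^ p * b ?z)"
            using elim by (simp add: norm_mult norm_inverse norm_power)
          also have "\<dots> \<le> inverse (t ^ p) * (2 * C * (2 * norm (complex_of_real t)) ^ Suc p)"
            unfolding b_def
            by (intro mult_left_mono weight_expansion_lowest(1)[OF hol\<phi>_nth \<phi>_bound \<psi>r[OF w] _ low[OF _ \<psi>r[OF w]]])
              (use elim in auto)
          also have "\<dots> = (4 * C * 2 ^ p) * t" using elim by (simp add: power_mult_distrib)
          finally show "dist (g t w) (\<theta> w) < \<epsilon>" using elim by (simp add: dist_norm)
        qed
      qed
    qed
    have "((\<lambda>t. weight_coeff e j (g t) w) \<longlongrightarrow> weight_coeff e j \<theta> w) (at_right 0)"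
      by (rule weight_coeff_limit[OF holg ul _ w]) (simp add: trivial_limit_at_right_real)
    moreover have "\<forall>\<^sub>F t in at_right 0. weight_coeff e j (g t) w = 0"
      using t01
    proof (rule eventually_mono)
      fix t :: real assume t: "0 < t \<and> t < 1/4"
      have "weight_coeff e j (\<lambda>w. T t w $ k) w = 0"
        using T_weight_coeff_vanish[of t j k 0, OF _ _ _ w] t j by simp
      then show "weight_coeff e j (g t) w = 0"
        unfolding g_def using weight_coeff_cmult[OF hol_T_nth w, of t] t by simp
    qed
    ultimately have "((\<lambda>t::real. 0) \<longlongrightarrow> weight_coeff e j \<theta> w) (at_right 0)"
      by (rule Lim_transform_eventually)
    then show ?thesis using tendsto_unique[OF _ tendsto_const] by (metis trivial_limit_at_right_real)
  qed
  have "m * e k \<le> p"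
  proof (rule weight_order_cases[OF hol\<theta> bd\<theta> r(1), where \<omega> = e])
    fix \<delta> :: real assume \<delta>: "\<delta> > 0" "\<And>w. w \<in> ball 0 \<delta> \<Longrightarrow> \<theta> w = 0"
    obtain \<eta> where \<eta>: "\<eta> > 0" "\<And>z. dist z 0 < \<eta> \<Longrightarrow> dist (\<phi> z) (\<phi> 0) < \<delta>"
      using cont\<phi> \<delta>(1) unfolding continuous_at_eps_delta by blast
    \<comment> \<open>Moves \<open>z1\<close> so close to 0 that its image under
      \<open>\<phi>\<close> lies where \<open>\<theta>\<close> is assumed to vanish, while
      homogeneity keeps the value of \<open>b\<close> non-zero.\<close>
    define \<sigma> where "\<sigma> = min 1 (\<eta> / (2 * \<rho>))"
    have \<sigma>: "0 < \<sigma>" "\<sigma> \<le> 1" "\<sigma> * \<rho> < \<eta>" using \<eta> \<rho> by (auto simp: \<sigma>_def min_def field_simps)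
    let ?z = "cscale \<mu> (of_real \<sigma>) z1"
    have "norm ?z \<le> \<sigma> * norm z1" using norm_cscale_le'[of "of_real \<sigma>" \<mu> z1] \<sigma> mu by simp
    also have "\<dots> \<le> \<sigma> * \<rho>" using \<sigma> z1 by (intro mult_left_mono) auto
    finally have nz: "norm ?z < \<eta>" using \<sigma> by simp
    have "?z \<in> ball 0 \<rho>" by (rule cscale_in_ball[OF z1(1)]) (use \<sigma> in simp)
    then have "\<theta> (\<phi> ?z) = b ?z" using \<rho>(2) \<psi>\<phi> by (auto simp: \<theta>_def)
    also have "\<dots> \<noteq> 0" using bcs[OF z1(1), of "of_real \<sigma>"] \<sigma> z1(2) by (simp add: b_def)
    finally show ?thesis using \<delta>(2)[of "\<phi> ?z"] \<eta>(2)[of ?z] nz \<phi>0 by simp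
  next
    fix q w assume q: "\<And>j w. j < q \<Longrightarrow> w \<in> ball 0 r \<Longrightarrow> weight_coeff e j \<theta> w = 0"
      "w \<in> ball 0 r" "weight_coeff e q \<theta> w \<noteq> 0"
    have "m * q = p" by (rule eigenfunction_order[OF hol\<theta> bd\<theta> eig q])
    moreover have "e k \<le> q" using coeff0 q(2,3) not_le_imp_less by blast
    ultimately show ?thesis by auto
  qed auto
  then show ?thesis using low[OF _ z] j by simp
qed auto

definition ord\<psi> :: "'n \<Rightarrow> nat" where
  "ord\<psi> l = (SOME q. m * q = \<mu> l \<and> (\<forall>k<q. \<forall>w\<in>ball 0 r. weight_coeff e k (\<lambda>w. \<psi> w $ l) w = 0))"

lemma ord\<psi>:
  "m * ord\<psi> l = \<mu> l" "\<And>k w. k < ord\<psi> l \<Longrightarrow> w \<in> ball 0 r \<Longrightarrow> weight_coeff e k (\<lambda>w. \<psi> w $ l) w = 0"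
  using someI_ex[OF \<psi>_order[of l]] unfolding ord\<psi>_def by blast+

text \<open>\<open>\<Phi>\<close> and \<open>\<Psi>\<close> are the limits of the rescaled chart and
  its inverse, written as weighted parts: the dilation by \<open>s\<close> on the side of
  \<open>M\<close> is paired with the dilation by \<open>s ^ m\<close> on the side of the
  model.\<close>

definition \<Phi> :: "complex ^ 'n \<Rightarrow> complex ^ 'n" where
  "\<Phi> z = (\<chi> k. weight_coeff \<mu> (m * e k) (\<lambda>z. \<phi> z $ k) z)"

definition \<Psi> :: "complex ^ 'n \<Rightarrow> complex ^ 'n" where
  "\<Psi> w = (\<chi> l. weight_coeff e (ord\<psi> l) (\<lambda>w. \<psi> w $ l) w)"

lemma hol\<Phi>: "holomorphic_map_on \<Phi> (ball 0 \<rho>)"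
  using holomorphic_fun_on_weight_coeff[OF hol\<phi>_nth \<phi>_bound \<phi>_order]
  by (simp add: holomorphic_map_on_iff \<Phi>_def)

lemma hol\<Psi>: "holomorphic_map_on \<Psi> (ball 0 r)"
  using holomorphic_fun_on_weight_coeff[OF hol\<psi>_nth \<psi>_bound ord\<psi>(2)]
  by (simp add: holomorphic_map_on_iff \<Psi>_def)

lemma \<Phi>0: "\<Phi> 0 = 0"
  by (simp add: \<Phi>_def vec_eq_iff weight_coeff_def \<phi>0)

lemma \<Phi>_limit:
  assumes "z \<in> ball 0 \<rho>" "(h \<longlongrightarrow> z) (at_right (0::real))"
  shows "((\<lambda>s. cscale e (1 / of_real s ^ m) (\<phi> (cscale \<mu> (of_real s) (h s)))) \<longlongrightarrow> \<Phi> z) (at_right 0)"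
proof (rule vec_tendstoI)
  fix k
  have "((\<lambda>s. \<phi> (cscale \<mu> (of_real s) (h s)) $ k / of_real s ^ (m * e k)) \<longlongrightarrow> \<Phi> z $ k) (at_right 0)"
    unfolding \<Phi>_def vec_lambda_beta
    by (rule weight_limit[OF hol\<phi>_nth \<phi>_bound \<phi>_order assms at_right_0_tendsto(1,2)])
  then show "((\<lambda>s. cscale e (1 / of_real s ^ m) (\<phi> (cscale \<mu> (of_real s) (h s))) $ k) \<longlongrightarrow> \<Phi> z $ k) (at_right 0)"
    by (simp add: power_divide power_mult)
qed

lemma pow_m_tendsto:
  "((\<lambda>s::real. s ^ m) \<longlongrightarrow> 0) (at_right 0)" "\<forall>\<^sub>F s::real in at_right 0. 0 < s ^ m"
  "((\<lambda>s. complex_of_real s ^ m) \<longlongrightarrow> 0) (at_right 0)" "\<forall>\<^sub>F s in at_right 0. complex_of_real s ^ m \<noteq> 0"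
proof -
  have "((\<lambda>s::real. s ^ m) \<longlongrightarrow> 0 ^ m) (at_right 0)" by (intro tendsto_intros)
  then show "((\<lambda>s::real. s ^ m) \<longlongrightarrow> 0) (at_right 0)" using m_pos by simp
  have "((\<lambda>s. complex_of_real s ^ m) \<longlongrightarrow> 0 ^ m) (at_right 0)"
    by (intro tendsto_power at_right_0_tendsto(1))
  then show "((\<lambda>s. complex_of_real s ^ m) \<longlongrightarrow> 0) (at_right 0)" by (simp only: zero_power[OF m_pos])
  show "\<forall>\<^sub>F s::real in at_right 0. 0 < s ^ m" using at_right_0_tendsto(3) by (rule eventually_mono) simp
  show "\<forall>\<^sub>F s in at_right 0. complex_of_real s ^ m \<noteq> 0" using at_right_0_tendsto(3) by (rule eventually_mono) simp
qed

lemma \<Psi>_limit: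
  assumes "w \<in> ball 0 r" "(h \<longlongrightarrow> w) (at_right (0::real))"
  shows "((\<lambda>s. cscale \<mu> (1 / of_real s) (\<psi> (cscale e (of_real s ^ m) (h s)))) \<longlongrightarrow> \<Psi> w) (at_right 0)"
proof (rule vec_tendstoI)
  fix l
  have "((\<lambda>s. \<psi> (cscale e (of_real s ^ m) (h s)) $ l / (of_real s ^ m) ^ ord\<psi> l) \<longlongrightarrow> \<Psi> w $ l) (at_right 0)"
    unfolding \<Psi>_def vec_lambda_beta
    by (rule weight_limit[OF hol\<psi>_nth \<psi>_bound ord\<psi>(2) assms pow_m_tendsto(3,4)])
  then show "((\<lambda>s. cscale \<mu> (1 / of_real s) (\<psi> (cscale e (of_real s ^ m) (h s))) $ l) \<longlongrightarrow> \<Psi> w $ l) (at_right 0)"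
    using ord\<psi>(1)[of l] by (simp add: power_divide flip: power_mult)
qed

lemma small_s: "\<forall>\<^sub>F s::real in at_right 0. 0 < s \<and> s < 1"
proof -
  have "((\<lambda>s::real. s) \<longlongrightarrow> 0) (at_right 0)" by (rule tendsto_ident_at)
  then have "\<forall>\<^sub>F s::real in at_right 0. s < 1" by (rule order_tendstoD(2)) simp
  with at_right_0_tendsto(3) show ?thesis by eventually_elim simp
qed

text \<open>Before the limit the two rescaled maps are inverse to each other. The points supplied by
  \<open>\<Psi>_limit\<close> move with \<open>s\<close>, which \<open>\<Phi>_limit\<close>
  permits.\<close>

lemma \<Phi>_\<Psi>:
  assumes w: "w \<in> ball 0 r" "\<Psi> w \<in> ball 0 \<rho>"
  shows "\<Phi> (\<Psi> w) = w"
proof -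
  let ?h = "\<lambda>s::real. cscale \<mu> (1 / of_real s) (\<psi> (cscale e (of_real s ^ m) w))"
  have "((\<lambda>s. cscale e (1 / of_real s ^ m) (\<phi> (cscale \<mu> (of_real s) (?h s)))) \<longlongrightarrow> \<Phi> (\<Psi> w)) (at_right 0)"
    by (rule \<Phi>_limit[OF w(2) \<Psi>_limit[OF w(1) tendsto_const]])
  moreover have "\<forall>\<^sub>F s in at_right 0. cscale e (1 / of_real s ^ m) (\<phi> (cscale \<mu> (of_real s) (?h s))) = w"
    using small_s
  proof (rule eventually_mono)
    fix s :: real assume s: "0 < s \<and> s < 1"
    have "cscale e (of_real s ^ m) w \<in> ball 0 r"
      by (rule cscale_in_ball[OF w(1)]) (use s in \<open>auto simp: norm_power intro!: power_le_one\<close>)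
    then have "cscale e (of_real s ^ m) w \<in> V" using r(3) by blast
    then show "cscale e (1 / of_real s ^ m) (\<phi> (cscale \<mu> (of_real s) (?h s))) = w"
      using s \<phi>\<psi> by simp
  qed
  ultimately have "((\<lambda>s::real. w) \<longlongrightarrow> \<Phi> (\<Psi> w)) (at_right 0)" by (rule Lim_transform_eventually)
  then show ?thesis using tendsto_unique[OF _ tendsto_const] by (metis trivial_limit_at_right_real)
qed

lemma \<Psi>_\<Phi>:
  assumes z: "z \<in> ball 0 \<rho>" "\<Phi> z \<in> ball 0 r"
  shows "\<Psi> (\<Phi> z) = z"
proof -
  let ?h = "\<lambda>s::real. cscale e (1 / of_real s ^ m) (\<phi> (cscale \<mu> (of_real s) z))"
  have "((\<lambda>s. cscale \<mu> (1 / of_real s) (\<psi> (cscale e (of_real s ^ m) (?h s)))) \<longlongrightarrow> \<Psi> (\<Phi> z)) (at_right 0)"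
    by (rule \<Psi>_limit[OF z(2) \<Phi>_limit[OF z(1) tendsto_const]])
  moreover have "\<forall>\<^sub>F s in at_right 0. cscale \<mu> (1 / of_real s) (\<psi> (cscale e (of_real s ^ m) (?h s))) = z"
    using small_s
  proof (rule eventually_mono)
    fix s :: real assume s: "0 < s \<and> s < 1"
    have "cscale \<mu> (of_real s) z \<in> ball 0 \<rho>" by (rule cscale_in_ball[OF z(1)]) (use s in simp)
    then have "cscale \<mu> (of_real s) z \<in> U" using \<rho>(2) by blast
    then show "cscale \<mu> (1 / of_real s) (\<psi> (cscale e (of_real s ^ m) (?h s))) = z"
      using s \<psi>\<phi> by simp
  qed
  ultimately have "((\<lambda>s::real. z) \<longlongrightarrow> \<Psi> (\<Phi> z)) (at_right 0)" by (rule Lim_transform_eventually)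
  then show ?thesis using tendsto_unique[OF _ tendsto_const] by (metis trivial_limit_at_right_real)
qed

text \<open>The dilated copies of \<open>z\<close> stay in \<open>M\<close>, so their images satisfy
  the graph equation; rescaled, this equation tends to that of the model.\<close>

lemma \<Phi>_model:
  assumes z: "z \<in> M" "z \<in> ball 0 \<rho>" shows "\<Phi> z \<in> model e i"
  unfolding model_def
proof (intro CollectI allI)
  fix k
  let ?w = "\<lambda>s::real. \<phi> (cscale \<mu> (of_real s) z)"
  have L: "((\<lambda>s. ?w s $ j / (of_real s ^ m) ^ e j) \<longlongrightarrow> \<Phi> z $ j) (at_right 0)" for j
    using tendsto_vec_nth[OF \<Phi>_limit[OF z(2) tendsto_const], of j] by (simp add: power_divide)
  have Li: "((\<lambda>s. ?w s $ i / of_real (s ^ m)) \<longlongrightarrow> \<Phi> z $ i) (at_right 0)"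
    using L[of i] e(3) by simp
  have 1: "((\<lambda>s. F k (?w s $ i) / (s ^ m) ^ e k) \<longlongrightarrow> Re (\<Phi> z $ i) ^ e k) (at_right 0)"
    by (rule F_limit[OF Li pow_m_tendsto(1,2)])
  have 2: "((\<lambda>s. Re (?w s $ k / (of_real s ^ m) ^ e k)) \<longlongrightarrow> Re (\<Phi> z $ k)) (at_right 0)"
    by (rule tendsto_Re[OF L])
  have "\<forall>\<^sub>F s in at_right 0. Re (?w s $ k / (of_real s ^ m) ^ e k) = F k (?w s $ i) / (s ^ m) ^ e k"
    using small_s
  proof (rule eventually_mono)
    fix s :: real assume s: "0 < s \<and> s < 1"
    have "cscale \<mu> (of_real s) z \<in> ball 0 \<rho>" by (rule cscale_in_ball[OF z(2)]) (use s in simp)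
    then have "cscale \<mu> (of_real s) z \<in> M \<inter> U" using \<rho>(2) scaleM z s by blast
    then have "?w s \<in> {w \<in> V. \<forall>k. Re (w $ k) = F k (w $ i)}" using graph by blast
    then have "Re (?w s $ k) = F k (?w s $ i)" by blast
    then show "Re (?w s $ k / (of_real s ^ m) ^ e k) = F k (?w s $ i) / (s ^ m) ^ e k"
      by (simp flip: of_real_power)
  qed
  from Lim_transform_eventually[OF 2 this] 1 show "Re (\<Phi> z $ k) = Re (\<Phi> z $ i) ^ e k"
    using tendsto_unique trivial_limit_at_right_real by blast
qed

text \<open>A model point is first approximated by points of the rescaled graph. Their images lie in
  \<open>M\<close> by dilation invariance, and \<open>M\<close> is closed.\<close>

lemma \<Psi>_model:
  assumes p: "p \<in> model e i" "p \<in> ball 0 r" shows "\<Psi> p \<in> M"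
proof -
  let ?p = "\<lambda>s::real. graph_approx (s ^ m) p"
  have plim: "(?p \<longlongrightarrow> p) (at_right 0)" by (rule graph_approx_tendsto[OF p(1) pow_m_tendsto(1,2)])
  have pball: "\<forall>\<^sub>F s in at_right 0. ?p s \<in> ball 0 r" by (rule eventually_in_open_ball[OF plim p(2)])
  have "((\<lambda>s. cscale \<mu> (1 / of_real s) (\<psi> (cscale e (of_real s ^ m) (?p s)))) \<longlongrightarrow> \<Psi> p) (at_right 0)"
    by (rule \<Psi>_limit[OF p(2) plim])
  note lim = this
  have "\<forall>\<^sub>F s in at_right 0. cscale \<mu> (1 / of_real s) (\<psi> (cscale e (of_real s ^ m) (?p s))) \<in> M"
    using small_s pball
  proof eventually_elim
    case (elim s)
    let ?w = "cscale e (of_real (s ^ m)) (?p s)"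
    have "?w \<in> ball 0 r" by (rule cscale_in_ball[OF elim(2)]) (use elim in \<open>auto simp: norm_power intro!: power_le_one\<close>)
    then have "?w \<in> V" using r(3) by blast
    moreover have "on_graph ?w" by (rule on_graph_approx) (use elim in simp)
    ultimately have "?w \<in> \<phi> ` (M \<inter> U)" unfolding graph by (simp add: on_graph_def)
    then have "\<psi> ?w \<in> M" using \<psi>\<phi> by auto
    then show ?case using scaleM[of "1 / s" "\<psi> ?w"] elim by simp
  qed
  then show ?thesis by (rule Lim_in_closed_set[OF closedM _ trivial_limit_at_right_real lim])
qed

theorem locally_biholomorphic_model: "locally_biholomorphic_at M 0 (model e i) 0"
  unfolding locally_biholomorphic_at_def
proof (intro exI conjI)
  let ?U = "ball 0 \<rho> \<inter> \<Phi> -` ball 0 r" and ?V = "ball 0 r \<inter> \<Psi> -` ball 0 \<rho>"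
  show "0 \<in> ?U" using \<rho> r by (simp add: \<Phi>0)
  show "\<Phi> 0 = 0" by (rule \<Phi>0)
  show "biholomorphism_between \<Phi> ?U ?V"
  proof (rule biholomorphism_betweenI)
    show "open ?U"
      by (rule continuous_open_preimage[OF holomorphic_map_on_continuous_on[OF hol\<Phi>]]) auto
    show "open ?V"
      by (rule continuous_open_preimage[OF holomorphic_map_on_continuous_on[OF hol\<Psi>]]) auto
    show "holomorphic_map_on \<Phi> ?U" by (rule holomorphic_map_on_subset[OF hol\<Phi>]) auto
    show "holomorphic_map_on \<Psi> ?V" by (rule holomorphic_map_on_subset[OF hol\<Psi>]) auto
  qed (use \<Phi>_\<Psi> \<Psi>_\<Phi> in auto)
  show "\<Phi> ` (M \<inter> ?U) = model e i \<inter> ?V"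
  proof (intro equalityI subsetI)
    fix w assume "w \<in> \<Phi> ` (M \<inter> ?U)"
    then obtain z where z: "z \<in> M" "z \<in> ball 0 \<rho>" "\<Phi> z \<in> ball 0 r" "w = \<Phi> z" by blast
    show "w \<in> model e i \<inter> ?V" using \<Phi>_model[OF z(1,2)] \<Psi>_\<Phi>[OF z(2,3)] z by auto
  next
    fix w assume "w \<in> model e i \<inter> ?V"
    then have w: "w \<in> model e i" "w \<in> ball 0 r" "\<Psi> w \<in> ball 0 \<rho>" by auto
    show "w \<in> \<Phi> ` (M \<inter> ?U)"
      by (rule image_eqI[of _ _ "\<Psi> w"]) (use \<Psi>_model[OF w(1,2)] \<Phi>_\<Psi>[OF w(2,3)] w in auto)
  qed
qed

end

section \<open>Vanishing orders and the normal form of rigid graphs\<close>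

abbreviation (input) dir :: "('a::real_normed_vector \<Rightarrow> 'b::real_normed_vector) \<Rightarrow> 'a \<Rightarrow> 'a \<Rightarrow> 'b" where
  "dir f v \<equiv> \<lambda>x. frechet_derivative f (at x) v"

lemma frechet_derivative_eqI:
  "(f has_derivative f') (at x) \<Longrightarrow> frechet_derivative f (at x) v = f' v"
  using frechet_derivative_at by metis

lemma frechet_derivative_cong_open:
  assumes "open B" "x \<in> B" "\<And>y. y \<in> B \<Longrightarrow> f y = g y"
  shows "frechet_derivative f (at x) = frechet_derivative g (at x)"
proof -
  have "(f has_derivative f') (at x) \<longleftrightarrow> (g has_derivative f') (at x)" for f'
    using has_derivative_transform_within_open[OF _ assms(1,2), of f f' UNIV g]
      has_derivative_transform_within_open[OF _ assms(1,2), of g f' UNIV f] assms(3) by auto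
  then show ?thesis by (simp add: frechet_derivative_def)
qed

text \<open>All derivatives of order less than \<open>q\<close> vanish at \<open>z\<close>; for
  smooth functions this is membership in the \<open>q\<close>-th power of the maximal ideal at
  \<open>z\<close>.\<close>

primrec vanishes :: "nat \<Rightarrow> ('a::real_normed_vector \<Rightarrow> 'b::real_normed_vector) \<Rightarrow> 'a \<Rightarrow> bool" where
  "vanishes 0 f z \<longleftrightarrow> True"
| "vanishes (Suc q) f z \<longleftrightarrow> f z = 0 \<and> (\<forall>v. vanishes q (dir f v) z)"

lemma vanishes_cong:
  assumes "open B" "z \<in> B" "\<And>x. x \<in> B \<Longrightarrow> f x = g x" "vanishes q f z"
  shows "vanishes q g z"
  using assms(3,4)
proof (induction q arbitrary: f g)
  case (Suc q)
  have "vanishes q (dir g v) z" for v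
    by (rule Suc.IH[of "dir f v"])
      (use Suc.prems frechet_derivative_cong_open[OF assms(1), of _ f g] in auto)
  then show ?case using Suc.prems assms(2) by auto
qed auto

lemma vanishes_SucD: "vanishes (Suc q) f z \<Longrightarrow> vanishes q f z"
proof (induction q arbitrary: f)
  case (Suc q)
  then show ?case by (metis vanishes.simps(2))
qed auto

lemma vanishes_mono: "vanishes p f z \<Longrightarrow> q \<le> p \<Longrightarrow> vanishes q f z"
proof (induction p)
  case (Suc p)
  then show ?case using vanishes_SucD[of p f z] by (metis le_SucE)
qed auto

context
  fixes B :: "'a::real_normed_vector set" and z :: 'a
  assumes B: "open B" "z \<in> B"
begin

lemma vanishes_add:
  fixes f g :: "'a \<Rightarrow> 'b::real_normed_vector"
  assumes "smooth_on f B" "smooth_on g B" "vanishes q f z" "vanishes q g z"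
  shows "vanishes q (\<lambda>x. f x + g x) z"
  using assms
proof (induction q arbitrary: f g)
  case (Suc q)
  have "vanishes q (dir (\<lambda>x. f x + g x) v) z" for v
  proof (rule vanishes_cong[OF B])
    show "vanishes q (\<lambda>x. dir f v x + dir g v x) z"
      by (rule Suc.IH) (use Suc.prems in \<open>auto intro: smooth_on_derivative\<close>)
    show "dir f v x + dir g v x = dir (\<lambda>x. f x + g x) v x" if "x \<in> B" for x
      by (rule frechet_derivative_eqI[symmetric])
        (intro has_derivative_add smooth_on_has_derivative[OF Suc.prems(1) that] smooth_on_has_derivative[OF Suc.prems(2) that])
  qed
  then show ?case using Suc.prems by simp
qed auto

lemma vanishes_linear_comp:
  fixes f :: "'a \<Rightarrow> 'b::real_normed_vector"
  assumes L: "bounded_linear L" and "smooth_on f B" "vanishes q f z"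
  shows "vanishes q (\<lambda>x. L (f x)) z"
  using assms(2,3)
proof (induction q arbitrary: f)
  case (Suc q)
  have "vanishes q (dir (\<lambda>x. L (f x)) v) z" for v
  proof (rule vanishes_cong[OF B])
    show "vanishes q (\<lambda>x. L (dir f v x)) z"
      by (rule Suc.IH) (use Suc.prems in \<open>auto intro: smooth_on_derivative\<close>)
    show "L (dir f v x) = dir (\<lambda>x. L (f x)) v x" if "x \<in> B" for x
      using frechet_derivative_linear_comp[OF L smooth_on_has_derivative[OF Suc.prems(1) that]] by simp
  qed
  then show ?case using Suc.prems linear_0[OF bounded_linear.linear[OF L]] by simp
qed auto

lemma vanishes_cmult:
  fixes f :: "'a \<Rightarrow> 'b::real_normed_algebra"
  shows "smooth_on f B \<Longrightarrow> vanishes q f z \<Longrightarrow> vanishes q (\<lambda>x. c * f x) z"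
  using vanishes_linear_comp[OF bounded_linear_mult_right] .

lemma vanishes_uminus:
  "smooth_on f B \<Longrightarrow> vanishes q f z \<Longrightarrow> vanishes q (\<lambda>x. - f x) z"
  using vanishes_linear_comp[OF bounded_linear_minus[OF bounded_linear_ident]] .

lemma vanishes_diff:
  fixes f g :: "'a \<Rightarrow> 'b::real_normed_vector"
  assumes "smooth_on f B" "smooth_on g B" "vanishes q f z" "vanishes q g z"
  shows "vanishes q (\<lambda>x. f x - g x) z"
  using vanishes_add[OF assms(1) smooth_on_uminus[OF B(1) assms(2)] assms(3) vanishes_uminus[OF assms(2,4)]]
  by simp

lemma frechet_derivative_mult:
  fixes f g :: "'a \<Rightarrow> 'b::real_normed_algebra"
  assumes "smooth_on f B" "smooth_on g B" "x \<in> B"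
  shows "frechet_derivative (\<lambda>x. f x * g x) (at x) v
    = f x * frechet_derivative g (at x) v + frechet_derivative f (at x) v * g x"
  by (rule frechet_derivative_eqI)
    (rule has_derivative_mult[OF smooth_on_has_derivative[OF assms(1,3)] smooth_on_has_derivative[OF assms(2,3)]])

lemma vanishes_mult:
  fixes f g :: "'a \<Rightarrow> 'b::real_normed_algebra"
  assumes "smooth_on f B" "smooth_on g B" "vanishes p f z" "vanishes q g z"
  shows "vanishes (p + q) (\<lambda>x. f x * g x) z"
  using assms
proof (induction "p + q" arbitrary: p q f g)
  case (Suc n)
  have "vanishes n (dir (\<lambda>x. f x * g x) v) z" for v
  proof (rule vanishes_cong[OF B])
    have df: "smooth_on (dir f v) B" and dg: "smooth_on (dir g v) B"
      using Suc.prems smooth_on_derivative by blast+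
    \<comment> \<open>The derivative falls on \<open>g\<close> and costs one order of
      \<open>g\<close>; if \<open>q = 0\<close> there is none to lose, and one order of
      \<open>f\<close> is given up instead.\<close>
    have 1: "vanishes n (\<lambda>x. f x * dir g v x) z"
    proof (cases q)
      case 0
      then obtain p' where "p = Suc p'" "n = p' + 0" using Suc.hyps by (cases p) auto
      then show ?thesis
        using Suc.hyps(1)[of p' 0 f "dir g v"] Suc.prems dg vanishes_SucD by auto
    next
      case (Suc q')
      then have "n = p + q'" using Suc.hyps by simp
      then show ?thesis
        using Suc.hyps(1)[of p q' f "dir g v"] Suc.prems dg \<open>q = Suc q'\<close> by auto
    qed
    have 2: "vanishes n (\<lambda>x. dir f v x * g x) z"
    proof (cases p)
      case 0
      then obtain q' where "q = Suc q'" "n = 0 + q'" using Suc.hyps by (cases q) auto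
      then show ?thesis
        using Suc.hyps(1)[of 0 q' "dir f v" g] Suc.prems df vanishes_SucD by auto
    next
      case (Suc p')
      then have "n = p' + q" using Suc.hyps by simp
      then show ?thesis
        using Suc.hyps(1)[of p' q "dir f v" g] Suc.prems df \<open>p = Suc p'\<close> by auto
    qed
    show "vanishes n (\<lambda>x. f x * dir g v x + dir f v x * g x) z"
      by (rule vanishes_add[OF _ _ 1 2]) (intro smooth_on_mult B(1) Suc.prems df dg)+
    show "f x * dir g v x + dir f v x * g x = dir (\<lambda>x. f x * g x) v x" if "x \<in> B" for x
      using frechet_derivative_mult[OF Suc.prems(1,2) that] by simp
  qed
  moreover have "f z * g z = 0"
    using Suc.hyps(2) Suc.prems by (cases p; cases q) auto
  ultimately show ?case unfolding Suc.hyps(2)[symmetric] by simp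
qed auto

lemma vanishes_power:
  fixes f :: "'a \<Rightarrow> 'b::real_normed_algebra_1"
  assumes "smooth_on f B" "vanishes 1 f z"
  shows "vanishes n (\<lambda>x. f x ^ n) z"
proof (induction n)
  case (Suc n)
  have "vanishes (1 + n) (\<lambda>x. f x * f x ^ n) z"
    by (rule vanishes_mult[OF assms(1) smooth_on_power[OF B(1) assms(1)] assms(2) Suc])
  then show ?case by simp
qed auto

text \<open>Replacing a function by its linear part inside an \<open>n\<close>-th power costs only
  order \<open>n + 1\<close>. This later exchanges the curve parameter for a linear function of the
  base coordinate.\<close>

lemma vanishes_power_diff:
  fixes f g :: "'a \<Rightarrow> real"
  assumes s: "smooth_on f B" "smooth_on g B" and v: "vanishes 1 f z" "vanishes 1 g z"
    and d: "vanishes 2 (\<lambda>x. f x - g x) z"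
  shows "vanishes (Suc n) (\<lambda>x. f x ^ n - g x ^ n) z"
proof (induction n)
  case 0
  have "vanishes q (\<lambda>x. 0::real) z" for q
    by (induction q) (auto simp: frechet_derivative_const)
  then show ?case by simp
next
  case (Suc n)
  have 1: "vanishes (Suc (Suc n)) (\<lambda>x. f x * (f x ^ n - g x ^ n)) z"
    using vanishes_mult[OF s(1) smooth_on_diff[OF B(1) smooth_on_power[OF B(1) s(1)] smooth_on_power[OF B(1) s(2)]] v(1) Suc]
    by simp
  have 2: "vanishes (2 + n) (\<lambda>x. (f x - g x) * g x ^ n) z"
    by (rule vanishes_mult[OF smooth_on_diff[OF B(1) s] smooth_on_power[OF B(1) s(2)] d vanishes_power[OF s(2) v(2)]])
  have "vanishes (Suc (Suc n)) (\<lambda>x. f x * (f x ^ n - g x ^ n) + (f x - g x) * g x ^ n) z"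
    using 2 by (intro vanishes_add 1)
      (auto intro!: smooth_on_mult smooth_on_diff smooth_on_power s B(1))
  then show ?case by (simp add: algebra_simps)
qed

lemma vanishes_SucI:
  fixes f :: "'a \<Rightarrow> 'b::real_normed_vector"
  assumes "f z = 0" "\<And>x. x \<in> B \<Longrightarrow> (f has_derivative f' x) (at x)"
    and "\<And>v. vanishes q (\<lambda>x. f' x v) z"
  shows "vanishes (Suc q) f z"
proof -
  have "vanishes q (dir f v) z" for v
    by (rule vanishes_cong[OF B _ assms(3)]) (simp add: frechet_derivative_eqI[OF assms(2)])
  then show ?thesis using assms(1) by simp
qed

end

text \<open>The partial derivatives are bounded with one power less, and the mean value inequality
  on the ball through \<open>x\<close> restores it.\<close>

lemma vanishes_bound:
  fixes f :: "complex \<Rightarrow> real"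
  assumes B: "open B" "z \<in> B" and "smooth_on f B" "vanishes q f z"
  shows "\<exists>C \<delta>. C \<ge> 0 \<and> \<delta> > 0 \<and> (\<forall>x\<in>ball z \<delta>. \<bar>f x\<bar> \<le> C * norm (x - z) ^ q)"
  using assms(3,4)
proof (induction q arbitrary: f)
  case 0
  have "isCont f z" using smooth_on_continuous_on[OF 0(1)] B by (simp add: continuous_on_eq_continuous_at)
  then obtain \<delta> where \<delta>: "\<delta> > 0" "\<And>x. dist x z < \<delta> \<Longrightarrow> dist (f x) (f z) < 1"
    unfolding continuous_at_eps_delta by (metis zero_less_one)
  show ?case
    by (intro exI[of _ "\<bar>f z\<bar> + 1"] exI[of _ \<delta>]) (use \<delta> in \<open>force simp: dist_commute dist_real_def\<close>)
next
  case (Suc q)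
  have IH: "\<exists>C \<delta>. C \<ge> 0 \<and> \<delta> > 0 \<and> (\<forall>x\<in>ball z \<delta>. \<bar>dir f v x\<bar> \<le> C * norm (x - z) ^ q)" for v
    by (rule Suc.IH) (use Suc.prems smooth_on_derivative in auto)
  obtain C1 \<delta>1 where 1: "C1 \<ge> 0" "\<delta>1 > 0" "\<And>x. x \<in> ball z \<delta>1 \<Longrightarrow> \<bar>dir f 1 x\<bar> \<le> C1 * norm (x - z) ^ q"
    using IH[of 1] by blast
  obtain C2 \<delta>2 where 2: "C2 \<ge> 0" "\<delta>2 > 0" "\<And>x. x \<in> ball z \<delta>2 \<Longrightarrow> \<bar>dir f \<i> x\<bar> \<le> C2 * norm (x - z) ^ q"
    using IH[of \<i>] by blast
  obtain \<delta>3 where 3: "\<delta>3 > 0" "ball z \<delta>3 \<subseteq> B" using B open_contains_ball by blast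
  define \<delta> where "\<delta> = min \<delta>1 (min \<delta>2 \<delta>3)"
  show ?case
  proof (rule exI[of _ "C1 + C2"], rule exI[of _ \<delta>], intro conjI ballI)
    show "C1 + C2 \<ge> 0" "\<delta> > 0" using 1 2 3 by (auto simp: \<delta>_def)
    fix x assume x: "x \<in> ball z \<delta>"
    have "norm (f x - f z) \<le> ((C1 + C2) * norm (x - z) ^ q) * norm (x - z)"
    proof (rule differentiable_bound[where S = "cball z (norm (x - z))" and f' = "\<lambda>y. frechet_derivative f (at y)"])
      show "convex (cball z (norm (x - z)))" by simp
      fix y assume y: "y \<in> cball z (norm (x - z))"
      then have yd: "y \<in> ball z \<delta>" using x by (simp add: dist_norm norm_minus_commute)
      then have D: "(f has_derivative frechet_derivative f (at y)) (at y)"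
        using smooth_on_has_derivative[OF Suc.prems(1)] 3 by (auto simp: \<delta>_def subset_iff)
      then show "(f has_derivative frechet_derivative f (at y)) (at y within cball z (norm (x - z)))"
        by (rule has_derivative_at_withinI)
      show "onorm (frechet_derivative f (at y)) \<le> (C1 + C2) * norm (x - z) ^ q"
      proof (rule onorm_le)
        fix h :: complex
        have lin: "linear (frechet_derivative f (at y))" using D has_derivative_linear by blast
        have "h = Re h *\<^sub>R 1 + Im h *\<^sub>R \<i>" by (simp add: complex_eq_iff)
        then have "frechet_derivative f (at y) h = Re h * dir f 1 y + Im h * dir f \<i> y"
          using linear_add[OF lin] linear_cmul[OF lin] by (metis real_scaleR_def)
        then have "norm (frechet_derivative f (at y) h) \<le> \<bar>Re h\<bar> * \<bar>dir f 1 y\<bar> + \<bar>Im h\<bar> * \<bar>dir f \<i> y\<bar>"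
          by (simp add: abs_mult order_trans[OF abs_triangle_ineq])
        also have "\<dots> \<le> norm h * (C1 * norm (y - z) ^ q) + norm h * (C2 * norm (y - z) ^ q)"
          by (intro add_mono mult_mono abs_Re_le_cmod abs_Im_le_cmod 1(3) 2(3))
            (use yd 1(1) 2(1) in \<open>auto simp: \<delta>_def\<close>)
        also have "\<dots> = (C1 + C2) * norm (y - z) ^ q * norm h" by (simp add: algebra_simps)
        also have "\<dots> \<le> (C1 + C2) * norm (x - z) ^ q * norm h"
          by (intro mult_right_mono mult_left_mono power_mono)
            (use y 1(1) 2(1) in \<open>auto simp: dist_norm norm_minus_commute\<close>)
        finally show "norm (frechet_derivative f (at y) h) \<le> (C1 + C2) * norm (x - z) ^ q * norm h" .
      qed
    qed (auto simp: dist_norm norm_minus_commute)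
    then show "\<bar>f x\<bar> \<le> (C1 + C2) * norm (x - z) ^ Suc q" using Suc.prems(2) by (simp add: mult_ac)
  qed
qed

section \<open>Cauchy-Riemann and Laplace equations up to finite order\<close>

lemma complex_derivative_expansion:
  fixes f :: "complex \<Rightarrow> 'b::real_normed_vector"
  assumes "(f has_derivative f') (at x)"
  shows "f' h = Re h *\<^sub>R f' 1 + Im h *\<^sub>R f' \<i>"
proof -
  have lin: "linear f'" using assms has_derivative_linear by blast
  have "h = Re h *\<^sub>R 1 + Im h *\<^sub>R \<i>" by (simp add: complex_eq_iff)
  then show ?thesis using linear_add[OF lin] linear_cmul[OF lin] by metis
qed

text \<open>The induction step applies the hypothesis to the \<open>x\<close>-derivative of \<open>E\<close> and integrates.\<close>

lemma dbar_vanishes: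
  fixes E :: "complex \<Rightarrow> complex"
  assumes B: "open B" "z \<in> B" and "smooth_on E B"
    and "vanishes q (\<lambda>x. dir E 1 x + \<i> * dir E \<i> x) z"
  shows "\<exists>P. P holomorphic_on UNIV \<and> vanishes (Suc q) (\<lambda>x. E x - P x) z"
  using assms(3,4)
proof (induction q arbitrary: E)
  case 0
  then show ?case by (intro exI[of _ "\<lambda>x. E z"]) auto
next
  case (Suc q)
  let ?Ex = "dir E 1"
  have sE: "smooth_on (dir E v) B" for v using Suc.prems(1) smooth_on_derivative by blast
  \<comment> \<open>Twice the antiholomorphic derivative of \<open>E\<close>, which measures the
    failure of \<open>E\<close> to be holomorphic.\<close>
  define G where "G = (\<lambda>x. dir E 1 x + \<i> * dir E \<i> x)"
  have sG: "smooth_on G B" unfolding G_def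
    by (intro smooth_on_add smooth_on_linear_comp[OF _ bounded_linear_mult_right] sE B)
  have "vanishes q (dir G 1) z" using Suc.prems(2) by (simp add: G_def)
  then have "vanishes q (\<lambda>x. dir ?Ex 1 x + \<i> * dir ?Ex \<i> x) z"
  proof (rule vanishes_cong[OF B, rotated])
    fix x assume x: "x \<in> B"
    have "dir G 1 x = dir (dir E 1) 1 x + \<i> * dir (dir E \<i>) 1 x"
      unfolding G_def
      by (rule frechet_derivative_eqI)
        (intro has_derivative_add has_derivative_mult_right smooth_on_has_derivative[OF sE x])
    also have "dir (dir E \<i>) 1 x = dir (dir E 1) \<i> x"
      by (rule second_derivative_symmetric[OF B(1) x Suc.prems(1)])
    finally show "dir G 1 x = dir ?Ex 1 x + \<i> * dir ?Ex \<i> x" .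
  qed
  then obtain P1 where P1: "P1 holomorphic_on UNIV" "vanishes (Suc q) (\<lambda>x. ?Ex x - P1 x) z"
    using Suc.IH[OF sE] by blast
  obtain P0 where P0: "\<And>x. (P0 has_field_derivative P1 x) (at x)"
    using holomorphic_convex_primitive'[OF convex_UNIV open_UNIV P1(1)] by auto
  define P where "P x = P0 x - P0 z + E z" for x
  have DP: "(P has_field_derivative P1 x) (at x)" for x
    unfolding P_def using P0[of x] by (auto intro!: derivative_eq_intros)
  have sP1: "smooth_on P1 B" using holomorphic_on_imp_smooth_on[OF open_UNIV P1(1)] smooth_on_subset by blast
  define H where "H = (\<lambda>x. ?Ex x - P1 x)"
  have sH: "smooth_on H B" unfolding H_def by (intro smooth_on_diff sE sP1 B)
  have vH: "vanishes (Suc q) H z" using P1(2) by (simp add: H_def)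
  have vG: "vanishes (Suc q) G z" using Suc.prems(2) by (simp add: G_def)
  have "vanishes (Suc (Suc q)) (\<lambda>x. E x - P x) z"
  proof (rule vanishes_SucI[OF B])
    show "E z - P z = 0" by (simp add: P_def)
    \<comment> \<open>\<open>P\<close> integrates only the \<open>x\<close>-derivative; the
      derivative in direction \<open>\<i>\<close> is recovered from the definition of
      \<open>G\<close> as \<open>\<i> * dir E 1 x - \<i> * G x\<close>.\<close>
    show "((\<lambda>x. E x - P x) has_derivative (\<lambda>v. of_real (Re v) * H x + of_real (Im v) * (\<i> * H x - \<i> * G x))) (at x)"
      if x: "x \<in> B" for x
    proof -
      have DE: "(E has_derivative frechet_derivative E (at x)) (at x)"
        by (rule smooth_on_has_derivative[OF Suc.prems(1) x])
      have "((\<lambda>x. E x - P x) has_derivative (\<lambda>v. frechet_derivative E (at x) v - P1 x * v)) (at x)"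
        using DE DP[of x] by (intro has_derivative_diff) (auto simp: has_field_derivative_def)
      moreover have "frechet_derivative E (at x) v - P1 x * v
          = of_real (Re v) * H x + of_real (Im v) * (\<i> * H x - \<i> * G x)" for v
      proof -
        have "P1 x * v = P1 x * (of_real (Re v) + \<i> * of_real (Im v))" by (metis complex_eq)
        then show ?thesis
          using complex_derivative_expansion[OF DE, of v]
          by (simp add: H_def G_def scaleR_conv_of_real algebra_simps)
      qed
      ultimately show ?thesis by simp
    qed
    show "vanishes (Suc q) (\<lambda>x. of_real (Re v) * H x + of_real (Im v) * (\<i> * H x - \<i> * G x)) z" for v
    proof (rule vanishes_add[OF B])
      have s: "smooth_on (\<lambda>x. c * H x) B" "smooth_on (\<lambda>x. c * G x) B" for c :: complex
        by (intro smooth_on_linear_comp[OF B(1) bounded_linear_mult_right] sH sG)+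
      show "smooth_on (\<lambda>x. of_real (Re v) * H x) B" by (rule s)
      have sd: "smooth_on (\<lambda>x. \<i> * H x - \<i> * G x) B" by (intro smooth_on_diff s B)
      then show "smooth_on (\<lambda>x. of_real (Im v) * (\<i> * H x - \<i> * G x)) B"
        by (rule smooth_on_linear_comp[OF B(1) bounded_linear_mult_right])
      show "vanishes (Suc q) (\<lambda>x. of_real (Re v) * H x) z" by (rule vanishes_cmult[OF B sH vH])
      show "vanishes (Suc q) (\<lambda>x. of_real (Im v) * (\<i> * H x - \<i> * G x)) z"
        by (rule vanishes_cmult[OF B sd])
          (rule vanishes_diff[OF B s(1) s(2) vanishes_cmult[OF B sH vH] vanishes_cmult[OF B sG vG]])
    qed
  qed
  moreover have "P holomorphic_on UNIV" using DP by (metis holomorphic_on_open open_UNIV)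
  ultimately show ?case by blast
qed

definition laplacian :: "(complex \<Rightarrow> real) \<Rightarrow> complex \<Rightarrow> real" where
  "laplacian F x = dir (dir F 1) 1 x + dir (dir F \<i>) \<i> x"

lemma smooth_on_laplacian: "open B \<Longrightarrow> smooth_on F B \<Longrightarrow> smooth_on (laplacian F) B"
  unfolding laplacian_def[abs_def] by (intro smooth_on_add smooth_on_derivative)

text \<open>The function \<open>E\<close> below is twice the holomorphic derivative of
  \<open>F\<close>, and its Cauchy-Riemann defect is the Laplacian. So \<open>E\<close> is
  holomorphic up to small order, and the real part of a primitive of its holomorphic approximation
  approximates \<open>F\<close>.\<close>

lemma laplacian_vanishes:
  fixes F :: "complex \<Rightarrow> real"
  assumes B: "open B" "z \<in> B" and F: "smooth_on F B" and v: "vanishes q (laplacian F) z"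
  shows "\<exists>Q. Q holomorphic_on UNIV \<and> vanishes (Suc (Suc q)) (\<lambda>x. F x - Re (Q x)) z"
proof -
  have sF: "smooth_on (dir F v) B" for v using F smooth_on_derivative by blast
  define E where "E x = of_real (dir F 1 x) + (- \<i>) * of_real (dir F \<i> x)" for x
  have sE: "smooth_on E B" unfolding E_def
    by (intro smooth_on_add smooth_on_linear_comp[OF _ bounded_linear_mult_right]
        smooth_on_linear_comp[OF _ bounded_linear_of_real] sF B)
  have dE: "dir E v x = of_real (dir (dir F 1) v x) + (- \<i>) * of_real (dir (dir F \<i>) v x)" if "x \<in> B" for x v
    unfolding E_def
    by (rule frechet_derivative_eqI)
      (intro has_derivative_add has_derivative_mult_right bounded_linear.has_derivative[OF bounded_linear_of_real]
        smooth_on_has_derivative[OF sF that])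
  have "vanishes q (\<lambda>x. complex_of_real (laplacian F x)) z"
    by (rule vanishes_linear_comp[OF B bounded_linear_of_real smooth_on_laplacian[OF B(1) F] v])
  then have "vanishes q (\<lambda>x. dir E 1 x + \<i> * dir E \<i> x) z"
  proof (rule vanishes_cong[OF B, rotated])
    fix x assume x: "x \<in> B"
    have "dir (dir F \<i>) 1 x = dir (dir F 1) \<i> x"
      by (rule second_derivative_symmetric[OF B(1) x F])
    then show "complex_of_real (laplacian F x) = dir E 1 x + \<i> * dir E \<i> x"
      unfolding dE[OF x] laplacian_def by (simp add: algebra_simps)
  qed
  then obtain P where P: "P holomorphic_on UNIV" "vanishes (Suc q) (\<lambda>x. E x - P x) z"
    using dbar_vanishes[OF B sE] by blast
  obtain Q0 where Q0: "\<And>x. (Q0 has_field_derivative P x) (at x)"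
    using holomorphic_convex_primitive'[OF convex_UNIV open_UNIV P(1)] by auto
  define Q where "Q x = Q0 x - Q0 z + of_real (F z)" for x
  have DQ: "(Q has_field_derivative P x) (at x)" for x
    unfolding Q_def using Q0[of x] by (auto intro!: derivative_eq_intros)
  have sP: "smooth_on P B" using holomorphic_on_imp_smooth_on[OF open_UNIV P(1)] smooth_on_subset by blast
  have "vanishes (Suc (Suc q)) (\<lambda>x. F x - Re (Q x)) z"
  proof (rule vanishes_SucI[OF B])
    show "F z - Re (Q z) = 0" by (simp add: Q_def)
    show "((\<lambda>x. F x - Re (Q x)) has_derivative (\<lambda>v. Re (v * (E x - P x)))) (at x)" if x: "x \<in> B" for x
    proof -
      have DF: "(F has_derivative frechet_derivative F (at x)) (at x)"
        by (rule smooth_on_has_derivative[OF F x])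
      have "(Q has_derivative (\<lambda>v. P x * v)) (at x)" using DQ[of x] by (simp add: has_field_derivative_def)
      then have "((\<lambda>x. F x - Re (Q x)) has_derivative (\<lambda>v. frechet_derivative F (at x) v - Re (P x * v))) (at x)"
        by (intro has_derivative_diff DF bounded_linear.has_derivative[OF bounded_linear_Re])
      moreover have "frechet_derivative F (at x) v - Re (P x * v) = Re (v * (E x - P x))" for v
        using complex_derivative_expansion[OF DF, of v] by (simp add: E_def algebra_simps)
      ultimately show ?thesis by simp
    qed
    have sd: "smooth_on (\<lambda>x. E x - P x) B" by (rule smooth_on_diff[OF B(1) sE sP])
    show "vanishes (Suc q) (\<lambda>x. Re (v * (E x - P x))) z" for v
      by (rule vanishes_linear_comp[OF B bounded_linear_Re
            smooth_on_linear_comp[OF B(1) bounded_linear_mult_right sd] vanishes_cmult[OF B sd P(2)]])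
  qed
  moreover have "Q holomorphic_on UNIV" using DQ by (metis holomorphic_on_open open_UNIV)
  ultimately show ?thesis by blast
qed


section \<open>Osculating bases and the normal form\<close>

lemma zero_derivative_imp_constant_on_ball:
  fixes f :: "'a::euclidean_space \<Rightarrow> real"
  assumes "\<And>x. x \<in> ball z \<rho> \<Longrightarrow> (f has_derivative (\<lambda>h. 0)) (at x)" "x \<in> ball z \<rho>"
  shows "f x = f z"
proof -
  have "f constant_on ball z \<rho>"
  proof (rule has_derivative_zero_connected_constant_on[where K = "{}"])
    show "continuous_on (ball z \<rho>) f"
      using assms(1) has_derivative_continuous continuous_at_imp_continuous_on by blast
    show "\<forall>x\<in>ball z \<rho> - {}. (f has_derivative (\<lambda>h. 0)) (at x within ball z \<rho>)"
      using assms(1) has_derivative_at_withinI by blast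
  qed simp_all
  moreover have "z \<in> ball z \<rho>" using assms(2) by (metis centre_in_ball ball_eq_empty empty_iff not_le_imp_less)
  ultimately show ?thesis using assms(2) unfolding constant_on_def by metis
qed

lemma frechet_derivative_divide_real:
  fixes f g :: "'a::real_normed_vector \<Rightarrow> real"
  assumes "smooth_on f B" "smooth_on g B" "x \<in> B" "g x \<noteq> 0"
  shows "frechet_derivative (\<lambda>x. f x / g x) (at x) v
    = (frechet_derivative f (at x) v * g x - f x * frechet_derivative g (at x) v) / (g x * g x)"
  by (rule frechet_derivative_eqI)
    (rule has_derivative_divide'[OF smooth_on_has_derivative[OF assms(1,3)] smooth_on_has_derivative[OF assms(2,3)] assms(4)])

text \<open>The \<open>g k\<close> are locally functions of \<open>s\<close>. As for Wronskians, the induction step divides by \<open>g 0\<close> and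
  differentiates with respect to \<open>s\<close>.\<close>

lemma osculating_basis:
  fixes s :: "complex \<Rightarrow> real" and g :: "nat \<Rightarrow> complex \<Rightarrow> real"
  assumes "open B" "B \<noteq> {}" "smooth_on s B" "\<And>x. x \<in> B \<Longrightarrow> dir s a x \<noteq> 0"
    and "\<And>k. k < N \<Longrightarrow> smooth_on (g k) B"
    and "\<And>k x. k < N \<Longrightarrow> x \<in> B \<Longrightarrow> \<exists>c. \<forall>v. dir (g k) v x = c * dir s v x"
    and "\<And>\<Omega> l. open \<Omega> \<Longrightarrow> \<Omega> \<noteq> {} \<Longrightarrow> \<Omega> \<subseteq> B \<Longrightarrow> (\<And>x. x \<in> \<Omega> \<Longrightarrow> (\<Sum>k<N. l k * g k x) = 0) \<Longrightarrow> \<forall>k<N. l k = 0"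
  shows "\<exists>z\<in>B. \<exists>l :: nat \<Rightarrow> nat \<Rightarrow> real.
    (\<forall>j<N. vanishes (Suc j) (\<lambda>x. (\<Sum>k<N. l j k * g k x) - (s x - s z) ^ j) z) \<and>
    (\<forall>c. (\<forall>k<N. (\<Sum>j<N. c j * l j k) = 0) \<longrightarrow> (\<forall>j<N. c j = 0))"
  using assms
proof (induction N arbitrary: B g)
  case 0
  then show ?case by auto
next
  case (Suc N)
  note B = Suc.prems(1) and s = Suc.prems(3) and ds = Suc.prems(4) and g = Suc.prems(5)
    and par = Suc.prems(6) and indep = Suc.prems(7)
  define B1 where "B1 = B \<inter> g 0 -` (- {0})"
  have B1: "open B1" unfolding B1_def
    by (rule continuous_open_preimage[OF smooth_on_continuous_on[OF g] B]) auto
  have B1B: "B1 \<subseteq> B" by (auto simp: B1_def)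
  have g0: "g 0 x \<noteq> 0" if "x \<in> B1" for x using that by (auto simp: B1_def)
  have "B1 \<noteq> {}"
  proof
    assume "B1 = {}"
    then have "(\<Sum>k<Suc N. (if k = 0 then 1 else 0) * g k x) = 0" if "x \<in> B" for x
      using that by (auto simp: B1_def if_distrib[of "\<lambda>t. t * _"] cong: if_cong)
    then have "\<forall>k<Suc N. (if k = 0 then 1 else 0::real) = 0"
      by (intro indep[OF B Suc.prems(2) order_refl])
    then show False by auto
  qed
  have s1: "smooth_on s B1" and g1: "\<And>k. k < Suc N \<Longrightarrow> smooth_on (g k) B1"
    using smooth_on_subset[OF s B1B] smooth_on_subset[OF g B1B] by auto
  define r where "r k x = g (Suc k) x / g 0 x" for k x
  have r: "smooth_on (r k) B1" if "k < N" for k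
    unfolding r_def by (rule smooth_on_divide[OF B1]) (use g1 g0 that in auto)
  have dsB1: "dir s a x \<noteq> 0" if "x \<in> B1" for x using ds that B1B by blast
  \<comment> \<open>The derivative of \<open>r k\<close> with respect to the parameter
    \<open>s\<close>; the direction \<open>a\<close> serves only to express the quotient.\<close>
  define h where "h k x = dir (r k) a x / dir s a x" for k x
  have h: "smooth_on (h k) B1" if "k < N" for k
    unfolding h_def
    by (rule smooth_on_divide[OF B1 dsB1 smooth_on_derivative[OF r[OF that]] smooth_on_derivative[OF s1]])
  have dr: "dir (r k) v x = h k x * dir s v x" if k: "k < N" and x: "x \<in> B1" for k v x
  proof -
    obtain c where c: "\<And>v. dir (g (Suc k)) v x = c * dir s v x" using par[of "Suc k" x] k x B1B by auto
    obtain d where d: "\<And>v. dir (g 0) v x = d * dir s v x" using par[of 0 x] x B1B by auto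
    have "dir (r k) v x = ((c * g 0 x - g (Suc k) x * d) / (g 0 x * g 0 x)) * dir s v x" for v
      unfolding r_def using k c d
      by (subst frechet_derivative_divide_real[OF g1 g1 x g0[OF x]]) (auto simp: algebra_simps)
    then show ?thesis using dsB1[OF x] by (simp add: h_def)
  qed
  \<comment> \<open>Differentiating \<open>dr = h ds\<close> and using symmetry of second
    derivatives shows that \<open>dh\<close> is proportional to \<open>ds\<close>, so the hypothesis
    on \<open>g\<close> passes to \<open>h\<close>.\<close>
  have parh: "\<exists>c. \<forall>v. dir (h k) v x = c * dir s v x" if k: "k < N" and x: "x \<in> B1" for k x
  proof -
    have *: "dir (dir (r k) v) u x = h k x * dir (dir s v) u x + dir (h k) u x * dir s v x" for u v
    proof -
      have "dir (dir (r k) v) u x = dir (\<lambda>x. h k x * dir s v x) u x"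
        using frechet_derivative_cong_open[OF B1 x, of "dir (r k) v" "\<lambda>x. h k x * dir s v x"] dr[OF k] by simp
      then show ?thesis using frechet_derivative_mult[OF B1 x h[OF k] smooth_on_derivative[OF s1] x] by simp
    qed
    have "dir (h k) u x * dir s a x = dir (h k) a x * dir s u x" for u
      using *[of a u] *[of u a] second_derivative_symmetric[OF B1 x r[OF k], of a u]
        second_derivative_symmetric[OF B1 x s1, of a u] by simp
    then show ?thesis
      using dsB1[OF x] by (intro exI[of _ "dir (h k) a x / dir s a x"]) (auto simp: field_simps)
  qed
  \<comment> \<open>A linear relation among the \<open>h k\<close> integrates to one among the
    \<open>r k\<close> up to a constant, and that constant becomes the coefficient of
    \<open>g 0\<close> in a relation among the \<open>g k\<close>.\<close>
  have indeph: "\<forall>k<N. l k = 0"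
    if \<Omega>: "open \<Omega>" "\<Omega> \<noteq> {}" "\<Omega> \<subseteq> B1" "\<And>x. x \<in> \<Omega> \<Longrightarrow> (\<Sum>k<N. l k * h k x) = 0" for \<Omega> l
  proof -
    obtain y \<rho> where y: "\<rho> > 0" "ball y \<rho> \<subseteq> \<Omega>" using \<Omega>(1,2) open_contains_ball by blast
    have const: "(\<Sum>k<N. l k * r k x) = (\<Sum>k<N. l k * r k y)" if "x \<in> ball y \<rho>" for x
    proof (rule zero_derivative_imp_constant_on_ball[OF _ that])
      fix x assume "x \<in> ball y \<rho>"
      then have x: "x \<in> \<Omega>" "x \<in> B1" using y \<Omega> by auto
      have "((\<lambda>x. \<Sum>k<N. l k * r k x) has_derivative (\<lambda>v. \<Sum>k<N. l k * dir (r k) v x)) (at x)"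
        by (intro has_derivative_sum has_derivative_mult_right smooth_on_has_derivative[OF r x(2)]) auto
      moreover have "(\<Sum>k<N. l k * dir (r k) v x) = 0" for v
      proof -
        have "(\<Sum>k<N. l k * dir (r k) v x) = (\<Sum>k<N. l k * h k x) * dir s v x"
          by (simp add: dr[OF _ x(2)] sum_distrib_right mult.assoc)
        then show ?thesis using \<Omega>(4)[OF x(1)] by simp
      qed
      ultimately show "((\<lambda>x. \<Sum>k<N. l k * r k x) has_derivative (\<lambda>h. 0)) (at x)" by simp
    qed
    define l' where "l' k = (case k of 0 \<Rightarrow> - (\<Sum>k<N. l k * r k y) | Suc k \<Rightarrow> l k)" for k
    have "(\<Sum>k<Suc N. l' k * g k x) = 0" if "x \<in> ball y \<rho>" for x
    proof -
      have "g 0 x \<noteq> 0" using that y \<Omega> g0 by blast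
      then have "(\<Sum>k<N. l k * g (Suc k) x) = (\<Sum>k<N. l k * r k x) * g 0 x"
        by (simp add: r_def sum_distrib_right)
      then show ?thesis
        unfolding sum.lessThan_Suc_shift by (simp add: l'_def const[OF that])
    qed
    then have "\<forall>k<Suc N. l' k = 0"
      by (intro indep[of "ball y \<rho>"]) (use y \<Omega> B1B in auto)
    then show ?thesis by (auto simp: l'_def split: nat.splits)
  qed
  obtain z l where z: "z \<in> B1"
    and l: "\<And>j. j < N \<Longrightarrow> vanishes (Suc j) (\<lambda>x. (\<Sum>k<N. l j k * h k x) - (s x - s z) ^ j) z"
    and linv: "\<And>c. \<forall>k<N. (\<Sum>j<N. c j * l j k) = 0 \<Longrightarrow> \<forall>j<N. c j = 0"
  proof -
    have "\<exists>z\<in>B1. \<exists>l :: nat \<Rightarrow> nat \<Rightarrow> real.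
      (\<forall>j<N. vanishes (Suc j) (\<lambda>x. (\<Sum>k<N. l j k * h k x) - (s x - s z) ^ j) z) \<and>
      (\<forall>c. (\<forall>k<N. (\<Sum>j<N. c j * l j k) = 0) \<longrightarrow> (\<forall>j<N. c j = 0))"
      by (rule Suc.IH) (fact B1 \<open>B1 \<noteq> {}\<close> s1 dsB1 h parh indeph)+
    then show ?thesis using that by blast
  qed
  \<comment> \<open>Integrating the power \<open>j\<close> of \<open>s x - s z\<close> produces the
    factor \<open>1 / (j + 1)\<close>, and multiplying back by \<open>g 0\<close> the value
    \<open>g 0 z\<close>; \<open>\<kappa> j\<close> compensates both. The coefficient of
    \<open>g 0\<close> in \<open>l'\<close> is the integration constant.\<close>
  define \<kappa> where "\<kappa> j = (real j + 1) / g 0 z" for j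
  define l' where "l' j k = (case j of 0 \<Rightarrow> (case k of 0 \<Rightarrow> 1 / g 0 z | Suc k \<Rightarrow> 0)
      | Suc j \<Rightarrow> (case k of 0 \<Rightarrow> - \<kappa> j * (\<Sum>k<N. l j k * r k z) | Suc k \<Rightarrow> \<kappa> j * l j k))" for j k
  have \<kappa>0: "\<kappa> j \<noteq> 0" for j using g0[OF z] by (simp add: \<kappa>_def add_nonneg_eq_0_iff)
  let ?\<sigma> = "\<lambda>x. s x - s z"
  have s\<sigma>: "smooth_on ?\<sigma> B1" by (intro smooth_on_diff smooth_on_const s1 B1)
  have v\<sigma>: "vanishes 1 ?\<sigma> z" by simp
  have "vanishes (Suc j) (\<lambda>x. (\<Sum>k<Suc N. l' j k * g k x) - (s x - s z) ^ j) z" if j: "j < Suc N" for j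
  proof (cases j)
    case 0
    then show ?thesis using g0[OF z] unfolding sum.lessThan_Suc_shift by (simp add: l'_def)
  next
    case j': (Suc i)
    then have i: "i < N" using j by simp
    \<comment> \<open>The antiderivative of \<open>H\<close> with respect to \<open>s\<close> that
      is 0 at \<open>z\<close>; integration gains one order of vanishing.\<close>
    define R where "R x = (\<Sum>k<N. l i k * r k x) - (\<Sum>k<N. l i k * r k z) - ?\<sigma> x ^ Suc i / (real i + 1)" for x
    define H where "H x = (\<Sum>k<N. l i k * h k x) - ?\<sigma> x ^ i" for x
    have sH: "smooth_on H B1"
      unfolding H_def by (intro smooth_on_diff smooth_on_sum smooth_on_linear_comp[OF _ bounded_linear_mult_right]
          smooth_on_power s\<sigma> B1 h) auto
    have sR: "smooth_on R B1"
      unfolding R_def divide_inverse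
      by (intro smooth_on_diff smooth_on_sum smooth_on_linear_comp[OF _ bounded_linear_mult_right]
          smooth_on_linear_comp[OF _ bounded_linear_mult_left] smooth_on_const
          smooth_on_power s\<sigma> B1 r) auto
    have vH: "vanishes (Suc i) H z" using l[OF i] by (simp only: H_def[abs_def])
    have vR: "vanishes (Suc (Suc i)) R z"
    proof (rule vanishes_SucI[OF B1 z])
      show "R z = 0" by (simp add: R_def)
      show "(R has_derivative (\<lambda>v. H x * dir s v x)) (at x)" if x: "x \<in> B1" for x
      proof -
        have Ds: "(?\<sigma> has_derivative (\<lambda>v. dir s v x)) (at x)"
          using has_derivative_diff[OF smooth_on_has_derivative[OF s1 x] has_derivative_const[of "s z"]] by simp
        have "(R has_derivative (\<lambda>v. (\<Sum>k<N. l i k * dir (r k) v x) - 0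
             - (real (Suc i) * ?\<sigma> x ^ i * dir s v x) / (real i + 1))) (at x)"
          unfolding R_def
          by (intro has_derivative_diff has_derivative_sum has_derivative_mult_right has_derivative_const
              smooth_on_has_derivative[OF r x] bounded_linear.has_derivative[OF bounded_linear_divide]
              has_derivative_eq_rhs[OF has_derivative_power[OF Ds, of "Suc i"]])
            (auto simp: algebra_simps)
        moreover have "(\<Sum>k<N. l i k * dir (r k) v x) - 0
             - (real (Suc i) * ?\<sigma> x ^ i * dir s v x) / (real i + 1) = H x * dir s v x" for v
        proof -
          have "(\<Sum>k<N. l i k * dir (r k) v x) = (\<Sum>k<N. l i k * h k x) * dir s v x"
            by (simp add: dr[OF _ x] sum_distrib_right mult.assoc)
          moreover have "(real (Suc i) * ?\<sigma> x ^ i * dir s v x) / (real i + 1) = ?\<sigma> x ^ i * dir s v x"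
            by (simp add: field_simps)
          ultimately show ?thesis by (simp only: H_def left_diff_distrib diff_0_right)
        qed
        ultimately show ?thesis by simp
      qed
      show "vanishes (Suc i) (\<lambda>x. H x * dir s v x) z" for v
        using vanishes_mult[OF B1 z sH smooth_on_derivative[OF s1] vH, of 0 v] by simp
    qed
    have g0s: "smooth_on (g 0) B1" using g1 by simp
    \<comment> \<open>The factor \<open>g 0 x\<close> is not constant. The relative error
      \<open>G1\<close> vanishes at \<open>z\<close> and gives its product with the power of
      \<open>s x - s z\<close> the missing order.\<close>
    define G where "G x = \<kappa> i * g 0 x" for x
    define G1 where "G1 x = g 0 x / g 0 z - 1" for x
    have sG: "smooth_on G B1" unfolding G_def
      by (intro smooth_on_linear_comp[OF B1 bounded_linear_mult_right] g0s)
    have sG1: "smooth_on G1 B1" unfolding G1_def divide_inverse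
      by (intro smooth_on_diff smooth_on_linear_comp[OF B1 bounded_linear_mult_left] g0s smooth_on_const B1)
    have 1: "vanishes (Suc (Suc i)) (\<lambda>x. G x * R x) z"
      using vanishes_mult[OF B1 z sG sR, of 0 "Suc (Suc i)"] vR by simp
    have vG1: "vanishes 1 G1 z" using g0[OF z] by (simp add: G1_def)
    have 2: "vanishes (Suc (Suc i)) (\<lambda>x. G1 x * ?\<sigma> x ^ Suc i) z"
      using vanishes_mult[OF B1 z sG1 smooth_on_power[OF B1 s\<sigma>] vG1 vanishes_power[OF B1 z s\<sigma> v\<sigma>], of "Suc i"]
      by simp
    have "vanishes (Suc (Suc i)) (\<lambda>x. G x * R x + G1 x * ?\<sigma> x ^ Suc i) z"
      by (rule vanishes_add[OF B1 z _ _ 1 2]) (intro smooth_on_mult smooth_on_power sG sR sG1 s\<sigma> B1)+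
    then show ?thesis unfolding j'
    proof (rule vanishes_cong[OF B1 z, rotated])
      fix x assume x: "x \<in> B1"
      have "(\<Sum>k<Suc N. l' (Suc i) k * g k x) = \<kappa> i * (\<Sum>k<N. l i k * g (Suc k) x) - \<kappa> i * (\<Sum>k<N. l i k * r k z) * g 0 x"
        unfolding sum.lessThan_Suc_shift by (simp add: l'_def sum_distrib_left sum_negf mult.assoc)
      also have "(\<Sum>k<N. l i k * g (Suc k) x) = (\<Sum>k<N. l i k * r k x) * g 0 x"
        using g0[OF x] by (simp add: r_def sum_distrib_right)
      finally have eq: "(\<Sum>k<Suc N. l' (Suc i) k * g k x) = G x * ((\<Sum>k<N. l i k * r k x) - (\<Sum>k<N. l i k * r k z))"
        by (simp add: G_def algebra_simps)
      have "G x * (?\<sigma> x ^ Suc i / (real i + 1)) = g 0 x / g 0 z * ?\<sigma> x ^ Suc i"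
      proof -
        have "d / a * b * (P / d) = b / a * P" if "d \<noteq> 0" for a b d P :: real using that by simp
        moreover have "real i + 1 \<noteq> 0" by linarith
        ultimately show ?thesis unfolding G_def \<kappa>_def by blast
      qed
      then show "G x * R x + G1 x * ?\<sigma> x ^ Suc i = (\<Sum>k<Suc N. l' (Suc i) k * g k x) - (s x - s z) ^ Suc i"
        unfolding eq R_def G1_def right_diff_distrib left_diff_distrib by simp
    qed
  qed
  moreover have "\<forall>j<Suc N. c j = 0" if c: "\<forall>k<Suc N. (\<Sum>j<Suc N. c j * l' j k) = 0" for c
  proof -
    have "(\<Sum>j<N. (c (Suc j) * \<kappa> j) * l j k) = 0" if "k < N" for k
      using spec[OF c, of "Suc k"] that unfolding sum.lessThan_Suc_shift by (simp add: l'_def mult.assoc)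
    then have "\<forall>j<N. c (Suc j) * \<kappa> j = 0" using linv[of "\<lambda>j. c (Suc j) * \<kappa> j"] by simp
    then have cS: "\<forall>j<N. c (Suc j) = 0" using \<kappa>0 by simp
    have "c 0 * (1 / g 0 z) = 0"
      using spec[OF c, of 0] cS unfolding sum.lessThan_Suc_shift by (simp add: l'_def)
    then have "c 0 = 0" using g0[OF z] by simp
    then show ?thesis using cS by (metis less_Suc_eq_0_disj)
  qed
  ultimately show ?case using z B1B by (intro bexI[of _ z] exI[of _ l']) auto
qed


lemma smooth_on_Re_linear: "open B \<Longrightarrow> smooth_on (\<lambda>x. Re (c * (x - z))) B"
  by (intro smooth_on_linear_comp[OF _ bounded_linear_Re] smooth_on_linear_comp[OF _ bounded_linear_mult_right]
      smooth_on_diff smooth_on_const smooth_on_bounded_linear[OF _ bounded_linear_ident])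

lemma has_derivative_Re_linear:
  "((\<lambda>x. Re (c * (x - z))) has_derivative (\<lambda>v. Re (c * v))) (at x)"
  by (auto intro!: derivative_eq_intros)

text \<open>The second derivatives in the directions 1 and \<open>\<i>\<close> carry the squares of
  \<open>Re c\<close> and \<open>- Im c\<close>, which add up to the squared modulus.\<close>

lemma laplacian_Re_linear_power:
  "laplacian (\<lambda>x. Re (c * (x - z)) ^ (n + 2)) x
    = real ((n + 2) * (n + 1)) * (cmod c)\<^sup>2 * Re (c * (x - z)) ^ n"
proof -
  let ?\<sigma> = "\<lambda>x. Re (c * (x - z))"
  have pw: "dir (\<lambda>x. ?\<sigma> x ^ Suc k) v x = real (Suc k) * ?\<sigma> x ^ k * Re (c * v)" for k v x
    by (rule frechet_derivative_eqI, rule has_derivative_eq_rhs[OF has_derivative_power[OF has_derivative_Re_linear]])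
      (auto simp: algebra_simps)
  have "dir (dir (\<lambda>x. ?\<sigma> x ^ (n + 2)) v) v x = real ((n + 2) * (n + 1)) * Re (c * v) ^ 2 * ?\<sigma> x ^ n" for v
  proof -
    have "dir (\<lambda>x. ?\<sigma> x ^ (n + 2)) v = (\<lambda>x. (real (n + 2) * Re (c * v)) * ?\<sigma> x ^ Suc n)"
      unfolding add_2_eq_Suc' pw by (simp only: mult_ac)
    then have "dir (dir (\<lambda>x. ?\<sigma> x ^ (n + 2)) v) v x = dir (\<lambda>x. (real (n + 2) * Re (c * v)) * ?\<sigma> x ^ Suc n) v x"
      by (simp only:)
    also have "\<dots> = (real (n + 2) * Re (c * v)) * dir (\<lambda>x. ?\<sigma> x ^ Suc n) v x"
      by (rule frechet_derivative_eqI)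
        (intro has_derivative_mult_right frechet_derivative_works[THEN iffD1] differentiable_power
          differentiableI[OF has_derivative_Re_linear])
    finally show ?thesis unfolding pw by (simp only: of_nat_mult power2_eq_square Suc_eq_plus1 mult_ac)
  qed
  then have "laplacian (\<lambda>x. ?\<sigma> x ^ (n + 2)) x
      = real ((n + 2) * (n + 1)) * (Re (c * 1) ^ 2 + Re (c * \<i>) ^ 2) * ?\<sigma> x ^ n"
    unfolding laplacian_def by (simp only: distrib_left distrib_right)
  also have "Re (c * 1) ^ 2 + Re (c * \<i>) ^ 2 = (cmod c)\<^sup>2" by (simp add: cmod_power2)
  finally show ?thesis .
qed

text \<open>By \<open>dep\<close> the quotients of the Laplacians have a common direction in which
  they are stationary, so locally they are functions of one parameter and
  \<open>osculating_basis\<close> applies. Multiplying back by \<open>h 0\<close> and inverting the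
  Laplacian raises the degree \<open>j\<close> to \<open>j + 2\<close>; the exponent 1 is left for
  the base coordinate.\<close>

lemma rigid_normal_form:
  fixes f :: "nat \<Rightarrow> complex \<Rightarrow> real"
  assumes B: "open B" "B \<noteq> {}" and N: "N > 0"
    and f: "\<And>k. k < N \<Longrightarrow> smooth_on (f k) B"
    and indep: "\<And>\<Omega> l. open \<Omega> \<Longrightarrow> \<Omega> \<noteq> {} \<Longrightarrow> \<Omega> \<subseteq> B \<Longrightarrow>
        (\<And>x. x \<in> \<Omega> \<Longrightarrow> (\<Sum>k<N. l k * laplacian (f k) x) = 0) \<Longrightarrow> \<forall>k<N. l k = 0"
    and dep: "\<And>x. N \<ge> 2 \<Longrightarrow> x \<in> B \<Longrightarrow> \<exists>\<alpha> v. (\<alpha> \<noteq> 0 \<or> v \<noteq> 0) \<and>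
        (\<forall>k<N. \<alpha> * laplacian (f k) x + dir (laplacian (f k)) v x = 0)"
  shows "\<exists>z\<in>B. \<exists>c (l :: nat \<Rightarrow> nat \<Rightarrow> real) Q. c \<noteq> 0 \<and>
    (\<forall>c'. (\<forall>k<N. (\<Sum>j<N. c' j * l j k) = 0) \<longrightarrow> (\<forall>j<N. c' j = 0)) \<and>
    (\<forall>j<N. Q j holomorphic_on UNIV \<and>
      vanishes (j + 3) (\<lambda>x. (\<Sum>k<N. l j k * f k x) - Re (Q j x) - Re (c * (x - z)) ^ (j + 2)) z)"
proof -
  define h where "h k = laplacian (f k)" for k
  have h: "smooth_on (h k) B" if "k < N" for k
    unfolding h_def by (rule smooth_on_laplacian[OF B(1) f[OF that]])
  define B1 where "B1 = B \<inter> h 0 -` (- {0})"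
  have B1: "open B1" unfolding B1_def
    by (rule continuous_open_preimage[OF smooth_on_continuous_on[OF h[OF N]] B(1)]) auto
  have B1B: "B1 \<subseteq> B" by (auto simp: B1_def)
  have h0: "h 0 x \<noteq> 0" if "x \<in> B1" for x using that by (auto simp: B1_def)
  have B1ne: "B1 \<noteq> {}"
  proof
    assume "B1 = {}"
    then have "(\<Sum>k<N. (if k = 0 then 1 else 0) * laplacian (f k) x) = 0" if "x \<in> B" for x
      using that N by (auto simp: B1_def h_def if_distrib[of "\<lambda>t. t * _"] sum.delta cong: if_cong)
    then have "\<forall>k<N. (if k = 0 then 1 else 0::real) = 0"
      by (intro indep[OF B(1,2) order_refl])
    then show False using N by auto
  qed
  have h1: "smooth_on (h k) B1" if "k < N" for k using smooth_on_subset[OF h[OF that] B1B] .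
  define r where "r k x = h k x / h 0 x" for k x
  have r: "smooth_on (r k) B1" if "k < N" for k
    unfolding r_def by (rule smooth_on_divide[OF B1 h0 h1[OF that] h1[OF N]])
  have rindep: "\<forall>k<N. l k = 0"
    if \<Omega>: "open \<Omega>" "\<Omega> \<noteq> {}" "\<Omega> \<subseteq> B1" "\<And>x. x \<in> \<Omega> \<Longrightarrow> (\<Sum>k<N. l k * r k x) = 0" for \<Omega> l
  proof (rule indep[OF \<Omega>(1,2)])
    show "\<Omega> \<subseteq> B" using \<Omega> B1B by blast
    fix x assume x: "x \<in> \<Omega>"
    then have "h 0 x \<noteq> 0" using \<Omega> h0 by blast
    then have "(\<Sum>k<N. l k * laplacian (f k) x) = (\<Sum>k<N. l k * r k x) * h 0 x"
      by (simp add: r_def h_def sum_distrib_right)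
    then show "(\<Sum>k<N. l k * laplacian (f k) x) = 0" using \<Omega>(4)[OF x] by simp
  qed
  have dr0: "dir (r 0) v x = 0" if "x \<in> B1" for v x
  proof -
    have "frechet_derivative (r 0) (at x) = frechet_derivative (\<lambda>x. 1) (at x)"
      by (rule frechet_derivative_cong_open[OF B1 that]) (simp add: r_def h0)
    then show ?thesis by (simp add: frechet_derivative_const)
  qed
  \<comment> \<open>For \<open>N = 1\<close> the only quotient is constant, and any function without
    critical points can serve as parameter. For \<open>N \<ge> 2\<close> the parameter is
    \<open>r 1\<close>, which independence prevents from being locally constant.\<close>
  obtain s a B2 where s: "open B2" "B2 \<noteq> {}" "B2 \<subseteq> B1" "smooth_on s B2" "\<And>x. x \<in> B2 \<Longrightarrow> dir s a x \<noteq> 0"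
    and par: "\<And>k x. k < N \<Longrightarrow> x \<in> B2 \<Longrightarrow> \<exists>c. \<forall>v. dir (r k) v x = c * dir s v x"
  proof (cases "N = 1")
    case True
    have "dir Re 1 x = 1" for x
      using frechet_derivative_eqI[OF bounded_linear_imp_has_derivative[OF bounded_linear_Re], of x 1] by simp
    then show ?thesis
      using that[of B1 Re 1] B1 B1ne smooth_on_bounded_linear[OF B1 bounded_linear_Re] dr0 True
      by (metis less_one mult_zero_left order_refl zero_neq_one)
  next
    case False
    then have N2: "N \<ge> 2" using N by simp
    then have N1: "1 < N" by simp
    have "\<exists>x\<in>B1. \<exists>a. dir (r 1) a x \<noteq> 0"
    proof (rule ccontr)
      assume "\<not> ?thesis"
      then have z: "dir (r 1) a x = 0" if "x \<in> B1" for a x using that by blast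
      obtain y \<rho> where y: "\<rho> > 0" "ball y \<rho> \<subseteq> B1" using B1 B1ne open_contains_ball by blast
      have const: "r 1 x = r 1 y" if "x \<in> ball y \<rho>" for x
      proof (rule zero_derivative_imp_constant_on_ball[OF _ that])
        fix x assume "x \<in> ball y \<rho>"
        then have x: "x \<in> B1" using y by blast
        show "(r 1 has_derivative (\<lambda>h. 0)) (at x)"
          using smooth_on_has_derivative[OF r[OF N1] x] z[OF x] by (metis (no_types) has_derivative_eq_rhs ext)
      qed
      define l where "l k = (if k = 0 then - r 1 y else if k = 1 then 1 else 0)" for k :: nat
      have "\<forall>k<N. l k = 0"
      proof (rule rindep[of "ball y \<rho>"])
        fix x assume x: "x \<in> ball y \<rho>"
        then have "r 0 x = 1" using y h0 by (auto simp: r_def)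
        moreover have "(\<Sum>k<N. l k * r k x) = (\<Sum>k\<in>{0,1}. l k * r k x)"
          by (rule sum.mono_neutral_right) (use N1 in \<open>auto simp: l_def\<close>)
        ultimately show "(\<Sum>k<N. l k * r k x) = 0" using const[OF x] by (simp add: l_def)
      qed (use y in auto)
      then show False using N1 by (auto simp: l_def)
    qed
    then obtain x0 a where x0: "x0 \<in> B1" "dir (r 1) a x0 \<noteq> 0" by blast
    define B2 where "B2 = B1 \<inter> (dir (r 1) a) -` (- {0})"
    have B2: "open B2" unfolding B2_def
      by (rule continuous_open_preimage[OF smooth_on_continuous_on[OF smooth_on_derivative[OF r[OF N1]]] B1]) auto
    show ?thesis
    proof (rule that[of B2 "r 1" a])
      show "B2 \<noteq> {}" using x0 by (auto simp: B2_def)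
      show "B2 \<subseteq> B1" by (auto simp: B2_def)
      then show "smooth_on (r 1) B2" using smooth_on_subset[OF r[OF N1]] by blast
      show "dir (r 1) a x \<noteq> 0" if "x \<in> B2" for x using that by (auto simp: B2_def)
      fix k x assume k: "k < N" and x2: "x \<in> B2"
      then have x: "x \<in> B1" "x \<in> B" "dir (r 1) a x \<noteq> 0" using B1B by (auto simp: B2_def)
      obtain \<alpha> v where av: "\<alpha> \<noteq> 0 \<or> v \<noteq> 0" "\<And>k. k < N \<Longrightarrow> \<alpha> * h k x + dir (h k) v x = 0"
        using dep[OF N2 x(2)] unfolding h_def by blast
      have "v \<noteq> 0"
      proof
        assume "v = 0"
        then have "dir (h 0) v x = 0"
          using linear_0[OF has_derivative_linear[OF smooth_on_has_derivative[OF h[OF N] x(2)]]] by simp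
        then show False using av(1) av(2)[OF N] h0[OF x(1)] \<open>v = 0\<close> by simp
      qed
      \<comment> \<open>Along \<open>v\<close> every \<open>h k\<close> is multiplied by the same
        rate \<open>- \<alpha>\<close>, so the quotients are stationary.\<close>
      have drv: "dir (r j) v x = 0" if j: "j < N" for j
      proof -
        have "dir (r j) v x = (dir (h j) v x * h 0 x - h j x * dir (h 0) v x) / (h 0 x * h 0 x)"
          unfolding r_def by (rule frechet_derivative_divide_real[OF h1[OF j] h1[OF N] x(1) h0[OF x(1)]])
        moreover have "dir (h j) v x = - \<alpha> * h j x" "dir (h 0) v x = - \<alpha> * h 0 x"
          using av(2)[OF j] av(2)[OF N] by simp_all
        ultimately show ?thesis by simp
      qed
      text \<open>\<open>v\<close> and \<open>\<i> v\<close> form a real basis of the plane.\<close>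
      have exp: "dir (r j) u x = Im (u / v) * dir (r j) (\<i> * v) x" if j: "j < N" for j u
      proof -
        have lin: "linear (frechet_derivative (r j) (at x))"
          using has_derivative_linear[OF smooth_on_has_derivative[OF r[OF j] x(1)]] .
        have "u = (u / v) * v" using \<open>v \<noteq> 0\<close> by simp
        also have "\<dots> = Re (u / v) *\<^sub>R v + Im (u / v) *\<^sub>R (\<i> * v)"
          by (subst (1) complex_eq[of "u / v"]) (simp add: scaleR_conv_of_real algebra_simps)
        finally have "dir (r j) u x = dir (r j) (Re (u / v) *\<^sub>R v + Im (u / v) *\<^sub>R (\<i> * v)) x" by simp
        then show ?thesis by (simp add: linear_add[OF lin] linear_cmul[OF lin] drv[OF j])
      qed
      have ne: "dir (r 1) (\<i> * v) x \<noteq> 0" using exp[OF N1, of a] x(3) by auto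
      show "\<exists>c. \<forall>u. dir (r k) u x = c * dir (r 1) u x"
      proof (rule exI[of _ "dir (r k) (\<i> * v) x / dir (r 1) (\<i> * v) x"], rule allI)
        fix u
        have "dir (r k) u x = Im (u / v) * dir (r k) (\<i> * v) x" "dir (r 1) u x = Im (u / v) * dir (r 1) (\<i> * v) x"
          by (rule exp[OF k], rule exp[OF N1])
        then show "dir (r k) u x = dir (r k) (\<i> * v) x / dir (r 1) (\<i> * v) x * dir (r 1) u x"
          using ne by simp
      qed
    qed (rule B2)
  qed
  have rB2: "smooth_on (r k) B2" if "k < N" for k using smooth_on_subset[OF r[OF that] s(3)] .
  obtain z l where z: "z \<in> B2"
    and l: "\<And>j. j < N \<Longrightarrow> vanishes (Suc j) (\<lambda>x. (\<Sum>k<N. l j k * r k x) - (s x - s z) ^ j) z"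
    and linv: "\<And>c. \<forall>k<N. (\<Sum>j<N. c j * l j k) = 0 \<Longrightarrow> \<forall>j<N. c j = 0"
  proof -
    have "\<exists>z\<in>B2. \<exists>l :: nat \<Rightarrow> nat \<Rightarrow> real.
      (\<forall>j<N. vanishes (Suc j) (\<lambda>x. (\<Sum>k<N. l j k * r k x) - (s x - s z) ^ j) z) \<and>
      (\<forall>c. (\<forall>k<N. (\<Sum>j<N. c j * l j k) = 0) \<longrightarrow> (\<forall>j<N. c j = 0))"
    proof (rule osculating_basis[OF s(1,2,4)])
      show "\<forall>k<N. l k = 0" if "open \<Omega>" "\<Omega> \<noteq> {}" "\<Omega> \<subseteq> B2" "\<And>x. x \<in> \<Omega> \<Longrightarrow> (\<Sum>k<N. l k * r k x) = 0" for \<Omega> l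
        by (rule rindep[of \<Omega>]) (use that s(3) in auto)
    qed (fact s(5) rB2 par)+
    then show ?thesis using that by blast
  qed
  note B2 = s(1)
  have zB: "z \<in> B1" "z \<in> B" using z s(3) B1B by auto
  \<comment> \<open>Makes the differential of \<open>s\<close> at \<open>z\<close> equal to
    \<open>\<lambda>v. Re (c * v)\<close>, so that \<open>s x - s z\<close> and
    \<open>Re (c * (x - z))\<close> agree up to terms of order 2.\<close>
  define c where "c = Complex (dir s 1 z) (- dir s \<i> z)"
  have ds: "dir s v z = Re (c * v)" for v
    using complex_derivative_expansion[OF smooth_on_has_derivative[OF s(4) z], of v] by (simp add: c_def)
  have c0: "c \<noteq> 0" using s(5)[OF z] ds by auto
  let ?\<tau> = "\<lambda>x. Re (c * (x - z))" and ?\<sigma> = "\<lambda>x. s x - s z"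
  have s\<tau>: "smooth_on ?\<tau> B2" by (rule smooth_on_Re_linear[OF B2])
  have s\<sigma>: "smooth_on ?\<sigma> B2" by (intro smooth_on_diff smooth_on_const s(4) B2)
  have v\<sigma>: "vanishes 1 ?\<sigma> z" and v\<tau>: "vanishes 1 ?\<tau> z" by simp_all
  have "vanishes (Suc 1) (\<lambda>x. ?\<sigma> x - ?\<tau> x) z"
  proof (rule vanishes_SucI[OF B2 z])
    show "((\<lambda>x. ?\<sigma> x - ?\<tau> x) has_derivative (\<lambda>v. (dir s v x - 0) - Re (c * v))) (at x)" if "x \<in> B2" for x
      by (intro has_derivative_diff has_derivative_Re_linear smooth_on_has_derivative[OF s(4) that] has_derivative_const)
    show "vanishes 1 (\<lambda>x. dir s v x - 0 - Re (c * v)) z" for v using ds by simp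
  qed simp
  then have v\<sigma>\<tau>: "vanishes 2 (\<lambda>x. ?\<sigma> x - ?\<tau> x) z" by (simp only: Suc_1)
  \<comment> \<open>The numerator matches the factor in \<open>laplacian_Re_linear_power\<close>;
    the denominator cancels the value at \<open>z\<close> of \<open>h 0\<close>, by which the
    quotients \<open>r k\<close> are multiplied to recover \<open>h k\<close>.\<close>
  define \<kappa> where "\<kappa> j = real ((j + 2) * (j + 1)) * (cmod c)\<^sup>2 / h 0 z" for j
  have \<kappa>0: "\<kappa> j \<noteq> 0" for j using c0 h0[OF zB(1)] by (simp add: \<kappa>_def del: of_nat_mult of_nat_add)
  define F where "F j x = (\<Sum>k<N. (\<kappa> j * l j k) * f k x) - ?\<tau> x ^ (j + 2)" for j x
  have fB2: "smooth_on (f k) B2" if "k < N" for k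
    by (rule smooth_on_subset[OF f[OF that]]) (use s(3) B1B in blast)
  have sF: "smooth_on (F j) B2" for j
    unfolding F_def by (intro smooth_on_diff smooth_on_sum smooth_on_linear_comp[OF _ bounded_linear_mult_right]
        smooth_on_power s\<tau> B2 fB2) auto
  have lapF: "laplacian (F j) x = (\<Sum>k<N. (\<kappa> j * l j k) * h k x) - laplacian (\<lambda>x. ?\<tau> x ^ (j + 2)) x" if x: "x \<in> B2" for j x
  proof -
    let ?p = "\<lambda>x. ?\<tau> x ^ (j + 2)"
    have sp: "smooth_on ?p B2" by (rule smooth_on_power[OF B2 s\<tau>])
    have d1: "dir (F j) v y = (\<Sum>k<N. (\<kappa> j * l j k) * dir (f k) v y) - dir ?p v y" if y: "y \<in> B2" for v y
      unfolding F_def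
      by (rule frechet_derivative_eqI)
        (intro has_derivative_diff has_derivative_sum has_derivative_mult_right
          smooth_on_has_derivative[OF fB2 y] smooth_on_has_derivative[OF sp y], auto)
    have d2: "dir (dir (F j) v) v x = (\<Sum>k<N. (\<kappa> j * l j k) * dir (dir (f k) v) v x) - dir (dir ?p v) v x" for v
    proof -
      have "dir (dir (F j) v) v x = dir (\<lambda>y. (\<Sum>k<N. (\<kappa> j * l j k) * dir (f k) v y) - dir ?p v y) v x"
        using frechet_derivative_cong_open[OF B2 x, of "dir (F j) v"] d1 by simp
      also have "\<dots> = (\<Sum>k<N. (\<kappa> j * l j k) * dir (dir (f k) v) v x) - dir (dir ?p v) v x"
        by (rule frechet_derivative_eqI)
          (intro has_derivative_diff has_derivative_sum has_derivative_mult_right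
            smooth_on_has_derivative[OF smooth_on_derivative[OF fB2] x] smooth_on_has_derivative[OF smooth_on_derivative[OF sp] x], auto)
      finally show ?thesis .
    qed
    show ?thesis
      unfolding h_def laplacian_def d2 by (simp add: sum.distrib distrib_left)
  qed
  have vanF: "vanishes (Suc j) (laplacian (F j)) z" if j: "j < N" for j
  proof -
    let ?K = "real ((j + 2) * (j + 1)) * (cmod c)\<^sup>2"
    \<comment> \<open>The defect splits into the osculation error \<open>W\<close>, the variation of
      \<open>h 0\<close> and the replacement of \<open>s x - s z\<close> by its linear part; each
      contribution vanishes to order \<open>j + 1\<close>.\<close>
    define W where "W x = (\<Sum>k<N. l j k * r k x) - ?\<sigma> x ^ j" for x
    have vW: "vanishes (Suc j) W z" unfolding W_def[abs_def] by (rule l[OF j])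
    have sW: "smooth_on W B2"
      unfolding W_def by (intro smooth_on_diff smooth_on_sum smooth_on_linear_comp[OF _ bounded_linear_mult_right]
        smooth_on_power s\<sigma> B2 rB2) auto
    define G where "G x = h 0 x / h 0 z" for x
    have sG: "smooth_on G B2" unfolding G_def divide_inverse
      by (intro smooth_on_linear_comp[OF B2 bounded_linear_mult_left] smooth_on_subset[OF h1[OF N] s(3)])
    have sG1: "smooth_on (\<lambda>x. G x - 1) B2" by (intro smooth_on_diff smooth_on_const sG B2)
    have 1: "vanishes (Suc j) (\<lambda>x. G x * W x) z"
      using vanishes_mult[OF B2 z sG sW, of 0 "Suc j"] vW by simp
    have "vanishes 1 (\<lambda>x. G x - 1) z" using h0[OF zB(1)] by (simp add: G_def)
    from vanishes_mult[OF B2 z sG1 smooth_on_power[OF B2 s\<sigma>] this vanishes_power[OF B2 z s\<sigma> v\<sigma>], of j]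
    have 2: "vanishes (Suc j) (\<lambda>x. (G x - 1) * ?\<sigma> x ^ j) z" by simp
    have 3: "vanishes (Suc j) (\<lambda>x. ?\<sigma> x ^ j - ?\<tau> x ^ j) z"
      by (rule vanishes_power_diff[OF B2 z s\<sigma> s\<tau> v\<sigma> v\<tau> v\<sigma>\<tau>])
    have s3: "smooth_on (\<lambda>x. ?\<sigma> x ^ j - ?\<tau> x ^ j) B2" by (intro smooth_on_diff smooth_on_power s\<sigma> s\<tau> B2)
    have s12: "smooth_on (\<lambda>x. G x * W x) B2" "smooth_on (\<lambda>x. (G x - 1) * ?\<sigma> x ^ j) B2"
      by (intro smooth_on_mult smooth_on_power sG sW sG1 s\<sigma> B2)+
    have 12: "vanishes (Suc j) (\<lambda>x. G x * W x + (G x - 1) * ?\<sigma> x ^ j) z"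
      by (rule vanishes_add[OF B2 z s12 1 2])
    have s12': "smooth_on (\<lambda>x. G x * W x + (G x - 1) * ?\<sigma> x ^ j) B2" by (rule smooth_on_add[OF B2 s12])
    have 4: "vanishes (Suc j) (\<lambda>x. (G x * W x + (G x - 1) * ?\<sigma> x ^ j) + (?\<sigma> x ^ j - ?\<tau> x ^ j)) z"
      by (rule vanishes_add[OF B2 z s12' s3 12 3])
    have "vanishes (Suc j) (\<lambda>x. ?K * ((G x * W x + (G x - 1) * ?\<sigma> x ^ j) + (?\<sigma> x ^ j - ?\<tau> x ^ j))) z"
      by (rule vanishes_cmult[OF B2 z smooth_on_add[OF B2 s12' s3] 4])
    then show ?thesis
    proof (rule vanishes_cong[OF B2 z, rotated])
      fix x assume x: "x \<in> B2"
      then have "h 0 x \<noteq> 0" using s(3) h0 by blast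
      then have "(\<Sum>k<N. l j k * h k x) = (\<Sum>k<N. l j k * r k x) * h 0 x"
        by (simp add: r_def sum_distrib_right)
      then have "(\<Sum>k<N. (\<kappa> j * l j k) * h k x) = ?K * (G x * (\<Sum>k<N. l j k * r k x))"
      proof -
        assume eq: "(\<Sum>k<N. l j k * h k x) = (\<Sum>k<N. l j k * r k x) * h 0 x"
        have "(\<Sum>k<N. (\<kappa> j * l j k) * h k x) = \<kappa> j * (\<Sum>k<N. l j k * h k x)"
          by (simp only: sum_distrib_left mult.assoc)
        also have "\<dots> = ?K * (G x * (\<Sum>k<N. l j k * r k x))"
          unfolding eq \<kappa>_def G_def by (simp only: divide_inverse mult_ac)
        finally show ?thesis .
      qed
      moreover have "G x * W x + (G x - 1) * ?\<sigma> x ^ j + (?\<sigma> x ^ j - ?\<tau> x ^ j) = G x * (\<Sum>k<N. l j k * r k x) - ?\<tau> x ^ j"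
        by (simp add: W_def algebra_simps)
      ultimately show "?K * ((G x * W x + (G x - 1) * ?\<sigma> x ^ j) + (?\<sigma> x ^ j - ?\<tau> x ^ j)) = laplacian (F j) x"
        unfolding lapF[OF x] laplacian_Re_linear_power by (simp only: right_diff_distrib)
    qed
  qed
  have "\<forall>j. \<exists>Q. j < N \<longrightarrow> Q holomorphic_on UNIV \<and> vanishes (Suc (Suc (Suc j))) (\<lambda>x. F j x - Re (Q x)) z"
    using laplacian_vanishes[OF B2 z sF vanF] by blast
  then obtain Q where Q: "\<And>j. j < N \<Longrightarrow> Q j holomorphic_on UNIV"
    "\<And>j. j < N \<Longrightarrow> vanishes (Suc (Suc (Suc j))) (\<lambda>x. F j x - Re (Q j x)) z" by metis
  have van: "vanishes (j + 3) (\<lambda>x. (\<Sum>k<N. (\<kappa> j * l j k) * f k x) - Re (Q j x) - ?\<tau> x ^ (j + 2)) z" if "j < N" for j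
  proof -
    have "(\<lambda>x. F j x - Re (Q j x)) = (\<lambda>x. (\<Sum>k<N. (\<kappa> j * l j k) * f k x) - Re (Q j x) - ?\<tau> x ^ (j + 2))"
      by (simp add: F_def fun_eq_iff)
    moreover have "Suc (Suc (Suc j)) = j + 3" by simp
    ultimately show ?thesis using Q(2)[OF that] by (simp only:)
  qed
  have inv: "\<forall>c'. (\<forall>k<N. (\<Sum>j<N. c' j * (\<kappa> j * l j k)) = 0) \<longrightarrow> (\<forall>j<N. c' j = 0)"
  proof (intro allI impI)
    fix c' j assume c': "\<forall>k<N. (\<Sum>j<N. c' j * (\<kappa> j * l j k)) = 0" and j: "j < N"
    have "\<forall>j<N. c' j * \<kappa> j = 0" by (rule linv) (use c' in \<open>simp add: mult.assoc\<close>)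
    then show "c' j = 0" using \<kappa>0 j by simp
  qed
  have all: "\<forall>j<N. Q j holomorphic_on UNIV \<and>
      vanishes (j + 3) (\<lambda>x. (\<Sum>k<N. (\<kappa> j * l j k) * f k x) - Re (Q j x) - ?\<tau> x ^ (j + 2)) z"
    using Q(1) van by simp
  show ?thesis
    by (rule bexI[OF _ zB(2)], rule exI[of _ c], rule exI[of _ "\<lambda>j k. \<kappa> j * l j k"], rule exI[of _ Q])
      (rule conjI[OF c0 conjI[OF inv all]])
qed

section \<open>The weak derived flag of a rigid graph\<close>

lemma linear_frechet_derivative_smooth:
  "smooth_on f U \<Longrightarrow> p \<in> U \<Longrightarrow> linear (frechet_derivative f (at p))"
  using has_derivative_linear[OF smooth_on_has_derivative] .

lemma frechet_derivative_expansion: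
  fixes \<phi> :: "'a::euclidean_space \<Rightarrow> 'b::real_normed_vector"
  assumes "smooth_on \<phi> U" "p \<in> U"
  shows "frechet_derivative \<phi> (at p) v = (\<Sum>b\<in>Basis. (v \<bullet> b) *\<^sub>R dir \<phi> b p)"
  by (rule linear_basis_expansion[OF linear_frechet_derivative_smooth[OF assms]])

lemma smooth_on_derivative_apply:
  fixes \<phi> :: "'a::euclidean_space \<Rightarrow> 'b::real_normed_vector"
  assumes U: "open U" and \<phi>: "smooth_on \<phi> U" and Y: "smooth_on Y U"
  shows "smooth_on (\<lambda>z. frechet_derivative \<phi> (at z) (Y z)) U"
proof -
  have "smooth_on (\<lambda>z. \<Sum>b\<in>Basis. (Y z \<bullet> b) *\<^sub>R dir \<phi> b z) U"
    by (intro smooth_on_sum smooth_on_scaleR U smooth_on_derivative[OF \<phi>]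
        smooth_on_linear_comp[OF U bounded_linear_inner_left Y])
  moreover have "(\<Sum>b\<in>Basis. (Y z \<bullet> b) *\<^sub>R dir \<phi> b z) = frechet_derivative \<phi> (at z) (Y z)" if "z \<in> U" for z
    by (rule frechet_derivative_expansion[OF \<phi> that, symmetric])
  ultimately show ?thesis
    using smooth_on_cong[OF U, of "\<lambda>z. \<Sum>b\<in>Basis. (Y z \<bullet> b) *\<^sub>R dir \<phi> b z"
        "\<lambda>z. frechet_derivative \<phi> (at z) (Y z)"] by blast
qed

definition second_derivative :: "('a::euclidean_space \<Rightarrow> 'b::real_normed_vector) \<Rightarrow> 'a \<Rightarrow> 'a \<Rightarrow> 'a \<Rightarrow> 'b" where
  "second_derivative \<phi> p u w = (\<Sum>b\<in>Basis. (w \<bullet> b) *\<^sub>R frechet_derivative (dir \<phi> b) (at p) u)"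

lemma second_derivative_commute:
  fixes \<phi> :: "'a::euclidean_space \<Rightarrow> 'b::euclidean_space"
  assumes "open U" "p \<in> U" "smooth_on \<phi> U"
  shows "second_derivative \<phi> p u w = second_derivative \<phi> p w u"
proof -
  have *: "second_derivative \<phi> p u w
      = (\<Sum>b\<in>Basis. \<Sum>c\<in>Basis. ((w \<bullet> b) * (u \<bullet> c)) *\<^sub>R frechet_derivative (dir \<phi> b) (at p) c)" for u w
  proof -
    have "frechet_derivative (dir \<phi> b) (at p) u = (\<Sum>c\<in>Basis. (u \<bullet> c) *\<^sub>R frechet_derivative (dir \<phi> b) (at p) c)" for b
      by (rule frechet_derivative_expansion[OF smooth_on_derivative[OF assms(3)] assms(2)])
    then have "second_derivative \<phi> p u w
        = (\<Sum>b\<in>Basis. (w \<bullet> b) *\<^sub>R (\<Sum>c\<in>Basis. (u \<bullet> c) *\<^sub>R frechet_derivative (dir \<phi> b) (at p) c))"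
      unfolding second_derivative_def by (intro sum.cong refl arg_cong[where f = "scaleR _"])
    then show ?thesis by (simp add: scaleR_sum_right)
  qed
  have "second_derivative \<phi> p u w
      = (\<Sum>b\<in>Basis. \<Sum>c\<in>Basis. ((u \<bullet> b) * (w \<bullet> c)) *\<^sub>R frechet_derivative (dir \<phi> c) (at p) b)"
    unfolding * by (subst sum.swap) (simp add: mult.commute)
  also have "\<dots> = second_derivative \<phi> p w u"
    unfolding * by (intro sum.cong refl arg_cong[where f = "scaleR _"] second_derivative_symmetric[OF assms])
  finally show ?thesis .
qed

lemma has_derivative_derivative_apply:
  fixes \<phi> :: "'a::euclidean_space \<Rightarrow> 'b::real_normed_vector"
  assumes U: "open U" "p \<in> U" and \<phi>: "smooth_on \<phi> U" and Y: "smooth_on Y U"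
  shows "((\<lambda>z. frechet_derivative \<phi> (at z) (Y z)) has_derivative
     (\<lambda>u. frechet_derivative \<phi> (at p) (frechet_derivative Y (at p) u) + second_derivative \<phi> p u (Y p))) (at p)"
proof -
  have "((\<lambda>z. \<Sum>b\<in>Basis. (Y z \<bullet> b) *\<^sub>R dir \<phi> b z) has_derivative
     (\<lambda>u. \<Sum>b\<in>Basis. (Y p \<bullet> b) *\<^sub>R frechet_derivative (dir \<phi> b) (at p) u
        + (frechet_derivative Y (at p) u \<bullet> b) *\<^sub>R dir \<phi> b p)) (at p)"
    by (intro has_derivative_sum has_derivative_scaleR has_derivative_inner_left
        smooth_on_has_derivative[OF Y U(2)] smooth_on_has_derivative[OF smooth_on_derivative[OF \<phi>] U(2)])
  then have "((\<lambda>z. \<Sum>b\<in>Basis. (Y z \<bullet> b) *\<^sub>R dir \<phi> b z) has_derivative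
     (\<lambda>u. frechet_derivative \<phi> (at p) (frechet_derivative Y (at p) u) + second_derivative \<phi> p u (Y p))) (at p)"
    unfolding second_derivative_def
    by (rule has_derivative_eq_rhs)
      (intro ext, subst frechet_derivative_expansion[OF \<phi> U(2), of "frechet_derivative Y (at p) _"],
        simp add: sum.distrib add.commute)
  then show ?thesis
    by (rule has_derivative_transform_within_open[OF _ U])
      (rule frechet_derivative_expansion[OF \<phi>, symmetric])
qed

text \<open>The chain rule produces a term with the second derivative of \<open>\<phi>\<close> in
  each half of the bracket; by symmetry the two cancel.\<close>

lemma lie_bracket_pushforward:
  fixes \<phi> \<psi> :: "'a::euclidean_space \<Rightarrow> 'a"
  assumes W: "open W" "p \<in> W" "open W'" "\<phi> p \<in> W'"
    and \<phi>: "smooth_on \<phi> W" and \<psi>: "smooth_on \<psi> W'" "\<And>w. w \<in> W' \<Longrightarrow> \<psi> w \<in> W"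
    and \<psi>\<phi>: "\<And>z. z \<in> W \<Longrightarrow> \<phi> z \<in> W' \<and> \<psi> (\<phi> z) = z"
    and X: "smooth_on X W" and Y: "smooth_on Y W"
  shows "lie_bracket (\<lambda>w. frechet_derivative \<phi> (at (\<psi> w)) (X (\<psi> w)))
      (\<lambda>w. frechet_derivative \<phi> (at (\<psi> w)) (Y (\<psi> w))) (\<phi> p)
    = frechet_derivative \<phi> (at p) (lie_bracket X Y p)"
proof -
  let ?push = "\<lambda>X w. frechet_derivative \<phi> (at (\<psi> w)) (X (\<psi> w))"
  have *: "frechet_derivative (?push Y) (at (\<phi> p)) (frechet_derivative \<phi> (at p) u)
      = frechet_derivative \<phi> (at p) (frechet_derivative Y (at p) u) + second_derivative \<phi> p u (Y p)"
    if Y: "smooth_on Y W" for Y u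
  proof -
    have "smooth_on (?push Y) W'"
      by (rule smooth_on_compose[OF W(3,1) _ smooth_on_derivative_apply[OF W(1) \<phi> Y] \<psi>(1)]) (use \<psi> in auto)
    then have D: "(?push Y has_derivative frechet_derivative (?push Y) (at (\<phi> p))) (at (\<phi> p))"
      using smooth_on_has_derivative W by blast
    have 1: "((\<lambda>z. ?push Y (\<phi> z)) has_derivative
        (\<lambda>u. frechet_derivative (?push Y) (at (\<phi> p)) (frechet_derivative \<phi> (at p) u))) (at p)"
      using diff_chain_at[OF smooth_on_has_derivative[OF \<phi> W(2)] D] by (simp add: o_def)
    have "((\<lambda>z. ?push Y (\<phi> z)) has_derivative
        (\<lambda>u. frechet_derivative \<phi> (at p) (frechet_derivative Y (at p) u) + second_derivative \<phi> p u (Y p))) (at p)"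
      by (rule has_derivative_transform_within_open[OF has_derivative_derivative_apply[OF W(1,2) \<phi> Y] W(1,2)])
        (use \<psi>\<phi> in auto)
    from fun_cong[OF has_derivative_unique[OF 1 this], of u] show ?thesis .
  qed
  have p: "\<psi> (\<phi> p) = p" using \<psi>\<phi> W(2) by blast
  show ?thesis
    unfolding lie_bracket_def p *[OF X] *[OF Y]
    using second_derivative_commute[OF W(1,2) \<phi>, of "X p" "Y p"]
    by (simp add: linear_diff[OF linear_frechet_derivative_smooth[OF \<phi> W(2)]])
qed

lemma tangent_space_pushforward:
  fixes \<phi> :: "'a::euclidean_space \<Rightarrow> 'b::euclidean_space"
  assumes U: "open U" "p \<in> U" and \<phi>: "smooth_on \<phi> U" and sub: "\<phi> ` (M \<inter> U) \<subseteq> N"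
    and v: "v \<in> tangent_space M p"
  shows "frechet_derivative \<phi> (at p) v \<in> tangent_space N (\<phi> p)"
proof -
  obtain \<gamma> :: "real \<Rightarrow> 'a" and \<epsilon> where \<gamma>: "\<epsilon> > 0" "smooth_on \<gamma> {-\<epsilon><..<\<epsilon>}" "\<gamma> ` {-\<epsilon><..<\<epsilon>} \<subseteq> M"
    "\<gamma> 0 = p" "(\<gamma> has_vector_derivative v) (at 0)"
    using v unfolding tangent_space_def by blast
  have "open ({-\<epsilon><..<\<epsilon>} \<inter> \<gamma> -` U)"
    by (rule continuous_open_preimage[OF smooth_on_continuous_on[OF \<gamma>(2)] _ U(1)]) auto
  moreover have "0 \<in> {-\<epsilon><..<\<epsilon>} \<inter> \<gamma> -` U" using \<gamma> U by auto
  ultimately obtain \<delta> where \<delta>: "\<delta> > 0" "ball 0 \<delta> \<subseteq> {-\<epsilon><..<\<epsilon>} \<inter> \<gamma> -` U"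
    using open_contains_ball by blast
  have b: "{-\<delta><..<\<delta>} = ball 0 \<delta>" by (auto simp: dist_real_def)
  have "smooth_on (\<lambda>t. \<phi> (\<gamma> t)) {-\<delta><..<\<delta>}"
    by (rule smooth_on_compose[OF _ U(1) _ \<phi> smooth_on_subset[OF \<gamma>(2)]]) (use \<delta> b in auto)
  moreover have "(\<lambda>t. \<phi> (\<gamma> t)) ` {-\<delta><..<\<delta>} \<subseteq> N" using \<delta> b \<gamma>(3) sub by blast
  moreover have "((\<lambda>t. \<phi> (\<gamma> t)) has_vector_derivative frechet_derivative \<phi> (at p) v) (at 0)"
    using diff_chain_at[OF \<gamma>(5)[unfolded has_vector_derivative_def], of \<phi> "frechet_derivative \<phi> (at p)"]
      smooth_on_has_derivative[OF \<phi> U(2)] \<gamma>(4) linear_cmul[OF linear_frechet_derivative_smooth[OF \<phi> U(2)]]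
    by (simp add: has_vector_derivative_def o_def)
  ultimately show ?thesis
    unfolding tangent_space_def using \<delta>(1) \<gamma>(4) by blast
qed

lemma CR_distribution_pushforward:
  assumes U: "open U" "p \<in> U" and \<phi>: "holomorphic_map_on \<phi> U" and sub: "\<phi> ` (M \<inter> U) \<subseteq> N"
    and v: "v \<in> CR_distribution M p"
  shows "frechet_derivative \<phi> (at p) v \<in> CR_distribution N (\<phi> p)"
proof -
  have s: "smooth_on \<phi> U" by (rule holomorphic_map_on_imp_smooth_on[OF U(1) \<phi>])
  obtain u where u: "u \<in> tangent_space M p" "v = \<i> *s u" "v \<in> tangent_space M p"
    using v unfolding CR_distribution_def by blast
  have "frechet_derivative \<phi> (at p) v = \<i> *s frechet_derivative \<phi> (at p) u"
    unfolding u(2) by (rule holomorphic_map_onD(2)[OF \<phi> U(2)])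
  then show ?thesis
    unfolding CR_distribution_def using tangent_space_pushforward[OF U s sub] u by blast
qed

text \<open>The hypotheses on the flag concern \<open>M\<close>, the computations take place on its
  graph. Local sections are pushed forward together with their ambient extensions, and their
  brackets follow.\<close>

lemma weak_derived_flag_pushforward:
  assumes bih: "biholomorphism_between \<phi> U V" and MN: "\<phi> ` (M \<inter> U) = N \<inter> V"
  shows "p \<in> M \<inter> U \<Longrightarrow> v \<in> weak_derived_flag M k p \<Longrightarrow>
     frechet_derivative \<phi> (at p) v \<in> weak_derived_flag N k (\<phi> p)"
proof (rule biholomorphism_betweenE[OF bih])
  fix \<psi> assume U: "open U" and V: "open V" and hol: "holomorphic_map_on \<phi> U" "holomorphic_map_on \<psi> V"
    and \<phi>V: "\<And>z. z \<in> U \<Longrightarrow> \<phi> z \<in> V" and \<psi>U: "\<And>w. w \<in> V \<Longrightarrow> \<psi> w \<in> U"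
    and \<psi>\<phi>: "\<And>z. z \<in> U \<Longrightarrow> \<psi> (\<phi> z) = z" and \<phi>\<psi>: "\<And>w. w \<in> V \<Longrightarrow> \<phi> (\<psi> w) = w"
  have s\<phi>: "smooth_on \<phi> U" and s\<psi>: "smooth_on \<psi> V"
    using holomorphic_map_on_imp_smooth_on U V hol by blast+
  have sub: "\<phi> ` (M \<inter> U) \<subseteq> N" using MN by blast
  have bck: "\<psi> w \<in> M \<inter> U" if "w \<in> N \<inter> V" for w
    using that MN \<psi>\<phi> by (metis (no_types, lifting) Int_iff imageE)
  have main: "\<forall>p v. p \<in> M \<inter> U \<longrightarrow> v \<in> weak_derived_flag M k p \<longrightarrow>
     frechet_derivative \<phi> (at p) v \<in> weak_derived_flag N k (\<phi> p)" for k
  proof (induction k)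
    case 0
    then show ?case using linear_0[OF linear_frechet_derivative_smooth[OF s\<phi>]] by simp
  next
    case (Suc k)
    show ?case
    proof (cases k)
      case 0
      then show ?thesis using CR_distribution_pushforward[OF U _ hol(1) sub] by simp
    next
      case k: (Suc k')
      show ?thesis
      proof (intro allI impI)
        fix p v assume p: "p \<in> M \<inter> U" and v: "v \<in> weak_derived_flag M (Suc k) p"
        let ?G = "\<lambda>N p. {lie_bracket X Y p | X Y. \<exists>U. open U \<and> p \<in> U \<and>
            section_on N (CR_distribution N) U X \<and> section_on N (weak_derived_flag N k) U Y}"
        have lin: "linear (frechet_derivative \<phi> (at p))"
          using linear_frechet_derivative_smooth[OF s\<phi>] p by blast
        have gens: "frechet_derivative \<phi> (at p) ` ?G M p \<subseteq> ?G N (\<phi> p)"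
        proof
          fix y assume "y \<in> frechet_derivative \<phi> (at p) ` ?G M p"
          then obtain X Y O' where XY: "y = frechet_derivative \<phi> (at p) (lie_bracket X Y p)" "open O'" "p \<in> O'"
            "section_on M (CR_distribution M) O' X" "section_on M (weak_derived_flag M k) O' Y"
            by blast
          define W where "W = U \<inter> O'"
          define W' where "W' = V \<inter> \<psi> -` W"
          have W: "open W" "p \<in> W" using U XY p by (auto simp: W_def)
          have W': "open W'" unfolding W'_def
            by (rule continuous_open_preimage[OF smooth_on_continuous_on[OF s\<psi>] V W(1)])
          have rel: "\<phi> z \<in> W' \<and> \<psi> (\<phi> z) = z" if "z \<in> W" for z
            using that \<phi>V \<psi>\<phi> by (auto simp: W_def W'_def)
          have \<psi>W: "\<psi> w \<in> W" if "w \<in> W'" for w using that by (simp add: W'_def)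
          have sW: "smooth_on \<phi> W" "smooth_on \<psi> W'" "smooth_on X W" "smooth_on Y W"
            using XY(4,5) smooth_on_subset[OF s\<phi>, of W] smooth_on_subset[OF s\<psi>, of W']
              smooth_on_subset[of X O' W] smooth_on_subset[of Y O' W]
            by (simp_all add: W_def W'_def section_on_def)
          define push where "push X w = frechet_derivative \<phi> (at (\<psi> w)) (X (\<psi> w))" for X w
          have spush: "smooth_on (push Z) W'" if "smooth_on Z W" for Z
            unfolding push_def
            by (rule smooth_on_compose[OF W' W(1) _ smooth_on_derivative_apply[OF W(1) sW(1) that] sW(2)])
              (use \<psi>W in auto)
          have pt: "\<psi> q \<in> M \<inter> U \<and> \<psi> q \<in> M \<inter> O' \<and> \<phi> (\<psi> q) = q" if "q \<in> N \<inter> W'" for q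
            using bck[of q] \<psi>W[of q] \<phi>\<psi>[of q] that by (auto simp: W'_def W_def)
          have "section_on N (CR_distribution N) W' (push X)"
            unfolding section_on_def
          proof (intro conjI ballI spush sW)
            fix q assume q: "q \<in> N \<inter> W'"
            have "X (\<psi> q) \<in> CR_distribution M (\<psi> q)" using XY(4) pt[OF q] by (simp add: section_on_def)
            then show "push X q \<in> CR_distribution N q"
              using CR_distribution_pushforward[OF U _ hol(1) sub, of "\<psi> q" "X (\<psi> q)"] pt[OF q] by (simp add: push_def)
          qed
          moreover have "section_on N (weak_derived_flag N k) W' (push Y)"
            unfolding section_on_def
          proof (intro conjI ballI spush sW)
            fix q assume q: "q \<in> N \<inter> W'"
            have "Y (\<psi> q) \<in> weak_derived_flag M k (\<psi> q)" using XY(5) pt[OF q] by (simp add: section_on_def)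
            then have "frechet_derivative \<phi> (at (\<psi> q)) (Y (\<psi> q)) \<in> weak_derived_flag N k (\<phi> (\<psi> q))"
              using Suc.IH pt[OF q] by blast
            then show "push Y q \<in> weak_derived_flag N k q" using pt[OF q] by (simp add: push_def)
          qed
          moreover have "y = lie_bracket (push X) (push Y) (\<phi> p)"
            unfolding XY(1) push_def
            by (rule lie_bracket_pushforward[OF W W' _ sW(1,2) \<psi>W rel sW(3,4), symmetric]) (use rel[OF W(2)] in blast)
          moreover have "\<phi> p \<in> W'" using rel W by blast
          ultimately show "y \<in> ?G N (\<phi> p)" using W' by blast
        qed
        have "v \<in> span (?G M p)" using v unfolding k by (simp add: bracket_distribution_def)
        then have "frechet_derivative \<phi> (at p) v \<in> span (frechet_derivative \<phi> (at p) ` ?G M p)"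
          using linear_span_image[OF lin] by blast
        then have "frechet_derivative \<phi> (at p) v \<in> span (?G N (\<phi> p))" using span_mono[OF gens] by blast
        then show "frechet_derivative \<phi> (at p) v \<in> weak_derived_flag N (Suc k) (\<phi> p)"
          unfolding k by (simp add: bracket_distribution_def)
      qed
    qed
  qed
  show "p \<in> M \<inter> U \<Longrightarrow> v \<in> weak_derived_flag M k p \<Longrightarrow>
     frechet_derivative \<phi> (at p) v \<in> weak_derived_flag N k (\<phi> p)"
    using main by blast
qed


section \<open>Tangent spaces and closed forms on a rigid graph\<close>

locale rigid_graph =
  fixes V :: "(complex ^ 'n) set" and i :: 'n and f :: "'n \<Rightarrow> complex \<Rightarrow> real"
  assumes openV: "open V" and f: "\<And>k. k \<noteq> i \<Longrightarrow> smooth_on (f k) ((\<lambda>w. w $ i) ` V)"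
begin

definition S :: "complex set" where "S = (\<lambda>w. w $ i) ` V"

definition N :: "(complex ^ 'n) set" where "N = {w \<in> V. \<forall>k. k \<noteq> i \<longrightarrow> Re (w $ k) = f k (w $ i)}"

lemma openS: "open S" unfolding S_def by (rule open_nth_image[OF openV])

lemma N_V: "w \<in> N \<Longrightarrow> w \<in> V" by (simp add: N_def)

lemma V_S: "w \<in> V \<Longrightarrow> w $ i \<in> S" by (simp add: S_def)

lemma fS: "k \<noteq> i \<Longrightarrow> smooth_on (f k) S" unfolding S_def by (rule f)

lemma smooth_on_base: "smooth_on g S \<Longrightarrow> smooth_on (\<lambda>w. g (w $ i)) V"
  by (rule smooth_on_compose[OF openV openS _ _ smooth_on_bounded_linear[OF openV bounded_linear_vec_nth]])
    (auto simp: S_def)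

lemma has_derivative_base:
  assumes "smooth_on g S" "w \<in> V"
  shows "((\<lambda>w. g (w $ i)) has_derivative (\<lambda>u. frechet_derivative g (at (w $ i)) (u $ i))) (at w)"
  using diff_chain_at[OF bounded_linear_imp_has_derivative[OF bounded_linear_vec_nth] smooth_on_has_derivative[OF assms(1) V_S[OF assms(2)]]]
  by (simp add: o_def)

abbreviation Df :: "'n \<Rightarrow> complex ^ 'n \<Rightarrow> complex \<Rightarrow> real" where
  "Df k w a \<equiv> frechet_derivative (f k) (at (w $ i)) a"

lemma tangent_vanish:
  assumes v: "v \<in> tangent_space N w" and O': "open O'" "w \<in> O'"
    and G: "(G has_derivative G') (at w)" "\<And>q. q \<in> N \<inter> O' \<Longrightarrow> G q = (0 :: real)"
  shows "G' v = 0"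
proof -
  obtain \<gamma> :: "real \<Rightarrow> complex ^ 'n" and \<epsilon> where \<gamma>: "\<epsilon> > 0" "smooth_on \<gamma> {-\<epsilon><..<\<epsilon>}" "\<gamma> ` {-\<epsilon><..<\<epsilon>} \<subseteq> N"
    "\<gamma> 0 = w" "(\<gamma> has_vector_derivative v) (at 0)"
    using v unfolding tangent_space_def by blast
  have op: "open ({-\<epsilon><..<\<epsilon>} \<inter> \<gamma> -` O')"
    by (rule continuous_open_preimage[OF smooth_on_continuous_on[OF \<gamma>(2)] _ O'(1)]) auto
  have 0: "0 \<in> {-\<epsilon><..<\<epsilon>} \<inter> \<gamma> -` O'" using \<gamma> O' by auto
  have 1: "((\<lambda>t. G (\<gamma> t)) has_derivative (\<lambda>h. G' (h *\<^sub>R v))) (at 0)"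
    using diff_chain_at[OF \<gamma>(5)[unfolded has_vector_derivative_def], of G G'] G(1) \<gamma>(4) by (simp add: o_def)
  have "((\<lambda>t. G (\<gamma> t)) has_derivative (\<lambda>h. 0)) (at 0)"
  proof (rule has_derivative_transform_within_open[OF has_derivative_const[of 0] op 0])
    fix t assume "t \<in> {-\<epsilon><..<\<epsilon>} \<inter> \<gamma> -` O'"
    then have "\<gamma> t \<in> N \<inter> O'" using \<gamma>(3) by blast
    then show "0 = G (\<gamma> t)" by (rule G(2)[symmetric])
  qed
  from fun_cong[OF has_derivative_unique[OF 1 this], of 1] show ?thesis by simp
qed

lemma tangent_space_N:
  assumes w: "w \<in> N"
  shows "v \<in> tangent_space N w \<longleftrightarrow> (\<forall>k. k \<noteq> i \<longrightarrow> Re (v $ k) = Df k w (v $ i))"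
proof (intro iffI allI impI)
  fix k assume v: "v \<in> tangent_space N w" and k: "k \<noteq> i"
  have "Re (v $ k) - Df k w (v $ i) = 0"
  proof (rule tangent_vanish[OF v openV N_V[OF w], where G = "\<lambda>w. Re (w $ k) - f k (w $ i)"])
    show "((\<lambda>w. Re (w $ k) - f k (w $ i)) has_derivative (\<lambda>u. Re (u $ k) - Df k w (u $ i))) (at w)"
      by (intro has_derivative_diff has_derivative_base[OF fS[OF k] N_V[OF w]]
          bounded_linear_imp_has_derivative bounded_linear_compose[OF bounded_linear_Re bounded_linear_vec_nth])
    show "\<And>q. q \<in> N \<inter> V \<Longrightarrow> Re (q $ k) - f k (q $ i) = 0" using k by (simp add: N_def)
  qed
  then show "Re (v $ k) = Df k w (v $ i)" by simp
next
  assume v: "\<forall>k. k \<noteq> i \<longrightarrow> Re (v $ k) = Df k w (v $ i)"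
  \<comment> \<open>The witness curve moves its base point on a straight line and its imaginary
    parts linearly; the real parts are dictated by the graph.\<close>
  define \<beta> where "\<beta> t = w $ i + t *\<^sub>R v $ i" for t :: real
  define \<gamma> where "\<gamma> t = (\<chi> k. if k = i then \<beta> t else complex_of_real (f k (\<beta> t)) + \<i> * complex_of_real (Im (w $ k) + t * Im (v $ k)))" for t
  have \<beta>0: "\<beta> 0 = w $ i" by (simp add: \<beta>_def)
  have D\<beta>: "(\<beta> has_derivative (\<lambda>h. h *\<^sub>R v $ i)) (at t)" for t
    unfolding \<beta>_def by (auto intro!: derivative_eq_intros)
  have s\<beta>: "smooth_on \<beta> A" if "open A" for A
    unfolding \<beta>_def
    by (intro smooth_on_add[OF that] smooth_on_const[OF that] smooth_on_bounded_linear[OF that]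
        bounded_linear_scaleR_left)
  have "open (\<beta> -` S)"
    using continuous_open_preimage[OF smooth_on_continuous_on[OF s\<beta>[OF open_UNIV]] open_UNIV openS] by simp
  moreover have "0 \<in> \<beta> -` S" using V_S[OF N_V[OF w]] by (simp add: \<beta>0)
  ultimately obtain \<delta>1 where \<delta>1: "\<delta>1 > 0" "ball 0 \<delta>1 \<subseteq> \<beta> -` S" using open_contains_ball by blast
  have s\<gamma>: "smooth_on \<gamma> (ball 0 \<delta>1)"
    unfolding \<gamma>_def
  proof (rule smooth_on_vec_lambda)
    fix k
    show "smooth_on (\<lambda>t. if k = i then \<beta> t else complex_of_real (f k (\<beta> t)) + \<i> * complex_of_real (Im (w $ k) + t * Im (v $ k))) (ball 0 \<delta>1)"
    proof (cases "k = i")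
      case True then show ?thesis using s\<beta> by simp
    next
      case False
      have s1: "smooth_on (\<lambda>t. f k (\<beta> t)) (ball 0 \<delta>1)"
        by (rule smooth_on_compose[OF open_ball openS _ fS[OF False] s\<beta>[OF open_ball]]) (use \<delta>1 in auto)
      have s2: "smooth_on (\<lambda>t. Im (w $ k) + t * Im (v $ k)) (ball 0 \<delta>1)"
        by (intro smooth_on_add[OF open_ball] smooth_on_const[OF open_ball]
            smooth_on_bounded_linear[OF open_ball bounded_linear_mult_left])
      have "smooth_on (\<lambda>t. complex_of_real (f k (\<beta> t)) + \<i> * complex_of_real (Im (w $ k) + t * Im (v $ k))) (ball 0 \<delta>1)"
        by (rule smooth_on_add[OF open_ball smooth_on_linear_comp[OF open_ball bounded_linear_of_real s1]
            smooth_on_linear_comp[OF open_ball bounded_linear_mult_right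
              smooth_on_linear_comp[OF open_ball bounded_linear_of_real s2]]])
      then show ?thesis using False by simp
    qed
  qed simp
  have \<gamma>0: "\<gamma> 0 = w" using w by (auto simp: \<gamma>_def \<beta>0 vec_eq_iff N_def complex_eq_iff)
  have "open (ball 0 \<delta>1 \<inter> \<gamma> -` V)"
    by (rule continuous_open_preimage[OF smooth_on_continuous_on[OF s\<gamma>] open_ball openV])
  moreover have "0 \<in> ball 0 \<delta>1 \<inter> \<gamma> -` V" using \<gamma>0 N_V[OF w] \<delta>1 by simp
  ultimately obtain \<delta> where \<delta>: "\<delta> > 0" "ball 0 \<delta> \<subseteq> ball 0 \<delta>1 \<inter> \<gamma> -` V" using open_contains_ball by blast
  have b: "{-\<delta><..<\<delta>} = ball 0 \<delta>" by (auto simp: dist_real_def)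
  have "smooth_on \<gamma> {-\<delta><..<\<delta>}" unfolding b by (rule smooth_on_subset[OF s\<gamma>]) (use \<delta> in blast)
  moreover have "\<gamma> ` {-\<delta><..<\<delta>} \<subseteq> N"
  proof
    fix y assume "y \<in> \<gamma> ` {-\<delta><..<\<delta>}"
    then obtain t where t: "t \<in> ball 0 \<delta>" "y = \<gamma> t" unfolding b by blast
    then have "y \<in> V" using \<delta> by blast
    then show "y \<in> N" unfolding N_def t by (auto simp: \<gamma>_def)
  qed
  moreover have "(\<gamma> has_vector_derivative v) (at 0)"
    unfolding has_vector_derivative_def
  proof (rule has_derivative_cart)
    fix k
    show "((\<lambda>t. \<gamma> t $ k) has_derivative (\<lambda>h. (h *\<^sub>R v) $ k)) (at 0)"
    proof (cases "k = i")
      case True then show ?thesis using D\<beta> by (simp add: \<gamma>_def)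
    next
      case False
      have "(f k has_derivative frechet_derivative (f k) (at (w $ i))) (at (\<beta> 0))"
        unfolding \<beta>0 by (rule smooth_on_has_derivative[OF fS[OF False] V_S[OF N_V[OF w]]])
      from diff_chain_at[OF D\<beta> this]
      have "((\<lambda>t. f k (\<beta> t)) has_derivative (\<lambda>h. Df k w (h *\<^sub>R v $ i))) (at 0)" by (simp add: o_def)
      moreover have "Df k w (h *\<^sub>R v $ i) = h * Re (v $ k)" for h
        using v False linear_cmul[OF linear_frechet_derivative_smooth[OF fS[OF False] V_S[OF N_V[OF w]]]] by simp
      ultimately have 1: "((\<lambda>t. f k (\<beta> t)) has_derivative (\<lambda>h. h * Re (v $ k))) (at 0)" by simp
      have 2: "((\<lambda>t. Im (w $ k) + t * Im (v $ k)) has_derivative (\<lambda>h. h * Im (v $ k))) (at 0)"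
        by (auto intro!: derivative_eq_intros)
      have "((\<lambda>t. complex_of_real (f k (\<beta> t)) + \<i> * complex_of_real (Im (w $ k) + t * Im (v $ k))) has_derivative
          (\<lambda>h. complex_of_real (h * Re (v $ k)) + \<i> * complex_of_real (h * Im (v $ k)))) (at 0)"
        by (intro has_derivative_add has_derivative_mult_right
            bounded_linear.has_derivative[OF bounded_linear_of_real 1] bounded_linear.has_derivative[OF bounded_linear_of_real 2])
      moreover have "complex_of_real (h * Re (v $ k)) + \<i> * complex_of_real (h * Im (v $ k)) = (h *\<^sub>R v) $ k" for h
        by (simp add: complex_eq_iff)
      ultimately show ?thesis using False by (simp add: \<gamma>_def del: vector_scaleR_component)
    qed
  qed
  ultimately show "v \<in> tangent_space N w"
    unfolding tangent_space_def using \<delta>(1) \<gamma>0 by blast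
qed

text \<open>Membership means that \<open>v\<close> and \<open>(- \<i>) *s v\<close> are both
  tangent; the second condition fixes the imaginary parts.\<close>

lemma CR_distribution_N:
  assumes w: "w \<in> N"
  shows "v \<in> CR_distribution N w \<longleftrightarrow> (\<forall>k. k \<noteq> i \<longrightarrow> v $ k = of_real (Df k w (v $ i)) - \<i> * of_real (Df k w (\<i> * v $ i)))"
proof -
  have "v \<in> CR_distribution N w \<longleftrightarrow> v \<in> tangent_space N w \<and> (- \<i>) *s v \<in> tangent_space N w"
  proof
    assume "v \<in> CR_distribution N w"
    then show "v \<in> tangent_space N w \<and> (- \<i>) *s v \<in> tangent_space N w"
      unfolding CR_distribution_def by auto
  next
    assume "v \<in> tangent_space N w \<and> (- \<i>) *s v \<in> tangent_space N w"
    moreover have "v = \<i> *s ((- \<i>) *s v)" by simp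
    ultimately show "v \<in> CR_distribution N w" unfolding CR_distribution_def by blast
  qed
  also have "\<dots> \<longleftrightarrow> (\<forall>k. k \<noteq> i \<longrightarrow> Re (v $ k) = Df k w (v $ i) \<and> Im (v $ k) = - Df k w (\<i> * v $ i))"
  proof -
    have "Df k w (- (\<i> * v $ i)) = - Df k w (\<i> * v $ i)" if "k \<noteq> i" for k
      using linear_neg[OF linear_frechet_derivative_smooth[OF fS[OF that] V_S[OF N_V[OF w]]]] .
    then show ?thesis unfolding tangent_space_N[OF w] by auto
  qed
  also have "\<dots> \<longleftrightarrow> (\<forall>k. k \<noteq> i \<longrightarrow> v $ k = of_real (Df k w (v $ i)) - \<i> * of_real (Df k w (\<i> * v $ i)))"
    by (auto simp: complex_eq_iff)
  finally show ?thesis .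
qed

text \<open>One-forms of the shape \<open>L + a dx + b dy\<close> on the graph with \<open>a\<close>, \<open>b\<close> functions of the base point;
  \<open>\<partial>b/\<partial>x = \<partial>a/\<partial>y\<close> means that the form is closed.\<close>

definition form :: "(complex ^ 'n \<Rightarrow> real) \<Rightarrow> (complex \<Rightarrow> real) \<Rightarrow> (complex \<Rightarrow> real) \<Rightarrow> complex ^ 'n \<Rightarrow> complex ^ 'n \<Rightarrow> real" where
  "form L a b w v = L v + a (w $ i) * Re (v $ i) + b (w $ i) * Im (v $ i)"

text \<open>Cartan's formula: for a closed form the value on a bracket is a difference of
  derivatives of its values on the two fields. Those values vanish on \<open>N\<close> only and may
  be differentiated only in tangent directions, whence the tangency conditions at
  \<open>w\<close>.\<close>

lemma closed_form_bracket:
  assumes L: "bounded_linear L" and a: "smooth_on a S" and b: "smooth_on b S"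
    and O': "open O'" "w \<in> O'" "w \<in> N" "w \<in> V"
    and closed: "dir b 1 (w $ i) = dir a \<i> (w $ i)"
    and X: "smooth_on X O'" "X w \<in> tangent_space N w" "\<And>q. q \<in> N \<inter> O' \<Longrightarrow> form L a b q (X q) = 0"
    and Y: "smooth_on Y O'" "Y w \<in> tangent_space N w" "\<And>q. q \<in> N \<inter> O' \<Longrightarrow> form L a b q (Y q) = 0"
  shows "form L a b w (lie_bracket X Y w) = 0"
proof -
  let ?\<zeta> = "w $ i"
  define \<omega> where "\<omega> u v = frechet_derivative a (at ?\<zeta>) (u $ i) * Re (v $ i) + frechet_derivative b (at ?\<zeta>) (u $ i) * Im (v $ i)"
    for u v :: "complex ^ 'n"
  have \<zeta>S: "?\<zeta> \<in> S" by (rule V_S[OF O'(4)])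
  have *: "form L a b w (frechet_derivative Y (at w) u) = - \<omega> u (Y w)"
    if Y: "smooth_on Y O'" "\<And>q. q \<in> N \<inter> O' \<Longrightarrow> form L a b q (Y q) = 0" and u: "u \<in> tangent_space N w" for Y u
  proof -
    let ?DY = "frechet_derivative Y (at w)"
    have DY: "(Y has_derivative ?DY) (at w)" by (rule smooth_on_has_derivative[OF Y(1) O'(2)])
    have "((\<lambda>q. form L a b q (Y q)) has_derivative
        (\<lambda>u. L (?DY u) + (a ?\<zeta> * Re (?DY u $ i) + frechet_derivative a (at ?\<zeta>) (u $ i) * Re (Y w $ i))
            + (b ?\<zeta> * Im (?DY u $ i) + frechet_derivative b (at ?\<zeta>) (u $ i) * Im (Y w $ i)))) (at w)"
      unfolding form_def
      by (intro has_derivative_add has_derivative_mult has_derivative_base a b O'(4)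
          bounded_linear.has_derivative[OF L DY]
          bounded_linear.has_derivative[OF bounded_linear_Re has_derivative_vec_nth[OF DY]]
          bounded_linear.has_derivative[OF bounded_linear_Im has_derivative_vec_nth[OF DY]])
    from tangent_vanish[OF u O'(1,2) this Y(2)] show ?thesis
      by (simp add: form_def \<omega>_def)
  qed
  have lin: "form L a b w (p - q) = form L a b w p - form L a b w q" for p q
    by (simp add: form_def linear_diff[OF bounded_linear.linear[OF L]] algebra_simps)
  have "form L a b w (lie_bracket X Y w) = \<omega> (Y w) (X w) - \<omega> (X w) (Y w)"
    unfolding lie_bracket_def lin using *[OF Y(1,3) X(2)] *[OF X(1,3) Y(2)] by simp
  also have "\<dots> = 0"
    unfolding \<omega>_def
    using complex_derivative_expansion[OF smooth_on_has_derivative[OF a \<zeta>S], of "X w $ i"]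
      complex_derivative_expansion[OF smooth_on_has_derivative[OF a \<zeta>S], of "Y w $ i"]
      complex_derivative_expansion[OF smooth_on_has_derivative[OF b \<zeta>S], of "X w $ i"]
      complex_derivative_expansion[OF smooth_on_has_derivative[OF b \<zeta>S], of "Y w $ i"] closed
    by (simp add: algebra_simps)
  finally show ?thesis .
qed

text \<open>A family of forms is carried through the induction together: sections of the flag must
  be tangent to \<open>N\<close> before \<open>closed_form_bracket\<close> applies, and
  \<open>tang\<close> derives this from the vanishing of all members.\<close>

lemma flag_form_zero:
  fixes L :: "'n \<Rightarrow> complex ^ 'n \<Rightarrow> real"
  assumes L: "\<And>j. bounded_linear (L j)" and a: "\<And>j. smooth_on (a j) S" and b: "\<And>j. smooth_on (b j) S"
    and \<Omega>: "open \<Omega>"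
    and closed: "\<And>j \<zeta>. \<zeta> \<in> S \<inter> \<Omega> \<Longrightarrow> dir (b j) 1 \<zeta> = dir (a j) \<i> \<zeta>"
    and CR: "\<And>j w v. w \<in> N \<Longrightarrow> v \<in> CR_distribution N w \<Longrightarrow> form (L j) (a j) (b j) w v = 0"
    and tang: "\<And>w v. w \<in> N \<Longrightarrow> (\<And>j. form (L j) (a j) (b j) w v = 0) \<Longrightarrow> v \<in> tangent_space N w"
  shows "\<forall>j w v. w \<in> N \<longrightarrow> w $ i \<in> \<Omega> \<longrightarrow> v \<in> weak_derived_flag N k w \<longrightarrow> form (L j) (a j) (b j) w v = 0"
proof (induction k)
  case 0
  then show ?case using linear_0[OF bounded_linear.linear[OF L]] by (simp add: form_def)
next
  case (Suc k)
  show ?case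
  proof (cases k)
    case 0
    then show ?thesis using CR by simp
  next
    case k: (Suc k')
    show ?thesis
    proof (intro allI impI)
      fix j w v assume w: "w \<in> N" "w $ i \<in> \<Omega>" and v: "v \<in> weak_derived_flag N (Suc k) w"
      have lin: "linear (form (L j) (a j) (b j) w)"
        by (rule linearI) (simp_all add: form_def linear_add[OF bounded_linear.linear[OF L]]
            linear_cmul[OF bounded_linear.linear[OF L]] algebra_simps)
      have gens: "form (L j) (a j) (b j) w y = 0"
        if y: "\<exists>X Y. y = lie_bracket X Y w \<and> (\<exists>U. open U \<and> w \<in> U \<and> section_on N (CR_distribution N) U X
            \<and> section_on N (weak_derived_flag N k) U Y)" for y
      proof -
        obtain X Y U where XY: "y = lie_bracket X Y w" "open U" "w \<in> U"
          "section_on N (CR_distribution N) U X" "section_on N (weak_derived_flag N k) U Y"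
          using y by blast
        \<comment> \<open>Closedness and the induction hypothesis are available over
          \<open>\<Omega>\<close> only, so the sections are restricted to the part above it.\<close>
        define O' where "O' = U \<inter> (\<lambda>w. w $ i) -` \<Omega>"
        have O': "open O'" "w \<in> O'"
          unfolding O'_def using XY w by (auto intro!: open_Int open_vimage \<Omega> continuous_intros)
        have X0: "form (L j) (a j) (b j) q (X q) = 0" if "q \<in> N \<inter> O'" for q j
          using CR[of q "X q" j] XY(4) that by (auto simp: section_on_def O'_def)
        have Y0: "form (L j) (a j) (b j) q (Y q) = 0" if "q \<in> N \<inter> O'" for q j
          using Suc.IH XY(5) that by (auto simp: section_on_def O'_def)
        have wO: "w \<in> N \<inter> O'" using O' w by blast
        show ?thesis unfolding XY(1)
        proof (rule closed_form_bracket[OF L a b O' w(1) N_V[OF w(1)]])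
          show "dir (b j) 1 (w $ i) = dir (a j) \<i> (w $ i)" using closed V_S[OF N_V[OF w(1)]] w(2) by blast
          show "smooth_on X O'" "smooth_on Y O'"
            using XY(4,5) smooth_on_subset[of X U O'] smooth_on_subset[of Y U O'] by (auto simp: section_on_def O'_def)
          show "X w \<in> tangent_space N w" "Y w \<in> tangent_space N w"
            using tang[OF w(1)] X0[OF wO] Y0[OF wO] by blast+
        qed (use X0 Y0 in blast)+
      qed
      have "v \<in> span {lie_bracket X Y w | X Y. \<exists>U. open U \<and> w \<in> U \<and> section_on N (CR_distribution N) U X
            \<and> section_on N (weak_derived_flag N k) U Y}"
        using v unfolding k by (simp add: bracket_distribution_def)
      then show "form (L j) (a j) (b j) w v = 0"
        by (rule linear_eq_0_on_span[OF lin _, rotated]) (use gens in blast)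
    qed
  qed
qed

lemma Df_expansion:
  assumes "w \<in> N" "k \<noteq> i"
  shows "Df k w h = Re h * dir (f k) 1 (w $ i) + Im h * dir (f k) \<i> (w $ i)"
  using complex_derivative_expansion[OF smooth_on_has_derivative[OF fS[OF assms(2)] V_S[OF N_V[OF assms(1)]]], of h]
  by simp

text \<open>If a combination of the \<open>f k\<close> is harmonic, the corresponding form
  \<open>\<Sum>\<^sub>k l\<^sub>k (Im dw\<^sub>k + df\<^sub>k(\<i> dw\<^sub>i))\<close> is closed, annihilates \<open>D\<close> and hence the whole flag.\<close>

lemma laplacian_independent:
  assumes gen: "\<And>w. w \<in> N \<Longrightarrow> tangent_space N w \<subseteq> weak_derived_flag N s w"
    and \<Omega>: "open \<Omega>" and w0: "w0 \<in> N" "w0 $ i \<in> \<Omega>"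
    and l: "\<And>\<zeta>. \<zeta> \<in> S \<inter> \<Omega> \<Longrightarrow> (\<Sum>k\<in>-{i}. l k * laplacian (f k) \<zeta>) = 0" and k: "k \<noteq> i"
  shows "l k = 0"
proof -
  \<comment> \<open>The index \<open>i\<close> carries the form of interest. Each other index
    \<open>j\<close> carries the real part of the differential of coordinate \<open>j\<close> minus
    the differential of \<open>f j\<close>; these forms cut out the tangent space.\<close>
  define L where "L j v = (if j = i then \<Sum>k\<in>-{i}. l k * Im (v $ k) else Re (v $ j))" for j and v :: "complex ^ 'n"
  define a where "a j \<zeta> = (if j = i then \<Sum>k\<in>-{i}. l k * dir (f k) \<i> \<zeta> else - dir (f j) 1 \<zeta>)" for j \<zeta>
  define b where "b j \<zeta> = (if j = i then - (\<Sum>k\<in>-{i}. l k * dir (f k) 1 \<zeta>) else - dir (f j) \<i> \<zeta>)" for j \<zeta>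
  have Re_nth: "bounded_linear (\<lambda>v::complex ^ 'n. Re (v $ j))" for j
    by (rule bounded_linear_compose[OF bounded_linear_Re bounded_linear_vec_nth])
  have Im_nth: "bounded_linear (\<lambda>v::complex ^ 'n. Im (v $ j))" for j
    by (rule bounded_linear_compose[OF bounded_linear_Im bounded_linear_vec_nth])
  have bL: "bounded_linear (L j)" for j
  proof (cases "j = i")
    case True
    have "bounded_linear (\<lambda>v::complex ^ 'n. \<Sum>k\<in>-{i}. l k * Im (v $ k))"
      by (intro bounded_linear_sum bounded_linear_compose[OF bounded_linear_mult_right Im_nth])
    then show ?thesis using True by (simp add: L_def[abs_def])
  next
    case False
    then show ?thesis using Re_nth by (simp add: L_def[abs_def])
  qed
  have sdir: "smooth_on (dir (f k) v) S" if "k \<noteq> i" for k v using smooth_on_derivative[OF fS[OF that]] .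
  have ssum: "smooth_on (\<lambda>\<zeta>. \<Sum>k\<in>-{i}. l k * dir (f k) v \<zeta>) S" for v
    by (rule smooth_on_sum[OF openS], rule smooth_on_linear_comp[OF openS bounded_linear_mult_right], rule sdir) auto
  have sa: "smooth_on (a j) S" for j
    using ssum smooth_on_uminus[OF openS sdir] by (cases "j = i") (simp_all add: a_def[abs_def])
  have sb: "smooth_on (b j) S" for j
    using smooth_on_uminus[OF openS ssum] smooth_on_uminus[OF openS sdir] by (cases "j = i") (simp_all add: b_def[abs_def])
  have dsum: "dir (\<lambda>\<zeta>. \<Sum>k\<in>-{i}. l k * dir (f k) v \<zeta>) u \<zeta> = (\<Sum>k\<in>-{i}. l k * dir (dir (f k) v) u \<zeta>)"
    if "\<zeta> \<in> S" for u v \<zeta>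
    by (rule frechet_derivative_eqI, rule has_derivative_sum, rule has_derivative_mult_right,
        rule smooth_on_has_derivative[OF sdir that]) auto
  have dneg: "dir (\<lambda>\<zeta>. - g \<zeta>) u \<zeta> = - dir g u \<zeta>" if "smooth_on g S" "\<zeta> \<in> S" for g :: "complex \<Rightarrow> real" and u \<zeta>
    by (rule frechet_derivative_eqI, rule has_derivative_minus, rule smooth_on_has_derivative[OF that])
  have closed: "dir (b j) 1 \<zeta> = dir (a j) \<i> \<zeta>" if \<zeta>: "\<zeta> \<in> S \<inter> \<Omega>" for j \<zeta>
  proof (cases "j = i")
    case True
    have "dir (b j) 1 \<zeta> = - (\<Sum>k\<in>-{i}. l k * dir (dir (f k) 1) 1 \<zeta>)"
      using True \<zeta> dneg[OF ssum] dsum by (simp add: b_def[abs_def])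
    moreover have "dir (a j) \<i> \<zeta> = (\<Sum>k\<in>-{i}. l k * dir (dir (f k) \<i>) \<i> \<zeta>)"
      using True \<zeta> dsum by (simp add: a_def[abs_def])
    moreover have "(\<Sum>k\<in>-{i}. l k * dir (dir (f k) 1) 1 \<zeta>) + (\<Sum>k\<in>-{i}. l k * dir (dir (f k) \<i>) \<i> \<zeta>) = 0"
      using l[OF \<zeta>] by (simp add: laplacian_def sum.distrib[symmetric] distrib_left)
    ultimately show ?thesis by simp
  next
    case False
    then show ?thesis
      using \<zeta> dneg[OF sdir[OF False]] second_derivative_symmetric[OF openS _ fS[OF False], of \<zeta> 1 \<i>]
      by (simp add: b_def[abs_def] a_def[abs_def])
  qed
  have form_j: "form (L j) (a j) (b j) w v = Re (v $ j) - Df j w (v $ i)" if "w \<in> N" "j \<noteq> i" for j w v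
    using that Df_expansion[OF that, of "v $ i"] by (simp add: form_def L_def a_def b_def)
  have CR: "form (L j) (a j) (b j) w v = 0" if w: "w \<in> N" and v: "v \<in> CR_distribution N w" for j w v
  proof -
    have vk: "Re (v $ k) = Df k w (v $ i)" "Im (v $ k) = - Df k w (\<i> * v $ i)" if "k \<noteq> i" for k
      using v that unfolding CR_distribution_N[OF w] by auto
    show ?thesis
    proof (cases "j = i")
      case True
      have "form (L j) (a j) (b j) w v = (\<Sum>k\<in>-{i}. l k * (Im (v $ k) + dir (f k) \<i> (w $ i) * Re (v $ i) - dir (f k) 1 (w $ i) * Im (v $ i)))"
        using True by (simp add: form_def L_def a_def b_def sum.distrib sum_subtractf sum_distrib_right sum_distrib_left algebra_simps)
      also have "\<dots> = 0"
        by (rule sum.neutral) (use vk Df_expansion[OF w, of _ "\<i> * v $ i"] in \<open>auto simp: algebra_simps\<close>)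
      finally show ?thesis .
    next
      case False
      then show ?thesis using form_j[OF w] vk by simp
    qed
  qed
  have tang: "v \<in> tangent_space N w" if w: "w \<in> N" and v: "\<And>j. form (L j) (a j) (b j) w v = 0" for w v
    unfolding tangent_space_N[OF w] using v form_j[OF w] by (metis eq_iff_diff_eq_0)
  \<comment> \<open>A vertical tangent vector on which the form with index \<open>i\<close> takes
    the value \<open>l k\<close>.\<close>
  define v :: "complex ^ 'n" where "v = axis k \<i>"
  have "v \<in> tangent_space N w0"
    unfolding tangent_space_N[OF w0(1)]
    using linear_0[OF linear_frechet_derivative_smooth[OF fS V_S[OF N_V[OF w0(1)]]]] k by (auto simp: v_def axis_def)
  then have "v \<in> weak_derived_flag N s w0" using gen w0 by blast
  then have "form (L i) (a i) (b i) w0 v = 0"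
    using flag_form_zero[where L = L and a = a and b = b and k = s, OF bL sa sb \<Omega> closed CR tang] w0 by blast
  then show ?thesis
    using k by (simp add: form_def L_def v_def axis_def if_distrib[of "\<lambda>z. Im z"] if_distrib[of "\<lambda>t. _ * t"] sum.delta cong: if_cong)
qed

section \<open>Explicit sections of the flag\<close>

definition base_field :: "('n \<Rightarrow> complex \<Rightarrow> complex) \<Rightarrow> complex ^ 'n \<Rightarrow> complex ^ 'n" where
  "base_field c w = (\<chi> k. c k (w $ i))"

lemma smooth_on_base_field: "(\<And>k. smooth_on (c k) S) \<Longrightarrow> smooth_on (base_field c) V"
  unfolding base_field_def[abs_def] by (rule smooth_on_vec_lambda[OF openV]) (rule smooth_on_base)

lemma has_derivative_base_field:
  assumes "\<And>k. smooth_on (c k) S" "w \<in> V"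
  shows "(base_field c has_derivative (\<lambda>u. \<chi> k. dir (c k) (u $ i) (w $ i))) (at w)"
  by (rule has_derivative_cart) (use has_derivative_base[OF assms] in \<open>simp add: base_field_def\<close>)

lemma lie_bracket_base_field:
  assumes "\<And>k. smooth_on (c k) S" "\<And>k. smooth_on (d k) S" "w \<in> V"
  shows "lie_bracket (base_field c) (base_field d) w
    = (\<chi> k. dir (d k) (c i (w $ i)) (w $ i) - dir (c k) (d i (w $ i)) (w $ i))"
  unfolding lie_bracket_def
    frechet_derivative_eqI[OF has_derivative_base_field[OF assms(1,3)]]
    frechet_derivative_eqI[OF has_derivative_base_field[OF assms(2,3)]]
  by (simp add: base_field_def vec_eq_iff)

text \<open>Coefficients of the complex tangent field that lifts the constant vector
  \<open>a\<close> on the base.\<close>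

definition Lc :: "complex \<Rightarrow> 'n \<Rightarrow> complex \<Rightarrow> complex" where
  "Lc a k \<zeta> = (if k = i then a else of_real (dir (f k) a \<zeta>) + (- \<i>) * of_real (dir (f k) (\<i> * a) \<zeta>))"

text \<open>A vertical field in imaginary directions, hence tangent to the graph, whose equations
  constrain real parts only.\<close>

definition Zc :: "('n \<Rightarrow> complex \<Rightarrow> real) \<Rightarrow> 'n \<Rightarrow> complex \<Rightarrow> complex" where
  "Zc g k \<zeta> = (if k = i then 0 else \<i> * of_real (g k \<zeta>))"

lemma smooth_Lc: "smooth_on (Lc a k) S"
proof (cases "k = i")
  case True
  then show ?thesis using smooth_on_const[OF openS] by (simp add: Lc_def[abs_def])
next
  case False
  have s: "smooth_on (\<lambda>\<zeta>. complex_of_real (dir (f k) a \<zeta>)) S" for a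
    by (rule smooth_on_linear_comp[OF openS bounded_linear_of_real smooth_on_derivative[OF fS[OF False]]])
  have "smooth_on (\<lambda>\<zeta>. of_real (dir (f k) a \<zeta>) + (- \<i>) * of_real (dir (f k) (\<i> * a) \<zeta>)) S"
    by (rule smooth_on_add[OF openS s smooth_on_linear_comp[OF openS bounded_linear_mult_right s]])
  then show ?thesis using False by (simp add: Lc_def[abs_def])
qed

lemma smooth_Zc:
  assumes "\<And>k. k \<noteq> i \<Longrightarrow> smooth_on (g k) S" shows "smooth_on (Zc g k) S"
proof (cases "k = i")
  case True
  then show ?thesis using smooth_on_const[OF openS] by (simp add: Zc_def[abs_def])
next
  case False
  have "smooth_on (\<lambda>\<zeta>. \<i> * complex_of_real (g k \<zeta>)) S"
    by (rule smooth_on_linear_comp[OF openS bounded_linear_mult_right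
          smooth_on_linear_comp[OF openS bounded_linear_of_real assms[OF False]]])
  then show ?thesis using False by (simp add: Zc_def[abs_def])
qed

lemma dir_Lc:
  assumes "k \<noteq> i" "\<zeta> \<in> S"
  shows "dir (Lc a k) u \<zeta> = of_real (dir (dir (f k) a) u \<zeta>) + (- \<i>) * of_real (dir (dir (f k) (\<i> * a)) u \<zeta>)"
proof (rule frechet_derivative_eqI)
  have s: "(dir (f k) a has_derivative (\<lambda>u. dir (dir (f k) a) u \<zeta>)) (at \<zeta>)" for a
    by (rule smooth_on_has_derivative[OF smooth_on_derivative[OF fS[OF assms(1)]] assms(2)])
  show "(Lc a k has_derivative (\<lambda>u. of_real (dir (dir (f k) a) u \<zeta>) + (- \<i>) * of_real (dir (dir (f k) (\<i> * a)) u \<zeta>))) (at \<zeta>)"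
    using has_derivative_add[OF bounded_linear.has_derivative[OF bounded_linear_of_real s]
        has_derivative_mult_right[OF bounded_linear.has_derivative[OF bounded_linear_of_real s]], of a "- \<i>" "\<i> * a"] assms(1)
    by (simp add: Lc_def[abs_def])
qed

lemma dir_Zc:
  assumes "k \<noteq> i" "\<zeta> \<in> S" "smooth_on (g k) S"
  shows "dir (Zc g k) u \<zeta> = \<i> * of_real (dir (g k) u \<zeta>)"
proof (rule frechet_derivative_eqI)
  show "(Zc g k has_derivative (\<lambda>u. \<i> * of_real (dir (g k) u \<zeta>))) (at \<zeta>)"
    using has_derivative_mult_right[OF bounded_linear.has_derivative[OF bounded_linear_of_real smooth_on_has_derivative[OF assms(3,2)]], of \<i>] assms(1)
    by (simp add: Zc_def[abs_def])
qed

lemma dir_const_i: "dir (Lc a i) u \<zeta> = 0" "dir (Zc g i) u \<zeta> = 0"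
  by (simp_all add: Lc_def[abs_def] Zc_def[abs_def] frechet_derivative_const)

lemma section_L: "section_on N (CR_distribution N) V (base_field (Lc a))"
  unfolding section_on_def
proof (intro conjI ballI smooth_on_base_field smooth_Lc)
  fix q assume "q \<in> N \<inter> V"
  then show "base_field (Lc a) q \<in> CR_distribution N q"
    by (subst CR_distribution_N) (auto simp: base_field_def Lc_def)
qed

lemma bracket_in_flag:
  assumes "w \<in> N" "section_on N (weak_derived_flag N (Suc k)) V Y"
  shows "lie_bracket (base_field (Lc a)) Y w \<in> weak_derived_flag N (Suc (Suc k)) w"
proof -
  have "lie_bracket (base_field (Lc a)) Y w \<in> {lie_bracket X Y w | X Y. \<exists>U. open U \<and> w \<in> U \<and>
      section_on N (CR_distribution N) U X \<and> section_on N (weak_derived_flag N (Suc k)) U Y}"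
    using openV N_V[OF assms(1)] section_L assms(2) by blast
  then show ?thesis by (simp add: bracket_distribution_def span_base)
qed

text \<open>With \<open>g = Re (w\<^sub>i - \<zeta>\<^sub>0)\<close> the bracket \<open>[L\<^sub>1, g Y]\<close> equals \<open>Y\<close> at the points over \<open>\<zeta>\<^sub>0\<close>.\<close>

lemma section_next:
  assumes Y: "section_on N (weak_derived_flag N (Suc k)) V Y"
  shows "section_on N (weak_derived_flag N (Suc (Suc k))) V Y"
  unfolding section_on_def
proof (intro conjI ballI)
  show sY: "smooth_on Y V" using Y by (simp add: section_on_def)
  fix q assume "q \<in> N \<inter> V"
  then have q: "q \<in> N" "q \<in> V" by auto
  define g where "g w = Re (w $ i - q $ i)" for w :: "complex ^ 'n"
  have Dg: "(g has_derivative (\<lambda>u. Re (u $ i))) (at w)" for w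
    unfolding g_def
    by (rule has_derivative_eq_rhs, rule bounded_linear.has_derivative[OF bounded_linear_Re
          has_derivative_diff[OF bounded_linear_imp_has_derivative[OF bounded_linear_vec_nth] has_derivative_const]]) simp
  have sg: "smooth_on g V"
    unfolding g_def
    by (rule smooth_on_linear_comp[OF openV bounded_linear_Re smooth_on_diff[OF openV
            smooth_on_bounded_linear[OF openV bounded_linear_vec_nth] smooth_on_const[OF openV]]])
  \<comment> \<open>Needed to multiply sections by functions. The first step of the flag is an
    intersection rather than a span, so its linearity is checked in coordinates.\<close>
  have sub: "subspace (weak_derived_flag N (Suc k) w)" if w: "w \<in> N" for w
  proof (cases k)
    case 0
    have z: "linear (frechet_derivative (f k) (at (w $ i)))" if "k \<noteq> i" for k
      by (rule linear_frechet_derivative_smooth[OF fS[OF that] V_S[OF N_V[OF w]]])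
    have CR: "CR_distribution N w = {v. \<forall>k. k \<noteq> i \<longrightarrow> v $ k = of_real (Df k w (v $ i)) - \<i> * of_real (Df k w (\<i> * v $ i))}"
      using CR_distribution_N[OF w] by blast
    have add: "Df k w (\<i> * (x + y)) = Df k w (\<i> * x) + Df k w (\<i> * y)" if "k \<noteq> i" for k x y
      using linear_add[OF z[OF that], of "\<i> * x" "\<i> * y"] by (simp add: distrib_left)
    have scale: "Df k w (\<i> * (c *\<^sub>R x)) = c * Df k w (\<i> * x)" if "k \<noteq> i" for k c x
      using linear_cmul[OF z[OF that], of c "\<i> * x"] by simp
    have "subspace (CR_distribution N w)"
      unfolding CR
    proof (rule subspaceI)
      show "0 \<in> {v. \<forall>k. k \<noteq> i \<longrightarrow> v $ k = of_real (Df k w (v $ i)) - \<i> * of_real (Df k w (\<i> * v $ i))}"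
        using linear_0[OF z] by simp
    next
      fix x y :: "complex ^ 'n"
      assume "x \<in> {v. \<forall>k. k \<noteq> i \<longrightarrow> v $ k = of_real (Df k w (v $ i)) - \<i> * of_real (Df k w (\<i> * v $ i))}"
        and "y \<in> {v. \<forall>k. k \<noteq> i \<longrightarrow> v $ k = of_real (Df k w (v $ i)) - \<i> * of_real (Df k w (\<i> * v $ i))}"
      then show "x + y \<in> {v. \<forall>k. k \<noteq> i \<longrightarrow> v $ k = of_real (Df k w (v $ i)) - \<i> * of_real (Df k w (\<i> * v $ i))}"
        using linear_add[OF z] by (simp add: add) (simp add: algebra_simps)
    next
      fix c :: real and x :: "complex ^ 'n"
      assume "x \<in> {v. \<forall>k. k \<noteq> i \<longrightarrow> v $ k = of_real (Df k w (v $ i)) - \<i> * of_real (Df k w (\<i> * v $ i))}"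
      then show "c *\<^sub>R x \<in> {v. \<forall>k. k \<noteq> i \<longrightarrow> v $ k = of_real (Df k w (v $ i)) - \<i> * of_real (Df k w (\<i> * v $ i))}"
        using linear_cmul[OF z] by (simp add: scale del: mult_scaleR_right)
          (simp add: algebra_simps scaleR_conv_of_real[where 'a = complex])
    qed
    then show ?thesis using 0 by simp
  next
    case (Suc k')
    then show ?thesis by (simp add: bracket_distribution_def)
  qed
  have "section_on N (weak_derived_flag N (Suc k)) V (\<lambda>w. g w *\<^sub>R Y w)"
    unfolding section_on_def
    using Y sub by (auto intro!: smooth_on_scaleR openV sg simp: section_on_def subspace_scale)
  from bracket_in_flag[OF q(1) this, of 1]
  have "lie_bracket (base_field (Lc 1)) (\<lambda>w. g w *\<^sub>R Y w) q \<in> weak_derived_flag N (Suc (Suc k)) q" .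
  moreover have "lie_bracket (base_field (Lc 1)) (\<lambda>w. g w *\<^sub>R Y w) q = Y q"
  proof -
    have "frechet_derivative (\<lambda>w. g w *\<^sub>R Y w) (at q) u = g q *\<^sub>R frechet_derivative Y (at q) u + Re (u $ i) *\<^sub>R Y q" for u
      by (rule frechet_derivative_eqI, rule has_derivative_scaleR[OF Dg smooth_on_has_derivative[OF sY q(2)]])
    moreover have "frechet_derivative (base_field (Lc 1)) (at q) 0 = 0"
      using linear_0[OF has_derivative_linear[OF smooth_on_has_derivative[OF smooth_on_base_field[OF smooth_Lc] q(2)]]] .
    ultimately show ?thesis
      by (simp add: lie_bracket_def g_def base_field_def Lc_def)
  qed
  ultimately show "Y q \<in> weak_derived_flag N (Suc (Suc k)) q" by simp
qed

lemma section_bracket: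
  assumes Y: "section_on N (weak_derived_flag N (Suc k)) V Y" and Z: "smooth_on Z V"
    and eq: "\<And>w. w \<in> V \<Longrightarrow> lie_bracket (base_field (Lc a)) Y w = Z w"
  shows "section_on N (weak_derived_flag N (Suc (Suc k))) V Z"
  unfolding section_on_def
proof (intro conjI ballI Z)
  fix q assume "q \<in> N \<inter> V"
  then show "Z q \<in> weak_derived_flag N (Suc (Suc k)) q"
    using bracket_in_flag[OF _ Y, of q a] eq[of q] by simp
qed

text \<open>The third step contains the horizontal fields \<open>Lc a\<close>, the field
  \<open>Zc h\<close> that arises as bracket of \<open>Lc 1\<close> with \<open>Lc \<i>\<close>, and
  the derivatives of \<open>Zc h\<close> along the base. Rank at most 4 forces a relation; its
  horizontal part is zero because of coordinate \<open>i\<close>, so it relates \<open>h\<close> to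
  its derivatives.\<close>

lemma laplacian_dependent:
  assumes w: "w \<in> N" and dim: "dim (weak_derived_flag N 3 w) \<le> 4"
  shows "\<exists>\<alpha> v. (\<alpha> \<noteq> 0 \<or> v \<noteq> 0) \<and> (\<forall>k. k \<noteq> i \<longrightarrow> \<alpha> * laplacian (f k) (w $ i) + dir (laplacian (f k)) v (w $ i) = 0)"
proof (rule ccontr)
  assume no: "\<not> ?thesis"
  define h where "h k = laplacian (f k)" for k
  have h: "smooth_on (h k) S" if "k \<noteq> i" for k unfolding h_def by (rule smooth_on_laplacian[OF openS fS[OF that]])
  have S1: "section_on N (weak_derived_flag N (Suc 0)) V (base_field (Lc a))" for a using section_L by simp
  have S2: "section_on N (weak_derived_flag N (Suc (Suc 0))) V (base_field (Zc h))"
  proof (rule section_bracket[OF S1])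
    show "smooth_on (base_field (Zc h)) V" by (rule smooth_on_base_field[OF smooth_Zc[OF h]])
    fix w assume wV: "w \<in> V"
    show "lie_bracket (base_field (Lc 1)) (base_field (Lc \<i>)) w = base_field (Zc h) w"
      unfolding lie_bracket_base_field[OF smooth_Lc smooth_Lc wV]
    proof (subst vec_eq_iff, intro allI)
      fix k
      show "(\<chi> k. dir (Lc \<i> k) (Lc 1 i (w $ i)) (w $ i) - dir (Lc 1 k) (Lc \<i> i (w $ i)) (w $ i)) $ k = base_field (Zc h) w $ k"
      proof (cases "k = i")
        case True
        then show ?thesis by (simp add: dir_const_i base_field_def Zc_def)
      next
        case False
        note wS = V_S[OF wV]
        have m1: "dir (f k) (\<i> * \<i>) \<zeta> = - dir (f k) 1 \<zeta>" if "\<zeta> \<in> S" for \<zeta>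
          using linear_neg[OF linear_frechet_derivative_smooth[OF fS[OF False] that], of 1] by simp
        have "dir (dir (f k) (\<i> * \<i>)) 1 (w $ i) = - dir (dir (f k) 1) 1 (w $ i)"
        proof (rule frechet_derivative_eqI[where f' = "\<lambda>u. - dir (dir (f k) 1) u (w $ i)"])
          show "(dir (f k) (\<i> * \<i>) has_derivative (\<lambda>u. - dir (dir (f k) 1) u (w $ i))) (at (w $ i))"
            by (rule has_derivative_transform_within_open[OF has_derivative_minus[OF smooth_on_has_derivative[OF
                      smooth_on_derivative[OF fS[OF False]] wS]] openS wS]) (rule m1[symmetric])
        qed
        then show ?thesis
          using False second_derivative_symmetric[OF openS wS fS[OF False], of 1 \<i>]
          by (simp add: dir_Lc[OF False wS] Lc_def[of _ i] base_field_def Zc_def h_def laplacian_def algebra_simps)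
      qed
    qed
  qed
  have S3L: "section_on N (weak_derived_flag N (Suc (Suc (Suc 0)))) V (base_field (Lc a))" for a
    by (rule section_next[OF section_next[OF S1]])
  have S3h: "section_on N (weak_derived_flag N (Suc (Suc (Suc 0)))) V (base_field (Zc h))"
    by (rule section_next[OF S2])
  have S3dh: "section_on N (weak_derived_flag N (Suc (Suc (Suc 0)))) V (base_field (Zc (\<lambda>k. dir (h k) a)))" for a
  proof (rule section_bracket[OF S2])
    show "smooth_on (base_field (Zc (\<lambda>k. dir (h k) a))) V"
      by (rule smooth_on_base_field[OF smooth_Zc[OF smooth_on_derivative[OF h]]])
    fix w assume wV: "w \<in> V"
    note wS = V_S[OF wV]
    have "dir (Zc h k) (Lc a i (w $ i)) (w $ i) - dir (Lc a k) (Zc h i (w $ i)) (w $ i) = Zc (\<lambda>k. dir (h k) a) k (w $ i)" for k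
    proof -
      have z: "dir (Lc a k) 0 (w $ i) = 0"
        using linear_0[OF linear_frechet_derivative_smooth[OF smooth_Lc wS]] .
      show ?thesis
      proof (cases "k = i")
        case True
        then show ?thesis by (simp add: dir_const_i Zc_def)
      next
        case False
        then show ?thesis using z dir_Zc[OF False wS, of h] h[OF False] by (simp add: Lc_def[of _ i] Zc_def)
      qed
    qed
    moreover have "lie_bracket (base_field (Lc a)) (base_field (Zc h)) w
        = (\<chi> k. dir (Zc h k) (Lc a i (w $ i)) (w $ i) - dir (Lc a k) (Zc h i (w $ i)) (w $ i))"
      by (rule lie_bracket_base_field[OF smooth_Lc smooth_Zc wV]) (rule h)
    ultimately show "lie_bracket (base_field (Lc a)) (base_field (Zc h)) w = base_field (Zc (\<lambda>k. dir (h k) a)) w"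
      by (simp add: base_field_def)
  qed
  define E where "E = weak_derived_flag N (Suc (Suc (Suc 0))) w"
  have subE: "subspace E" by (simp add: E_def bracket_distribution_def)
  have wV: "w \<in> V" and wS: "w $ i \<in> S" using N_V[OF w] V_S by auto
  have inE: "base_field (Lc a) w \<in> E" "base_field (Zc h) w \<in> E" "base_field (Zc (\<lambda>k. dir (h k) a)) w \<in> E" for a
    using S3L S3h S3dh w wV by (auto simp: section_on_def E_def)
  \<comment> \<open>Five real parameters: two for the horizontal lift, one for \<open>h\<close> and
    two for its derivatives. Without a relation \<open>G\<close> would be injective into the third
    step of the flag.\<close>
  define G :: "complex \<times> real \<times> complex \<Rightarrow> complex ^ 'n" where
    "G = (\<lambda>(a, \<alpha>, v). base_field (Lc a) w + \<alpha> *\<^sub>R base_field (Zc h) w + base_field (Zc (\<lambda>k. dir (h k) v)) w)"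
  have linf: "linear (frechet_derivative (f k) (at (w $ i)))" if "k \<noteq> i" for k
    by (rule linear_frechet_derivative_smooth[OF fS[OF that] wS])
  have linh: "linear (frechet_derivative (h k) (at (w $ i)))" if "k \<noteq> i" for k
    by (rule linear_frechet_derivative_smooth[OF h[OF that] wS])
  have G: "G (a, \<alpha>, v) $ k = (if k = i then a else of_real (dir (f k) a (w $ i)) + \<i> *
      (of_real (\<alpha> * h k (w $ i) + dir (h k) v (w $ i)) - of_real (dir (f k) (\<i> * a) (w $ i))))" for a \<alpha> v k
    by (simp add: G_def base_field_def Lc_def Zc_def algebra_simps scaleR_conv_of_real[where 'a = complex])
  have linG: "linear G"
  proof (rule linearI)
    fix x y :: "complex \<times> real \<times> complex"
    obtain a \<alpha> v where x: "x = (a, \<alpha>, v)" by (cases x)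
    obtain a' \<alpha>' v' where y: "y = (a', \<alpha>', v')" by (cases y)
    show "G (x + y) = G x + G y"
      by (simp add: vec_eq_iff G x y linear_add[OF linf] linear_add[OF linh] algebra_simps)
  next
    fix c :: real and x :: "complex \<times> real \<times> complex"
    obtain a \<alpha> v where x: "x = (a, \<alpha>, v)" by (cases x)
    have lf: "Df k w (c *\<^sub>R a) = c * Df k w a" "Df k w (\<i> * (c *\<^sub>R a)) = c * Df k w (\<i> * a)" if "k \<noteq> i" for k
      using linear_cmul[OF linf[OF that], of c a] linear_cmul[OF linf[OF that], of c "\<i> * a"] by simp_all
    have lh: "dir (h k) (c *\<^sub>R v) (w $ i) = c * dir (h k) v (w $ i)" if "k \<noteq> i" for k
      using linear_cmul[OF linh[OF that], of c v] by simp
    show "G (c *\<^sub>R x) = c *\<^sub>R G x"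
    proof (subst vec_eq_iff, rule allI)
      fix k
      have "c *\<^sub>R x = (c *\<^sub>R a, c * \<alpha>, c *\<^sub>R v)" by (simp add: x)
      then show "G (c *\<^sub>R x) $ k = (c *\<^sub>R G x) $ k"
        unfolding x by (cases "k = i")
          (simp_all add: G lf lh del: mult_scaleR_right, simp add: algebra_simps scaleR_conv_of_real[where 'a = complex])
    qed
  qed
  have inj: "inj G"
    unfolding linear_injective_0[OF linG]
  proof (intro allI impI)
    fix x assume x0: "G x = 0"
    obtain a \<alpha> v where x: "x = (a, \<alpha>, v)" by (cases x)
    have "G (a, \<alpha>, v) $ i = 0" using x0 x by simp
    then have a: "a = 0" by (simp add: G)
    have "\<alpha> * h k (w $ i) + dir (h k) v (w $ i) = 0" if k: "k \<noteq> i" for k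
    proof -
      have "G (a, \<alpha>, v) $ k = 0" using x0 x by simp
      then have "\<i> * of_real (\<alpha> * h k (w $ i) + dir (h k) v (w $ i)) = 0"
        using k a linear_0[OF linf[OF k]] by (simp add: G del: of_real_add of_real_mult)
      then show ?thesis by (simp del: of_real_add of_real_mult)
    qed
    then have "\<alpha> = 0 \<and> v = 0" using no unfolding h_def by blast
    then show "x = 0" using a x by (simp add: zero_prod_def)
  qed
  have "dim (range G) = DIM(complex \<times> real \<times> complex)"
    using dim_image_eq[OF linG, of UNIV] inj by (simp add: dim_UNIV)
  moreover have "range G \<subseteq> E"
  proof
    fix y assume "y \<in> range G"
    then obtain a \<alpha> v where y: "y = G (a, \<alpha>, v)" by auto
    show "y \<in> E" unfolding y G_def using subE inE by (auto intro!: subspace_add subspace_scale)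
  qed
  ultimately have "5 \<le> dim E" using dim_subset[of "range G" E] by simp
  then show False using dim by (simp add: E_def numeral_3_eq_3)
qed

end

section \<open>Uniqueness\<close>

text \<open>Each weighted homogeneous equation is preserved by the dilations, and the origin, the
  base point of the rescaling, is the limit of the contracted copies of any point of
  \<open>M\<close>.\<close>

lemma CR_model_cone:
  assumes "CR_model M"
  obtains \<mu> where "closed M" "\<And>k. \<mu> k > 0" "\<And>t z. t > 0 \<Longrightarrow> z \<in> M \<Longrightarrow> cscale \<mu> (of_real t) z \<in> M"
    "M \<noteq> {} \<Longrightarrow> 0 \<in> M"
proof -
  obtain \<mu> Ps where \<mu>: "\<And>k. \<mu> k > 0" and
    Ps: "\<And>P. P \<in> Ps \<Longrightarrow> real_polynomial_function P \<and> weighted_homogeneous \<mu> P" and M: "M = {z. \<forall>P\<in>Ps. P z = 0}"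
    using assms unfolding CR_model_def by blast
  have "closed {z. P z = 0}" if "P \<in> Ps" for P
  proof -
    have "continuous_on UNIV P"
      using Ps[OF that] continuous_real_polymonial_function continuous_at_imp_continuous_on by blast
    then show ?thesis by (intro closed_Collect_eq continuous_on_const)
  qed
  moreover have "M = (\<Inter>P\<in>Ps. {z. P z = 0})" using M by auto
  ultimately have cl: "closed M" by auto
  have sc: "cscale \<mu> (of_real t) z \<in> M" if t: "t > 0" and z: "z \<in> M" for t z
    unfolding M
  proof (intro CollectI ballI)
    fix P assume P: "P \<in> Ps"
    then obtain d where "P (weighted_scaling \<mu> t z) = t ^ d * P z"
      using Ps t unfolding weighted_homogeneous_def by blast
    then show "P (cscale \<mu> (of_real t) z) = 0" using z P M by (simp add: weighted_scaling_eq)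
  qed
  have "0 \<in> M" if ne: "M \<noteq> {}"
  proof -
    obtain z where z: "z \<in> M" using ne by blast
    have lim: "((\<lambda>t. cscale \<mu> (of_real t) z) \<longlongrightarrow> 0) (at_right 0)"
    proof (rule vec_tendstoI)
      fix k
      have "((\<lambda>t. of_real t ^ \<mu> k * z $ k) \<longlongrightarrow> 0 ^ \<mu> k * z $ k) (at_right 0)"
        by (intro tendsto_mult tendsto_power at_right_0_tendsto(1) tendsto_const)
      then show "((\<lambda>t. cscale \<mu> (of_real t) z $ k) \<longlongrightarrow> 0 $ k) (at_right 0)" using \<mu>[of k] by (simp add: zero_power)
    qed
    have "\<forall>\<^sub>F t in at_right 0. cscale \<mu> (of_real t) z \<in> M"
      using at_right_0_tendsto(3) by (rule eventually_mono) (rule sc[OF _ z])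
    then show ?thesis by (rule Lim_in_closed_set[OF cl _ trivial_limit_at_right_real lim])

  qed
  then show ?thesis using that cl \<mu> sc by blast
qed

section \<open>Coordinates adapted to the normal form\<close>

lemma linear_inj_if_no_annihilator:
  fixes A :: "'a::euclidean_space \<Rightarrow> 'a"
  assumes A: "linear A" and no: "\<And>a. (\<And>v. a \<bullet> A v = 0) \<Longrightarrow> a = 0"
  shows "inj A" "surj A"
proof -
  show "surj A"
  proof (rule ccontr)
    assume "range A \<noteq> UNIV"
    moreover have "span (range A) = range A"
      using linear_subspace_image[OF A subspace_UNIV] span_eq_iff by blast
    ultimately have "span (range A) \<subset> span (UNIV :: 'a set)"
      by (metis psubsetI span_UNIV subset_UNIV)
    then obtain x where x: "x \<noteq> 0" "\<And>y. y \<in> span (range A) \<Longrightarrow> orthogonal x y"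
      using orthogonal_to_subspace_exists_gen by metis
    have "x \<bullet> A v = 0" for v using x(2)[OF span_base, of "A v"] by (simp add: orthogonal_def)
    then show False using no x(1) by blast
  qed
  then show "inj A" using linear_surjective_imp_injective[OF A] by simp
qed

text \<open>The normal form is realised by a global biholomorphism: an invertible linear map forms
  the combinations \<open>l\<close>, entire functions \<open>Q\<close> are subtracted, and the base
  coordinate is translated and multiplied by \<open>c\<close>. Coordinate \<open>k\<close> receives
  the combination with number \<open>e k - 2\<close>, because its exponent is to be
  \<open>e k\<close>.\<close>

lemma normalize_rigid_graph:
  fixes f :: "'n::finite \<Rightarrow> complex \<Rightarrow> real" and w1 :: "complex ^ 'n"
  assumes e: "bij_betw e UNIV {1..CARD('n)}" "e i0 = 1" and m': "m' = CARD('n) - 1"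
    and b: "bij_betw b {..<m'} (-{i})" and c: "c \<noteq> 0"
    and linv: "\<And>c'. \<forall>k<m'. (\<Sum>j<m'. c' j * l j k) = 0 \<Longrightarrow> \<forall>j<m'. c' j = (0 :: real)"
    and Q: "\<And>j. j < m' \<Longrightarrow> Q j holomorphic_on UNIV"
    and B: "open B" "z \<in> B" and f: "\<And>k. k \<noteq> i \<Longrightarrow> smooth_on (f k) B"
    and van: "\<And>j. j < m' \<Longrightarrow> vanishes (j + 3) (\<lambda>x. (\<Sum>k<m'. l j k * f (b k) x) - Re (Q j x) - Re (c * (x - z)) ^ (j + 2)) z"
    and w1: "w1 $ i = z" "\<And>k. k \<noteq> i \<Longrightarrow> Re (w1 $ k) = f k z"
  shows "\<exists>F K R. K \<ge> 0 \<and> R > 0 \<and> F i0 = Re \<and>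
    (\<forall>k \<zeta>. norm \<zeta> < R \<longrightarrow> \<bar>F k \<zeta> - Re \<zeta> ^ e k\<bar> \<le> K * norm \<zeta> ^ Suc (e k)) \<and>
    locally_biholomorphic_at {w. \<forall>k. k \<noteq> i \<longrightarrow> Re (w $ k) = f k (w $ i)} w1 {w. \<forall>k. Re (w $ k) = F k (w $ i0)} 0"
proof -
  have e_inj: "e k = e k' \<longleftrightarrow> k = k'" for k k' using e(1) by (auto simp: bij_betw_def inj_on_def)
  have e_ge: "e k - 2 < m' \<and> e k - 2 + 2 = e k" if "k \<noteq> i0" for k
  proof -
    have "e k \<in> {1..CARD('n)}" using e(1) by (auto simp: bij_betw_def)
    moreover have "e k \<noteq> 1" using e_inj[of k i0] e(2) that by simp
    ultimately show ?thesis unfolding m' by auto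
  qed
  have ek: "bij_betw (\<lambda>k. e k - 2) (-{i0}) {..<m'}"
  proof (rule bij_betwI[where g = "\<lambda>j. inv e (j + 2)"])
    have eq: "e (inv e (j + 2)) = j + 2" if "j < m'" for j
    proof (rule f_inv_into_f)
      have "j + 2 \<in> {1..CARD('n)}" using that unfolding m' by auto
      then show "j + 2 \<in> range e" using e(1) by (simp add: bij_betw_def)
    qed
    show "(\<lambda>k. e k - 2) \<in> -{i0} \<rightarrow> {..<m'}" using e_ge by auto
    show "(\<lambda>j. inv e (j + 2)) \<in> {..<m'} \<rightarrow> -{i0}" using eq e(2) by fastforce
    show "inv e (e k - 2 + 2) = k" if "k \<in> -{i0}" for k
      using e_ge[of k] that e(1) by (simp add: bij_betw_def)
    show "e (inv e (j + 2)) - 2 = j" if "j \<in> {..<m'}" for j using eq that by simp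
  qed
  have bi: "b k \<noteq> i" if "k < m'" for k using b that by (auto simp: bij_betw_def)
  have b_inj: "b k = b k' \<longleftrightarrow> k = k'" if "k < m'" "k' < m'" for k k'
    using b that by (auto simp: bij_betw_def inj_on_def)
  define A :: "complex ^ 'n \<Rightarrow> complex ^ 'n" where
    "A v = (\<chi> k. if k = i0 then c * v $ i else \<Sum>k'<m'. of_real (l (e k - 2) k') * v $ b k')" for v
  have A_nth: "A v $ i0 = c * v $ i" "k \<noteq> i0 \<Longrightarrow> A v $ k = (\<Sum>k'<m'. of_real (l (e k - 2) k') * v $ b k')" for v k
    by (simp_all add: A_def)
  have A_add: "A (u + v) = A u + A v" for u v
    by (simp add: A_def vec_eq_iff distrib_left sum.distrib)
  have A_scale: "A (a *s v) = a *s A v" for a v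
    by (simp add: A_def vec_eq_iff sum_distrib_left mult_ac)
  have scaleR_eq: "r *\<^sub>R v = of_real r *s v" for r and v :: "complex ^ 'n"
    by (simp add: vec_eq_iff scaleR_conv_of_real[where 'a = complex])
  have linA: "linear A" by (rule linearI) (simp_all add: A_add A_scale scaleR_eq)
  \<comment> \<open>Translates independence of the rows of the real matrix \<open>l\<close> into
    invertibility of the complex map: a vector orthogonal to the range, tested on the axes, yields a
    relation between the rows.\<close>
  have noann: "a = 0" if a: "\<And>v. a \<bullet> A v = 0" for a
  proof -
    have ai0: "a $ i0 = 0"
    proof -
      have "A (axis i (a $ i0 / c)) = axis i0 (a $ i0)"
      proof (subst vec_eq_iff, rule allI)
        fix k show "A (axis i (a $ i0 / c)) $ k = axis i0 (a $ i0) $ k"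
          using c bi by (cases "k = i0") (auto simp: A_nth axis_def intro!: sum.neutral)
      qed
      then have "a $ i0 \<bullet> a $ i0 = 0" using a[of "axis i (a $ i0 / c)"] by (simp add: inner_axis)
      then show ?thesis by simp
    qed
    have aj: "\<forall>j<m'. a $ inv_into (-{i0}) (\<lambda>k. e k - 2) j \<bullet> u = 0" for u
    proof (rule linv, intro allI impI)
      fix k assume k: "k < m'"
      have Ak: "A (axis (b k) u) $ j = of_real (l (e j - 2) k) * u" if "j \<noteq> i0" for j
      proof -
        have "A (axis (b k) u) $ j = (\<Sum>k'<m'. if k' = k then of_real (l (e j - 2) k') * u else 0)"
          unfolding A_nth(2)[OF that] by (rule sum.cong) (use k b_inj in \<open>auto simp: axis_def\<close>)
        then show ?thesis using k by simp
      qed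
      have "0 = a \<bullet> A (axis (b k) u)" using a by simp
      also have "\<dots> = (\<Sum>j\<in>-{i0}. a $ j \<bullet> A (axis (b k) u) $ j)"
        unfolding inner_vec_def
        by (rule sum.mono_neutral_right) (use bi[OF k] in \<open>auto simp: A_nth axis_def\<close>)
      also have "\<dots> = (\<Sum>j\<in>-{i0}. a $ j \<bullet> u * l (e j - 2) k)"
        by (rule sum.cong) (auto simp: Ak inner_complex_def algebra_simps)
      also have "\<dots> = (\<Sum>j\<in>-{i0}. a $ inv_into (-{i0}) (\<lambda>k. e k - 2) (e j - 2) \<bullet> u * l (e j - 2) k)"
        by (rule sum.cong) (use inv_into_f_f[OF bij_betw_imp_inj_on[OF ek]] in auto)
      also have "\<dots> = (\<Sum>j<m'. a $ inv_into (-{i0}) (\<lambda>k. e k - 2) j \<bullet> u * l j k)"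
        by (rule sum.reindex_bij_betw[OF ek])
      finally show "(\<Sum>j<m'. a $ inv_into (-{i0}) (\<lambda>k. e k - 2) j \<bullet> u * l j k) = 0" by simp
    qed
    have "a $ k = 0" if "k \<noteq> i0" for k
    proof -
      have "inv_into (-{i0}) (\<lambda>k. e k - 2) (e k - 2) = k"
        using inv_into_f_f[OF bij_betw_imp_inj_on[OF ek]] that by simp
      then have "a $ k \<bullet> a $ k = 0" using aj[of "a $ k"] e_ge[OF that] by metis
      then show ?thesis by simp
    qed
    then show "a = 0" using ai0 by (metis vec_eq_iff zero_index)
  qed
  have injA: "inj A" and surjA: "surj A" using linear_inj_if_no_annihilator[OF linA noann] by blast+
  define A' where "A' = inv A"
  have AA': "A (A' y) = y" for y unfolding A'_def by (rule surj_f_inv_f[OF surjA])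
  have A'A: "A' (A v) = v" for v unfolding A'_def by (rule inv_f_f[OF injA])
  have holA: "holomorphic_map_on A UNIV"
    unfolding holomorphic_map_on_iff
  proof
    fix k show "holomorphic_fun_on (\<lambda>z. A z $ k) UNIV"
      by (cases "k = i0") (auto simp: A_nth intro!: holomorphic_fun_on_cmult holomorphic_fun_on_nth holomorphic_fun_on_sum)
  qed
  have linA': "linear A'"
    by (rule linearI) (metis A'A AA' A_add, metis A'A AA' A_scale scaleR_eq)
  have holA': "holomorphic_map_on A' UNIV"
    unfolding holomorphic_map_on_def
  proof (intro ballI exI conjI)
    fix z
    show "(A' has_derivative A') (at z)"
      using linA' linear_conv_bounded_linear bounded_linear_imp_has_derivative by blast
    have "A' (a *s v) = a *s A' v" for a v by (metis A'A AA' A_scale)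
    then show "Vector_Spaces.linear (*s) (*s) A'"
      using linear_add[OF linA']
      by unfold_locales (auto simp: vec.scale_right_distrib vec.scale_left_distrib)
  qed
  \<comment> \<open>Purely imaginary constants, so that the real equations are unaffected; they make
    \<open>X\<close> send \<open>w1\<close> to 0.\<close>
  define con where "con k = \<i> * of_real (Im (A w1 $ k - Q (e k - 2) z))" for k
  define q :: "complex \<Rightarrow> complex ^ 'n" where "q \<zeta> = (\<chi> k. if k = i0 then c * z else Q (e k - 2) \<zeta> + con k)" for \<zeta>
  define X where "X w = A w - q (w $ i)" for w
  \<comment> \<open>Coordinate \<open>i0\<close> of \<open>X w\<close> determines
    \<open>w $ i\<close>, so the nonlinear part can be added back before \<open>A\<close> is
    inverted.\<close>
  define Y where "Y y = A' (y + q (z + inverse c * y $ i0))" for y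
  have X_i0: "X w $ i0 = c * (w $ i - z)" for w by (simp add: X_def A_nth q_def algebra_simps)
  have base: "z + inverse c * (X w $ i0) = w $ i" for w unfolding X_i0 using c by (simp add: field_simps)
  have YX: "Y (X w) = w" for w unfolding Y_def base by (simp add: X_def A'A)
  have XY: "X (Y y) = y" for y
  proof -
    have "c * (Y y $ i) = A (Y y) $ i0" by (simp add: A_nth)
    also have "\<dots> = y $ i0 + c * z" unfolding Y_def AA' by (simp add: q_def)
    finally have "Y y $ i = z + inverse c * y $ i0" using c by (simp add: field_simps)
    then show ?thesis unfolding X_def by (simp add: Y_def AA')
  qed
  have holq: "holomorphic_fun_on (\<lambda>w. q (p w) $ k) UNIV" if "holomorphic_map_on (\<lambda>w. axis i (p w) :: complex ^ 'n) UNIV"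
    for p :: "complex ^ 'n \<Rightarrow> complex" and k
  proof (cases "k = i0")
    case True
    then show ?thesis by (simp add: q_def holomorphic_fun_on_const)
  next
    case False
    have "holomorphic_fun_on (\<lambda>v. Q (e k - 2) (v $ i)) UNIV"
      by (rule holomorphic_fun_on_one_variable[OF Q open_UNIV]) (use e_ge[OF False] in auto)
    from holomorphic_fun_on_compose[OF this that]
    have "holomorphic_fun_on (\<lambda>w. Q (e k - 2) (p w)) UNIV" by (simp add: axis_def)
    then show ?thesis using False by (simp add: q_def holomorphic_fun_on_add holomorphic_fun_on_const)
  qed
  have hol_axis: "holomorphic_map_on (\<lambda>w. axis i (p w) :: complex ^ 'n) UNIV" if "holomorphic_fun_on p UNIV"
    for p :: "complex ^ 'n \<Rightarrow> complex"
    unfolding holomorphic_map_on_iff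
  proof
    fix k show "holomorphic_fun_on (\<lambda>w. (axis i (p w) :: complex ^ 'n) $ k) UNIV"
      using that by (cases "k = i") (simp_all add: axis_def holomorphic_fun_on_const)
  qed
  have holX: "holomorphic_map_on X UNIV"
    unfolding holomorphic_map_on_iff X_def
    using holA holq[OF hol_axis[OF holomorphic_fun_on_nth]]
    by (auto simp: holomorphic_map_on_iff intro: holomorphic_fun_on_diff)
  have holY: "holomorphic_map_on Y UNIV"
  proof -
    have p: "holomorphic_fun_on (\<lambda>y. z + inverse c * y $ i0) (UNIV :: (complex ^ 'n) set)"
      by (intro holomorphic_fun_on_add holomorphic_fun_on_const holomorphic_fun_on_cmult holomorphic_fun_on_nth)
    have "holomorphic_map_on (\<lambda>y. y + q (z + inverse c * y $ i0)) UNIV"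
      unfolding holomorphic_map_on_iff
      using holq[OF hol_axis[OF p]] by (auto intro: holomorphic_fun_on_add holomorphic_fun_on_nth)
    then show ?thesis unfolding Y_def by (rule holomorphic_map_on_compose[OF holA']) auto
  qed
  have bih: "biholomorphism_between X UNIV UNIV"
    by (rule biholomorphism_betweenI[OF open_UNIV open_UNIV holX holY]) (simp_all add: XY YX)
  define G where "G j x = (\<Sum>k<m'. l j k * f (b k) x) - Re (Q j x)" for j x
  have Gz: "G j z = 0" if "j < m'" for j
    using vanishes_mono[OF van[OF that], of 1] by (simp add: G_def)
  define F where "F k \<zeta> = (if k = i0 then Re \<zeta> else G (e k - 2) (z + inverse c * \<zeta>))" for k \<zeta>
  have ReA: "Re (A w $ k) = (\<Sum>k'<m'. l (e k - 2) k' * Re (w $ b k'))" if "k \<noteq> i0" for w k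
    by (simp add: A_nth(2)[OF that])
  have Xw1: "X w1 = 0"
  proof (subst vec_eq_iff, rule allI)
    fix k
    show "X w1 $ k = 0 $ k"
    proof (cases "k = i0")
      case True
      then show ?thesis using X_i0 w1(1) by simp
    next
      case False
      have "Re (A w1 $ k) = (\<Sum>k'<m'. l (e k - 2) k' * f (b k') z)"
        unfolding ReA[OF False] using w1(2) bi by (intro sum.cong) auto
      then have "Re (A w1 $ k) = Re (Q (e k - 2) z)" using Gz[of "e k - 2"] e_ge[OF False] by (simp add: G_def)
      then show ?thesis using False unfolding X_def w1(1) by (simp add: q_def con_def complex_eq_iff)
    qed
  qed
  have graph_iff: "(\<forall>k. k \<noteq> i \<longrightarrow> Re (w $ k) = f k (w $ i)) \<longleftrightarrow> (\<forall>k. Re (X w $ k) = F k (X w $ i0))" for w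
  proof -
    have *: "Re (X w $ k) - F k (X w $ i0) = (\<Sum>k'<m'. l (e k - 2) k' * (Re (w $ b k') - f (b k') (w $ i)))" if "k \<noteq> i0" for k
    proof -
      have "Re (X w $ k) = Re (A w $ k) - Re (Q (e k - 2) (w $ i))"
        using that by (simp add: X_def q_def con_def)
      moreover have "F k (X w $ i0) = G (e k - 2) (w $ i)" using that base[of w] by (simp add: F_def)
      ultimately show ?thesis unfolding ReA[OF that] by (simp add: G_def sum_subtractf right_diff_distrib)
    qed
    show ?thesis
    proof
      assume h: "\<forall>k. k \<noteq> i \<longrightarrow> Re (w $ k) = f k (w $ i)"
      show "\<forall>k. Re (X w $ k) = F k (X w $ i0)"
      proof
        fix k
        show "Re (X w $ k) = F k (X w $ i0)"
        proof (cases "k = i0")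
          case False
          have "(\<Sum>k'<m'. l (e k - 2) k' * (Re (w $ b k') - f (b k') (w $ i))) = 0"
            by (rule sum.neutral) (use h bi in auto)
          then show ?thesis using *[OF False] by simp
        qed (simp add: F_def)
      qed
    next
      assume h: "\<forall>k. Re (X w $ k) = F k (X w $ i0)"
      \<comment> \<open>The new equations involve only combinations of the defects of the old ones;
        injectivity of \<open>A\<close> recovers each defect separately.\<close>
      define v :: "complex ^ 'n" where "v = (\<chi> k. if k = i then 0 else of_real (Re (w $ k) - f k (w $ i)))"
      have "A v = 0"
      proof (subst vec_eq_iff, rule allI)
        fix k
        show "A v $ k = 0 $ k"
        proof (cases "k = i0")
          case True then show ?thesis by (simp add: A_nth v_def)
        next
          case False
          have "A v $ k = of_real (\<Sum>k'<m'. l (e k - 2) k' * (Re (w $ b k') - f (b k') (w $ i)))"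
            unfolding A_nth(2)[OF False] of_real_sum by (rule sum.cong) (use bi in \<open>auto simp: v_def\<close>)
          moreover have "(\<Sum>k'<m'. l (e k - 2) k' * (Re (w $ b k') - f (b k') (w $ i))) = 0"
            using *[OF False] h by simp
          ultimately show ?thesis by (simp only: of_real_0 zero_index)
        qed
      qed
      then have "v = 0" using injA linA linear_injective_0 by blast
      show "\<forall>k. k \<noteq> i \<longrightarrow> Re (w $ k) = f k (w $ i)"
      proof (intro allI impI)
        fix k assume "k \<noteq> i"
        moreover have "v $ k = 0" using \<open>v = 0\<close> by simp
        ultimately have "complex_of_real (Re (w $ k) - f k (w $ i)) = 0" by (simp only: v_def vec_lambda_beta if_False)
        then have "Re (w $ k) - f k (w $ i) = 0" by (rule of_real_eq_0_iff[THEN iffD1])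
        then show "Re (w $ k) = f k (w $ i)" by simp
      qed
    qed
  qed
  have lb: "locally_biholomorphic_at {w. \<forall>k. k \<noteq> i \<longrightarrow> Re (w $ k) = f k (w $ i)} w1 {w. \<forall>k. Re (w $ k) = F k (w $ i0)} 0"
    unfolding locally_biholomorphic_at_def
  proof (rule exI[of _ UNIV], rule exI[of _ UNIV], rule exI[of _ X], intro conjI)
    show "X ` ({w. \<forall>k. k \<noteq> i \<longrightarrow> Re (w $ k) = f k (w $ i)} \<inter> UNIV) = {w. \<forall>k. Re (w $ k) = F k (w $ i0)} \<inter> UNIV"
    proof (intro equalityI subsetI)
      fix y assume "y \<in> X ` ({w. \<forall>k. k \<noteq> i \<longrightarrow> Re (w $ k) = f k (w $ i)} \<inter> UNIV)"
      then show "y \<in> {w. \<forall>k. Re (w $ k) = F k (w $ i0)} \<inter> UNIV" using graph_iff by blast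
    next
      fix y assume "y \<in> {w. \<forall>k. Re (w $ k) = F k (w $ i0)} \<inter> UNIV"
      then have "\<forall>k. Re (X (Y y) $ k) = F k (X (Y y) $ i0)" unfolding XY by blast
      then have "Y y \<in> {w. \<forall>k. k \<noteq> i \<longrightarrow> Re (w $ k) = f k (w $ i)} \<inter> UNIV" using graph_iff by blast
      then show "y \<in> X ` ({w. \<forall>k. k \<noteq> i \<longrightarrow> Re (w $ k) = f k (w $ i)} \<inter> UNIV)"
        using image_eqI[where f = X and x = "Y y" and b = y, OF XY[symmetric]] by blast
    qed
  qed (simp_all add: bih Xw1)
  have "\<exists>C \<delta>. C \<ge> 0 \<and> \<delta> > 0 \<and> (\<forall>x\<in>ball z \<delta>. \<bar>G j x - Re (c * (x - z)) ^ (j + 2)\<bar> \<le> C * norm (x - z) ^ (j + 3))"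
    if j: "j < m'" for j
  proof (rule vanishes_bound[OF B])
    have sQ: "smooth_on (Q j) B"
      using holomorphic_on_imp_smooth_on[OF open_UNIV Q[OF j]] smooth_on_subset by blast
    show "smooth_on (\<lambda>x. G j x - Re (c * (x - z)) ^ (j + 2)) B"
      unfolding G_def
      by (intro smooth_on_diff smooth_on_power smooth_on_Re_linear smooth_on_sum B(1)
          smooth_on_linear_comp[OF B(1) bounded_linear_Re sQ])
        (rule smooth_on_linear_comp[OF B(1) bounded_linear_mult_right f], use bi in auto)
    show "vanishes (j + 3) (\<lambda>x. G j x - Re (c * (x - z)) ^ (j + 2)) z"
      unfolding G_def by (rule van[OF j])
  qed
  then have "\<exists>C \<delta>. \<forall>j<m'. C j \<ge> 0 \<and> \<delta> j > 0 \<and> (\<forall>x\<in>ball z (\<delta> j). \<bar>G j x - Re (c * (x - z)) ^ (j + 2)\<bar> \<le> C j * norm (x - z) ^ (j + 3))"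
    by metis
  then obtain C \<delta> where C: "\<And>j. j < m' \<Longrightarrow> C j \<ge> (0::real)" and \<delta>: "\<And>j. j < m' \<Longrightarrow> \<delta> j > (0::real)"
    and bd: "\<And>j x. j < m' \<Longrightarrow> x \<in> ball z (\<delta> j) \<Longrightarrow> \<bar>G j x - Re (c * (x - z)) ^ (j + 2)\<bar> \<le> C j * norm (x - z) ^ (j + 3)"
    by blast
  \<comment> \<open>Powers of \<open>inverse (norm c)\<close> come from
    \<open>x - z = inverse c * \<zeta>\<close>, and the sum dominates all indices at once. In
    \<open>R\<close> the inserted 1 keeps the set under the minimum non-empty.\<close>
  define K where "K = (\<Sum>j<m'. C j * inverse (norm c) ^ (j + 3))"
  define R where "R = norm c * Min (insert 1 (\<delta> ` {..<m'}))"
  have K: "K \<ge> 0" unfolding K_def by (rule sum_nonneg) (use C in auto)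
  have R: "R > 0" unfolding R_def using c \<delta> by (intro mult_pos_pos) auto
  have bound: "\<bar>F k \<zeta> - Re \<zeta> ^ e k\<bar> \<le> K * norm \<zeta> ^ Suc (e k)" if \<zeta>: "norm \<zeta> < R" for k \<zeta>
  proof (cases "k = i0")
    case True
    then show ?thesis using e(2) K by (simp add: F_def)
  next
    case False
    define j where "j = e k - 2"
    have j: "j < m'" "e k = j + 2" using e_ge[OF False] by (auto simp: j_def)
    define x where "x = z + inverse c * \<zeta>"
    have xz: "x - z = inverse c * \<zeta>" "c * (x - z) = \<zeta>" using c by (simp_all add: x_def)
    have nxz: "norm (x - z) = inverse (norm c) * norm \<zeta>" unfolding xz by (simp add: norm_mult norm_inverse)
    have "Min (insert 1 (\<delta> ` {..<m'})) \<le> \<delta> j" using j by (intro Min_le) auto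
    then have "norm c * Min (insert 1 (\<delta> ` {..<m'})) \<le> norm c * \<delta> j" by (intro mult_left_mono) auto
    then have "norm \<zeta> < norm c * \<delta> j" using \<zeta> unfolding R_def by linarith
    then have "norm (x - z) < \<delta> j" unfolding nxz using c by (simp add: field_simps)
    then have "x \<in> ball z (\<delta> j)" by (simp add: dist_norm norm_minus_commute)
    from bd[OF j(1) this] have "\<bar>G j x - Re \<zeta> ^ (j + 2)\<bar> \<le> C j * norm (x - z) ^ (j + 3)" unfolding xz(2) .
    also have "\<dots> = (C j * inverse (norm c) ^ (j + 3)) * norm \<zeta> ^ (j + 3)"
      unfolding nxz by (simp only: power_mult_distrib mult.assoc)
    also have "\<dots> \<le> K * norm \<zeta> ^ (j + 3)"
      unfolding K_def by (intro mult_right_mono member_le_sum) (use j C in auto)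
    finally have "\<bar>G j x - Re \<zeta> ^ (j + 2)\<bar> \<le> K * norm \<zeta> ^ (j + 3)" .
    moreover have "F k \<zeta> = G j x" using False by (simp add: F_def j_def x_def)
    moreover have "Suc (e k) = j + 3" using j by simp
    ultimately show ?thesis by (simp only: j(2))
  qed
  have "F i0 = Re" by (simp add: F_def[abs_def])
  then show ?thesis using K R bound lb by blast
qed

section \<open>The chart at the origin and comparison with the model\<close>

lemma frechet_derivative_inverse_pair:
  assumes "smooth_on \<phi> U" "smooth_on \<psi> V" "open V" "w \<in> V" "\<psi> w \<in> U" "\<And>w. w \<in> V \<Longrightarrow> \<phi> (\<psi> w) = w"
  shows "frechet_derivative \<phi> (at (\<psi> w)) (frechet_derivative \<psi> (at w) v) = v"
proof -
  have 1: "((\<lambda>w. \<phi> (\<psi> w)) has_derivative (\<lambda>v. frechet_derivative \<phi> (at (\<psi> w)) (frechet_derivative \<psi> (at w) v))) (at w)"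
    using diff_chain_at[OF smooth_on_has_derivative[OF assms(2,4)] smooth_on_has_derivative[OF assms(1,5)]] by (simp add: o_def)
  have "((\<lambda>w. \<phi> (\<psi> w)) has_derivative (\<lambda>v. v)) (at w)"
    by (rule has_derivative_transform_within_open[OF has_derivative_ident assms(3,4)]) (simp add: assms(6))
  from fun_cong[OF has_derivative_unique[OF 1 this], of v] show ?thesis .
qed

text \<open>The flag of \<open>M\<close> is carried to the graph to meet the hypotheses of
  \<open>rigid_normal_form\<close>: independence comes from bracket generation, dependence from the
  third entry of the growth vector.\<close>

lemma graph_chart_at_origin:
  fixes M :: "(complex ^ 'n) set"
  assumes n: "CARD('n) > 1" and bg: "bracket_generating M"
    and gv: "has_reduced_growth_vector M (2 # replicate (CARD('n) - 1) 1)"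
    and rig: "rigid M" and hom: "locally_homogeneous M" and M0: "0 \<in> M"
    and e: "bij_betw e UNIV {1..CARD('n)}" "e i0 = 1"
  shows "\<exists>F K R. K \<ge> 0 \<and> R > 0 \<and> F i0 = Re \<and>
    (\<forall>k \<zeta>. norm \<zeta> < R \<longrightarrow> \<bar>F k \<zeta> - Re \<zeta> ^ e k\<bar> \<le> K * norm \<zeta> ^ Suc (e k)) \<and>
    locally_biholomorphic_at M 0 {w. \<forall>k. Re (w $ k) = F k (w $ i0)} 0"
proof -
  obtain U V \<phi> i f where 0: "0 \<in> U" and bih: "biholomorphism_between \<phi> U V"
    and f: "\<And>k. k \<noteq> i \<Longrightarrow> smooth_on (f k) ((\<lambda>w. w $ i) ` V)"
    and graph: "\<phi> ` (M \<inter> U) = {w \<in> V. \<forall>k. k \<noteq> i \<longrightarrow> Re (w $ k) = f k (w $ i)}"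
    using rig M0 unfolding rigid_def by meson
  obtain \<psi> where bih': "biholomorphism_between \<psi> V U" and \<psi>\<phi>: "\<And>z. z \<in> U \<Longrightarrow> \<psi> (\<phi> z) = z" and \<phi>\<psi>: "\<And>w. w \<in> V \<Longrightarrow> \<phi> (\<psi> w) = w"
    using biholomorphism_between_inverse[OF bih] by metis
  have U: "open U" and V: "open V" and \<phi>V: "\<And>z. z \<in> U \<Longrightarrow> \<phi> z \<in> V" and \<psi>U: "\<And>w. w \<in> V \<Longrightarrow> \<psi> w \<in> U"
    using bih bih' by (auto simp: biholomorphism_between_def bij_betw_def)
  have s\<phi>: "smooth_on \<phi> U" and s\<psi>: "smooth_on \<psi> V"
    using bih bih' holomorphic_map_on_imp_smooth_on by (auto simp: biholomorphism_between_def)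
  interpret rigid_graph V i f by unfold_locales (use V f in auto)
  have MN: "\<phi> ` (M \<inter> U) = N \<inter> V" unfolding graph N_def by auto
  have NM: "\<psi> ` (N \<inter> V) = M \<inter> U"
    unfolding MN[symmetric] image_image using \<psi>\<phi> by (auto simp: image_iff)
  have \<psi>M: "\<psi> w \<in> M \<inter> U" if "w \<in> N" for w using NM that N_V by blast
  have inv: "frechet_derivative \<phi> (at (\<psi> w)) (frechet_derivative \<psi> (at w) v) = v" if "w \<in> V" for w v
    by (rule frechet_derivative_inverse_pair[OF s\<phi> s\<psi> V that \<psi>U[OF that] \<phi>\<psi>])
  obtain s where s: "\<And>p. p \<in> M \<Longrightarrow> weak_derived_flag M s p = tangent_space M p"
    using bg unfolding bracket_generating_def by blast
  have gen: "tangent_space N w \<subseteq> weak_derived_flag N s w" if w: "w \<in> N" for w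
  proof
    fix v assume "v \<in> tangent_space N w"
    then have "frechet_derivative \<psi> (at w) v \<in> tangent_space M (\<psi> w)"
      using tangent_space_pushforward[OF V N_V[OF w] s\<psi>, of N M] NM by blast
    then have "frechet_derivative \<psi> (at w) v \<in> weak_derived_flag M s (\<psi> w)" using s \<psi>M[OF w] by blast
    from weak_derived_flag_pushforward[OF bih MN \<psi>M[OF w] this]
    show "v \<in> weak_derived_flag N s w" using inv[OF N_V[OF w]] \<phi>\<psi>[OF N_V[OF w]] by simp
  qed
  \<comment> \<open>4 is 2 + 1 + 1. For \<open>CARD('n) = 2\<close> the growth vector has no third
    entry; accordingly \<open>rigid_normal_form\<close> asks for dependence only if
    \<open>N \<ge> 2\<close>.\<close>
  have dim3: "dim (weak_derived_flag N 3 w) \<le> 4" if n3: "CARD('n) \<ge> 3" and w: "w \<in> N" for w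
  proof -
    let ?rs = "2 # replicate (CARD('n) - 1) 1 :: nat list"
    have p: "\<psi> w \<in> M" using \<psi>M[OF w] by blast
    have step: "dim (weak_derived_flag M (Suc k) (\<psi> w)) = dim (weak_derived_flag M k (\<psi> w)) + ?rs ! k"
      if "k < length ?rs" for k
      using gv p that unfolding has_reduced_growth_vector_def by blast
    have "dim (weak_derived_flag M 3 (\<psi> w)) = 4"
      using step[of 0] step[of 1] step[of 2] n3 by (simp add: numeral_2_eq_2 numeral_3_eq_3 del: weak_derived_flag.simps(2,3))
    moreover have "dim (weak_derived_flag N 3 w) = dim (frechet_derivative \<psi> (at w) ` weak_derived_flag N 3 w)"
    proof (rule dim_image_eq[symmetric])
      show "linear (frechet_derivative \<psi> (at w))" by (rule linear_frechet_derivative_smooth[OF s\<psi> N_V[OF w]])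
      show "inj_on (frechet_derivative \<psi> (at w)) (span (weak_derived_flag N 3 w))"
        by (rule inj_on_inverseI[where g = "frechet_derivative \<phi> (at (\<psi> w))"]) (rule inv[OF N_V[OF w]])
    qed
    moreover have "frechet_derivative \<psi> (at w) ` weak_derived_flag N 3 w \<subseteq> weak_derived_flag M 3 (\<psi> w)"
      using weak_derived_flag_pushforward[OF bih' NM] w N_V by blast
    ultimately show ?thesis using dim_subset by metis
  qed
  define w0 where "w0 = \<phi> 0"
  have w0: "w0 \<in> N" using MN M0 0 unfolding w0_def by blast
  \<comment> \<open>A section of the graph over the base. Imaginary parts do not enter the equations
    and are kept equal to those of \<open>w0\<close>.\<close>
  define lift :: "complex \<Rightarrow> complex ^ 'n" where "lift \<zeta> = (\<chi> k. if k = i then \<zeta> else of_real (f k \<zeta>) + \<i> * of_real (Im (w0 $ k)))" for \<zeta>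
  have lift_i: "lift \<zeta> $ i = \<zeta>" for \<zeta> by (simp add: lift_def)
  have lift_Re: "Re (lift \<zeta> $ k) = f k \<zeta>" if "k \<noteq> i" for k \<zeta> using that by (simp add: lift_def)
  have slift: "smooth_on lift S"
    unfolding lift_def[abs_def]
  proof (rule smooth_on_vec_lambda[OF openS])
    fix k
    show "smooth_on (\<lambda>\<zeta>. if k = i then \<zeta> else of_real (f k \<zeta>) + \<i> * of_real (Im (w0 $ k))) S"
    proof (cases "k = i")
      case True
      then show ?thesis using smooth_on_bounded_linear[OF openS bounded_linear_ident] by simp
    next
      case False
      then show ?thesis
        using smooth_on_add[OF openS smooth_on_linear_comp[OF openS bounded_linear_of_real fS[OF False]] smooth_on_const[OF openS]]
        by simp
    qed
  qed
  \<comment> \<open>\<open>V\<close> need not be a product, so the lift of a point of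
    \<open>S\<close> may leave \<open>V\<close>; \<open>B\<close> collects the points whose lift
    lies on the graph inside \<open>V\<close>.\<close>
  define B where "B = S \<inter> lift -` V"
  have B: "open B" unfolding B_def by (rule continuous_open_preimage[OF smooth_on_continuous_on[OF slift] openS V])
  have "lift (w0 $ i) = w0"
    using w0 by (auto simp: lift_def vec_eq_iff N_def complex_eq_iff)
  then have "w0 $ i \<in> B" using N_V[OF w0] V_S by (simp add: B_def)
  then have Bne: "B \<noteq> {}" by blast
  have BS: "B \<subseteq> S" by (simp add: B_def)
  have liftN: "lift \<zeta> \<in> N" if "\<zeta> \<in> B" for \<zeta>
    using that unfolding N_def B_def by (auto simp: lift_i lift_Re)
  define m' where "m' = CARD('n) - 1"
  have m'0: "m' > 0" using n by (simp add: m'_def)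
  have "card (- {i}) = m'" by (simp add: m'_def Compl_eq_Diff_UNIV)
  then obtain b where b: "bij_betw b {..<m'} (-{i})"
    using ex_bij_betw_nat_finite[of "-{i}"] by (auto simp: atLeast0LessThan)
  have bi: "b k \<noteq> i" if "k < m'" for k using b that by (auto simp: bij_betw_def)
  have fB: "smooth_on (f k) B" if "k \<noteq> i" for k by (rule smooth_on_subset[OF fS[OF that] BS])
  have indep: "\<forall>k<m'. l k = 0"
    if \<Omega>: "open \<Omega>" "\<Omega> \<noteq> {}" "\<Omega> \<subseteq> B" "\<And>x. x \<in> \<Omega> \<Longrightarrow> (\<Sum>k<m'. l k * laplacian (f (b k)) x) = 0" for \<Omega> l
  proof (intro allI impI)
    fix k assume k: "k < m'"
    obtain \<zeta> where \<zeta>: "\<zeta> \<in> \<Omega>" using \<Omega> by blast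
    define l' where "l' j = l (inv_into {..<m'} b j)" for j
    have l'b: "l' (b k) = l k" if "k < m'" for k
      using inv_into_f_f[OF bij_betw_imp_inj_on[OF b]] that by (simp add: l'_def)
    have "l' (b k) = 0"
    proof (rule laplacian_independent[OF gen \<Omega>(1), of "lift \<zeta>"])
      show "lift \<zeta> \<in> N" using liftN \<zeta> \<Omega> by blast
      show "lift \<zeta> $ i \<in> \<Omega>" using \<zeta> by (simp add: lift_i)
      show "b k \<noteq> i" by (rule bi[OF k])
      fix x assume "x \<in> S \<inter> \<Omega>"
      then have "(\<Sum>k<m'. l' (b k) * laplacian (f (b k)) x) = 0" using \<Omega>(4)[of x] l'b by simp
      then show "(\<Sum>k\<in>-{i}. l' k * laplacian (f k) x) = 0"
        using sum.reindex_bij_betw[OF b, of "\<lambda>k. l' k * laplacian (f k) x"] by simp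
    qed
    then show "l k = 0" using l'b[OF k] by simp
  qed
  have dep: "\<exists>\<alpha> v. (\<alpha> \<noteq> 0 \<or> v \<noteq> 0) \<and> (\<forall>k<m'. \<alpha> * laplacian (f (b k)) x + dir (laplacian (f (b k))) v x = 0)"
    if m2: "m' \<ge> 2" and x: "x \<in> B" for x
  proof -
    have "CARD('n) \<ge> 3" using m2 by (simp add: m'_def)
    from laplacian_dependent[OF liftN[OF x] dim3[OF this liftN[OF x]]]
    show ?thesis unfolding lift_i using bi by blast
  qed
  obtain z c l Q where z: "z \<in> B" and c: "c \<noteq> 0"
    and linv: "\<And>c'. \<forall>k<m'. (\<Sum>j<m'. c' j * l j k) = 0 \<Longrightarrow> \<forall>j<m'. c' j = (0 :: real)"
    and Q: "\<And>j. j < m' \<Longrightarrow> Q j holomorphic_on UNIV"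
    and van: "\<And>j. j < m' \<Longrightarrow> vanishes (j + 3) (\<lambda>x. (\<Sum>k<m'. l j k * f (b k) x) - Re (Q j x) - Re (c * (x - z)) ^ (j + 2)) z"
  proof -
    have "\<exists>z\<in>B. \<exists>c (l :: nat \<Rightarrow> nat \<Rightarrow> real) Q. c \<noteq> 0 \<and>
      (\<forall>c'. (\<forall>k<m'. (\<Sum>j<m'. c' j * l j k) = 0) \<longrightarrow> (\<forall>j<m'. c' j = 0)) \<and>
      (\<forall>j<m'. Q j holomorphic_on UNIV \<and>
        vanishes (j + 3) (\<lambda>x. (\<Sum>k<m'. l j k * f (b k) x) - Re (Q j x) - Re (c * (x - z)) ^ (j + 2)) z)"
    proof (rule rigid_normal_form[OF B Bne m'0])
      show "smooth_on (f (b k)) B" if "k < m'" for k by (rule fB[OF bi[OF that]])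
    qed (fact indep dep)+
    then show ?thesis using that by blast
  qed
  define w1 where "w1 = lift z"
  have w1N: "w1 \<in> N" unfolding w1_def by (rule liftN[OF z])
  have w1: "w1 $ i = z" "\<And>k. k \<noteq> i \<Longrightarrow> Re (w1 $ k) = f k z" by (simp_all add: w1_def lift_i lift_Re)
  obtain F K R where FKR: "K \<ge> 0" "R > 0" "F i0 = Re"
    "\<forall>k \<zeta>. norm \<zeta> < R \<longrightarrow> \<bar>F k \<zeta> - Re \<zeta> ^ e k\<bar> \<le> K * norm \<zeta> ^ Suc (e k)"
    and lb3: "locally_biholomorphic_at {w. \<forall>k. k \<noteq> i \<longrightarrow> Re (w $ k) = f k (w $ i)} w1 {w. \<forall>k. Re (w $ k) = F k (w $ i0)} 0"
    using normalize_rigid_graph[OF e m'_def b c linv Q B z fB van w1] by blast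
  have p1: "\<psi> w1 \<in> M" using \<psi>M[OF w1N] by blast
  have lb1: "locally_biholomorphic_at M 0 M (\<psi> w1)" using hom M0 p1 unfolding locally_homogeneous_def by blast
  have lb2: "locally_biholomorphic_at M (\<psi> w1) {w. \<forall>k. k \<noteq> i \<longrightarrow> Re (w $ k) = f k (w $ i)} w1"
    unfolding locally_biholomorphic_at_def
  proof (rule exI[of _ U], rule exI[of _ V], rule exI[of _ \<phi>], intro conjI bih)
    show "\<psi> w1 \<in> U" "\<phi> (\<psi> w1) = w1" using \<psi>M[OF w1N] \<phi>\<psi>[OF N_V[OF w1N]] by auto
    show "\<phi> ` (M \<inter> U) = {w. \<forall>k. k \<noteq> i \<longrightarrow> Re (w $ k) = f k (w $ i)} \<inter> V" unfolding graph by blast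
  qed
  have "locally_biholomorphic_at M 0 {w. \<forall>k. Re (w $ k) = F k (w $ i0)} 0"
    by (rule locally_biholomorphic_at_trans[OF lb1 locally_biholomorphic_at_trans[OF lb2 lb3]])
  then show ?thesis using FKR by blast
qed

text \<open>Neighbourhoods are shrunk until \<open>\<phi>\<close> is bounded by 1 on
  \<open>ball 0 \<rho>\<close> and \<open>\<psi>\<close> maps \<open>ball 0 r\<close> into it; then
  the rescaling argument applies.\<close>

lemma weighted_graph_imp_model:
  fixes M :: "(complex ^ 'n) set"
  assumes closed: "closed M" and \<mu>: "\<And>k. \<mu> k > 0"
    and scale: "\<And>t z. t > 0 \<Longrightarrow> z \<in> M \<Longrightarrow> cscale \<mu> (of_real t) z \<in> M"
    and e: "inj e" "\<And>k. e k > 0" "e i = 1" and F: "F i = Re" "K \<ge> 0" "R > 0"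
      "\<And>k \<zeta>. norm \<zeta> < R \<Longrightarrow> \<bar>F k \<zeta> - Re \<zeta> ^ e k\<bar> \<le> K * norm \<zeta> ^ Suc (e k)"
    and lb: "locally_biholomorphic_at M 0 {w. \<forall>k. Re (w $ k) = F k (w $ i)} 0"
  shows "locally_biholomorphic_at M 0 (model e i) 0"
proof -
  obtain U V \<phi> where UV: "0 \<in> U" "biholomorphism_between \<phi> U V" "\<phi> 0 = 0"
    "\<phi> ` (M \<inter> U) = {w. \<forall>k. Re (w $ k) = F k (w $ i)} \<inter> V"
    using lb unfolding locally_biholomorphic_at_def by blast
  obtain \<psi> where \<psi>: "open U" "open V" "holomorphic_map_on \<phi> U" "holomorphic_map_on \<psi> V"
    "\<And>z. z \<in> U \<Longrightarrow> \<phi> z \<in> V" "\<And>w. w \<in> V \<Longrightarrow> \<psi> w \<in> U"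
    "\<And>z. z \<in> U \<Longrightarrow> \<psi> (\<phi> z) = z" "\<And>w. w \<in> V \<Longrightarrow> \<phi> (\<psi> w) = w"
    using biholomorphism_betweenE[OF UV(2)] by metis
  have cont: "isCont \<phi> 0"
    using holomorphic_map_on_continuous_on[OF \<psi>(3)] \<psi>(1) UV(1) by (simp add: continuous_on_eq_continuous_at)
  obtain \<rho>1 where \<rho>1: "\<rho>1 > 0" "\<And>z. dist z 0 < \<rho>1 \<Longrightarrow> dist (\<phi> z) (\<phi> 0) < 1"
    using cont unfolding continuous_at_eps_delta by (metis zero_less_one)
  obtain \<rho>2 where \<rho>2: "\<rho>2 > 0" "ball 0 \<rho>2 \<subseteq> U" using \<psi>(1) UV(1) open_contains_ball by blast
  define \<rho> where "\<rho> = min \<rho>1 \<rho>2"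
  have V0: "0 \<in> V" "\<psi> 0 = 0" using \<psi>(5)[OF UV(1)] \<psi>(7)[OF UV(1)] UV(3) by auto
  have op: "open (V \<inter> \<psi> -` ball 0 \<rho>)"
    by (rule continuous_open_preimage[OF holomorphic_map_on_continuous_on[OF \<psi>(4)] \<psi>(2) open_ball])
  moreover have "0 \<in> V \<inter> \<psi> -` ball 0 \<rho>" using V0 \<rho>1 \<rho>2 by (simp add: \<rho>_def)
  ultimately obtain r1 where r1: "r1 > 0" "ball 0 r1 \<subseteq> V \<inter> \<psi> -` ball 0 \<rho>" using open_contains_ball by blast
  define r where "r = min r1 R"
  have rsub: "ball 0 r \<subseteq> V \<inter> \<psi> -` ball 0 \<rho>" using r1(2) by (auto simp: r_def subset_iff)
  interpret weighted_graph_chart M \<mu> e i F \<phi> \<psi> U V R K 1 \<rho> r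
  proof
    show "\<phi> ` (M \<inter> U) = {w \<in> V. \<forall>k. Re (w $ k) = F k (w $ i)}" using UV(4) by auto
    show "\<rho> > 0" "ball 0 \<rho> \<subseteq> U" using \<rho>1 \<rho>2 by (auto simp: \<rho>_def subset_iff)
    show "norm (\<phi> z) \<le> 1" if "z \<in> ball 0 \<rho>" for z
      using \<rho>1(2)[of z] that UV(3) by (simp add: \<rho>_def)
    show "r > 0" "r \<le> R" using r1 F(3) by (auto simp: r_def)
    show "ball 0 r \<subseteq> V" using rsub by blast
    show "\<psi> w \<in> ball 0 \<rho>" if "w \<in> ball 0 r" for w using rsub that by blast
  qed (fact closed scale \<mu> e F UV(1,3) \<psi>)+
  show ?thesis by (rule locally_biholomorphic_model)
qed

lemma model_at_origin:
  fixes M :: "(complex ^ 'n) set"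
  assumes n: "CARD('n) > 1" and bg: "bracket_generating M"
    and gv: "has_reduced_growth_vector M (2 # replicate (CARD('n) - 1) 1)"
    and model: "rigid_homogeneous_CR_model M" and ne: "M \<noteq> {}"
    and e: "bij_betw e UNIV {1..CARD('n)}" "e i0 = 1"
  shows "0 \<in> M" "locally_biholomorphic_at M 0 (model e i0) 0"
proof -
  have M: "CR_model M" "rigid M" "locally_homogeneous M"
    using model by (simp_all add: rigid_homogeneous_CR_model_def)
  obtain \<mu> where \<mu>: "closed M" "\<And>k. \<mu> k > 0" "\<And>t z. t > 0 \<Longrightarrow> z \<in> M \<Longrightarrow> cscale \<mu> (of_real t) z \<in> M"
    and M0: "M \<noteq> {} \<Longrightarrow> 0 \<in> M"
    using CR_model_cone[OF M(1)] by metis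
  show "0 \<in> M" by (rule M0[OF ne])
  obtain F K R where F: "K \<ge> 0" "R > 0" "F i0 = Re"
    "\<forall>k \<zeta>. norm \<zeta> < R \<longrightarrow> \<bar>F k \<zeta> - Re \<zeta> ^ e k\<bar> \<le> K * norm \<zeta> ^ Suc (e k)"
    and lb: "locally_biholomorphic_at M 0 {w. \<forall>k. Re (w $ k) = F k (w $ i0)} 0"
    using graph_chart_at_origin[OF n bg gv M(2,3) M0[OF ne] e] by blast
  have "inj e" using e(1) by (simp add: bij_betw_def)
  moreover have "e k > 0" for k
  proof -
    have "e k \<in> {1..CARD('n)}" using e(1) by (auto simp: bij_betw_def)
    then show ?thesis by simp
  qed
  ultimately show "locally_biholomorphic_at M 0 (model e i0) 0"
    using weighted_graph_imp_model[where M = M and \<mu> = \<mu> and e = e and i = i0 and F = F and K = K and R = R,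
        OF \<mu> _ _ e(2) F(3,1,2) _ lb] F(4) by blast
qed

theorem corollary2:
  fixes M M' :: "(complex ^ 'n) set"
  assumes "CARD('n) > 1"
    and "real_submanifold (CARD('n) + 1) M" "real_submanifold (CARD('n) + 1) M'"
    and "has_CR_dimension M 1" "has_CR_dimension M' 1"
    and "bracket_generating M" "bracket_generating M'"
    and "has_reduced_growth_vector M (2 # replicate (CARD('n) - 1) 1)"
        "has_reduced_growth_vector M' (2 # replicate (CARD('n) - 1) 1)"
    and "rigid_homogeneous_CR_model M" "rigid_homogeneous_CR_model M'"
  shows "\<forall>p\<in>M. \<forall>q\<in>M'. locally_biholomorphic_at M p M' q"
proof (intro ballI)
  fix p q assume p: "p \<in> M" and q: "q \<in> M'"
  \<comment> \<open>The index type carries no order, so an arbitrary enumeration assigns the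
    exponents 1 to n. The same \<open>e\<close> and \<open>i\<close> serve both manifolds, which are
    thereby compared with one and the same model.\<close>
  obtain h where h: "bij_betw h (UNIV :: 'n set) {0..<CARD('n)}"
    using ex_bij_betw_finite_nat[OF finite, of "UNIV :: 'n set"] by blast
  define e where "e k = Suc (h k)" for k
  have "bij_betw (Suc \<circ> h) UNIV (Suc ` {0..<CARD('n)})"
    by (rule bij_betw_trans[OF h]) (simp add: bij_betw_def)
  then have e: "bij_betw e UNIV {1..CARD('n)}"
    by (simp add: e_def[abs_def] o_def image_Suc_atLeastLessThan atLeastLessThanSuc_atLeastAtMost)
  have "1 \<in> e ` UNIV" using e assms(1) by (simp add: bij_betw_def)
  then obtain i where i: "e i = 1" by auto
  have hom: "locally_homogeneous M" "locally_homogeneous M'"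
    using assms(10,11) by (simp_all add: rigid_homogeneous_CR_model_def)
  note M = model_at_origin[OF assms(1,6,8,10) _ e i] and M' = model_at_origin[OF assms(1,7,9,11) _ e i]
  have "locally_biholomorphic_at M p M 0"
    using hom(1) p M(1) unfolding locally_homogeneous_def by blast
  moreover have "locally_biholomorphic_at M 0 (model e i) 0" using M(2) p by blast
  moreover have "locally_biholomorphic_at (model e i) 0 M' 0"
    using locally_biholomorphic_at_sym[OF M'(2)] q by blast
  moreover have "locally_biholomorphic_at M' 0 M' q"
    using hom(2) q M'(1) unfolding locally_homogeneous_def by blast
  ultimately show "locally_biholomorphic_at M p M' q"
    using locally_biholomorphic_at_trans by blast
qed

end
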